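(* Every non-tubular rotational surface of constant (extrinsic) Gauss curvature $K\neq 0$ in $\mathbb{S}^3\subset\mathbb{R}^4$ is given by $$(s,\theta)\mapsto\left(r(s)\cos\theta,\ r(s)\sin\theta,\ \sqrt{1-r^2(s)}\,\cos\psi(s),\ \sqrt{1-r^2(s)}\,\sin\psi(s)\right),$$ where $r,\psi$ are one of the following pairs of functions (with a parameter $p$ and an auxiliary constant $\Xi$): Case $K<-1$: (i) $r(s)=\sqrt{\tfrac{p^2}{p^2-(K+1)}}\ \mathrm{cn}_p(\Xi s)$, $\ \psi(s)=\tfrac{K}{\Xi}\,\Pi\!\left(\tfrac{p^2}{K+1};\Xi s\,|\,p\right)-Ks$, $\ \Xi=\sqrt{\tfrac{K(K+1)}{p^2-(K+1)}}$, $p\in[0,1]$; (ii) $r(s)=\sqrt{\tfrac{1}{1-(K+1)p^2}}\ \mathrm{dn}_p(\Xi s)$, $\ \psi(s)=\tfrac{K}{\Xi}\,\Pi\!\left(\tfrac{1}{K+1};\Xi s\,|\,p\right)-Ks$, $\ \Xi=\sqrt{\tfrac{K(K+1)}{1-(K+1)p^2}}$, $p\in[0,1]$. Case $K=-1$: $r(s)=\sqrt{1-p^2}\,\cos(ps)$, $\ \psi(s)=s-\arctan\!\left(\tfrac{\tan(ps)}{p}\right)$, $p\in(0,1)$. Case $K\in(-1,0)$: (i) $r(s)=\sqrt{\tfrac{p^2}{(K+1)p^2-K}}\ \mathrm{cd}_p(\Xi s)$, $\ \psi(s)=\tfrac{1}{\Xi}\,\Pi\!\left(\tfrac{(K+1)p^2}{K};\Xi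 s\,|\,p\right)$, $\ \Xi=\sqrt{\tfrac{(-K)(K+1)}{(K+1)p^2-K}}$, $p\in[0,1]$; (ii) $r(s)=\sqrt{\tfrac{p^2}{K+1-Kp^2}}\ \mathrm{cd}_p(\Xi s)$, $\ \psi(s)=s-\tfrac{1}{\Xi}\,\Pi\!\left(\tfrac{Kp^2}{K+1};\Xi s\,|\,p\right)$, $\ \Xi=\sqrt{\tfrac{(-K)(K+1)}{K+1-Kp^2}}$, $p\in[0,1]$. Case $K>0$: (i) $r(s)=\sqrt{\tfrac{p^2}{K+p^2}}\ \mathrm{cn}_p(\Xi s)$, $\ \psi(s)=\tfrac{K+1}{\Xi}\,\Pi\!\left(-\tfrac{p^2}{K};\Xi s\,|\,p\right)-Ks$, $\ \Xi=\sqrt{\tfrac{K(K+1)}{K+p^2}}$, $p\in[0,1]$; (ii) $r(s)=\sqrt{\tfrac{1}{Kp^2+1}}\ \mathrm{dn}_p(\Xi s)$, $\ \psi(s)=\tfrac{K+1}{\Xi}\,\Pi\!\left(-\tfrac{1}{K};\Xi s\,|\,p\right)-Ks$, $\ \Xi=\sqrt{\tfrac{K(K+1)}{Kp^2+1}}$, $p\in[0,1]$.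
   Context: $\mathbb{S}^3$ is the unit sphere in Euclidean $\mathbb{R}^4$. $K=k_1k_2$ denotes the extrinsic Gauss curvature (product of the principal curvatures in $\mathbb{S}^3$); the intrinsic Gauss curvature is $K+1$. A rotational surface is a surface invariant under a $1$-parameter group of isometries of $\mathbb{S}^3$ acting as rotations in a fixed $2$-plane of $\mathbb{R}^4$ and as the identity on its orthogonal complement. "Given by" is understood up to isometries of $\mathbb{S}^3$ and reparametrisation. A surface is tubular if one of its principal curvatures is constant. $\mathrm{sn}_p,\mathrm{cn}_p,\mathrm{dn}_p$ denote the Jacobi elliptic functions of modulus $p$ (so that $\mathrm{sn}_p^2+\mathrm{cn}_p^2=\mathrm{dn}_p^2+p^2\mathrm{sn}_p^2=1$), and $\mathrm{cd}_p=\mathrm{cn}_p/\mathrm{dn}_p$. The incomplete elliptic integral of the third kind with parameter $k$ and modulus $p$ is used in the form $\Pi(k;s\,|\,p)=\int_0^s\frac{du}{1-k\,\mathrm{sn}_p^2(u)}$.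
   Formalization: For K in (-1,0) one further pair is allowed: r(s)=tanh(Ξs), ψ(s)=-Ks, Ξ=sqrt(-K(K+1)). This non-tubular surface of constant curvature K is missing from the listed families, whose formulas at p=1 degenerate to r=1, a circle. *)

theory Defs
  imports "HOL-Analysis.Analysis"
begin

section \<open>Smooth immersions of plane domains\<close>

definition dir_deriv :: "real \<times> real \<Rightarrow> (real \<times> real \<Rightarrow> real^4) \<Rightarrow> real \<times> real \<Rightarrow> real^4" where
  "dir_deriv v X z = frechet_derivative X (at z) v"

fun Ck_on :: "nat \<Rightarrow> (real \<times> real) set \<Rightarrow> (real \<times> real \<Rightarrow> real^4) \<Rightarrow> bool" where
  "Ck_on 0 W X \<longleftrightarrow> continuous_on W X"
| "Ck_on (Suc n) W X \<longleftrightarrow> (\<forall>z\<in>W. X differentiable (at z)) \<and> (\<forall>v. Ck_on n W (dir_deriv v X))"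

definition smooth_immersion_on :: "(real \<times> real) set \<Rightarrow> (real \<times> real \<Rightarrow> real^4) \<Rightarrow> bool" where
  "smooth_immersion_on W X \<longleftrightarrow>
     (\<forall>n. Ck_on n W X) \<and> (\<forall>z\<in>W. inj (frechet_derivative X (at z)))"

section \<open>Immersed surfaces in the 3-sphere\<close>

text \<open>
  A surface is a connected Hausdorff space \<open>M\<close> together with a map \<open>f\<close> into the unit sphere that
  becomes a smooth immersion in suitable local coordinates \<open>\<sigma>\<close>. No separate smooth structure on \<open>M\<close>
  is needed: two coordinate systems as below have smooth transition maps, because \<open>f\<close> is locally an
  embedding. An embedded regular surface \<open>S\<close> is the case \<open>M = S\<close>, \<open>f = id\<close>.
\<close>

definition local_coords ::
  "('m::t2_space \<Rightarrow> real^4) \<Rightarrow> 'm set \<Rightarrow> (real \<times> real) set \<Rightarrow> (real \<times> real \<Rightarrow> 'm) \<Rightarrow> bool" where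
  "local_coords f M W \<sigma> \<longleftrightarrow>
     open W \<and> openin (top_of_set M) (\<sigma> ` W) \<and> (\<exists>\<tau>. homeomorphism W (\<sigma> ` W) \<sigma> \<tau>) \<and>
     smooth_immersion_on W (f \<circ> \<sigma>)"

definition immersed_surface_S3 :: "('m::t2_space \<Rightarrow> real^4) \<Rightarrow> 'm set \<Rightarrow> bool" where
  "immersed_surface_S3 f M \<longleftrightarrow>
     connected M \<and> f ` M \<subseteq> sphere 0 1 \<and> (\<forall>x\<in>M. \<exists>W \<sigma>. local_coords f M W \<sigma> \<and> x \<in> \<sigma> ` W)"

section \<open>Curvature\<close>

text \<open>
  \<open>\<nu>\<close> is a unit vector tangent to the sphere and normal to the surface. The second fundamental form
  in the sphere with respect to \<open>\<nu>\<close> is the \<open>\<nu>\<close>-component of the second derivatives in \<open>\<real>\<^sup>4\<close>, since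
  the sphere has normal \<open>X z\<close>, which is orthogonal to \<open>\<nu>\<close>.
\<close>

definition unit_normal :: "(real \<times> real \<Rightarrow> real^4) \<Rightarrow> real \<times> real \<Rightarrow> real^4 \<Rightarrow> bool" where
  "unit_normal X z \<nu> \<longleftrightarrow> norm \<nu> = 1 \<and> \<nu> \<bullet> X z = 0 \<and> (\<forall>v. \<nu> \<bullet> dir_deriv v X z = 0)"

definition fund_form1 ::
  "(real \<times> real \<Rightarrow> real^4) \<Rightarrow> real \<times> real \<Rightarrow> real \<times> real \<Rightarrow> real \<times> real \<Rightarrow> real" where
  "fund_form1 X z v w = dir_deriv v X z \<bullet> dir_deriv w X z"

definition fund_form2 ::
  "(real \<times> real \<Rightarrow> real^4) \<Rightarrow> real \<times> real \<Rightarrow> real^4 \<Rightarrow> real \<times> real \<Rightarrow> real \<times> real \<Rightarrow> real" where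
  "fund_form2 X z \<nu> v w = dir_deriv v (dir_deriv w X) z \<bullet> \<nu>"

text \<open>
  \<open>k1\<close>, \<open>k2\<close> are the eigenvalues, with multiplicity, of the shape operator at \<open>x\<close>. The unit normal
  is chosen at the single point \<open>x\<close>, so the pair is determined up to order and a common sign.
\<close>

definition principal_curvatures ::
  "('m::t2_space \<Rightarrow> real^4) \<Rightarrow> 'm set \<Rightarrow> 'm \<Rightarrow> real \<Rightarrow> real \<Rightarrow> bool" where
  "principal_curvatures f M x k1 k2 \<longleftrightarrow>
     (\<exists>W \<sigma> z \<nu> v1 v2. local_coords f M W \<sigma> \<and> z \<in> W \<and> \<sigma> z = x \<and>
        unit_normal (f \<circ> \<sigma>) z \<nu> \<and> v1 \<noteq> v2 \<and> independent {v1, v2} \<and>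
        (\<forall>w. fund_form2 (f \<circ> \<sigma>) z \<nu> v1 w = k1 * fund_form1 (f \<circ> \<sigma>) z v1 w) \<and>
        (\<forall>w. fund_form2 (f \<circ> \<sigma>) z \<nu> v2 w = k2 * fund_form1 (f \<circ> \<sigma>) z v2 w))"

definition constant_gauss_curvature :: "('m::t2_space \<Rightarrow> real^4) \<Rightarrow> 'm set \<Rightarrow> real \<Rightarrow> bool" where
  "constant_gauss_curvature f M K \<longleftrightarrow>
     (\<forall>x\<in>M. {k1 * k2 | k1 k2. principal_curvatures f M x k1 k2} = {K})"

definition tubular :: "('m::t2_space \<Rightarrow> real^4) \<Rightarrow> 'm set \<Rightarrow> bool" where
  "tubular f M \<longleftrightarrow> (\<exists>c. \<forall>x\<in>M. \<exists>k. principal_curvatures f M x c k)"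

section \<open>Rotational surfaces\<close>

text \<open>For orthonormal \<open>a\<close>, \<open>b\<close>: rotation by \<open>t\<close> in the plane of \<open>a\<close>, \<open>b\<close>, identity on its complement.\<close>

definition plane_rotation :: "real^4 \<Rightarrow> real^4 \<Rightarrow> real \<Rightarrow> real^4 \<Rightarrow> real^4" where
  "plane_rotation a b t y =
     y + ((cos t - 1) * (y \<bullet> a) - sin t * (y \<bullet> b)) *\<^sub>R a
       + (sin t * (y \<bullet> a) + (cos t - 1) * (y \<bullet> b)) *\<^sub>R b"

text \<open>
  Invariance of an immersed surface: the rotations are covered by a continuous one-parameter group of
  transformations of \<open>M\<close>. For \<open>f = id\<close> this says that every rotation maps \<open>M\<close> into itself.
\<close>

definition rotational_surface :: "('m::t2_space \<Rightarrow> real^4) \<Rightarrow> 'm set \<Rightarrow> bool" where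
  "rotational_surface f M \<longleftrightarrow>
     (\<exists>a b \<phi>. norm a = 1 \<and> norm b = 1 \<and> a \<bullet> b = 0 \<and>
        continuous_on (UNIV \<times> M) (\<lambda>(t, x). \<phi> t x) \<and>
        (\<forall>x\<in>M. \<phi> 0 x = x) \<and>
        (\<forall>t. \<forall>x\<in>M. \<phi> t x \<in> M \<and> f (\<phi> t x) = plane_rotation a b t (f x)) \<and>
        (\<forall>s t. \<forall>x\<in>M. \<phi> (s + t) x = \<phi> s (\<phi> t x)))"

definition rotational_param :: "(real \<Rightarrow> real) \<Rightarrow> (real \<Rightarrow> real) \<Rightarrow> real \<times> real \<Rightarrow> real^4" where
  "rotational_param r \<psi> = (\<lambda>(s, \<theta>).
     vector [r s * cos \<theta>, r s * sin \<theta>,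
             sqrt (1 - (r s)\<^sup>2) * cos (\<psi> s), sqrt (1 - (r s)\<^sup>2) * sin (\<psi> s)])"

text \<open>
  The surface is given by \<open>(r, \<psi>)\<close> up to an isometry \<open>\<Phi>\<close> of the sphere and a reparametrisation \<open>g\<close>.
  The coordinate \<open>\<theta>\<close> is an angle, so \<open>g\<close> is a surjective local diffeomorphism onto \<open>M\<close> rather than a
  bijection; it is a local diffeomorphism by the continuity of \<open>g\<close> and the regularity of
  the parametrisation on \<open>I\<close>. The interval \<open>I\<close> is needed because the profile curves
  have singularities and because a surface may be a part of a larger one.
\<close>

definition given_by ::
  "('m::t2_space \<Rightarrow> real^4) \<Rightarrow> 'm set \<Rightarrow> (real \<Rightarrow> real) \<Rightarrow> (real \<Rightarrow> real) \<Rightarrow> bool" where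
  "given_by f M r \<psi> \<longleftrightarrow>
     (\<exists>\<Phi> I g. orthogonal_transformation \<Phi> \<and> open I \<and> is_interval I \<and>
        (\<forall>z \<in> I \<times> UNIV. rotational_param r \<psi> differentiable (at z) \<and>
                        inj (frechet_derivative (rotational_param r \<psi>) (at z))) \<and>
        continuous_on (I \<times> UNIV) g \<and> g ` (I \<times> UNIV) = M \<and>
        (\<forall>z \<in> I \<times> UNIV. f (g z) = \<Phi> (rotational_param r \<psi> z)))"

section \<open>Jacobi elliptic functions of modulus \<open>p\<close> in \<open>[0, 1]\<close>\<close>

definition elliptic_F :: "real \<Rightarrow> real \<Rightarrow> real" where
  "elliptic_F p \<phi> = (LBINT t=0..\<phi>. 1 / sqrt (1 - p\<^sup>2 * (sin t)\<^sup>2))"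

text \<open>
  The amplitude inverts the incomplete integral of the first kind. For \<open>p = 1\<close> that integral diverges
  at \<open>\<plusminus>\<pi>/2\<close> and the amplitude takes values in between.
\<close>

definition jacobi_am :: "real \<Rightarrow> real \<Rightarrow> real" where
  "jacobi_am p u = (THE \<phi>. (p = 1 \<longrightarrow> \<bar>\<phi>\<bar> < pi / 2) \<and> elliptic_F p \<phi> = u)"

definition jacobi_sn :: "real \<Rightarrow> real \<Rightarrow> real" where
  "jacobi_sn p u = sin (jacobi_am p u)"

definition jacobi_cn :: "real \<Rightarrow> real \<Rightarrow> real" where
  "jacobi_cn p u = cos (jacobi_am p u)"

definition jacobi_dn :: "real \<Rightarrow> real \<Rightarrow> real" where
  "jacobi_dn p u = sqrt (1 - p\<^sup>2 * (jacobi_sn p u)\<^sup>2)"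

definition jacobi_cd :: "real \<Rightarrow> real \<Rightarrow> real" where
  "jacobi_cd p u = jacobi_cn p u / jacobi_dn p u"

definition elliptic_Pi :: "real \<Rightarrow> real \<Rightarrow> real \<Rightarrow> real" where
  "elliptic_Pi k s p = (LBINT u=0..s. 1 / (1 - k * (jacobi_sn p u)\<^sup>2))"

section \<open>The profile functions\<close>

definition profile_hyperbolic :: "real \<Rightarrow> (real \<Rightarrow> real) \<Rightarrow> (real \<Rightarrow> real) \<Rightarrow> bool" where
  "profile_hyperbolic K r \<psi> \<longleftrightarrow>
     (\<exists>p\<in>{0..1}. let \<Xi> = sqrt (K * (K + 1) / (p\<^sup>2 - (K + 1))) in
        r = (\<lambda>s. sqrt (p\<^sup>2 / (p\<^sup>2 - (K + 1))) * jacobi_cn p (\<Xi> * s)) \<and>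
        \<psi> = (\<lambda>s. K / \<Xi> * elliptic_Pi (p\<^sup>2 / (K + 1)) (\<Xi> * s) p - K * s)) \<or>
     (\<exists>p\<in>{0..1}. let \<Xi> = sqrt (K * (K + 1) / (1 - (K + 1) * p\<^sup>2)) in
        r = (\<lambda>s. sqrt (1 / (1 - (K + 1) * p\<^sup>2)) * jacobi_dn p (\<Xi> * s)) \<and>
        \<psi> = (\<lambda>s. K / \<Xi> * elliptic_Pi (1 / (K + 1)) (\<Xi> * s) p - K * s))"

definition profile_flat :: "(real \<Rightarrow> real) \<Rightarrow> (real \<Rightarrow> real) \<Rightarrow> bool" where
  "profile_flat r \<psi> \<longleftrightarrow>
     (\<exists>p\<in>{0<..<1}. r = (\<lambda>s. sqrt (1 - p\<^sup>2) * cos (p * s)) \<and>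
                  \<psi> = (\<lambda>s. s - arctan (tan (p * s) / p)))"

text \<open>
  In both families below, \<open>cd\<^sub>1 = 1\<close> makes \<open>r\<close> identically \<open>1\<close>, so that \<open>p = 1\<close> does not yield a surface.
  If the parameter is first shifted by a quarter period, so that \<open>cd\<close> becomes \<open>-sn\<close> and \<open>sn\<close> becomes
  \<open>cd\<close>, and \<open>\<psi>\<close> is normalised by \<open>\<psi> 0 = 0\<close>, then both families do have a common regular limit for
  \<open>p \<rightarrow> 1\<close>, up to the sign of \<open>r\<close>: there \<open>sn\<^sub>1 = tanh\<close>, and
  \<open>1 / (1 - (K+1)/K) = -K = 1 - 1 / (1 - K/(K+1))\<close> is the derivative of \<open>\<psi>\<close>. The profile curve is a
  loxodrome of the 2-sphere. This limit is the last alternative; the corresponding surface has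
  constant curvature \<open>K\<close>, is not tubular, and is not given by any other parameter value.
\<close>

definition profile_intermediate :: "real \<Rightarrow> (real \<Rightarrow> real) \<Rightarrow> (real \<Rightarrow> real) \<Rightarrow> bool" where
  "profile_intermediate K r \<psi> \<longleftrightarrow>
     (\<exists>p\<in>{0..1}. let \<Xi> = sqrt ((- K) * (K + 1) / ((K + 1) * p\<^sup>2 - K)) in
        r = (\<lambda>s. sqrt (p\<^sup>2 / ((K + 1) * p\<^sup>2 - K)) * jacobi_cd p (\<Xi> * s)) \<and>
        \<psi> = (\<lambda>s. 1 / \<Xi> * elliptic_Pi ((K + 1) * p\<^sup>2 / K) (\<Xi> * s) p)) \<or>
     (\<exists>p\<in>{0..1}. let \<Xi> = sqrt ((- K) * (K + 1) / (K + 1 - K * p\<^sup>2)) in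
        r = (\<lambda>s. sqrt (p\<^sup>2 / (K + 1 - K * p\<^sup>2)) * jacobi_cd p (\<Xi> * s)) \<and>
        \<psi> = (\<lambda>s. s - 1 / \<Xi> * elliptic_Pi (K * p\<^sup>2 / (K + 1)) (\<Xi> * s) p)) \<or>
     (let \<Xi> = sqrt ((- K) * (K + 1)) in
        r = (\<lambda>s. jacobi_sn 1 (\<Xi> * s)) \<and> \<psi> = (\<lambda>s. - K * s))"

definition profile_spherical :: "real \<Rightarrow> (real \<Rightarrow> real) \<Rightarrow> (real \<Rightarrow> real) \<Rightarrow> bool" where
  "profile_spherical K r \<psi> \<longleftrightarrow>
     (\<exists>p\<in>{0..1}. let \<Xi> = sqrt (K * (K + 1) / (K + p\<^sup>2)) in
        r = (\<lambda>s. sqrt (p\<^sup>2 / (K + p\<^sup>2)) * jacobi_cn p (\<Xi> * s)) \<and>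
        \<psi> = (\<lambda>s. (K + 1) / \<Xi> * elliptic_Pi (- (p\<^sup>2 / K)) (\<Xi> * s) p - K * s)) \<or>
     (\<exists>p\<in>{0..1}. let \<Xi> = sqrt (K * (K + 1) / (K * p\<^sup>2 + 1)) in
        r = (\<lambda>s. sqrt (1 / (K * p\<^sup>2 + 1)) * jacobi_dn p (\<Xi> * s)) \<and>
        \<psi> = (\<lambda>s. (K + 1) / \<Xi> * elliptic_Pi (- (1 / K)) (\<Xi> * s) p - K * s))"

end

theory Submission
  imports Defs
begin

text \<open>
  A surface that is invariant under the rotations of a plane is swept out by its profile, a curve in the
  half sphere where the first coordinate \<open>r\<close> is positive and the second one vanishes. Along the profile the
  orbits are lines of curvature, so one principal curvature is visible in first derivatives: it is
  \<open>v / r\<close> up to sign, where \<open>v\<close> is the length of the component of the unit normal in the plane of rotation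
  (\<open>orbit_eigenvector\<close>). Gauss' equation \<open>k1 k2 = K\<close> then is an ordinary differential equation of second order
  for the profile. By arc length it reads \<open>r'' = - (K + 1) r\<close>, since the intrinsic curvature is \<open>K + 1\<close>. The
  angle in the fixed plane involves \<open>v\<close> as well, and the system becomes polynomial in the time with
  \<open>ds = d(arc length) / v\<close>: with \<open>w\<close> the derivative of \<open>r\<close> by arc length,
  \<open>r' = w v\<close>, \<open>w' = - (K + 1) r v\<close>, \<open>v' = K r w\<close>, \<open>r^2 + w^2 + v^2 = 1\<close>,
  and the angle satisfies \<open>\<psi>' = v^2 / (1 - r^2)\<close>. These are the equations of the Euler top, whose solutions are
  Jacobi elliptic functions with the angle an integral of the third kind. The values of the first
  integral \<open>v^2 - K r^2\<close> separate the families of the theorem, and every admissible initial value lies on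
  one of the explicit solutions (\<open>explicit_profile_through\<close>).

  The passage between the surface and the equations is local in both directions. Curves in \<open>M\<close> are
  only continuous, so velocities and accelerations are read off from their images in space: the normal
  acceleration of a curve is the second fundamental form of its velocity (\<open>curve_in_chart_second\<close>). Through
  every point off the axis this yields a local profile curve in the time of the Euler system, by rotating a
  straight line of a chart into the half plane (\<open>profile_of_chart_line\<close>, \<open>local_profile\<close>). Gauss' equation with
  \<open>K \<noteq> 0\<close> ensures \<open>v \<noteq> 0\<close>, so the time change is regular.

  To make the description global, start at one point, choose the explicit solution through its data,
  and continue the local profile along this solution as far as it stays in \<open>M\<close>
  (\<open>maximal_profile_curve\<close>). The sweep of the maximal curve is open. A second profile curve that meets it has
  the same tangent plane there, hence the same data, hence it continues the maximal curve
  (\<open>sweep_absorbs\<close>); so no point off the axis is a boundary point. At a point of the axis the tangent plane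
  is the plane of rotation, by symmetry, so \<open>v\<close> and \<open>r\<close> both tend to 0, which contradicts a nonzero value of
  \<open>v^2 - K r^2\<close> (\<open>axis_not_adherent\<close>). As \<open>M\<close> is connected, it is the sweep (\<open>surface_is_sweep\<close>).

  Non-tubularity provides the starting point: if \<open>v^2 = K r^2\<close> held everywhere, then \<open>sqrt K\<close> would be a
  principal curvature at every point (\<open>not_tubular_point\<close>).
\<close>

section \<open>Jacobi elliptic functions\<close>

lemma interval_integral_from_0_has_derivative:
  fixes g :: "real \<Rightarrow> real"
  assumes S: "open S" "is_interval S" "0 \<in> S" "x \<in> S" and g: "continuous_on S g"
  shows "((\<lambda>u. LBINT y=0..u. g y) has_real_derivative g x) (at x)"
proof -
  obtain e1 where e1: "e1 > 0" "cball (min 0 x) e1 \<subseteq> S"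
    using S open_contains_cball by (metis min_def)
  obtain e2 where e2: "e2 > 0" "cball (max 0 x) e2 \<subseteq> S"
    using S open_contains_cball by (metis max_def)
  define a where "a = min 0 x - e1"
  define b where "b = max 0 x + e2"
  have ab: "a \<in> S" "b \<in> S" "a < 0" "a < x" "0 < b" "x < b"
    using e1 e2 by (auto simp: a_def b_def dist_real_def subset_eq)
  have sub: "{a..b} \<subseteq> S"
    using S(2) ab(1,2) unfolding is_interval_1 by fastforce
  have "((\<lambda>u. LBINT y=0..u. g y) has_vector_derivative g x) (at x within {a..b})"
    using interval_integral_FTC2[of a 0 b g x] ab continuous_on_subset[OF g sub]
    by (simp add: zero_ereal_def)
  then show ?thesis
    using ab by (simp add: at_within_Icc_at has_real_derivative_iff_has_vector_derivative)
qed

lemma DERIV_inverse_open: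
  fixes F g :: "real \<Rightarrow> real"
  assumes "open S" "x \<in> S" "continuous_on S F" "\<And>x. x \<in> S \<Longrightarrow> g (F x) = x"
    and "(F has_real_derivative D) (at x)" "D \<noteq> 0"
  shows "(g has_real_derivative inverse D) (at (F x))"
proof -
  have "(*) D \<circ> (*) (inverse D) = id" using assms(6) by auto
  then show ?thesis
    using has_derivative_inverse_strong[OF assms(1-4)] assms(5)
    unfolding has_field_derivative_def by blast
qed

text \<open>
  The interval on which the elliptic integral of the first kind is a bijection onto the reals. For
  modulus 1 the integrand is \<open>1 / \<bar>cos\<bar>\<close>, which is not integrable at \<open>- pi / 2\<close> and \<open>pi / 2\<close>.
\<close>

definition am_range :: "real \<Rightarrow> real set" where
  "am_range p = (if p = 1 then {- pi / 2 <..< pi / 2} else UNIV)"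

lemma am_range: "open (am_range p)" "is_interval (am_range p)" "0 \<in> am_range p"
  by (auto simp: am_range_def is_interval_1)

lemma am_range_iff: "\<phi> \<in> am_range p \<longleftrightarrow> (p = 1 \<longrightarrow> \<bar>\<phi>\<bar> < pi / 2)"
  by (auto simp: am_range_def)

context
  fixes p :: real
  assumes p: "p \<in> {0..1}"
begin

lemma elliptic_radicand_pos:
  assumes "\<phi> \<in> am_range p" shows "1 - p\<^sup>2 * (sin \<phi>)\<^sup>2 > 0"
proof (cases "p = 1")
  case True
  then have "cos \<phi> > 0" using assms by (intro cos_gt_zero_pi) (auto simp: am_range_def)
  then have "(cos \<phi>)\<^sup>2 > 0" by simp
  then show ?thesis using True by (simp add: cos_squared_eq)
next
  case False
  then have "p\<^sup>2 < 1" using p by (simp add: power_less_one_iff)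
  moreover have "p\<^sup>2 * (sin \<phi>)\<^sup>2 \<le> p\<^sup>2 * 1" by (intro mult_left_mono) (auto simp: abs_square_le_1)
  ultimately show ?thesis by simp
qed

lemma elliptic_F_has_derivative:
  assumes "\<phi> \<in> am_range p"
  shows "(elliptic_F p has_real_derivative 1 / sqrt (1 - p\<^sup>2 * (sin \<phi>)\<^sup>2)) (at \<phi>)"
proof -
  have "continuous_on (am_range p) (\<lambda>t. 1 / sqrt (1 - p\<^sup>2 * (sin t)\<^sup>2))"
    using elliptic_radicand_pos by (intro continuous_intros) (auto simp: less_le)
  from interval_integral_from_0_has_derivative[OF am_range assms this]
  show ?thesis by (simp add: elliptic_F_def[abs_def])
qed

lemma elliptic_F_continuous: "continuous_on (am_range p) (elliptic_F p)"
  using elliptic_F_has_derivative by (meson DERIV_isCont continuous_at_imp_continuous_on)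

lemma elliptic_F_0: "elliptic_F p 0 = 0"
  by (simp add: elliptic_F_def zero_ereal_def)

lemma elliptic_F_strict_mono:
  assumes "\<phi>1 \<in> am_range p" "\<phi>2 \<in> am_range p" "\<phi>1 < \<phi>2"
  shows "elliptic_F p \<phi>1 < elliptic_F p \<phi>2"
proof (rule DERIV_pos_imp_increasing[OF assms(3)])
  fix x assume "\<phi>1 \<le> x" "x \<le> \<phi>2"
  then have "x \<in> am_range p" using assms am_range(2)[of p] unfolding is_interval_1 by blast
  then show "\<exists>y. (elliptic_F p has_real_derivative y) (at x) \<and> 0 < y"
    using elliptic_F_has_derivative elliptic_radicand_pos by fastforce
qed

text \<open>
  For modulus 1 the integral is \<open>artanh (sin \<phi>)\<close>, the inverse Gudermannian function. Otherwise the
  integrand is at least 1, so that the integral grows at least linearly and the intermediate value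
  theorem applies.
\<close>

lemma elliptic_F_surj: "\<exists>\<phi>\<in>am_range p. elliptic_F p \<phi> = u"
proof (cases "p = 1")
  case True
  let ?G = "\<lambda>\<phi>. artanh (sin \<phi>)"
  have G: "elliptic_F p \<phi> = ?G \<phi>" if "\<phi> \<in> am_range p" for \<phi>
  proof -
    have "\<exists>c. \<forall>x\<in>am_range p. elliptic_F p x - ?G x = c"
    proof (rule has_field_derivative_zero_constant)
      show "convex (am_range p)" using am_range(2) by (simp add: is_interval_convex)
      fix x assume x: "x \<in> am_range p"
      then have c: "cos x > 0" using True by (intro cos_gt_zero_pi) (auto simp: am_range_def)
      have s: "\<bar>sin x\<bar> < 1"
        using c sin_cos_squared_add[of x] by (metis abs_square_less_1 less_add_same_cancel1 zero_less_power)
      have "sqrt (1 - (sin x)\<^sup>2) = cos x"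
        using c by (simp add: cos_squared_eq[symmetric])
      then have "((\<lambda>x. elliptic_F p x - ?G x) has_real_derivative 0) (at x)"
        using DERIV_diff[OF elliptic_F_has_derivative[OF x]
            DERIV_chain2[OF artanh_real_has_field_derivative DERIV_sin, of x]] c s True
        by (simp add: cos_squared_eq[symmetric] abs_less_iff) (simp add: power2_eq_square)
      then show "((\<lambda>x. elliptic_F p x - ?G x) has_real_derivative 0) (at x within am_range p)"
        by (rule has_field_derivative_at_within)
    qed
    then obtain c where c: "\<And>x. x \<in> am_range p \<Longrightarrow> elliptic_F p x - ?G x = c" by blast
    from c[OF am_range(3)] c[OF that] show ?thesis by (simp add: elliptic_F_0)
  qed
  have t: "-1 < tanh u" "tanh u < 1" by (auto simp: tanh_real_gt_neg1 tanh_real_lt_1)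
  have "arcsin (tanh u) \<in> am_range p"
    using arcsin_lt_bounded[OF t] True by (simp add: am_range_def)
  then show ?thesis
    using G t by (intro bexI[of _ "arcsin (tanh u)"]) (auto simp: artanh_tanh_real)
next
  case False
  then have am: "am_range p = UNIV" by (simp add: am_range_def)
  have cont: "continuous_on UNIV (elliptic_F p)" using elliptic_F_continuous am by simp
  have ge: "(elliptic_F p has_real_derivative y) (at x) \<Longrightarrow> y \<ge> 1" for x y
  proof -
    assume "(elliptic_F p has_real_derivative y) (at x)"
    then have "y = 1 / sqrt (1 - p\<^sup>2 * (sin x)\<^sup>2)"
      using elliptic_F_has_derivative[of x] am DERIV_unique by auto
    moreover have "1 - p\<^sup>2 * (sin x)\<^sup>2 > 0" using elliptic_radicand_pos am by simp
    moreover have "sqrt (1 - p\<^sup>2 * (sin x)\<^sup>2) \<le> 1" by simp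
    ultimately show "y \<ge> 1" by (simp only: le_divide_eq_1_pos real_sqrt_gt_0_iff)
  qed
  have mono: "elliptic_F p y - y \<ge> elliptic_F p x - x" if "x \<le> y" for x y
  proof (rule DERIV_nonneg_imp_nondecreasing[OF that])
    fix z
    show "\<exists>d. ((\<lambda>x. elliptic_F p x - x) has_real_derivative d) (at z) \<and> 0 \<le> d"
      using elliptic_F_has_derivative[of z] ge am
      by (intro exI[of _ "1 / sqrt (1 - p\<^sup>2 * (sin z)\<^sup>2) - 1"]) (auto intro!: derivative_eq_intros)
  qed
  have 1: "elliptic_F p (- \<bar>u\<bar>) \<le> u" using mono[of "- \<bar>u\<bar>" 0] by (simp add: elliptic_F_0)
  have 2: "u \<le> elliptic_F p \<bar>u\<bar>" using mono[of 0 "\<bar>u\<bar>"] by (simp add: elliptic_F_0)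
  show ?thesis
    using IVT'[OF 1 2 _ continuous_on_subset[OF cont]] am by auto
qed

lemma jacobi_am:
  shows jacobi_am_range: "jacobi_am p u \<in> am_range p"
    and elliptic_F_jacobi_am: "elliptic_F p (jacobi_am p u) = u"
    and jacobi_am_elliptic_F: "\<phi> \<in> am_range p \<Longrightarrow> jacobi_am p (elliptic_F p \<phi>) = \<phi>"
proof -
  have ex1: "\<exists>!\<phi>. (p = 1 \<longrightarrow> \<bar>\<phi>\<bar> < pi / 2) \<and> elliptic_F p \<phi> = u" for u
    using elliptic_F_surj[of u] elliptic_F_strict_mono unfolding am_range_iff[symmetric]
    by (metis linorder_neqE_linordered_idom order_less_irrefl)
  show "jacobi_am p u \<in> am_range p" "elliptic_F p (jacobi_am p u) = u"
    using theI'[OF ex1[of u]] unfolding jacobi_am_def am_range_iff[symmetric] by auto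
  show "jacobi_am p (elliptic_F p \<phi>) = \<phi>" if "\<phi> \<in> am_range p"
    unfolding jacobi_am_def using that
    by (intro the1_equality[OF ex1]) (auto simp: am_range_iff)
qed

lemma jacobi_dn_pos: "jacobi_dn p u > 0"
  using elliptic_radicand_pos[OF jacobi_am_range] by (simp add: jacobi_dn_def jacobi_sn_def)

lemma jacobi_dn_sq: "(jacobi_dn p u)\<^sup>2 = 1 - p\<^sup>2 * (jacobi_sn p u)\<^sup>2"
  using elliptic_radicand_pos[OF jacobi_am_range, of u] by (simp add: jacobi_dn_def jacobi_sn_def)

lemma jacobi_am_has_derivative: "(jacobi_am p has_real_derivative jacobi_dn p u) (at u)"
proof -
  let ?\<phi> = "jacobi_am p u"
  have "1 / sqrt (1 - p\<^sup>2 * (sin ?\<phi>)\<^sup>2) \<noteq> 0"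
    using elliptic_radicand_pos[OF jacobi_am_range, of u] by simp
  then have "(jacobi_am p has_real_derivative inverse (1 / sqrt (1 - p\<^sup>2 * (sin ?\<phi>)\<^sup>2)))
      (at (elliptic_F p ?\<phi>))"
    by (intro DERIV_inverse_open[OF am_range(1) jacobi_am_range elliptic_F_continuous])
      (auto simp: jacobi_am_elliptic_F intro: elliptic_F_has_derivative jacobi_am_range)
  then show ?thesis
    by (simp add: elliptic_F_jacobi_am jacobi_dn_def jacobi_sn_def)
qed

lemma jacobi_sn_has_derivative:
  "(jacobi_sn p has_real_derivative jacobi_cn p u * jacobi_dn p u) (at u)"
  unfolding jacobi_sn_def[abs_def] jacobi_cn_def
  by (auto intro!: derivative_eq_intros jacobi_am_has_derivative)

lemma jacobi_cn_has_derivative: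
  "(jacobi_cn p has_real_derivative - (jacobi_sn p u * jacobi_dn p u)) (at u)"
  unfolding jacobi_cn_def[abs_def] jacobi_sn_def
  by (auto intro!: derivative_eq_intros jacobi_am_has_derivative)

lemma jacobi_dn_has_derivative:
  "(jacobi_dn p has_real_derivative - (p\<^sup>2 * jacobi_sn p u * jacobi_cn p u)) (at u)"
proof -
  have "1 - p\<^sup>2 * (jacobi_sn p u)\<^sup>2 > 0"
    using jacobi_dn_pos[of u] jacobi_dn_sq[of u] by (metis zero_less_power)
  then show ?thesis
    using jacobi_dn_pos[of u]
    unfolding jacobi_dn_def[abs_def]
    by (auto intro!: derivative_eq_intros jacobi_sn_has_derivative
        simp: jacobi_dn_def field_simps power2_eq_square)
qed

lemma jacobi_sn_cn: "(jacobi_sn p u)\<^sup>2 + (jacobi_cn p u)\<^sup>2 = 1"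
  by (simp add: jacobi_sn_def jacobi_cn_def)

text \<open>
  \<open>(cn, sn)\<close> is \<open>(cos, sin)\<close> of the amplitude, so it runs through the whole circle, and through the open
  right half of it when the modulus is 1.
\<close>

lemma jacobi_point:
  assumes "x\<^sup>2 + y\<^sup>2 = 1" "p = 1 \<longrightarrow> x > 0"
  obtains u where "jacobi_cn p u = x" "jacobi_sn p u = y"
proof -
  obtain t where t: "x = cos t" "y = sin t" "-pi < t" "t \<le> pi"
    using sincos_principal_value sincos_total_2pi assms(1) by metis
  have "t \<in> am_range p"
  proof (cases "p = 1")
    case True
    then have "cos t > 0" using assms t by simp
    then have "\<bar>t\<bar> < pi / 2"
      using t(3,4) cos_ge_minus_one
      by (smt (verit, best) cos_minus cos_monotone_0_pi_le cos_pi_half pi_gt_zero field_sum_of_halves)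
    then show ?thesis by (auto simp: am_range_def)
  qed (simp add: am_range_def)
  then show thesis
    using that[of "elliptic_F p t"] t by (simp add: jacobi_cn_def jacobi_sn_def jacobi_am_elliptic_F)
qed

text \<open>
  For \<open>k \<le> 0\<close> the denominator stays positive, so the integral is differentiable on the whole line. All
  the parameters that occur in the classification are of this kind.
\<close>

lemma elliptic_Pi_has_derivative:
  assumes "k \<le> 0"
  shows "((\<lambda>s. elliptic_Pi k s p) has_real_derivative 1 / (1 - k * (jacobi_sn p s)\<^sup>2)) (at s)"
proof -
  have "1 - k * (jacobi_sn p u)\<^sup>2 > 0" for u
    using assms by (smt (verit) mult_nonpos_nonneg zero_le_power2)
  then have "continuous_on UNIV (\<lambda>u. 1 / (1 - k * (jacobi_sn p u)\<^sup>2))"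
    using jacobi_sn_has_derivative
    by (intro continuous_intros DERIV_continuous_on[where D="\<lambda>u. jacobi_cn p u * jacobi_dn p u"])
       (auto simp: less_le)
  from interval_integral_from_0_has_derivative[OF _ _ _ _ this]
  show ?thesis by (simp add: elliptic_Pi_def[abs_def])
qed

end

section \<open>The Euler system and its elliptic solutions\<close>

text \<open>
  The equations of the Euler top for \<open>(r, w, v)\<close> on the unit sphere. For a rotational surface of
  curvature \<open>K\<close>, \<open>r\<close> is the radius of the orbit and \<open>w\<close> its derivative by arc length of the profile;
  \<open>v\<close> is the speed of the profile, and also the length of the component of the unit normal in the plane
  of rotation. By arc length, \<open>r'' = - (K + 1) r\<close>: this is the equation of a surface of revolution of
  intrinsic curvature \<open>K + 1\<close>.
\<close>

definition euler_top ::
  "real \<Rightarrow> real set \<Rightarrow> (real \<Rightarrow> real) \<Rightarrow> (real \<Rightarrow> real) \<Rightarrow> (real \<Rightarrow> real) \<Rightarrow> bool" where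
  "euler_top K I r w v \<longleftrightarrow> (\<forall>s\<in>I.
     (r has_real_derivative w s * v s) (at s) \<and>
     (w has_real_derivative - (K + 1) * r s * v s) (at s) \<and>
     (v has_real_derivative K * r s * w s) (at s) \<and>
     (r s)\<^sup>2 + (w s)\<^sup>2 + (v s)\<^sup>2 = 1)"

context
  fixes p :: real
  assumes p: "p \<in> {0..1}"
begin

lemma jacobi_scaled_derivs:
  fixes X s :: real
  shows "((\<lambda>s. jacobi_sn p (X * s)) has_real_derivative
           X * (jacobi_cn p (X * s) * jacobi_dn p (X * s))) (at s)"
    and "((\<lambda>s. jacobi_cn p (X * s)) has_real_derivative
           - (X * (jacobi_sn p (X * s) * jacobi_dn p (X * s)))) (at s)"
    and "((\<lambda>s. jacobi_dn p (X * s)) has_real_derivative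
           - (X * (p\<^sup>2 * jacobi_sn p (X * s) * jacobi_cn p (X * s)))) (at s)"
  using DERIV_chain2[OF jacobi_sn_has_derivative[OF p] DERIV_cmult_Id[of X s]]
    DERIV_chain2[OF jacobi_cn_has_derivative[OF p] DERIV_cmult_Id[of X s]]
    DERIV_chain2[OF jacobi_dn_has_derivative[OF p] DERIV_cmult_Id[of X s]]
  by (simp_all add: algebra_simps)

lemma elliptic_Pi_scaled_deriv:
  fixes X s k :: real
  assumes "k \<le> 0" "X \<noteq> 0"
  shows "((\<lambda>s. c / X * elliptic_Pi k (X * s) p) has_real_derivative
           c / (1 - k * (jacobi_sn p (X * s))\<^sup>2)) (at s)"
  using DERIV_cmult[OF DERIV_chain2[OF elliptic_Pi_has_derivative[OF p assms(1)] DERIV_cmult_Id[of X s]], of "c / X"]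
  using assms(2) by simp

text \<open>
  The derivative of each of \<open>sn\<close>, \<open>cn\<close>, \<open>dn\<close> is a multiple of the product of the other two, as in the
  Euler system; so suitably scaled copies of them, in any order, are solutions. The order is decided by
  the signs of \<open>K\<close> and \<open>K + 1\<close> and by the value of a first integral: the component that keeps its sign is
  the one given by \<open>dn\<close>.
\<close>

lemma euler_top_cn_sn_dn:
  assumes "A * X = B * C" "C * X = (K + 1) * A * B" "B * p\<^sup>2 * X = K * A * C"
    and "A\<^sup>2 + B\<^sup>2 = 1" "C\<^sup>2 = A\<^sup>2 + B\<^sup>2 * p\<^sup>2"
  shows "euler_top K UNIV (\<lambda>s. A * jacobi_cn p (X * s)) (\<lambda>s. - C * jacobi_sn p (X * s))
           (\<lambda>s. B * jacobi_dn p (X * s))"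
  unfolding euler_top_def
proof (intro ballI conjI)
  fix s :: real
  define sn cn dn where defs: "sn = jacobi_sn p (X * s)" "cn = jacobi_cn p (X * s)" "dn = jacobi_dn p (X * s)"
  note d = jacobi_scaled_derivs[of X s, folded defs]
  have i: "sn\<^sup>2 + cn\<^sup>2 = 1" "dn\<^sup>2 = 1 - p\<^sup>2 * sn\<^sup>2"
    unfolding defs using jacobi_sn_cn[OF p] jacobi_dn_sq[OF p] by auto
  show "((\<lambda>s. A * jacobi_cn p (X * s)) has_real_derivative (- C * jacobi_sn p (X * s)) * (B * jacobi_dn p (X * s))) (at s)"
    unfolding defs[symmetric] by (rule DERIV_cong[OF DERIV_cmult[OF d(2)]]) (use assms(1) in algebra)
  show "((\<lambda>s. - C * jacobi_sn p (X * s)) has_real_derivative - (K + 1) * (A * jacobi_cn p (X * s)) * (B * jacobi_dn p (X * s))) (at s)"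
    unfolding defs[symmetric] by (rule DERIV_cong[OF DERIV_cmult[OF d(1)]]) (use assms(2) in algebra)
  show "((\<lambda>s. B * jacobi_dn p (X * s)) has_real_derivative K * (A * jacobi_cn p (X * s)) * (- C * jacobi_sn p (X * s))) (at s)"
    unfolding defs[symmetric] by (rule DERIV_cong[OF DERIV_cmult[OF d(3)]]) (use assms(3) in algebra)
  show "(A * jacobi_cn p (X * s))\<^sup>2 + (- C * jacobi_sn p (X * s))\<^sup>2 + (B * jacobi_dn p (X * s))\<^sup>2 = 1"
    unfolding defs[symmetric] using assms(4,5) i by algebra
qed

lemma euler_top_dn_sn_cn:
  assumes "A * p\<^sup>2 * X = B * C" "C * X = (K + 1) * A * B" "B * X = K * A * C"
    and "A\<^sup>2 + B\<^sup>2 = 1" "C\<^sup>2 = A\<^sup>2 * p\<^sup>2 + B\<^sup>2"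
  shows "euler_top K UNIV (\<lambda>s. A * jacobi_dn p (X * s)) (\<lambda>s. - C * jacobi_sn p (X * s))
           (\<lambda>s. B * jacobi_cn p (X * s))"
  unfolding euler_top_def
proof (intro ballI conjI)
  fix s :: real
  define sn cn dn where defs: "sn = jacobi_sn p (X * s)" "cn = jacobi_cn p (X * s)" "dn = jacobi_dn p (X * s)"
  note d = jacobi_scaled_derivs[of X s, folded defs]
  have i: "sn\<^sup>2 + cn\<^sup>2 = 1" "dn\<^sup>2 = 1 - p\<^sup>2 * sn\<^sup>2"
    unfolding defs using jacobi_sn_cn[OF p] jacobi_dn_sq[OF p] by auto
  show "((\<lambda>s. A * jacobi_dn p (X * s)) has_real_derivative (- C * jacobi_sn p (X * s)) * (B * jacobi_cn p (X * s))) (at s)"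
    unfolding defs[symmetric] by (rule DERIV_cong[OF DERIV_cmult[OF d(3)]]) (use assms(1) in algebra)
  show "((\<lambda>s. - C * jacobi_sn p (X * s)) has_real_derivative - (K + 1) * (A * jacobi_dn p (X * s)) * (B * jacobi_cn p (X * s))) (at s)"
    unfolding defs[symmetric] by (rule DERIV_cong[OF DERIV_cmult[OF d(1)]]) (use assms(2) in algebra)
  show "((\<lambda>s. B * jacobi_cn p (X * s)) has_real_derivative K * (A * jacobi_dn p (X * s)) * (- C * jacobi_sn p (X * s))) (at s)"
    unfolding defs[symmetric] by (rule DERIV_cong[OF DERIV_cmult[OF d(2)]]) (use assms(3) in algebra)
  show "(A * jacobi_dn p (X * s))\<^sup>2 + (- C * jacobi_sn p (X * s))\<^sup>2 + (B * jacobi_cn p (X * s))\<^sup>2 = 1"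
    unfolding defs[symmetric] using assms(4,5) i by algebra
qed

lemma euler_top_cn_dn_sn:
  assumes "A * X = B * C" "C * p\<^sup>2 * X = - (K + 1) * A * B" "B * X = - K * A * C"
    and "A\<^sup>2 + C\<^sup>2 = 1" "B\<^sup>2 = A\<^sup>2 + C\<^sup>2 * p\<^sup>2"
  shows "euler_top K UNIV (\<lambda>s. A * jacobi_cn p (X * s)) (\<lambda>s. - C * jacobi_dn p (X * s))
           (\<lambda>s. B * jacobi_sn p (X * s))"
  unfolding euler_top_def
proof (intro ballI conjI)
  fix s :: real
  define sn cn dn where defs: "sn = jacobi_sn p (X * s)" "cn = jacobi_cn p (X * s)" "dn = jacobi_dn p (X * s)"
  note d = jacobi_scaled_derivs[of X s, folded defs]
  have i: "sn\<^sup>2 + cn\<^sup>2 = 1" "dn\<^sup>2 = 1 - p\<^sup>2 * sn\<^sup>2"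
    unfolding defs using jacobi_sn_cn[OF p] jacobi_dn_sq[OF p] by auto
  show "((\<lambda>s. A * jacobi_cn p (X * s)) has_real_derivative (- C * jacobi_dn p (X * s)) * (B * jacobi_sn p (X * s))) (at s)"
    unfolding defs[symmetric] by (rule DERIV_cong[OF DERIV_cmult[OF d(2)]]) (use assms(1) in algebra)
  show "((\<lambda>s. - C * jacobi_dn p (X * s)) has_real_derivative - (K + 1) * (A * jacobi_cn p (X * s)) * (B * jacobi_sn p (X * s))) (at s)"
    unfolding defs[symmetric] by (rule DERIV_cong[OF DERIV_cmult[OF d(3)]]) (use assms(2) in algebra)
  show "((\<lambda>s. B * jacobi_sn p (X * s)) has_real_derivative K * (A * jacobi_cn p (X * s)) * (- C * jacobi_dn p (X * s))) (at s)"
    unfolding defs[symmetric] by (rule DERIV_cong[OF DERIV_cmult[OF d(1)]]) (use assms(3) in algebra)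
  show "(A * jacobi_cn p (X * s))\<^sup>2 + (- C * jacobi_dn p (X * s))\<^sup>2 + (B * jacobi_sn p (X * s))\<^sup>2 = 1"
    unfolding defs[symmetric] using assms(4,5) i by algebra
qed

lemma euler_top_dn_cn_sn:
  assumes "A * p\<^sup>2 * X = B * C" "C * X = - (K + 1) * A * B" "B * X = - K * A * C"
    and "A\<^sup>2 + C\<^sup>2 = 1" "B\<^sup>2 = C\<^sup>2 + A\<^sup>2 * p\<^sup>2"
  shows "euler_top K UNIV (\<lambda>s. A * jacobi_dn p (X * s)) (\<lambda>s. - C * jacobi_cn p (X * s))
           (\<lambda>s. B * jacobi_sn p (X * s))"
  unfolding euler_top_def
proof (intro ballI conjI)
  fix s :: real
  define sn cn dn where defs: "sn = jacobi_sn p (X * s)" "cn = jacobi_cn p (X * s)" "dn = jacobi_dn p (X * s)"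
  note d = jacobi_scaled_derivs[of X s, folded defs]
  have i: "sn\<^sup>2 + cn\<^sup>2 = 1" "dn\<^sup>2 = 1 - p\<^sup>2 * sn\<^sup>2"
    unfolding defs using jacobi_sn_cn[OF p] jacobi_dn_sq[OF p] by auto
  show "((\<lambda>s. A * jacobi_dn p (X * s)) has_real_derivative (- C * jacobi_cn p (X * s)) * (B * jacobi_sn p (X * s))) (at s)"
    unfolding defs[symmetric] by (rule DERIV_cong[OF DERIV_cmult[OF d(3)]]) (use assms(1) in algebra)
  show "((\<lambda>s. - C * jacobi_cn p (X * s)) has_real_derivative - (K + 1) * (A * jacobi_dn p (X * s)) * (B * jacobi_sn p (X * s))) (at s)"
    unfolding defs[symmetric] by (rule DERIV_cong[OF DERIV_cmult[OF d(2)]]) (use assms(2) in algebra)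
  show "((\<lambda>s. B * jacobi_sn p (X * s)) has_real_derivative K * (A * jacobi_dn p (X * s)) * (- C * jacobi_cn p (X * s))) (at s)"
    unfolding defs[symmetric] by (rule DERIV_cong[OF DERIV_cmult[OF d(1)]]) (use assms(3) in algebra)
  show "(A * jacobi_dn p (X * s))\<^sup>2 + (- C * jacobi_cn p (X * s))\<^sup>2 + (B * jacobi_sn p (X * s))\<^sup>2 = 1"
    unfolding defs[symmetric] using assms(4,5) i by algebra
qed

text \<open>
  The quotients \<open>cd\<close>, \<open>sd\<close>, \<open>nd\<close> are \<open>sn\<close>, \<open>cn\<close>, \<open>dn\<close> with the argument moved by a quarter period, up to
  constants and for moduli below 1, so they form a triple of the same kind.
\<close>

lemma jacobi_cd_sd_nd_derivs:
  fixes X s :: real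
  defines "m \<equiv> 1 - p\<^sup>2"
  shows "((\<lambda>s. jacobi_cd p (X * s)) has_real_derivative
           - (X * (m * (jacobi_sn p (X * s) / (jacobi_dn p (X * s))\<^sup>2)))) (at s)"
    and "((\<lambda>s. jacobi_sn p (X * s) / jacobi_dn p (X * s)) has_real_derivative
           X * (jacobi_cn p (X * s) / (jacobi_dn p (X * s))\<^sup>2)) (at s)"
    and "((\<lambda>s. 1 / jacobi_dn p (X * s)) has_real_derivative
           X * (p\<^sup>2 * (jacobi_sn p (X * s) * jacobi_cn p (X * s) / (jacobi_dn p (X * s))\<^sup>2))) (at s)"
proof -
  have nz: "jacobi_dn p u \<noteq> 0" for u using jacobi_dn_pos[OF p, of u] by simp
  let ?s = "jacobi_sn p (X * s)" and ?c = "jacobi_cn p (X * s)" and ?d = "jacobi_dn p (X * s)"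
  have i: "?s\<^sup>2 + ?c\<^sup>2 = 1" "?d\<^sup>2 = 1 - p\<^sup>2 * ?s\<^sup>2"
    using jacobi_sn_cn[OF p] jacobi_dn_sq[OF p] by auto
  have 1: "(- (X * (?s * ?d)) * ?d - ?c * - (X * (p\<^sup>2 * ?s * ?c))) = - (X * (m * ?s))"
    unfolding m_def using i by algebra
  have 2: "(X * (?c * ?d) * ?d - ?s * - (X * (p\<^sup>2 * ?s * ?c))) = X * ?c"
    using i by algebra
  show "((\<lambda>s. jacobi_cd p (X * s)) has_real_derivative - (X * (m * (?s / ?d\<^sup>2)))) (at s)"
    unfolding jacobi_cd_def
    using DERIV_divide[OF jacobi_scaled_derivs(2,3)[of X s] nz] unfolding 1 by (simp add: power2_eq_square)
  show "((\<lambda>s. jacobi_sn p (X * s) / jacobi_dn p (X * s)) has_real_derivative X * (?c / ?d\<^sup>2)) (at s)"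
    using DERIV_divide[OF jacobi_scaled_derivs(1,3)[of X s] nz] unfolding 2 by (simp add: power2_eq_square)
  show "((\<lambda>s. 1 / jacobi_dn p (X * s)) has_real_derivative X * (p\<^sup>2 * (?s * ?c / ?d\<^sup>2))) (at s)"
    using DERIV_divide[OF DERIV_const jacobi_scaled_derivs(3)[of X s] nz, of 1]
    by (simp add: power2_eq_square mult.assoc)
qed

lemma euler_top_cd_sd_nd:
  assumes "A * (1 - p\<^sup>2) * X = B * C" "C * X = (K + 1) * A * B" "B * p\<^sup>2 * X = - K * A * C"
    and "A\<^sup>2 + B\<^sup>2 = 1" "B\<^sup>2 + C\<^sup>2 = 1 - p\<^sup>2"
  shows "euler_top K UNIV (\<lambda>s. A * jacobi_cd p (X * s)) (\<lambda>s. - C * (jacobi_sn p (X * s) / jacobi_dn p (X * s)))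
           (\<lambda>s. B * (1 / jacobi_dn p (X * s)))"
  unfolding euler_top_def
proof (intro ballI conjI)
  fix s :: real
  define sn cn dn where defs: "sn = jacobi_sn p (X * s)" "cn = jacobi_cn p (X * s)" "dn = jacobi_dn p (X * s)"
  note d = jacobi_cd_sd_nd_derivs[of X s, folded defs]
  have i: "sn\<^sup>2 + cn\<^sup>2 = 1" "dn\<^sup>2 = 1 - p\<^sup>2 * sn\<^sup>2"
    unfolding defs using jacobi_sn_cn[OF p] jacobi_dn_sq[OF p] by auto
  have nz: "dn \<noteq> 0" unfolding defs using jacobi_dn_pos[OF p, of "X * s"] by simp
  show "((\<lambda>s. A * jacobi_cd p (X * s)) has_real_derivative (- C * (jacobi_sn p (X * s) / jacobi_dn p (X * s))) * (B * (1 / jacobi_dn p (X * s)))) (at s)"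
    by (rule DERIV_cong[OF DERIV_cmult[OF d(1)]])
      (use assms(1) nz in \<open>simp add: jacobi_cd_def defs[symmetric] field_simps power2_eq_square; algebra\<close>)
  show "((\<lambda>s. - C * (jacobi_sn p (X * s) / jacobi_dn p (X * s))) has_real_derivative - (K + 1) * (A * jacobi_cd p (X * s)) * (B * (1 / jacobi_dn p (X * s)))) (at s)"
    by (rule DERIV_cong[OF DERIV_cmult[OF d(2)]])
      (use assms(2) nz in \<open>simp add: jacobi_cd_def defs[symmetric] field_simps power2_eq_square; algebra\<close>)
  show "((\<lambda>s. B * (1 / jacobi_dn p (X * s))) has_real_derivative K * (A * jacobi_cd p (X * s)) * (- C * (jacobi_sn p (X * s) / jacobi_dn p (X * s)))) (at s)"
    by (rule DERIV_cong[OF DERIV_cmult[OF d(3)]])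
      (use assms(3) nz in \<open>simp add: jacobi_cd_def defs[symmetric] field_simps power2_eq_square; algebra\<close>)
  have "(A * cn)\<^sup>2 + (C * sn)\<^sup>2 + B\<^sup>2 = dn\<^sup>2" using assms(4,5) i by algebra
  then show "(A * jacobi_cd p (X * s))\<^sup>2 + (- C * (jacobi_sn p (X * s) / jacobi_dn p (X * s)))\<^sup>2 + (B * (1 / jacobi_dn p (X * s)))\<^sup>2 = 1"
    using nz by (simp add: jacobi_cd_def defs[symmetric] power_divide power_mult_distrib add_divide_distrib[symmetric])
qed

lemma euler_top_cd_nd_sd:
  assumes "A * (1 - p\<^sup>2) * X = B * C" "C * p\<^sup>2 * X = (K + 1) * A * B" "B * X = - K * A * C"
    and "A\<^sup>2 + C\<^sup>2 = 1" "B\<^sup>2 + C\<^sup>2 = 1 - p\<^sup>2"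
  shows "euler_top K UNIV (\<lambda>s. A * jacobi_cd p (X * s)) (\<lambda>s. - C * (1 / jacobi_dn p (X * s)))
           (\<lambda>s. B * (jacobi_sn p (X * s) / jacobi_dn p (X * s)))"
  unfolding euler_top_def
proof (intro ballI conjI)
  fix s :: real
  define sn cn dn where defs: "sn = jacobi_sn p (X * s)" "cn = jacobi_cn p (X * s)" "dn = jacobi_dn p (X * s)"
  note d = jacobi_cd_sd_nd_derivs[of X s, folded defs]
  have i: "sn\<^sup>2 + cn\<^sup>2 = 1" "dn\<^sup>2 = 1 - p\<^sup>2 * sn\<^sup>2"
    unfolding defs using jacobi_sn_cn[OF p] jacobi_dn_sq[OF p] by auto
  have nz: "dn \<noteq> 0" unfolding defs using jacobi_dn_pos[OF p, of "X * s"] by simp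
  show "((\<lambda>s. A * jacobi_cd p (X * s)) has_real_derivative (- C * (1 / jacobi_dn p (X * s))) * (B * (jacobi_sn p (X * s) / jacobi_dn p (X * s)))) (at s)"
    by (rule DERIV_cong[OF DERIV_cmult[OF d(1)]])
      (use assms(1) nz in \<open>simp add: jacobi_cd_def defs[symmetric] field_simps power2_eq_square; algebra\<close>)
  show "((\<lambda>s. - C * (1 / jacobi_dn p (X * s))) has_real_derivative - (K + 1) * (A * jacobi_cd p (X * s)) * (B * (jacobi_sn p (X * s) / jacobi_dn p (X * s)))) (at s)"
    by (rule DERIV_cong[OF DERIV_cmult[OF d(3)]])
      (use assms(2) nz in \<open>simp add: jacobi_cd_def defs[symmetric] field_simps power2_eq_square; algebra\<close>)
  show "((\<lambda>s. B * (jacobi_sn p (X * s) / jacobi_dn p (X * s))) has_real_derivative K * (A * jacobi_cd p (X * s)) * (- C * (1 / jacobi_dn p (X * s)))) (at s)"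
    by (rule DERIV_cong[OF DERIV_cmult[OF d(2)]])
      (use assms(3) nz in \<open>simp add: jacobi_cd_def defs[symmetric] field_simps power2_eq_square; algebra\<close>)
  have "(A * cn)\<^sup>2 + C\<^sup>2 + (B * sn)\<^sup>2 = dn\<^sup>2" using assms(4,5) i by algebra
  then show "(A * jacobi_cd p (X * s))\<^sup>2 + (- C * (1 / jacobi_dn p (X * s)))\<^sup>2 + (B * (jacobi_sn p (X * s) / jacobi_dn p (X * s)))\<^sup>2 = 1"
    using nz by (simp add: jacobi_cd_def defs[symmetric] power_divide power_mult_distrib add_divide_distrib[symmetric])
qed

end

section \<open>Solutions with prescribed initial values\<close>

text \<open>
  \<open>\<psi>\<close> is the angle of the profile in the plane fixed by the rotation. Its equation is demanded only where
  \<open>r\<close> and \<open>v\<close> are positive: a profile curve lives there, and the explicit formulas go on beyond it.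
\<close>

definition profile_solution ::
  "real \<Rightarrow> (real \<Rightarrow> real) \<Rightarrow> (real \<Rightarrow> real) \<Rightarrow> (real \<Rightarrow> real) \<Rightarrow> (real \<Rightarrow> real) \<Rightarrow> bool" where
  "profile_solution K r w v \<psi> \<longleftrightarrow> euler_top K UNIV r w v \<and>
     (\<forall>s. r s > 0 \<longrightarrow> v s > 0 \<longrightarrow> (\<psi> has_real_derivative (v s)\<^sup>2 / (1 - (r s)\<^sup>2)) (at s))"

definition explicit_profile :: "real \<Rightarrow> (real \<Rightarrow> real) \<Rightarrow> (real \<Rightarrow> real) \<Rightarrow> bool" where
  "explicit_profile K r \<psi> \<longleftrightarrow>
     (K < -1 \<longrightarrow> profile_hyperbolic K r \<psi>) \<and>
     (K = -1 \<longrightarrow> profile_flat r \<psi>) \<and>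
     (-1 < K \<and> K < 0 \<longrightarrow> profile_intermediate K r \<psi>) \<and>
     (K > 0 \<longrightarrow> profile_spherical K r \<psi>)"

lemma jacobi_point_ex:
  assumes "p \<in> {0..1}" "x\<^sup>2 + y\<^sup>2 = 1" "p < 1 \<or> x > 0"
  shows "\<exists>u. jacobi_cn p u = x \<and> jacobi_sn p u = y"
  using assms(3) by (rule_tac jacobi_point[OF assms(1,2)]) auto

lemma ellipse_point:
  fixes A B :: real
  assumes "A > 0" "B > 0" "x\<^sup>2 * B\<^sup>2 + y\<^sup>2 * A\<^sup>2 = A\<^sup>2 * B\<^sup>2"
  shows "(x / A)\<^sup>2 + (y / B)\<^sup>2 = 1"
proof -
  have "(x / A)\<^sup>2 + (y / B)\<^sup>2 = (x\<^sup>2 * B\<^sup>2 + y\<^sup>2 * A\<^sup>2) / (A\<^sup>2 * B\<^sup>2)"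
    using assms(1,2) by (simp add: add_divide_distrib power_divide)
  then show ?thesis unfolding assms(3) using assms(1,2) by simp
qed

lemma nonneg_eq_of_sphere:
  fixes x :: real
  assumes "x\<^sup>2 + y\<^sup>2 + z\<^sup>2 = 1" "x'\<^sup>2 + y\<^sup>2 + z\<^sup>2 = 1" "x \<ge> 0" "x' \<ge> 0"
  shows "x = x'"
proof (rule power2_eq_imp_eq)
  show "x\<^sup>2 = x'\<^sup>2" using assms(1,2) by linarith
qed (use assms(3,4) in linarith)+

text \<open>
  Dividing by \<open>dn\<close> maps the circle of \<open>(cn, sn)\<close> onto the ellipse of \<open>(cd, sd)\<close>: conversely a point of
  the ellipse has the direction of a point of the circle, which \<open>q\<close> normalises.
\<close>

lemma jacobi_point_cd:
  assumes p: "p \<in> {0..1}" "p < 1" and xy: "x\<^sup>2 + (1 - p\<^sup>2) * y\<^sup>2 = 1"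
  shows "\<exists>u. jacobi_cd p u = x \<and> jacobi_sn p u / jacobi_dn p u = y"
proof -
  define q where "q = sqrt (1 + p\<^sup>2 * y\<^sup>2)"
  have q2: "q\<^sup>2 = 1 + p\<^sup>2 * y\<^sup>2" and q: "q > 0" by (auto simp: q_def add_pos_nonneg)
  have "x\<^sup>2 + y\<^sup>2 = q\<^sup>2" unfolding q2 using xy by algebra
  then have "(x / q)\<^sup>2 + (y / q)\<^sup>2 = 1"
    using q by (simp only: power_divide add_divide_distrib[symmetric]) simp
  then have "\<exists>u. jacobi_cn p u = x / q \<and> jacobi_sn p u = y / q"
    by (rule jacobi_point_ex[OF p(1)]) (use p(2) in simp)
  then obtain u where u: "jacobi_cn p u = x / q" "jacobi_sn p u = y / q" by blast
  have "(jacobi_dn p u)\<^sup>2 = (q\<^sup>2 - p\<^sup>2 * y\<^sup>2) / q\<^sup>2"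
    unfolding jacobi_dn_sq[OF p(1)] u using q by (simp add: power_divide diff_divide_distrib)
  also have "\<dots> = (1 / q)\<^sup>2" by (simp add: q2 power_divide)
  finally have "jacobi_dn p u = 1 / q"
    using q jacobi_dn_pos[OF p(1), of u] by (simp add: power2_eq_iff_nonneg)
  then show ?thesis using u q by (intro exI[of _ u]) (simp add: jacobi_cd_def)
qed

context
  fixes K r0 w0 v0 :: real
  assumes sphere: "r0\<^sup>2 + w0\<^sup>2 + v0\<^sup>2 = 1" and r0: "r0 > 0" and v0: "v0 > 0"
begin

text \<open>
  The quantity \<open>c = (K + 1) r^2 + w^2\<close> is a first integral of the Euler system, with the critical values
  0, 1 and \<open>K + 1\<close>, taken at its fixed points. In each of the regions between these values one of the
  elliptic families fills the level sets of \<open>c\<close>: the modulus \<open>p\<close> is computed from \<open>c\<close>, two of the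
  three initial values then give the parameter \<open>s\<close> as a point of an ellipse, and the sphere gives the
  absolute value of the third one. The formula for \<open>\<psi>\<close> comes from writing \<open>v^2 / (1 - r^2)\<close> as a constant plus
  a multiple of \<open>1 / y\<close>, where \<open>y\<close> is the denominator in the integral of the third kind.
\<close>

lemma spherical_cn_through:
  assumes K: "K > 0" and c: "(K + 1) * r0\<^sup>2 + w0\<^sup>2 < 1"
  shows "\<exists>r w v \<psi> s. profile_solution K r w v \<psi> \<and> r s = r0 \<and> w s = w0 \<and> v s = v0 \<and>
    profile_spherical K r \<psi>"
proof -
  define c where "c = (K + 1) * r0\<^sup>2 + w0\<^sup>2"
  have c01: "0 < c" "c < 1"
    using K r0 c unfolding c_def by (simp_all add: add_pos_nonneg)
  \<comment> \<open>The solution of \<open>c (K + p^2) = (K + 1) p^2\<close>, the value of the first integral on the family.\<close>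
  define p where "p = sqrt (c * K / (K + 1 - c))"
  have "0 < c * K / (K + 1 - c)"
    by (intro divide_pos_pos mult_pos_pos) (use c01 K in simp_all)
  then have p2: "p\<^sup>2 = c * K / (K + 1 - c)" and p: "0 < p"
    unfolding p_def by (simp_all only: real_sqrt_pow2 real_sqrt_gt_0_iff less_imp_le)
  have "p\<^sup>2 < 1"
  proof -
    have "c * (K + 1) < 1 * (K + 1)" using c01 K by (intro mult_strict_right_mono) auto
    then have "c * K < K + 1 - c" by (simp add: distrib_left)
    moreover have "0 < (K + 1 - c)" by (intro mult_pos_pos)? (use c01 K in simp_all)
    ultimately show ?thesis unfolding p2 by (simp only: divide_less_eq_1_pos divide_le_eq_1_pos)
  qed
  then have p1: "p < 1" using p by (simp add: power_less_one_iff)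
  then have pI: "p \<in> {0..1}" using p by simp
  define a e D where defs: "a = sqrt K" "e = sqrt (K + 1)" "D = sqrt (K + p\<^sup>2)"
  have D2: "K + p\<^sup>2 > 0"
  proof -
    have "0 < 1 + p\<^sup>2" by (simp add: add_pos_nonneg)
    then show ?thesis using K zero_less_power[OF p, of 2] by linarith
  qed
  have pos: "a > 0" "e > 0" "D > 0" and sq: "a\<^sup>2 = K" "e\<^sup>2 = K + 1" "D\<^sup>2 = K + p\<^sup>2"
    using K D2 by (simp_all add: defs)
  define A B C where ABC: "A = p / D" "B = a / D" "C = e * p / D"
  define X where Xd: "X = a * e / D"
  have X: "X \<noteq> 0" using pos Xd by simp
  define r where "r = (\<lambda>s. A * jacobi_cn p (X * s))"
  define w where "w = (\<lambda>s. - C * jacobi_sn p (X * s))"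
  define v where "v = (\<lambda>s. B * jacobi_dn p (X * s))"
  define \<psi> where "\<psi> = (\<lambda>s. (K + 1) / X * elliptic_Pi (- (p\<^sup>2 / K)) (X * s) p - K * s)"
  have top: "euler_top K UNIV r w v"
    unfolding r_def w_def v_def
  proof (rule euler_top_cn_sn_dn[OF pI])
    show "A * X = B * C" unfolding ABC Xd by simp
    show "C * X = (K + 1) * A * B" unfolding ABC Xd sq(2)[symmetric] by (simp add: power2_eq_square)
    show "B * p\<^sup>2 * X = K * A * C" unfolding ABC Xd sq(1)[symmetric] by (simp add: power2_eq_square)
    show "A\<^sup>2 + B\<^sup>2 = 1" "C\<^sup>2 = A\<^sup>2 + B\<^sup>2 * p\<^sup>2"
      using D2 by (auto simp: ABC power_divide power_mult_distrib sq divide_simps) (simp_all add: algebra_simps)?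
  qed
  have ABC_pos: "A > 0" "B > 0" "C > 0" using p pos by (simp_all add: ABC)
  have "c * D\<^sup>2 = p\<^sup>2 * (K + 1)" unfolding sq p2 using c01 K by (simp add: divide_simps) (simp add: algebra_simps)?
  then have "c = (K + 1) * A\<^sup>2" using D2 by (simp add: ABC power_divide eq_divide_eq mult.commute sq)
  moreover have "C\<^sup>2 = (K + 1) * A\<^sup>2" by (simp add: ABC power_divide power_mult_distrib sq)
  ultimately have "r0\<^sup>2 * C\<^sup>2 + (- w0)\<^sup>2 * A\<^sup>2 = A\<^sup>2 * C\<^sup>2"
    unfolding c_def by algebra
  then have "(r0 / A)\<^sup>2 + (- w0 / C)\<^sup>2 = 1" by (rule ellipse_point[OF ABC_pos(1,3)])
  then have "\<exists>u. jacobi_cn p u = r0 / A \<and> jacobi_sn p u = - w0 / C"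
    by (rule jacobi_point_ex[OF pI]) (use p1 in simp)
  then obtain u where u: "jacobi_cn p u = r0 / A" "jacobi_sn p u = - w0 / C" by blast
  define s where "s = u / X"
  have Xs: "X * s = u" using X by (simp add: s_def)
  have rs: "r s = r0" "w s = w0" unfolding r_def w_def v_def Xs u using ABC_pos by simp_all
  have "(v s)\<^sup>2 + r0\<^sup>2 + w0\<^sup>2 = 1"
    using top unfolding euler_top_def rs[symmetric] by (simp add: algebra_simps)
  moreover have "v0\<^sup>2 + r0\<^sup>2 + w0\<^sup>2 = 1" unfolding power2_minus using sphere by linarith
  moreover have "v s \<ge> 0" using ABC_pos jacobi_dn_pos[OF pI, of "X * s"] by (simp add: v_def)
  moreover have "v0 \<ge> 0" using r0 v0 by simp
  ultimately have "v s = v0" by (rule nonneg_eq_of_sphere)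
  then have st: "r s = r0" "w s = w0" "v s = v0" using rs by simp_all
  moreover have "profile_solution K r w v \<psi>"
    unfolding profile_solution_def
  proof (intro conjI allI impI top)
    fix s
    let ?sn = "jacobi_sn p (X * s)"
    define y where "y = 1 + p\<^sup>2 / K * ?sn\<^sup>2"
    have y: "y > 0" using K by (simp add: y_def add_pos_nonneg)
    have cn: "(jacobi_cn p (X * s))\<^sup>2 = 1 - ?sn\<^sup>2" using jacobi_sn_cn[OF pI] by (simp add: algebra_simps)
    have Ky: "K * y = K + p\<^sup>2 * ?sn\<^sup>2" using K by (simp add: y_def distrib_left)
    have "(v s)\<^sup>2 = K * (1 - p\<^sup>2 * ?sn\<^sup>2) / (K + p\<^sup>2)"
      by (simp add: v_def ABC power_mult_distrib power_divide sq jacobi_dn_sq[OF pI])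
    moreover have "1 - (r s)\<^sup>2 = K * y / (K + p\<^sup>2)"
      using D2 by (simp add: r_def ABC power_mult_distrib power_divide sq cn Ky divide_simps) (simp add: algebra_simps)
    ultimately have "(v s)\<^sup>2 / (1 - (r s)\<^sup>2) = (1 - p\<^sup>2 * ?sn\<^sup>2) / y"
      using D2 K by simp
    moreover have "1 - p\<^sup>2 * ?sn\<^sup>2 = (K + 1) - K * y" using Ky by linarith
    ultimately have "(K + 1) / y - K = (v s)\<^sup>2 / (1 - (r s)\<^sup>2)"
      using y by (simp only: diff_divide_distrib) simp
    moreover have "(\<psi> has_real_derivative (K + 1) / y - K) (at s)"
      unfolding \<psi>_def y_def using K
        elliptic_Pi_scaled_deriv[OF pI _ X, of "- (p\<^sup>2 / K)" "K + 1" s]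
      by (intro DERIV_diff DERIV_cmult_Id) simp_all
    ultimately show "(\<psi> has_real_derivative (v s)\<^sup>2 / (1 - (r s)\<^sup>2)) (at s)" by simp
  qed
  moreover have "profile_spherical K r \<psi>"
  proof -
    have "X = sqrt (K * (K + 1) / (K + p\<^sup>2))" "A = sqrt (p\<^sup>2 / (K + p\<^sup>2))"
      using p unfolding ABC Xd defs real_sqrt_divide real_sqrt_mult by simp_all
    then show ?thesis unfolding profile_spherical_def Let_def
      by (intro disjI1 bexI[of _ p] conjI pI) (simp_all only: r_def \<psi>_def)
  qed
  ultimately show ?thesis
    using st by (intro exI[of _ r] exI[of _ w] exI[of _ v] exI[of _ \<psi>] exI[of _ s] conjI)
qed

lemma spherical_dn_through:
  assumes K: "K > 0" and c: "(K + 1) * r0\<^sup>2 + w0\<^sup>2 > 1"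
  shows "\<exists>r w v \<psi> s. profile_solution K r w v \<psi> \<and> r s = r0 \<and> w s = w0 \<and> v s = v0 \<and>
    profile_spherical K r \<psi>"
proof -
  define c where "c = (K + 1) * r0\<^sup>2 + w0\<^sup>2"
  have Kc: "K + 1 - c = (K + 1) * v0\<^sup>2 + K * w0\<^sup>2" unfolding c_def using sphere by algebra
  have c01: "1 < c" "0 < K + 1 - c"
    using c K v0 unfolding Kc unfolding c_def by (simp_all add: add_pos_nonneg)
  \<comment> \<open>The solution of \<open>c (K p^2 + 1) = K + 1\<close>.\<close>
  define p where "p = sqrt ((K + 1 - c) / (c * K))"
  have "0 < (K + 1 - c) / (c * K)"
    by (intro divide_pos_pos mult_pos_pos) (use c01 K in simp_all)
  then have p2: "p\<^sup>2 = (K + 1 - c) / (c * K)" and p: "0 < p"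
    unfolding p_def by (simp_all only: real_sqrt_pow2 real_sqrt_gt_0_iff less_imp_le)
  have "p\<^sup>2 < 1"
  proof -
    have "1 * (K + 1) < c * (K + 1)" using c01 K by (intro mult_strict_right_mono) auto
    then have "K + 1 - c < c * K" by (simp add: distrib_left)
    moreover have "0 < (c * K)" by (intro mult_pos_pos)? (use c01 K in simp_all)
    ultimately show ?thesis unfolding p2 by (simp only: divide_less_eq_1_pos divide_le_eq_1_pos)
  qed
  then have p1: "p < 1" using p by (simp add: power_less_one_iff)
  then have pI: "p \<in> {0..1}" using p by simp
  define a e D where defs: "a = sqrt K" "e = sqrt (K + 1)" "D = sqrt (K * p\<^sup>2 + 1)"
  have D2: "K * p\<^sup>2 + 1 > 0"
  proof -
    have "0 < K * p\<^sup>2" using K p by (intro mult_pos_pos) auto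
    then show ?thesis using K zero_less_power[OF p, of 2] by linarith
  qed
  have pos: "a > 0" "e > 0" "D > 0" and sq: "a\<^sup>2 = K" "e\<^sup>2 = K + 1" "D\<^sup>2 = K * p\<^sup>2 + 1"
    using K D2 by (simp_all add: defs)
  define A B C where ABC: "A = 1 / D" "B = a * p / D" "C = e * p / D"
  define X where Xd: "X = a * e / D"
  have X: "X \<noteq> 0" using pos Xd by simp
  define r where "r = (\<lambda>s. A * jacobi_dn p (X * s))"
  define w where "w = (\<lambda>s. - C * jacobi_sn p (X * s))"
  define v where "v = (\<lambda>s. B * jacobi_cn p (X * s))"
  define \<psi> where "\<psi> = (\<lambda>s. (K + 1) / X * elliptic_Pi (- (1 / K)) (X * s) p - K * s)"
  have top: "euler_top K UNIV r w v"
    unfolding r_def w_def v_def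
  proof (rule euler_top_dn_sn_cn[OF pI])
    show "A * p\<^sup>2 * X = B * C" unfolding ABC Xd by (simp add: power2_eq_square)
    show "C * X = (K + 1) * A * B" unfolding ABC Xd sq(2)[symmetric] by (simp add: power2_eq_square)
    show "B * X = K * A * C" unfolding ABC Xd sq(1)[symmetric] by (simp add: power2_eq_square)
    show "A\<^sup>2 + B\<^sup>2 = 1" "C\<^sup>2 = A\<^sup>2 * p\<^sup>2 + B\<^sup>2"
      using D2 by (auto simp: ABC power_divide power_mult_distrib sq divide_simps) (simp_all add: algebra_simps)?
  qed
  have ABC_pos: "A > 0" "B > 0" "C > 0" using p pos by (simp_all add: ABC)
  have "c * D\<^sup>2 = K + 1" unfolding sq p2 using c01 K by (simp add: divide_simps) (simp add: algebra_simps)?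
  then have "c = (K + 1) * A\<^sup>2" using D2 by (simp add: ABC power_divide eq_divide_eq mult.commute sq)
  moreover have "C\<^sup>2 = (K + 1) * (p\<^sup>2 * A\<^sup>2)" "B\<^sup>2 = K * (p\<^sup>2 * A\<^sup>2)"
    by (simp_all add: ABC power_divide power_mult_distrib sq)
  moreover have "A\<^sup>2 + K * (p\<^sup>2 * A\<^sup>2) = 1"
    using D2 by (simp add: ABC power_divide sq divide_simps) (simp add: algebra_simps)?
  ultimately have "v0\<^sup>2 * C\<^sup>2 + (- w0)\<^sup>2 * B\<^sup>2 = B\<^sup>2 * C\<^sup>2"
    using Kc by algebra
  then have "(v0 / B)\<^sup>2 + (- w0 / C)\<^sup>2 = 1" by (rule ellipse_point[OF ABC_pos(2,3)])
  then have "\<exists>u. jacobi_cn p u = v0 / B \<and> jacobi_sn p u = - w0 / C"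
    by (rule jacobi_point_ex[OF pI]) (use p1 in simp)
  then obtain u where u: "jacobi_cn p u = v0 / B" "jacobi_sn p u = - w0 / C" by blast
  define s where "s = u / X"
  have Xs: "X * s = u" using X by (simp add: s_def)
  have rs: "w s = w0" "v s = v0" unfolding r_def w_def v_def Xs u using ABC_pos by simp_all
  have "(r s)\<^sup>2 + w0\<^sup>2 + v0\<^sup>2 = 1"
    using top unfolding euler_top_def rs[symmetric] by (simp add: algebra_simps)
  moreover have "r0\<^sup>2 + w0\<^sup>2 + v0\<^sup>2 = 1" unfolding power2_minus using sphere by linarith
  moreover have "r s \<ge> 0" using ABC_pos jacobi_dn_pos[OF pI, of "X * s"] by (simp add: r_def)
  moreover have "r0 \<ge> 0" using r0 v0 by simp
  ultimately have "r s = r0" by (rule nonneg_eq_of_sphere)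
  then have st: "r s = r0" "w s = w0" "v s = v0" using rs by simp_all
  moreover have "profile_solution K r w v \<psi>"
    unfolding profile_solution_def
  proof (intro conjI allI impI top)
    fix s
    let ?sn = "jacobi_sn p (X * s)"
    define y where "y = 1 + 1 / K * ?sn\<^sup>2"
    have y: "y > 0" using K by (simp add: y_def add_pos_nonneg)
    have cn: "(jacobi_cn p (X * s))\<^sup>2 = 1 - ?sn\<^sup>2" using jacobi_sn_cn[OF pI] by (simp add: algebra_simps)
    have Ky: "K * y = K + ?sn\<^sup>2" using K by (simp add: y_def distrib_left)
    have "(v s)\<^sup>2 = K * p\<^sup>2 * (1 - ?sn\<^sup>2) / (K * p\<^sup>2 + 1)"
      by (simp add: v_def ABC power_mult_distrib power_divide sq cn)
    moreover have "1 - (r s)\<^sup>2 = K * p\<^sup>2 * y / (K * p\<^sup>2 + 1)"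
    proof -
      have Ky: "K * p\<^sup>2 * y = K * p\<^sup>2 + p\<^sup>2 * ?sn\<^sup>2" using Ky by algebra
      then show ?thesis
        using D2 by (simp add: r_def ABC power_mult_distrib power_divide sq jacobi_dn_sq[OF pI] Ky divide_simps)
    qed
    ultimately have "(v s)\<^sup>2 / (1 - (r s)\<^sup>2) = (1 - ?sn\<^sup>2) / y"
      using D2 K p by simp
    moreover have "1 - ?sn\<^sup>2 = (K + 1) - K * y" using Ky by linarith
    ultimately have "(K + 1) / y - K = (v s)\<^sup>2 / (1 - (r s)\<^sup>2)"
      using y by (simp only: diff_divide_distrib) simp
    moreover have "(\<psi> has_real_derivative (K + 1) / y - K) (at s)"
      unfolding \<psi>_def y_def using K
        elliptic_Pi_scaled_deriv[OF pI _ X, of "- (1 / K)" "K + 1" s]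
      by (intro DERIV_diff DERIV_cmult_Id) simp_all
    ultimately show "(\<psi> has_real_derivative (v s)\<^sup>2 / (1 - (r s)\<^sup>2)) (at s)" by simp
  qed
  moreover have "profile_spherical K r \<psi>"
  proof -
    have "X = sqrt (K * (K + 1) / (K * p\<^sup>2 + 1))" "A = sqrt (1 / (K * p\<^sup>2 + 1))"
      using p unfolding ABC Xd defs real_sqrt_divide real_sqrt_mult by simp_all
    then show ?thesis unfolding profile_spherical_def Let_def
      by (intro disjI2 bexI[of _ p] conjI pI) (simp_all only: r_def \<psi>_def)
  qed
  ultimately show ?thesis
    using st by (intro exI[of _ r] exI[of _ w] exI[of _ v] exI[of _ \<psi>] exI[of _ s] conjI)
qed

text \<open>
  Here \<open>w\<close> is a negative multiple of \<open>dn\<close> and never changes sign. The solutions with positive \<open>w\<close> are the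
  same ones run backwards. For \<open>c = 0\<close> the modulus is 1.
\<close>

lemma hyperbolic_cn_through:
  assumes K: "K < -1" and c: "(K + 1) * r0\<^sup>2 + w0\<^sup>2 \<ge> 0" and w0: "w0 \<le> 0"
  shows "\<exists>r w v \<psi> s. profile_solution K r w v \<psi> \<and> r s = r0 \<and> w s = w0 \<and> v s = v0 \<and>
    profile_hyperbolic K r \<psi>"
proof -
  define c where "c = (K + 1) * r0\<^sup>2 + w0\<^sup>2"
  have Kc: "1 - c = v0\<^sup>2 - K * r0\<^sup>2" unfolding c_def using sphere by algebra
  have "K * r0\<^sup>2 < 0" using K r0 by (simp add: mult_neg_pos)
  then have c01: "0 \<le> c" "c < 1" using c Kc zero_less_power[OF v0, of 2] unfolding c_def by linarith+
  have K: "K < -1" "0 < - (K + 1)" "0 < - K" "0 < c - (K + 1)" using K c01 by auto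
  \<comment> \<open>The solution of \<open>(1 - c) (p^2 - (K + 1)) = - K p^2\<close>.\<close>
  define p where "p = sqrt (- (K + 1) * (1 - c) / (c - (K + 1)))"
  have "0 < - (K + 1) * (1 - c) / (c - (K + 1))"
    by (intro divide_pos_pos mult_pos_pos) (use c01 K in simp_all)
  then have p2: "p\<^sup>2 = - (K + 1) * (1 - c) / (c - (K + 1))" and p: "0 < p"
    unfolding p_def by (simp_all only: real_sqrt_pow2 real_sqrt_gt_0_iff less_imp_le)
  have "p\<^sup>2 \<le> 1"
  proof -
    have "0 \<le> c * (- K)" using c01 K by (intro mult_nonneg_nonneg) auto
    then have "- (K + 1) * (1 - c) \<le> c - (K + 1)" by (simp add: algebra_simps)
    moreover have "0 < (c - (K + 1))" by (intro mult_pos_pos)? (use c01 K in simp_all)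
    ultimately show ?thesis unfolding p2 by (simp only: divide_less_eq_1_pos divide_le_eq_1_pos)
  qed
  then have "p \<le> 1" using p by (simp add: power_le_one_iff)
  then have pI: "p \<in> {0..1}" using p by simp
  define a e D where defs: "a = sqrt (- K)" "e = sqrt (- (K + 1))" "D = sqrt (p\<^sup>2 - (K + 1))"
  have D2: "p\<^sup>2 - (K + 1) > 0"
  proof -
    have "0 < 1 + p\<^sup>2" by (simp add: add_pos_nonneg)
    then show ?thesis using K zero_less_power[OF p, of 2] by linarith
  qed
  have pos: "a > 0" "e > 0" "D > 0" and sq: "a\<^sup>2 = - K" "e\<^sup>2 = - (K + 1)" "D\<^sup>2 = p\<^sup>2 - (K + 1)"
    using K D2 by (simp_all add: defs)
  define A B C where ABC: "A = p / D" "B = a * p / D" "C = e / D"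
  define X where Xd: "X = a * e / D"
  have X: "X \<noteq> 0" using pos Xd by simp
  define r where "r = (\<lambda>s. A * jacobi_cn p (X * s))"
  define w where "w = (\<lambda>s. - C * jacobi_dn p (X * s))"
  define v where "v = (\<lambda>s. B * jacobi_sn p (X * s))"
  define \<psi> where "\<psi> = (\<lambda>s. K / X * elliptic_Pi (p\<^sup>2 / (K + 1)) (X * s) p - K * s)"
  have top: "euler_top K UNIV r w v"
    unfolding r_def w_def v_def
  proof (rule euler_top_cn_dn_sn[OF pI])
    show "A * X = B * C" unfolding ABC Xd by (simp add: power2_eq_square)
    show "C * p\<^sup>2 * X = - (K + 1) * A * B" unfolding ABC Xd sq(2)[symmetric] by (simp add: power2_eq_square)
    show "B * X = - K * A * C" unfolding ABC Xd sq(1)[symmetric] by (simp add: power2_eq_square)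
    show "A\<^sup>2 + C\<^sup>2 = 1" "B\<^sup>2 = A\<^sup>2 + C\<^sup>2 * p\<^sup>2"
      using D2 by (auto simp: ABC power_divide power_mult_distrib sq divide_simps) (simp_all add: algebra_simps)?
  qed
  have ABC_pos: "A > 0" "B > 0" "C > 0" using p pos by (simp_all add: ABC)
  have "(1 - c) * D\<^sup>2 = - K * p\<^sup>2" unfolding sq p2 using K by (simp add: divide_simps) (simp add: algebra_simps)?
  then have "1 - c = - K * p\<^sup>2 / D\<^sup>2" using pos by (simp only: eq_divide_eq) simp
  then have "1 - c = - K * A\<^sup>2" by (simp add: ABC power_divide)
  moreover have "B\<^sup>2 = - K * A\<^sup>2" by (simp add: ABC power_divide power_mult_distrib sq)
  ultimately have "r0\<^sup>2 * B\<^sup>2 + v0\<^sup>2 * A\<^sup>2 = A\<^sup>2 * B\<^sup>2"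
    using Kc by algebra
  then have "(r0 / A)\<^sup>2 + (v0 / B)\<^sup>2 = 1" by (rule ellipse_point[OF ABC_pos(1,2)])
  then have "\<exists>u. jacobi_cn p u = r0 / A \<and> jacobi_sn p u = v0 / B"
    by (rule jacobi_point_ex[OF pI]) (use ABC_pos r0 in simp)
  then obtain u where u: "jacobi_cn p u = r0 / A" "jacobi_sn p u = v0 / B" by blast
  define s where "s = u / X"
  have Xs: "X * s = u" using X by (simp add: s_def)
  have rs: "r s = r0" "v s = v0" unfolding r_def w_def v_def Xs u using ABC_pos by simp_all
  have "(- w s)\<^sup>2 + r0\<^sup>2 + v0\<^sup>2 = 1"
    using top unfolding euler_top_def rs[symmetric] by (simp add: algebra_simps)
  moreover have "(- w0)\<^sup>2 + r0\<^sup>2 + v0\<^sup>2 = 1" unfolding power2_minus using sphere by linarith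
  moreover have "- w s \<ge> 0" using ABC_pos jacobi_dn_pos[OF pI, of "X * s"] by (simp add: w_def)
  moreover have "(- w0) \<ge> 0" using r0 v0 w0 by simp
  ultimately have "- w s = (- w0)" by (rule nonneg_eq_of_sphere)
  then have st: "r s = r0" "w s = w0" "v s = v0" using rs by simp_all
  moreover have "profile_solution K r w v \<psi>"
    unfolding profile_solution_def
  proof (intro conjI allI impI top)
    fix s
    let ?sn = "jacobi_sn p (X * s)"
    define y where "y = 1 - p\<^sup>2 / (K + 1) * ?sn\<^sup>2"
    have y: "y > 0"
    proof -
      have "p\<^sup>2 / (K + 1) * ?sn\<^sup>2 \<le> 0" using K by (intro mult_nonpos_nonneg divide_nonneg_neg) auto
      then show ?thesis unfolding y_def by linarith
    qed
    have cn: "(jacobi_cn p (X * s))\<^sup>2 = 1 - ?sn\<^sup>2" using jacobi_sn_cn[OF pI] by (simp add: algebra_simps)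
    have Ky: "(K + 1) * y = K + 1 - p\<^sup>2 * ?sn\<^sup>2" using K by (simp add: y_def right_diff_distrib)
    have "(v s)\<^sup>2 = - K * p\<^sup>2 * ?sn\<^sup>2 / (p\<^sup>2 - (K + 1))"
      by (simp add: v_def ABC power_mult_distrib power_divide sq)
    moreover have "1 - (r s)\<^sup>2 = - ((K + 1) * y) / (p\<^sup>2 - (K + 1))"
      using D2 by (simp add: r_def ABC power_mult_distrib power_divide sq cn Ky divide_simps) (simp add: algebra_simps)
    ultimately have "(v s)\<^sup>2 / (1 - (r s)\<^sup>2) = (- K * p\<^sup>2 * ?sn\<^sup>2) / (- ((K + 1) * y))"
      using D2 K by simp
    moreover have eq: "- K * p\<^sup>2 * ?sn\<^sup>2 = (- (K + 1)) * (K - K * y)" using Ky by algebra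
    ultimately have "(v s)\<^sup>2 / (1 - (r s)\<^sup>2) = ((- (K + 1)) * (K - K * y)) / ((- (K + 1)) * y)"
      by (simp only: mult_minus_left)
    then have "(v s)\<^sup>2 / (1 - (r s)\<^sup>2) = (K - K * y) / y" using K by simp
    then have "K / y - K = (v s)\<^sup>2 / (1 - (r s)\<^sup>2)"
      using y by (simp only: diff_divide_distrib) simp
    moreover have "(\<psi> has_real_derivative K / y - K) (at s)"
      unfolding \<psi>_def y_def using K
        elliptic_Pi_scaled_deriv[OF pI _ X, of "p\<^sup>2 / (K + 1)" "K" s]
      by (intro DERIV_diff DERIV_cmult_Id) (simp_all add: divide_nonneg_neg)
    ultimately show "(\<psi> has_real_derivative (v s)\<^sup>2 / (1 - (r s)\<^sup>2)) (at s)" by simp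
  qed
  moreover have "profile_hyperbolic K r \<psi>"
  proof -
    have KK: "K * (K + 1) = (- K) * (- (K + 1))" by algebra
    have "X = sqrt (K * (K + 1) / (p\<^sup>2 - (K + 1)))" "A = sqrt (p\<^sup>2 / (p\<^sup>2 - (K + 1)))"
      using p unfolding KK ABC Xd defs real_sqrt_divide real_sqrt_mult by simp_all
    then show ?thesis unfolding profile_hyperbolic_def Let_def
      by (intro disjI1 bexI[of _ p] conjI pI) (simp_all only: r_def \<psi>_def)
  qed
  ultimately show ?thesis
    using st by (intro exI[of _ r] exI[of _ w] exI[of _ v] exI[of _ \<psi>] exI[of _ s] conjI)
qed

lemma hyperbolic_dn_through:
  assumes K: "K < -1" and c: "(K + 1) * r0\<^sup>2 + w0\<^sup>2 < 0"
  shows "\<exists>r w v \<psi> s. profile_solution K r w v \<psi> \<and> r s = r0 \<and> w s = w0 \<and> v s = v0 \<and>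
    profile_hyperbolic K r \<psi>"
proof -
  define c where "c = (K + 1) * r0\<^sup>2 + w0\<^sup>2"
  have Kc: "- (K + 1) + c = - K * w0\<^sup>2 - (K + 1) * v0\<^sup>2" unfolding c_def using sphere by algebra
  have "(K + 1) * v0\<^sup>2 < 0" "- K * w0\<^sup>2 \<ge> 0" using K v0 by (auto simp: mult_neg_pos mult_nonpos_nonneg)
  then have c01: "c < 0" "0 < - (K + 1) + c" "0 < 1 - c" using c Kc unfolding c_def by linarith+
  have K: "K < -1" "0 < - (K + 1)" "0 < - K" using K by auto
  \<comment> \<open>The solution of \<open>(c - (K + 1)) (1 - (K + 1) p^2) = K (K + 1) p^2\<close>.\<close>
  define p where "p = sqrt ((- (K + 1) + c) / (- (K + 1) * (1 - c)))"
  have "0 < (- (K + 1) + c) / (- (K + 1) * (1 - c))"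
    by (intro divide_pos_pos mult_pos_pos) (use c01 K in simp_all)
  then have p2: "p\<^sup>2 = (- (K + 1) + c) / (- (K + 1) * (1 - c))" and p: "0 < p"
    unfolding p_def by (simp_all only: real_sqrt_pow2 real_sqrt_gt_0_iff less_imp_le)
  have "p\<^sup>2 < 1"
  proof -
    have "c * (- K) < 0" using c01 K by (intro mult_neg_pos) auto
    then have "- (K + 1) + c < - (K + 1) * (1 - c)" by (simp add: algebra_simps)
    moreover have "0 < (- (K + 1) * (1 - c))" by (intro mult_pos_pos)? (use c01 K in simp_all)
    ultimately show ?thesis unfolding p2 by (simp only: divide_less_eq_1_pos divide_le_eq_1_pos)
  qed
  then have p1: "p < 1" using p by (simp add: power_less_one_iff)
  then have pI: "p \<in> {0..1}" using p by simp
  define a e D where defs: "a = sqrt (- K)" "e = sqrt (- (K + 1))" "D = sqrt (1 - (K + 1) * p\<^sup>2)"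
  have D2: "1 - (K + 1) * p\<^sup>2 > 0"
  proof -
    have "(K + 1) * p\<^sup>2 < 0" using K p by (intro mult_neg_pos) auto
    then show ?thesis using K zero_less_power[OF p, of 2] by linarith
  qed
  have pos: "a > 0" "e > 0" "D > 0" and sq: "a\<^sup>2 = - K" "e\<^sup>2 = - (K + 1)" "D\<^sup>2 = 1 - (K + 1) * p\<^sup>2"
    using K D2 by (simp_all add: defs)
  define A B C where ABC: "A = 1 / D" "B = a * p / D" "C = e * p / D"
  define X where Xd: "X = a * e / D"
  have X: "X \<noteq> 0" using pos Xd by simp
  define r where "r = (\<lambda>s. A * jacobi_dn p (X * s))"
  define w where "w = (\<lambda>s. - C * jacobi_cn p (X * s))"
  define v where "v = (\<lambda>s. B * jacobi_sn p (X * s))"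
  define \<psi> where "\<psi> = (\<lambda>s. K / X * elliptic_Pi (1 / (K + 1)) (X * s) p - K * s)"
  have top: "euler_top K UNIV r w v"
    unfolding r_def w_def v_def
  proof (rule euler_top_dn_cn_sn[OF pI])
    show "A * p\<^sup>2 * X = B * C" unfolding ABC Xd by (simp add: power2_eq_square)
    show "C * X = - (K + 1) * A * B" unfolding ABC Xd sq(2)[symmetric] by (simp add: power2_eq_square)
    show "B * X = - K * A * C" unfolding ABC Xd sq(1)[symmetric] by (simp add: power2_eq_square)
    show "A\<^sup>2 + C\<^sup>2 = 1" "B\<^sup>2 = C\<^sup>2 + A\<^sup>2 * p\<^sup>2"
      using D2 by (auto simp: ABC power_divide power_mult_distrib sq divide_simps) (simp_all add: algebra_simps)?
  qed
  have ABC_pos: "A > 0" "B > 0" "C > 0" using p pos by (simp_all add: ABC)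
  have "(- (K + 1) + c) * D\<^sup>2 = K * (K + 1) * p\<^sup>2" unfolding sq p2 using K c01 by (simp add: divide_simps) (simp add: algebra_simps)?
  then have "- (K + 1) + c = K * (K + 1) * p\<^sup>2 / D\<^sup>2" using pos by (simp only: eq_divide_eq) simp
  then have "- (K + 1) + c = K * (K + 1) * (p\<^sup>2 * A\<^sup>2)" by (simp add: ABC power_divide)
  moreover have "B\<^sup>2 = - K * (p\<^sup>2 * A\<^sup>2)" "C\<^sup>2 = - (K + 1) * (p\<^sup>2 * A\<^sup>2)"
    by (simp_all add: ABC power_divide power_mult_distrib sq)
  ultimately have "(- w0)\<^sup>2 * B\<^sup>2 + v0\<^sup>2 * C\<^sup>2 = C\<^sup>2 * B\<^sup>2"
    using Kc by algebra
  then have "(- w0 / C)\<^sup>2 + (v0 / B)\<^sup>2 = 1" by (rule ellipse_point[OF ABC_pos(3,2)])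
  then have "\<exists>u. jacobi_cn p u = - w0 / C \<and> jacobi_sn p u = v0 / B"
    by (rule jacobi_point_ex[OF pI]) (use p1 in simp)
  then obtain u where u: "jacobi_cn p u = - w0 / C" "jacobi_sn p u = v0 / B" by blast
  define s where "s = u / X"
  have Xs: "X * s = u" using X by (simp add: s_def)
  have rs: "w s = w0" "v s = v0" unfolding r_def w_def v_def Xs u using ABC_pos by simp_all
  have "(r s)\<^sup>2 + w0\<^sup>2 + v0\<^sup>2 = 1"
    using top unfolding euler_top_def rs[symmetric] by (simp add: algebra_simps)
  moreover have "r0\<^sup>2 + w0\<^sup>2 + v0\<^sup>2 = 1" unfolding power2_minus using sphere by linarith
  moreover have "r s \<ge> 0" using ABC_pos jacobi_dn_pos[OF pI, of "X * s"] by (simp add: r_def)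
  moreover have "r0 \<ge> 0" using r0 v0 by simp
  ultimately have "r s = r0" by (rule nonneg_eq_of_sphere)
  then have st: "r s = r0" "w s = w0" "v s = v0" using rs by simp_all
  moreover have "profile_solution K r w v \<psi>"
    unfolding profile_solution_def
  proof (intro conjI allI impI top)
    fix s
    let ?sn = "jacobi_sn p (X * s)"
    define y where "y = 1 - 1 / (K + 1) * ?sn\<^sup>2"
    have y: "y > 0"
    proof -
      have "1 / (K + 1) * ?sn\<^sup>2 \<le> 0" using K by (intro mult_nonpos_nonneg divide_nonneg_neg) auto
      then show ?thesis unfolding y_def by linarith
    qed
    have Ky: "(K + 1) * y = K + 1 - ?sn\<^sup>2" using K by (simp add: y_def right_diff_distrib)
    have "(v s)\<^sup>2 = - K * p\<^sup>2 * ?sn\<^sup>2 / (1 - (K + 1) * p\<^sup>2)"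
      by (simp add: v_def ABC power_mult_distrib power_divide sq)
    moreover have "1 - (r s)\<^sup>2 = - (p\<^sup>2 * ((K + 1) * y)) / (1 - (K + 1) * p\<^sup>2)"
      using D2 by (simp add: r_def ABC power_mult_distrib power_divide sq jacobi_dn_sq[OF pI] Ky divide_simps) (simp add: algebra_simps)
    ultimately have "(v s)\<^sup>2 / (1 - (r s)\<^sup>2) = (- K * p\<^sup>2 * ?sn\<^sup>2) / (- (p\<^sup>2 * ((K + 1) * y)))"
      using D2 by simp
    moreover have eq: "- K * p\<^sup>2 * ?sn\<^sup>2 = (- (p\<^sup>2 * (K + 1))) * (K - K * y)" using Ky by algebra
    ultimately have "(v s)\<^sup>2 / (1 - (r s)\<^sup>2) = ((- (p\<^sup>2 * (K + 1))) * (K - K * y)) / ((- (p\<^sup>2 * (K + 1))) * y)"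
      by (simp only: mult_minus_left mult.assoc)
    then have "(v s)\<^sup>2 / (1 - (r s)\<^sup>2) = (K - K * y) / y" using K p by simp
    then have "K / y - K = (v s)\<^sup>2 / (1 - (r s)\<^sup>2)"
      using y by (simp only: diff_divide_distrib) simp
    moreover have "(\<psi> has_real_derivative K / y - K) (at s)"
      unfolding \<psi>_def y_def using K
        elliptic_Pi_scaled_deriv[OF pI _ X, of "1 / (K + 1)" "K" s]
      by (intro DERIV_diff DERIV_cmult_Id) (simp_all add: divide_nonneg_neg)
    ultimately show "(\<psi> has_real_derivative (v s)\<^sup>2 / (1 - (r s)\<^sup>2)) (at s)" by simp
  qed
  moreover have "profile_hyperbolic K r \<psi>"
  proof -
    have KK: "K * (K + 1) = (- K) * (- (K + 1))" by algebra
    have "X = sqrt (K * (K + 1) / (1 - (K + 1) * p\<^sup>2))" "A = sqrt (1 / (1 - (K + 1) * p\<^sup>2))"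
      using p unfolding KK ABC Xd defs real_sqrt_divide real_sqrt_mult by simp_all
    then show ?thesis unfolding profile_hyperbolic_def Let_def
      by (intro disjI2 bexI[of _ p] conjI pI) (simp_all only: r_def \<psi>_def)
  qed
  ultimately show ?thesis
    using st by (intro exI[of _ r] exI[of _ w] exI[of _ v] exI[of _ \<psi>] exI[of _ s] conjI)
qed

lemma intermediate_below_through:
  assumes K: "-1 < K" "K < 0" and c: "(K + 1) * r0\<^sup>2 + w0\<^sup>2 < K + 1"
  shows "\<exists>r w v \<psi> s. profile_solution K r w v \<psi> \<and> r s = r0 \<and> w s = w0 \<and> v s = v0 \<and>
    profile_intermediate K r \<psi>"
proof -
  define c where "c = (K + 1) * r0\<^sup>2 + w0\<^sup>2"
  have "0 < (K + 1) * r0\<^sup>2" using K r0 by (intro mult_pos_pos) auto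
  then have c01: "0 < c" "c < K + 1" "0 < K + 1" "0 < - K" "0 < 1 - c"
    using c K zero_le_power2[of w0] unfolding c_def by linarith+
  \<comment> \<open>The solution of \<open>c ((K + 1) p^2 - K) = (K + 1) p^2\<close>.\<close>
  define p where "p = sqrt (c * (- K) / ((K + 1) * (1 - c)))"
  have "0 < c * (- K) / ((K + 1) * (1 - c))"
    by (intro divide_pos_pos mult_pos_pos) (use c01 K in simp_all)
  then have p2: "p\<^sup>2 = c * (- K) / ((K + 1) * (1 - c))" and p: "0 < p"
    unfolding p_def by (simp_all only: real_sqrt_pow2 real_sqrt_gt_0_iff less_imp_le)
  have "p\<^sup>2 < 1"
  proof -
    have "c * (- K) < (K + 1) * (1 - c)" using c01 by (simp add: algebra_simps)
    moreover have "0 < ((K + 1) * (1 - c))" by (intro mult_pos_pos)? (use c01 K in simp_all)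
    ultimately show ?thesis unfolding p2 by (simp only: divide_less_eq_1_pos divide_le_eq_1_pos)
  qed
  then have p1: "p < 1" using p by (simp add: power_less_one_iff)
  then have pI: "p \<in> {0..1}" using p by simp
  define a e D where defs: "a = sqrt (- K)" "e = sqrt (K + 1)" "D = sqrt ((K + 1) * p\<^sup>2 - K)"
  have D2: "(K + 1) * p\<^sup>2 - K > 0"
  proof -
    have "0 < (K + 1) * p\<^sup>2" using K p by (intro mult_pos_pos) auto
    then show ?thesis using K zero_less_power[OF p, of 2] by linarith
  qed
  have pos: "a > 0" "e > 0" "D > 0" and sq: "a\<^sup>2 = - K" "e\<^sup>2 = K + 1" "D\<^sup>2 = (K + 1) * p\<^sup>2 - K"
    using K D2 by (simp_all add: defs)
  have m2: "1 - p\<^sup>2 > 0" using p p1 by (simp add: power_less_one_iff)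
  define m where "m = sqrt (1 - p\<^sup>2)"
  have m: "m > 0" "m\<^sup>2 = 1 - p\<^sup>2" using m2 by (simp_all add: m_def)
  define A B C where ABC: "A = p / D" "B = a * m / D" "C = e * p * m / D"
  define X where Xd: "X = a * e / D"
  have X: "X \<noteq> 0" using pos Xd by simp
  define r where "r = (\<lambda>s. A * jacobi_cd p (X * s))"
  define w where "w = (\<lambda>s. - C * (jacobi_sn p (X * s) / jacobi_dn p (X * s)))"
  define v where "v = (\<lambda>s. B * (1 / jacobi_dn p (X * s)))"
  define \<psi> where "\<psi> = (\<lambda>s. 1 / X * elliptic_Pi ((K + 1) * p\<^sup>2 / K) (X * s) p)"
  have top: "euler_top K UNIV r w v"
    unfolding r_def w_def v_def
  proof (rule euler_top_cd_sd_nd[OF pI])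
    show "A * (1 - p\<^sup>2) * X = B * C" unfolding ABC Xd m(2)[symmetric] by (simp add: power2_eq_square)
    show "C * X = (K + 1) * A * B" unfolding ABC Xd sq(2)[symmetric] by (simp add: power2_eq_square)
    show "B * p\<^sup>2 * X = - K * A * C" unfolding ABC Xd sq(1)[symmetric] by (simp add: power2_eq_square)
    show "A\<^sup>2 + B\<^sup>2 = 1" "B\<^sup>2 + C\<^sup>2 = 1 - p\<^sup>2"
      using D2 by (auto simp: ABC power_divide power_mult_distrib sq m(2) divide_simps) (simp_all add: algebra_simps)?
  qed
  have ABC_pos: "A > 0" "B > 0" "C > 0" using p pos m by (simp_all add: ABC)
  have "c * D\<^sup>2 = (K + 1) * p\<^sup>2" unfolding sq p2 using c01 K by (simp add: divide_simps) (simp add: algebra_simps)?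
  then have "c = (K + 1) * p\<^sup>2 / D\<^sup>2" using pos by (simp only: eq_divide_eq) simp
  then have "c = (K + 1) * A\<^sup>2" by (simp add: ABC power_divide)
  then have "r0\<^sup>2 * (e * A)\<^sup>2 + (- w0)\<^sup>2 * A\<^sup>2 = A\<^sup>2 * (e * A)\<^sup>2"
    unfolding c_def using sq(2) by algebra
  then have "(r0 / A)\<^sup>2 + (- w0 / (e * A))\<^sup>2 = 1"
    using pos ABC_pos by (intro ellipse_point) simp_all
  moreover have "- w0 / (e * A) = m * (- w0 / C)" using m pos p by (simp add: ABC)
  ultimately have "(r0 / A)\<^sup>2 + (1 - p\<^sup>2) * (- w0 / C)\<^sup>2 = 1"
    by (simp only: power_mult_distrib m(2))
  then have "\<exists>u. jacobi_cd p u = r0 / A \<and> jacobi_sn p u / jacobi_dn p u = - w0 / C"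
    by (rule jacobi_point_cd[OF pI p1])
  then obtain u where u: "jacobi_cd p u = r0 / A" "jacobi_sn p u / jacobi_dn p u = - w0 / C" by blast
  define s where "s = u / X"
  have Xs: "X * s = u" using X by (simp add: s_def)
  have rs: "r s = r0" "w s = w0" unfolding r_def w_def v_def Xs u using ABC_pos by simp_all
  have "(v s)\<^sup>2 + r0\<^sup>2 + w0\<^sup>2 = 1"
    using top unfolding euler_top_def rs[symmetric] by (simp add: algebra_simps)
  moreover have "v0\<^sup>2 + r0\<^sup>2 + w0\<^sup>2 = 1" unfolding power2_minus using sphere by linarith
  moreover have "v s \<ge> 0" using ABC_pos jacobi_dn_pos[OF pI, of "X * s"] by (simp add: v_def)
  moreover have "v0 \<ge> 0" using r0 v0 by simp
  ultimately have "v s = v0" by (rule nonneg_eq_of_sphere)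
  then have st: "r s = r0" "w s = w0" "v s = v0" using rs by simp_all
  moreover have "profile_solution K r w v \<psi>"
    unfolding profile_solution_def
  proof (intro conjI allI impI top)
    fix s
    let ?sn = "jacobi_sn p (X * s)"
    define y where "y = 1 - (K + 1) * p\<^sup>2 / K * ?sn\<^sup>2"
    have y: "y > 0"
    proof -
      have "(K + 1) * p\<^sup>2 / K * ?sn\<^sup>2 \<le> 0" using K by (intro mult_nonpos_nonneg divide_nonneg_neg) auto
      then show ?thesis unfolding y_def by linarith
    qed
    have cn: "(jacobi_cn p (X * s))\<^sup>2 = 1 - ?sn\<^sup>2" using jacobi_sn_cn[OF pI] by (simp add: algebra_simps)
    have Ky: "K * y = K - (K + 1) * p\<^sup>2 * ?sn\<^sup>2" using K by (simp add: y_def right_diff_distrib)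
    have dn: "jacobi_dn p (X * s) > 0" by (rule jacobi_dn_pos[OF pI])
    have "(v s)\<^sup>2 = - K * (1 - p\<^sup>2) / (D * jacobi_dn p (X * s))\<^sup>2"
      by (simp add: v_def ABC power_mult_distrib power_divide sq m(2))
    moreover have "1 - (r s)\<^sup>2 = (- K * (1 - p\<^sup>2) * y) / (D * jacobi_dn p (X * s))\<^sup>2"
    proof -
      have "(r s)\<^sup>2 = p\<^sup>2 * (1 - ?sn\<^sup>2) / (D * jacobi_dn p (X * s))\<^sup>2"
        by (simp add: r_def jacobi_cd_def ABC power_mult_distrib power_divide cn)
      moreover have "(D * jacobi_dn p (X * s))\<^sup>2 - p\<^sup>2 * (1 - ?sn\<^sup>2) = - K * (1 - p\<^sup>2) * y"
        using Ky sq(3) jacobi_dn_sq[OF pI, of "X * s"] by algebra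
      moreover have "1 = (D * jacobi_dn p (X * s))\<^sup>2 / (D * jacobi_dn p (X * s))\<^sup>2" using pos dn by simp
      ultimately show ?thesis by (metis diff_divide_distrib)
    qed
    ultimately have "(v s)\<^sup>2 / (1 - (r s)\<^sup>2) = (- K * (1 - p\<^sup>2)) / ((- K * (1 - p\<^sup>2)) * y)"
      using pos dn by simp
    also have "\<dots> = 1 / y" using K m2 by simp
    finally have "1 / y = (v s)\<^sup>2 / (1 - (r s)\<^sup>2)" ..
    moreover have "(\<psi> has_real_derivative 1 / y) (at s)"
      unfolding \<psi>_def y_def using K elliptic_Pi_scaled_deriv[OF pI _ X, of "(K + 1) * p\<^sup>2 / K" 1 s]
      by (simp add: divide_nonneg_neg)
    ultimately show "(\<psi> has_real_derivative (v s)\<^sup>2 / (1 - (r s)\<^sup>2)) (at s)" by simp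
  qed
  moreover have "profile_intermediate K r \<psi>"
  proof -
    have "X = sqrt ((- K) * (K + 1) / ((K + 1) * p\<^sup>2 - K))" "A = sqrt (p\<^sup>2 / ((K + 1) * p\<^sup>2 - K))"
      using p unfolding ABC Xd defs real_sqrt_divide real_sqrt_mult by simp_all
    then show ?thesis unfolding profile_intermediate_def Let_def
      by (intro disjI1 bexI[of _ p] conjI pI) (simp_all only: r_def \<psi>_def)
  qed
  ultimately show ?thesis
    using st by (intro exI[of _ r] exI[of _ w] exI[of _ v] exI[of _ \<psi>] exI[of _ s] conjI)
qed

text \<open>
  As for \<open>hyperbolic_cn_through\<close>, the sign of \<open>w\<close> is constant along a solution.
\<close>

lemma intermediate_above_through:
  assumes K: "-1 < K" "K < 0" and c: "(K + 1) * r0\<^sup>2 + w0\<^sup>2 > K + 1" and w0: "w0 \<le> 0"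
  shows "\<exists>r w v \<psi> s. profile_solution K r w v \<psi> \<and> r s = r0 \<and> w s = w0 \<and> v s = v0 \<and>
    profile_intermediate K r \<psi>"
proof -
  define c where "c = (K + 1) * r0\<^sup>2 + w0\<^sup>2"
  have Kc: "1 - c = v0\<^sup>2 + (- K) * r0\<^sup>2" unfolding c_def using sphere by algebra
  have "0 < (- K) * r0\<^sup>2" by (rule mult_pos_pos) (use K r0 in simp_all)
  moreover have "0 < v0\<^sup>2" using v0 by simp
  ultimately have c01: "0 < c" "K + 1 < c" "0 < K + 1" "0 < - K" "0 < 1 - c"
    using c K Kc unfolding c_def by linarith+
  define p where "p = sqrt ((K + 1) * (1 - c) / (c * (- K)))"
  have "0 < (K + 1) * (1 - c) / (c * (- K))"
    by (intro divide_pos_pos mult_pos_pos) (use c01 K in simp_all)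
  then have p2: "p\<^sup>2 = (K + 1) * (1 - c) / (c * (- K))" and p: "0 < p"
    unfolding p_def by (simp_all only: real_sqrt_pow2 real_sqrt_gt_0_iff less_imp_le)
  have "p\<^sup>2 < 1"
  proof -
    have "(K + 1) * (1 - c) < c * (- K)" using c01 by (simp add: algebra_simps)
    moreover have "0 < (c * (- K))" by (intro mult_pos_pos)? (use c01 K in simp_all)
    ultimately show ?thesis unfolding p2 by (simp only: divide_less_eq_1_pos divide_le_eq_1_pos)
  qed
  then have p1: "p < 1" using p by (simp add: power_less_one_iff)
  then have pI: "p \<in> {0..1}" using p by simp
  define a e D where defs: "a = sqrt (- K)" "e = sqrt (K + 1)" "D = sqrt (K + 1 - K * p\<^sup>2)"
  have D2: "K + 1 - K * p\<^sup>2 > 0"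
  proof -
    have "K * p\<^sup>2 < 0" using K p by (intro mult_neg_pos) auto
    then show ?thesis using K zero_less_power[OF p, of 2] by linarith
  qed
  have pos: "a > 0" "e > 0" "D > 0" and sq: "a\<^sup>2 = - K" "e\<^sup>2 = K + 1" "D\<^sup>2 = K + 1 - K * p\<^sup>2"
    using K D2 by (simp_all add: defs)
  have m2: "1 - p\<^sup>2 > 0" using p p1 by (simp add: power_less_one_iff)
  define m where "m = sqrt (1 - p\<^sup>2)"
  have m: "m > 0" "m\<^sup>2 = 1 - p\<^sup>2" using m2 by (simp_all add: m_def)
  define A B C where ABC: "A = p / D" "B = a * p * m / D" "C = e * m / D"
  define X where Xd: "X = a * e / D"
  have X: "X \<noteq> 0" using pos Xd by simp
  define r where "r = (\<lambda>s. A * jacobi_cd p (X * s))"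
  define w where "w = (\<lambda>s. - C * (1 / jacobi_dn p (X * s)))"
  define v where "v = (\<lambda>s. B * (jacobi_sn p (X * s) / jacobi_dn p (X * s)))"
  define \<psi> where "\<psi> = (\<lambda>s. s - 1 / X * elliptic_Pi (K * p\<^sup>2 / (K + 1)) (X * s) p)"
  have top: "euler_top K UNIV r w v"
    unfolding r_def w_def v_def
  proof (rule euler_top_cd_nd_sd[OF pI])
    show "A * (1 - p\<^sup>2) * X = B * C" unfolding ABC Xd m(2)[symmetric] by (simp add: power2_eq_square)
    show "C * p\<^sup>2 * X = (K + 1) * A * B" unfolding ABC Xd sq(2)[symmetric] by (simp add: power2_eq_square)
    show "B * X = - K * A * C" unfolding ABC Xd sq(1)[symmetric] by (simp add: power2_eq_square)
    show "A\<^sup>2 + C\<^sup>2 = 1" "B\<^sup>2 + C\<^sup>2 = 1 - p\<^sup>2"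
      using D2 by (auto simp: ABC power_divide power_mult_distrib sq m(2) divide_simps) (simp_all add: algebra_simps)?
  qed
  have ABC_pos: "A > 0" "B > 0" "C > 0" using p pos m by (simp_all add: ABC)
  have "(1 - c) * D\<^sup>2 = (- K) * p\<^sup>2" unfolding sq p2 using c01 K by (simp add: divide_simps) (simp add: algebra_simps)?
  then have "1 - c = (- K) * p\<^sup>2 / D\<^sup>2" using pos by (simp only: eq_divide_eq) simp
  then have "1 - c = (- K) * A\<^sup>2" by (simp add: ABC power_divide)
  then have "r0\<^sup>2 * (a * A)\<^sup>2 + v0\<^sup>2 * A\<^sup>2 = A\<^sup>2 * (a * A)\<^sup>2"
    using Kc sq(1) by algebra
  then have "(r0 / A)\<^sup>2 + (v0 / (a * A))\<^sup>2 = 1"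
    using pos ABC_pos by (intro ellipse_point) simp_all
  moreover have "v0 / (a * A) = m * (v0 / B)" using m pos p by (simp add: ABC)
  ultimately have "(r0 / A)\<^sup>2 + (1 - p\<^sup>2) * (v0 / B)\<^sup>2 = 1"
    by (simp only: power_mult_distrib m(2))
  then have "\<exists>u. jacobi_cd p u = r0 / A \<and> jacobi_sn p u / jacobi_dn p u = v0 / B"
    by (rule jacobi_point_cd[OF pI p1])
  then obtain u where u: "jacobi_cd p u = r0 / A" "jacobi_sn p u / jacobi_dn p u = v0 / B" by blast
  define s where "s = u / X"
  have Xs: "X * s = u" using X by (simp add: s_def)
  have rs: "r s = r0" "v s = v0" unfolding r_def w_def v_def Xs u using ABC_pos by simp_all
  have "(- w s)\<^sup>2 + r0\<^sup>2 + v0\<^sup>2 = 1"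
    using top unfolding euler_top_def rs[symmetric] by (simp add: algebra_simps)
  moreover have "(- w0)\<^sup>2 + r0\<^sup>2 + v0\<^sup>2 = 1" unfolding power2_minus using sphere by linarith
  moreover have "- w s \<ge> 0" using ABC_pos jacobi_dn_pos[OF pI, of "X * s"] by (simp add: w_def)
  moreover have "(- w0) \<ge> 0" using r0 v0 w0 by simp
  ultimately have "- w s = (- w0)" by (rule nonneg_eq_of_sphere)
  then have st: "r s = r0" "w s = w0" "v s = v0" using rs by simp_all
  moreover have "profile_solution K r w v \<psi>"
    unfolding profile_solution_def
  proof (intro conjI allI impI top)
    fix s
    let ?sn = "jacobi_sn p (X * s)"
    define y where "y = 1 - K * p\<^sup>2 / (K + 1) * ?sn\<^sup>2"
    have y: "y > 0"
    proof -
      have "K * p\<^sup>2 / (K + 1) * ?sn\<^sup>2 \<le> 0" using K by (intro mult_nonpos_nonneg divide_nonpos_pos) auto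
      then show ?thesis unfolding y_def by linarith
    qed
    have cn: "(jacobi_cn p (X * s))\<^sup>2 = 1 - ?sn\<^sup>2" using jacobi_sn_cn[OF pI] by (simp add: algebra_simps)
    have Ky: "(K + 1) * y = K + 1 - K * p\<^sup>2 * ?sn\<^sup>2" using K by (simp add: y_def right_diff_distrib)
    have dn: "jacobi_dn p (X * s) > 0" by (rule jacobi_dn_pos[OF pI])
    have "(v s)\<^sup>2 = - K * p\<^sup>2 * ?sn\<^sup>2 * (1 - p\<^sup>2) / (D * jacobi_dn p (X * s))\<^sup>2"
      by (simp add: v_def ABC power_mult_distrib power_divide sq m(2))
    moreover have "1 - (r s)\<^sup>2 = ((K + 1) * (1 - p\<^sup>2) * y) / (D * jacobi_dn p (X * s))\<^sup>2"
    proof -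
      have "(r s)\<^sup>2 = p\<^sup>2 * (1 - ?sn\<^sup>2) / (D * jacobi_dn p (X * s))\<^sup>2"
        by (simp add: r_def jacobi_cd_def ABC power_mult_distrib power_divide cn)
      moreover have "(D * jacobi_dn p (X * s))\<^sup>2 - p\<^sup>2 * (1 - ?sn\<^sup>2) = (K + 1) * (1 - p\<^sup>2) * y"
        using Ky sq(3) jacobi_dn_sq[OF pI, of "X * s"] by algebra
      moreover have "1 = (D * jacobi_dn p (X * s))\<^sup>2 / (D * jacobi_dn p (X * s))\<^sup>2" using pos dn by simp
      ultimately show ?thesis by (metis diff_divide_distrib)
    qed
    moreover have "- K * p\<^sup>2 * ?sn\<^sup>2 * (1 - p\<^sup>2) = (K + 1) * (1 - p\<^sup>2) * (y - 1)" using Ky by algebra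
    ultimately have "(v s)\<^sup>2 / (1 - (r s)\<^sup>2) =
        ((K + 1) * (1 - p\<^sup>2) * (y - 1)) / ((K + 1) * (1 - p\<^sup>2) * y)"
      using pos dn by (simp only:) simp
    also have "\<dots> = (y - 1) / y" using K m2 by simp
    also have "\<dots> = 1 - 1 / y" using y by (simp add: diff_divide_distrib)
    finally have "1 - 1 / y = (v s)\<^sup>2 / (1 - (r s)\<^sup>2)" ..
    moreover have "(\<psi> has_real_derivative 1 - 1 / y) (at s)"
      unfolding \<psi>_def y_def using K elliptic_Pi_scaled_deriv[OF pI _ X, of "K * p\<^sup>2 / (K + 1)" 1 s]
      by (intro DERIV_diff DERIV_ident) (simp add: divide_nonpos_pos mult_nonpos_nonneg)
    ultimately show "(\<psi> has_real_derivative (v s)\<^sup>2 / (1 - (r s)\<^sup>2)) (at s)" by simp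
  qed
  moreover have "profile_intermediate K r \<psi>"
  proof -
    have "X = sqrt ((- K) * (K + 1) / (K + 1 - K * p\<^sup>2))" "A = sqrt (p\<^sup>2 / (K + 1 - K * p\<^sup>2))"
      using p unfolding ABC Xd defs real_sqrt_divide real_sqrt_mult by simp_all
    then show ?thesis unfolding profile_intermediate_def Let_def
      by (intro disjI2 disjI1 bexI[of _ p] conjI pI) (simp_all only: r_def \<psi>_def)
  qed
  ultimately show ?thesis
    using st by (intro exI[of _ r] exI[of _ w] exI[of _ v] exI[of _ \<psi>] exI[of _ s] conjI)
qed

text \<open>
  On the level \<open>c = K + 1\<close> the functions degenerate to modulus 1, where \<open>dn = cn\<close>: the solution runs from
  one fixed point of the Euler system to another, and \<open>v^2 = - K (1 - r^2)\<close> makes \<open>\<psi>\<close> linear.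
\<close>

lemma intermediate_separatrix_through:
  assumes K: "-1 < K" "K < 0" and c: "(K + 1) * r0\<^sup>2 + w0\<^sup>2 = K + 1" and w0: "w0 \<ge> 0"
  shows "\<exists>r w v \<psi> s. profile_solution K r w v \<psi> \<and> r s = r0 \<and> w s = w0 \<and> v s = v0 \<and>
    profile_intermediate K r \<psi>"
proof -
  have pI: "(1::real) \<in> {0..1}" by simp
  define a e X where defs: "a = sqrt (- K)" "e = sqrt (K + 1)" "X = sqrt ((- K) * (K + 1))"
  have pos: "a > 0" "e > 0" and sq: "a\<^sup>2 = - K" "e\<^sup>2 = K + 1" using K by (simp_all add: defs)
  have X: "X = a * e" by (simp only: defs real_sqrt_mult)
  have X0: "X \<noteq> 0" using X pos by simp
  have cn_pos: "jacobi_cn 1 u > 0" for u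
    using jacobi_am_range[OF pI, of u] by (auto simp: am_range_def jacobi_cn_def intro!: cos_gt_zero_pi)
  have dn: "jacobi_dn 1 u = jacobi_cn 1 u" for u
  proof -
    have "(jacobi_dn 1 u)\<^sup>2 = (jacobi_cn 1 u)\<^sup>2"
      using jacobi_dn_sq[OF pI, of u] jacobi_sn_cn[OF pI, of u] by simp
    then show ?thesis using cn_pos[of u] jacobi_dn_pos[OF pI, of u] by (simp add: power2_eq_iff_nonneg)
  qed
  define r where "r = (\<lambda>s. jacobi_sn 1 (X * s))"
  define w where "w = (\<lambda>s. e * jacobi_cn 1 (X * s))"
  define v where "v = (\<lambda>s. a * jacobi_cn 1 (X * s))"
  define \<psi> where "\<psi> = (\<lambda>s. - K * s)"
  have top: "euler_top K UNIV r w v"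
    unfolding euler_top_def
  proof (intro ballI conjI)
    fix s
    define sn cn where sc: "sn = jacobi_sn 1 (X * s)" "cn = jacobi_cn 1 (X * s)"
    note d = jacobi_scaled_derivs[OF pI, of X s, unfolded dn, folded sc]
    have vals: "r s = sn" "w s = e * cn" "v s = a * cn" by (simp_all add: r_def w_def v_def sc)
    have sn_cn: "sn\<^sup>2 + cn\<^sup>2 = 1" unfolding sc by (rule jacobi_sn_cn[OF pI])
    show "(r has_real_derivative w s * v s) (at s)"
      unfolding vals unfolding r_def by (rule DERIV_cong[OF d(1)]) (use X in algebra)
    show "(w has_real_derivative - (K + 1) * r s * v s) (at s)"
      unfolding vals unfolding w_def by (rule DERIV_cong[OF DERIV_cmult[OF d(2)]]) (use X sq in algebra)
    show "(v has_real_derivative K * r s * w s) (at s)"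
      unfolding vals unfolding v_def by (rule DERIV_cong[OF DERIV_cmult[OF d(2)]]) (use X sq in algebra)
    show "(r s)\<^sup>2 + (w s)\<^sup>2 + (v s)\<^sup>2 = 1" unfolding vals using sn_cn sq by algebra
  qed
  have "w0\<^sup>2 = (K + 1) * (1 - r0\<^sup>2)" using c by algebra
  then have "(w0 / e)\<^sup>2 = 1 - r0\<^sup>2" using K by (simp add: power_divide sq)
  then have unit: "(w0 / e)\<^sup>2 + r0\<^sup>2 = 1" by simp
  have "w0 \<noteq> 0"
  proof
    assume "w0 = 0"
    then have "r0\<^sup>2 = 1" using unit by simp
    then show False using sphere \<open>w0 = 0\<close> v0 by simp
  qed
  then have "w0 / e > 0" using w0 pos by simp
  then have "\<exists>u. jacobi_cn 1 u = w0 / e \<and> jacobi_sn 1 u = r0"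
    using jacobi_point_ex[OF pI unit] by blast
  then obtain u where u: "jacobi_cn 1 u = w0 / e" "jacobi_sn 1 u = r0" by blast
  define s where "s = u / X"
  have rs: "r s = r0" "w s = w0" using u X0 pos by (simp_all add: r_def w_def s_def)
  have "(v s)\<^sup>2 + r0\<^sup>2 + w0\<^sup>2 = 1"
    using top unfolding euler_top_def rs[symmetric] by (simp add: algebra_simps)
  moreover have "v0\<^sup>2 + r0\<^sup>2 + w0\<^sup>2 = 1" using sphere by linarith
  moreover have "v s \<ge> 0" using pos cn_pos[of "X * s"] by (simp add: v_def)
  ultimately have vs: "v s = v0" using v0 by (intro nonneg_eq_of_sphere[of "v s" r0 w0 v0]) simp_all
  have "profile_solution K r w v \<psi>"
    unfolding profile_solution_def
  proof (intro conjI allI impI top)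
    fix s
    have "1 - (r s)\<^sup>2 = (jacobi_cn 1 (X * s))\<^sup>2"
      using jacobi_sn_cn[OF pI, of "X * s"] by (simp add: r_def algebra_simps)
    then have "(v s)\<^sup>2 / (1 - (r s)\<^sup>2) = - K"
      using cn_pos[of "X * s"] by (simp add: v_def power_mult_distrib sq)
    then show "(\<psi> has_real_derivative (v s)\<^sup>2 / (1 - (r s)\<^sup>2)) (at s)"
      unfolding \<psi>_def by (simp only: DERIV_cmult_Id)
  qed
  moreover have "profile_intermediate K r \<psi>"
    unfolding profile_intermediate_def Let_def by (intro disjI2 conjI) (simp_all only: r_def \<psi>_def defs(3))
  ultimately show ?thesis
    using rs vs by (intro exI[of _ r] exI[of _ w] exI[of _ v] exI[of _ \<psi>] exI[of _ s] conjI)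
qed

text \<open>
  For \<open>K = -1\<close> the equation \<open>w' = 0\<close> leaves a rotation of \<open>(r, v)\<close> with angular velocity \<open>p = - w\<close>.
\<close>

lemma flat_through:
  assumes K: "K = -1" and w0: "w0 < 0"
  shows "\<exists>r w v \<psi> s. profile_solution K r w v \<psi> \<and> r s = r0 \<and> w s = w0 \<and> v s = v0 \<and>
    profile_flat r \<psi>"
proof -
  define p where "p = - w0"
  have "0 < r0\<^sup>2" "0 < v0\<^sup>2" using r0 v0 by auto
  then have m2: "1 - p\<^sup>2 > 0" unfolding p_def power2_minus using sphere by linarith
  have p: "p > 0" using w0 by (simp add: p_def)
  have "p\<^sup>2 < 1\<^sup>2" using m2 by simp
  then have p1: "p < 1" by (rule power2_less_imp_less) simp
  define m where "m = sqrt (1 - p\<^sup>2)"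
  have m: "m > 0" "m\<^sup>2 = 1 - p\<^sup>2" using m2 by (simp_all add: m_def)
  define r where "r = (\<lambda>s. m * cos (p * s))"
  define w where "w = (\<lambda>s::real. - p)"
  define v where "v = (\<lambda>s. m * sin (p * s))"
  define \<psi> where "\<psi> = (\<lambda>s. s - arctan (tan (p * s) / p))"
  have top: "euler_top K UNIV r w v"
    unfolding euler_top_def
  proof (intro ballI conjI)
    fix s
    show "(r has_real_derivative w s * v s) (at s)" "(w has_real_derivative - (K + 1) * r s * v s) (at s)"
      "(v has_real_derivative K * r s * w s) (at s)"
      unfolding r_def w_def v_def K by (auto intro!: derivative_eq_intros)
    have "(sin (p * s))\<^sup>2 + (cos (p * s))\<^sup>2 = 1" by simp
    then show "(r s)\<^sup>2 + (w s)\<^sup>2 + (v s)\<^sup>2 = 1" unfolding r_def w_def v_def using m(2) by algebra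
  qed
  have "(r0 / m)\<^sup>2 + (v0 / m)\<^sup>2 = 1"
  proof (rule ellipse_point[OF m(1) m(1)])
    show "r0\<^sup>2 * m\<^sup>2 + v0\<^sup>2 * m\<^sup>2 = m\<^sup>2 * m\<^sup>2" using sphere unfolding m(2) p_def by algebra
  qed
  then obtain t where t: "r0 / m = cos t" "v0 / m = sin t" using sincos_total_2pi by metis
  define s where "s = t / p"
  have st: "r s = r0" "w s = w0" "v s = v0"
    using t p m(1) by (simp_all add: r_def w_def v_def s_def p_def field_simps)
  have "profile_solution K r w v \<psi>"
    unfolding profile_solution_def
  proof (intro conjI allI impI top)
    fix s assume "r s > 0"
    define c t where ct: "c = cos (p * s)" "t = sin (p * s)"
    have c: "c \<noteq> 0" using \<open>r s > 0\<close> m by (auto simp: ct r_def)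
    have i: "t\<^sup>2 = 1 - c\<^sup>2" by (simp add: ct sin_squared_eq)
    have q: "p\<^sup>2 * c\<^sup>2 + t\<^sup>2 > 0" using c p by (simp add: add_pos_nonneg)
    have "(\<psi> has_real_derivative
        1 - inverse (1 + (tan (p * s) / p)\<^sup>2) * (inverse ((cos (p * s))\<^sup>2) * p / p)) (at s)"
      unfolding \<psi>_def using c p ct
      by (auto intro!: derivative_eq_intros simp: field_simps)
    moreover have "inverse (1 + (tan (p * s) / p)\<^sup>2) * (inverse ((cos (p * s))\<^sup>2) * p / p) =
        p\<^sup>2 / (p\<^sup>2 * c\<^sup>2 + t\<^sup>2)"
    proof -
      have "1 + (tan (p * s) / p)\<^sup>2 = (p\<^sup>2 * c\<^sup>2 + t\<^sup>2) / (p\<^sup>2 * c\<^sup>2)"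
        using c p by (simp add: tan_def ct[symmetric] power_divide add_divide_distrib power_mult_distrib mult.commute)
      then show ?thesis using c p q by (simp add: ct[symmetric] inverse_eq_divide)
    qed
    moreover have "1 - p\<^sup>2 / (p\<^sup>2 * c\<^sup>2 + t\<^sup>2) = (v s)\<^sup>2 / (1 - (r s)\<^sup>2)"
    proof -
      have "1 - (r s)\<^sup>2 = p\<^sup>2 * c\<^sup>2 + t\<^sup>2" "(v s)\<^sup>2 = (p\<^sup>2 * c\<^sup>2 + t\<^sup>2) - p\<^sup>2"
        unfolding r_def v_def ct[symmetric] using i m(2) by algebra+
      then show ?thesis using q by (simp add: diff_divide_distrib)
    qed
    ultimately show "(\<psi> has_real_derivative (v s)\<^sup>2 / (1 - (r s)\<^sup>2)) (at s)" by simp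
  qed
  moreover have "profile_flat r \<psi>"
    unfolding profile_flat_def by (rule bexI[of _ p]) (use p p1 in \<open>auto simp: r_def \<psi>_def m_def\<close>)
  ultimately show ?thesis
    using st by (intro exI[of _ r] exI[of _ w] exI[of _ v] exI[of _ \<psi>] exI[of _ s] conjI)
qed

text \<open>
  The hypothesis \<open>v^2 \<noteq> K r^2\<close> excludes the level \<open>c = 1\<close>, on which the orbits have normal curvature of
  modulus \<open>sqrt K\<close>. In the families where \<open>w\<close> keeps its sign, the formulas have \<open>w < 0\<close>, except that \<open>r\<close>
  increases on the separatrix.
\<close>

theorem explicit_profile_through:
  assumes "K \<noteq> 0" and nontub: "v0\<^sup>2 \<noteq> K * r0\<^sup>2" and "K = -1 \<longrightarrow> w0 \<noteq> 0"
    and sgn: "if -1 < K \<and> K < 0 \<and> (K + 1) * r0\<^sup>2 + w0\<^sup>2 = K + 1 then w0 \<ge> 0 else w0 \<le> 0"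
  shows "\<exists>r w v \<psi> s. profile_solution K r w v \<psi> \<and> r s = r0 \<and> w s = w0 \<and> v s = v0 \<and>
    explicit_profile K r \<psi>"
proof -
  have c1: "(K + 1) * r0\<^sup>2 + w0\<^sup>2 \<noteq> 1" using nontub sphere by algebra
  consider "K < -1" "(K + 1) * r0\<^sup>2 + w0\<^sup>2 \<ge> 0" | "K < -1" "(K + 1) * r0\<^sup>2 + w0\<^sup>2 < 0" | "K = -1"
    | "-1 < K" "K < 0" "(K + 1) * r0\<^sup>2 + w0\<^sup>2 < K + 1"
    | "-1 < K" "K < 0" "(K + 1) * r0\<^sup>2 + w0\<^sup>2 > K + 1"
    | "-1 < K" "K < 0" "(K + 1) * r0\<^sup>2 + w0\<^sup>2 = K + 1"
    | "K > 0" "(K + 1) * r0\<^sup>2 + w0\<^sup>2 < 1" | "K > 0" "(K + 1) * r0\<^sup>2 + w0\<^sup>2 > 1"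
    using assms(1) c1 by linarith
  then show ?thesis
  proof cases
    case 1
    then show ?thesis using hyperbolic_cn_through sgn by (simp add: explicit_profile_def)
  next
    case 2
    then show ?thesis using hyperbolic_dn_through by (simp add: explicit_profile_def)
  next
    case 3
    then show ?thesis using flat_through sgn assms(3) by (simp add: explicit_profile_def)
  next
    case 4
    then show ?thesis using intermediate_below_through by (simp add: explicit_profile_def)
  next
    case 5
    then show ?thesis using intermediate_above_through sgn by (simp add: explicit_profile_def)
  next
    case 6
    then show ?thesis using intermediate_separatrix_through sgn by (simp add: explicit_profile_def)
  next
    case 7
    then show ?thesis using spherical_cn_through by (simp add: explicit_profile_def)
  next
    case 8
    then show ?thesis using spherical_dn_through by (simp add: explicit_profile_def)
  qed
qed

end

section \<open>Second derivatives of immersions\<close>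

text \<open>
  The classical second difference: the mean value theorem in direction \<open>u\<close> turns it into a first
  difference of the directional derivative \<open>Fu\<close>, whose differentiability at the one point \<open>z\<close> gives the
  bound.
\<close>

lemma second_difference_bound:
  fixes F Fu :: "'a::real_normed_vector \<Rightarrow> real"
  assumes W: "open W" "z \<in> W"
    and F: "\<And>x. x \<in> W \<Longrightarrow> (F has_derivative DF x) (at x)" "\<And>x. x \<in> W \<Longrightarrow> DF x u = Fu x"
    and Fu: "(Fu has_derivative DU) (at z)" and "\<epsilon> > 0"
  shows "\<exists>\<delta>>0. \<forall>s. 0 < s \<and> s < \<delta> \<longrightarrow>
    \<bar>F (z + s *\<^sub>R u + s *\<^sub>R v) - F (z + s *\<^sub>R u) - F (z + s *\<^sub>R v) + F z - s\<^sup>2 * DU v\<bar> \<le> \<epsilon> * s\<^sup>2"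
proof -
  define N where "N = norm u + norm v + 1"
  have N: "N > 0" by (simp add: N_def add_nonneg_pos)
  obtain r where r: "r > 0" "ball z r \<subseteq> W" using W open_contains_ball by blast
  obtain d where d: "d > 0" "\<And>y. norm (y - z) < d \<Longrightarrow> \<bar>Fu y - Fu z - DU (y - z)\<bar> \<le> \<epsilon> / (2 * N) * norm (y - z)"
    using Fu[unfolded has_derivative_at_alt] N \<open>\<epsilon> > 0\<close>
    by (metis divide_pos_pos mult_pos_pos real_norm_def zero_less_numeral)
  have lin: "linear DU" using Fu has_derivative_linear by blast
  define \<delta> where "\<delta> = min d r / N"
  have "\<bar>F (z + s *\<^sub>R u + s *\<^sub>R v) - F (z + s *\<^sub>R u) - F (z + s *\<^sub>R v) + F z - s\<^sup>2 * DU v\<bar> \<le> \<epsilon> * s\<^sup>2"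
    if s: "0 < s" "s < \<delta>" for s
  proof -
    have near: "norm (t *\<^sub>R u + q *\<^sub>R v) \<le> s * N" "norm (t *\<^sub>R u + q *\<^sub>R v) < min d r" if "0 \<le> t" "t \<le> s" "0 \<le> q" "q \<le> s" for t q
    proof -
      have "norm (t *\<^sub>R u + q *\<^sub>R v) \<le> t * norm u + q * norm v"
        using norm_triangle_ineq[of "t *\<^sub>R u" "q *\<^sub>R v"] that by simp
      also have "\<dots> \<le> s * norm u + s * norm v" using that by (intro add_mono mult_right_mono) auto
      also have "\<dots> \<le> s * N" using s by (simp add: N_def algebra_simps)
      finally show 1: "norm (t *\<^sub>R u + q *\<^sub>R v) \<le> s * N" .
      have "s * N < min d r" using s(2) N by (simp add: \<delta>_def pos_less_divide_eq)
      with 1 show "norm (t *\<^sub>R u + q *\<^sub>R v) < min d r" by simp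
    qed
    have inW: "z + t *\<^sub>R u + q *\<^sub>R v \<in> W" if "0 \<le> t" "t \<le> s" "0 \<le> q" "q \<le> s" for t q
    proof -
      have "dist z (z + t *\<^sub>R u + q *\<^sub>R v) = norm (t *\<^sub>R u + q *\<^sub>R v)"
        by (metis dist_norm dist_commute add.assoc add_diff_cancel_left')
      then show ?thesis using near(2)[OF that] r(2) by (auto simp: subset_eq)
    qed
    define \<phi> where "\<phi> = (\<lambda>t. F (z + t *\<^sub>R u + s *\<^sub>R v) - F (z + t *\<^sub>R u + 0 *\<^sub>R v))"
    have F_line: "((\<lambda>t. F (z + t *\<^sub>R u + q *\<^sub>R v)) has_real_derivative Fu (z + t *\<^sub>R u + q *\<^sub>R v)) (at t)"
      if "0 \<le> t" "t \<le> s" "0 \<le> q" "q \<le> s" for t q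
    proof -
      have "((\<lambda>t. z + t *\<^sub>R u + q *\<^sub>R v) has_derivative (\<lambda>h. h *\<^sub>R u)) (at t)"
        by (auto intro!: derivative_eq_intros)
      from has_derivative_compose[OF this F(1)[OF inW[OF that]]]
      have "((\<lambda>t. F (z + t *\<^sub>R u + q *\<^sub>R v)) has_derivative (\<lambda>h. DF (z + t *\<^sub>R u + q *\<^sub>R v) (h *\<^sub>R u))) (at t)" .
      moreover have "DF (z + t *\<^sub>R u + q *\<^sub>R v) (h *\<^sub>R u) = h * Fu (z + t *\<^sub>R u + q *\<^sub>R v)" for h
        using linear_scale[OF has_derivative_linear[OF F(1)[OF inW[OF that]]]] F(2)[OF inW[OF that]] by simp
      ultimately show ?thesis unfolding has_field_derivative_def by (simp add: mult.commute[of _ "Fu _"] fun_eq_iff)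
    qed
    have "(\<phi> has_real_derivative Fu (z + t *\<^sub>R u + s *\<^sub>R v) - Fu (z + t *\<^sub>R u + 0 *\<^sub>R v)) (at t)"
      if "0 \<le> t" "t \<le> s" for t
      unfolding \<phi>_def using that s(1) by (intro DERIV_diff F_line) simp_all
    from MVT2[OF s(1) this] obtain \<xi> where \<xi>: "0 < \<xi>" "\<xi> < s"
      "\<phi> s - \<phi> 0 = (s - 0) * (Fu (z + \<xi> *\<^sub>R u + s *\<^sub>R v) - Fu (z + \<xi> *\<^sub>R u + 0 *\<^sub>R v))"
      by auto
    have est: "\<bar>Fu (z + \<xi> *\<^sub>R u + q *\<^sub>R v) - Fu z - \<xi> * DU u - q * DU v\<bar> \<le> \<epsilon> / 2 * s" if "0 \<le> q" "q \<le> s" for q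
    proof -
      let ?y = "z + \<xi> *\<^sub>R u + q *\<^sub>R v"
      have y: "?y - z = \<xi> *\<^sub>R u + q *\<^sub>R v" by simp
      note nr = near[of \<xi> q, OF _ _ that]
      have "\<bar>Fu ?y - Fu z - DU (?y - z)\<bar> \<le> \<epsilon> / (2 * N) * norm (?y - z)"
        using nr \<xi> by (intro d(2)) (simp add: y)
      also have "\<dots> \<le> \<epsilon> / (2 * N) * (s * N)"
        using nr(1) \<xi> N \<open>\<epsilon> > 0\<close> unfolding y by (intro mult_left_mono) auto
      also have "\<dots> = \<epsilon> / 2 * s" using N by simp
      finally show ?thesis unfolding y by (simp add: linear_add[OF lin] linear_scale[OF lin] algebra_simps)
    qed
    define E where "E = (\<lambda>q. Fu (z + \<xi> *\<^sub>R u + q *\<^sub>R v) - Fu z - \<xi> * DU u - q * DU v)"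
    have "\<phi> s - \<phi> 0 - s\<^sup>2 * DU v = s * (E s - E 0)"
      unfolding \<xi>(3) E_def by (simp add: algebra_simps power2_eq_square)
    also have "\<bar>\<dots>\<bar> = s * \<bar>E s - E 0\<bar>" using s(1) by (simp add: abs_mult)
    also have "\<dots> \<le> s * (\<epsilon> / 2 * s + \<epsilon> / 2 * s)"
    proof (rule mult_left_mono)
      have "\<bar>E s\<bar> \<le> \<epsilon> / 2 * s" "\<bar>E 0\<bar> \<le> \<epsilon> / 2 * s" unfolding E_def using est[of s] est[of 0] s(1) by simp_all
      then show "\<bar>E s - E 0\<bar> \<le> \<epsilon> / 2 * s + \<epsilon> / 2 * s" by linarith
    qed (use s(1) in simp)
    also have "\<dots> = \<epsilon> * s\<^sup>2" by (simp add: power2_eq_square field_simps)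
    finally show ?thesis unfolding \<phi>_def by (simp add: algebra_simps)
  qed
  moreover have "\<delta> > 0" using d(1) r(1) N by (simp add: \<delta>_def)
  ultimately show ?thesis by blast
qed

text \<open>
  The second difference is symmetric in \<open>u\<close> and \<open>v\<close>, so the two bounds compare \<open>DU v\<close> with \<open>DV u\<close>.
\<close>

lemma mixed_partials_commute:
  fixes F Fu Fv :: "'a::real_normed_vector \<Rightarrow> real"
  assumes W: "open W" "z \<in> W"
    and F: "\<And>x. x \<in> W \<Longrightarrow> (F has_derivative DF x) (at x)"
    and "\<And>x. x \<in> W \<Longrightarrow> DF x u = Fu x" "\<And>x. x \<in> W \<Longrightarrow> DF x v = Fv x"
    and "(Fu has_derivative DU) (at z)" "(Fv has_derivative DV) (at z)"
  shows "DU v = DV u"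
proof (rule ccontr)
  assume "DU v \<noteq> DV u"
  define \<epsilon> where "\<epsilon> = \<bar>DU v - DV u\<bar> / 3"
  have \<epsilon>: "\<epsilon> > 0" using \<open>DU v \<noteq> DV u\<close> by (simp add: \<epsilon>_def)
  obtain d1 where d1: "d1 > 0" "\<And>s. 0 < s \<and> s < d1 \<Longrightarrow>
    \<bar>F (z + s *\<^sub>R u + s *\<^sub>R v) - F (z + s *\<^sub>R u) - F (z + s *\<^sub>R v) + F z - s\<^sup>2 * DU v\<bar> \<le> \<epsilon> * s\<^sup>2"
    using second_difference_bound[OF W F assms(4,6) \<epsilon>, of v] by blast
  obtain d2 where d2: "d2 > 0" "\<And>s. 0 < s \<and> s < d2 \<Longrightarrow>
    \<bar>F (z + s *\<^sub>R v + s *\<^sub>R u) - F (z + s *\<^sub>R v) - F (z + s *\<^sub>R u) + F z - s\<^sup>2 * DV u\<bar> \<le> \<epsilon> * s\<^sup>2"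
    using second_difference_bound[OF W F assms(5,7) \<epsilon>, of u] by blast
  define s where "s = min d1 d2 / 2"
  have s: "0 < s" "s < d1" "s < d2" using d1(1) d2(1) by (auto simp: s_def min_def)
  have "\<bar>s\<^sup>2 * DU v - s\<^sup>2 * DV u\<bar> \<le> \<epsilon> * s\<^sup>2 + \<epsilon> * s\<^sup>2"
    using d1(2)[of s] d2(2)[of s] s by (simp add: algebra_simps)
  also have "\<bar>s\<^sup>2 * DU v - s\<^sup>2 * DV u\<bar> = s\<^sup>2 * (3 * \<epsilon>)"
    by (simp add: \<epsilon>_def right_diff_distrib[symmetric] abs_mult)
  finally show False using s(1) \<epsilon> by (simp add: algebra_simps)
qed

lemma fund_form1_commute: "fund_form1 X z u v = fund_form1 X z v u"
  by (simp add: fund_form1_def inner_commute)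

context
  fixes W :: "(real \<times> real) set" and X :: "real \<times> real \<Rightarrow> real^4"
  assumes W: "open W" and imm: "smooth_immersion_on W X"
begin

lemma immersion_Ck: "Ck_on n W X"
  using imm by (simp add: smooth_immersion_on_def)

lemma immersion_has_derivative:
  assumes "z \<in> W" shows "(X has_derivative (\<lambda>v. dir_deriv v X z)) (at z)"
  using immersion_Ck[of "Suc 0"] assms by (simp add: dir_deriv_def frechet_derivative_works[symmetric])

lemma dir_deriv_linear:
  assumes "z \<in> W" shows "linear (\<lambda>v. dir_deriv v X z)"
  using has_derivative_linear[OF immersion_has_derivative[OF assms]] .

lemma dir_deriv_inj:
  assumes "z \<in> W" shows "inj (\<lambda>v. dir_deriv v X z)"
  using imm assms by (simp add: smooth_immersion_on_def dir_deriv_def[abs_def])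

lemma dir_deriv_continuous_on: "continuous_on W (dir_deriv v X)"
  using immersion_Ck[of "Suc 0"] by (simp del: split_paired_All)

lemma dir_deriv_has_derivative:
  assumes "z \<in> W" shows "(dir_deriv v X has_derivative (\<lambda>u. dir_deriv u (dir_deriv v X) z)) (at z)"
  using immersion_Ck[of "Suc (Suc 0)"] assms
  by (simp add: dir_deriv_def[of _ "dir_deriv v X"] frechet_derivative_works[symmetric] del: split_paired_All)

lemma dir_deriv2_commute:
  assumes z: "z \<in> W" shows "dir_deriv u (dir_deriv v X) z = dir_deriv v (dir_deriv u X) z"
proof (rule vector_eq_ldot[THEN iffD1], rule allI)
  fix e
  show "e \<bullet> dir_deriv u (dir_deriv v X) z = e \<bullet> dir_deriv v (dir_deriv u X) z"
    by (rule mixed_partials_commute[OF W z has_derivative_inner_right[OF immersion_has_derivative]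
          refl refl has_derivative_inner_right[OF dir_deriv_has_derivative[OF z]]
          has_derivative_inner_right[OF dir_deriv_has_derivative[OF z]], of e])
qed

lemma dir_deriv2_linear_left:
  assumes "z \<in> W" shows "linear (\<lambda>u. dir_deriv u (dir_deriv v X) z)"
  using has_derivative_linear[OF dir_deriv_has_derivative[OF assms]] .

lemma fund_form2_commute: "z \<in> W \<Longrightarrow> fund_form2 X z \<nu> u v = fund_form2 X z \<nu> v u"
  by (simp add: fund_form2_def dir_deriv2_commute)

lemma fund_form_linear:
  assumes "z \<in> W"
  shows "linear (\<lambda>u. fund_form2 X z \<nu> u v)" "linear (\<lambda>u. fund_form2 X z \<nu> v u)"
    and "linear (\<lambda>u. fund_form1 X z u v)" "linear (\<lambda>u. fund_form1 X z v u)"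
proof -
  have *: "linear (\<lambda>u. L u \<bullet> y)" if "linear L" for L :: "real \<times> real \<Rightarrow> real^4" and y
    using linear_compose[OF that bounded_linear.linear[OF bounded_linear_inner_left[of y]]] by (simp add: o_def)
  show 1: "linear (\<lambda>u. fund_form2 X z \<nu> u v)"
    unfolding fund_form2_def by (rule *[OF dir_deriv2_linear_left[OF assms]])
  then show "linear (\<lambda>u. fund_form2 X z \<nu> v u)" using fund_form2_commute[OF assms] by simp
  show 2: "linear (\<lambda>u. fund_form1 X z u v)"
    unfolding fund_form1_def by (rule *[OF dir_deriv_linear[OF assms]])
  then show "linear (\<lambda>u. fund_form1 X z v u)" using fund_form1_commute by simp
qed

text \<open>
  The height of an immersed surface over its tangent plane is half the second fundamental form, up to
  second order.
\<close>

lemma normal_taylor2: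
  assumes z: "z \<in> W" and \<nu>: "\<And>v. \<nu> \<bullet> dir_deriv v X z = 0" and "\<epsilon> > 0"
  shows "\<exists>\<delta>>0. \<forall>h. norm h < \<delta> \<longrightarrow>
    \<bar>(X (z + h) - X z) \<bullet> \<nu> - fund_form2 X z \<nu> h h / 2\<bar> \<le> \<epsilon> * (norm h)\<^sup>2"
proof -
  obtain r where r: "r > 0" "ball z r \<subseteq> W" using W z open_contains_ball by blast
  define \<epsilon>' where "\<epsilon>' = \<epsilon> / (2 * (norm \<nu> + 1))"
  have nn: "norm \<nu> + 1 > 0" by (simp add: add_nonneg_pos)
  have \<epsilon>': "\<epsilon>' > 0" using \<open>\<epsilon> > 0\<close> nn by (simp add: \<epsilon>'_def)
  have *: "\<exists>d>0. \<forall>k. norm k < d \<longrightarrow>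
      norm (dir_deriv v X (z + k) - dir_deriv v X z - dir_deriv k (dir_deriv v X) z) \<le> \<epsilon>' * norm k" for v
    using dir_deriv_has_derivative[OF z, of v, unfolded has_derivative_at_alt] \<epsilon>'
    by (metis add_diff_cancel_left')
  obtain d1 d2 where d1: "d1 > 0" "\<And>k. norm k < d1 \<Longrightarrow>
      norm (dir_deriv (1,0) X (z + k) - dir_deriv (1,0) X z - dir_deriv k (dir_deriv (1,0) X) z) \<le> \<epsilon>' * norm k"
    and d2: "d2 > 0" "\<And>k. norm k < d2 \<Longrightarrow>
      norm (dir_deriv (0,1) X (z + k) - dir_deriv (0,1) X z - dir_deriv k (dir_deriv (0,1) X) z) \<le> \<epsilon>' * norm k"
    using *[of "(1,0)"] *[of "(0,1)"] by blast
  define \<delta> where "\<delta> = min r (min d1 d2)"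
  have "\<bar>(X (z + h) - X z) \<bullet> \<nu> - fund_form2 X z \<nu> h h / 2\<bar> \<le> \<epsilon> * (norm h)\<^sup>2" if h: "norm h < \<delta>" for h
  proof -
    obtain h1 h2 where hh: "h = (h1, h2)" by fastforce
    have h12: "\<bar>h1\<bar> \<le> norm h" "\<bar>h2\<bar> \<le> norm h"
      using norm_fst_le[of h1 h2] norm_snd_le[of h2 h1] by (auto simp: hh)
    have dec: "L h = h1 *\<^sub>R L (1,0) + h2 *\<^sub>R L (0,1)" if "linear L" for L :: "real \<times> real \<Rightarrow> 'b::real_vector"
    proof -
      have "h = h1 *\<^sub>R (1,0) + h2 *\<^sub>R (0,1)" by (simp add: hh)
      then show ?thesis using linear_add[OF that] linear_scale[OF that] by metis
    qed
    have inW: "z + t *\<^sub>R h \<in> W" "norm (t *\<^sub>R h) \<le> norm h" if "0 \<le> t" "t \<le> 1" for t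
    proof -
      show le: "norm (t *\<^sub>R h) \<le> norm h" using that by (simp add: mult_left_le_one_le)
      have "dist z (z + t *\<^sub>R h) < r" using le h by (simp add: \<delta>_def dist_norm)
      then show "z + t *\<^sub>R h \<in> W" using r(2) by auto
    qed
    define B where "B = fund_form2 X z \<nu> h h"
    define G where "G = (\<lambda>t. X (z + t *\<^sub>R h) \<bullet> \<nu> - t\<^sup>2 / 2 * B)"
    have G': "(G has_real_derivative (dir_deriv h X (z + t *\<^sub>R h) \<bullet> \<nu> - t * B)) (at t)" if "0 \<le> t" "t \<le> 1" for t
    proof -
      have "((\<lambda>t. z + t *\<^sub>R h) has_derivative (\<lambda>q. q *\<^sub>R h)) (at t)"
        by (auto intro!: derivative_eq_intros)
      from has_derivative_compose[OF this immersion_has_derivative[OF inW(1)[OF that]]]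
      have "((\<lambda>t. X (z + t *\<^sub>R h)) has_vector_derivative dir_deriv h X (z + t *\<^sub>R h)) (at t)"
        unfolding has_vector_derivative_def
        using linear_scale[OF dir_deriv_linear[OF inW(1)[OF that]]] by simp
      from bounded_linear.has_vector_derivative[OF bounded_linear_inner_left[of \<nu>] this]
      have "((\<lambda>t. X (z + t *\<^sub>R h) \<bullet> \<nu>) has_real_derivative dir_deriv h X (z + t *\<^sub>R h) \<bullet> \<nu>) (at t)"
        by (simp add: has_real_derivative_iff_has_vector_derivative)
      then show ?thesis unfolding G_def by (auto intro!: derivative_eq_intros)
    qed
    obtain t where t: "0 < t" "t < 1" "G 1 - G 0 = (1 - 0) * (dir_deriv h X (z + t *\<^sub>R h) \<bullet> \<nu> - t * B)"
      using MVT2[of 0 1 G, OF _ G'] by auto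
    define R where "R = (\<lambda>v. dir_deriv v X (z + t *\<^sub>R h) - dir_deriv v X z - dir_deriv (t *\<^sub>R h) (dir_deriv v X) z)"
    have Rb: "norm (R (1,0)) \<le> \<epsilon>' * norm h" "norm (R (0,1)) \<le> \<epsilon>' * norm h"
      using d1(2)[of "t *\<^sub>R h"] d2(2)[of "t *\<^sub>R h"] inW(2)[of t] t h \<epsilon>'
      unfolding R_def \<delta>_def by (auto intro: order_trans[OF _ mult_left_mono[OF inW(2)[of t]]])
    have "dir_deriv h X (z + t *\<^sub>R h) \<bullet> \<nu> - t * B = (h1 *\<^sub>R R (1,0) + h2 *\<^sub>R R (0,1)) \<bullet> \<nu>"
    proof -
      have "linear R"
        unfolding R_def dir_deriv2_commute[OF z, of "t *\<^sub>R h"] using t inW(1)[of t]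
        by (intro linear_compose_sub dir_deriv_linear dir_deriv2_linear_left z) auto
      from dec[OF this] have "h1 *\<^sub>R R (1,0) + h2 *\<^sub>R R (0,1) = R h" by simp
      moreover have "R h \<bullet> \<nu> = dir_deriv h X (z + t *\<^sub>R h) \<bullet> \<nu> - t * B"
        unfolding R_def B_def fund_form2_def
        using \<nu> linear_scale[OF dir_deriv2_linear_left[OF z]]
        by (simp add: inner_diff_left inner_diff_right inner_commute[of _ \<nu>])
      ultimately show ?thesis by simp
    qed
    also have "\<bar>\<dots>\<bar> \<le> norm (h1 *\<^sub>R R (1,0) + h2 *\<^sub>R R (0,1)) * norm \<nu>" by (rule Cauchy_Schwarz_ineq2)
    also have "\<dots> \<le> (norm h * (\<epsilon>' * norm h) + norm h * (\<epsilon>' * norm h)) * (norm \<nu> + 1)"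
      using Rb h12 \<epsilon>' by (intro mult_mono order_trans[OF norm_triangle_ineq] add_mono) (auto intro!: mult_mono add_nonneg_nonneg)
    also have "\<dots> = \<epsilon> * (norm h)\<^sup>2"
    proof -
      have "\<epsilon>' * (norm \<nu> + 1) = \<epsilon> / 2" 
      proof -
        have "\<epsilon> / (2 * n) * n = \<epsilon> / 2" if "n > 0" for n :: real using that by simp
        then show ?thesis unfolding \<epsilon>'_def using nn by blast
      qed
      then show ?thesis by algebra
    qed
    finally have "\<bar>G 1 - G 0\<bar> \<le> \<epsilon> * (norm h)\<^sup>2" unfolding t(3) by simp
    then show ?thesis unfolding G_def B_def by (simp add: inner_diff_left)
  qed
  moreover have "\<delta> > 0" using r d1 d2 by (simp add: \<delta>_def)
  ultimately show ?thesis by blast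
qed

end

context
  fixes W :: "(real \<times> real) set" and X :: "real \<times> real \<Rightarrow> real^4"
  assumes W: "open W" and imm: "smooth_immersion_on W X"
begin

text \<open>
  A linear left inverse \<open>L\<close> of the derivative at \<open>z\<close> makes \<open>L \<circ> X\<close> a map of the plane with derivative the
  identity at \<open>z\<close>, to which the inverse function theorem applies. In this way a curve on the surface is
  recovered from its image in space.
\<close>

lemma immersion_local_inverse:
  assumes z: "z \<in> W"
  shows "\<exists>L g r. linear L \<and> (\<forall>v. L (dir_deriv v X z) = v) \<and> r > 0 \<and> ball z r \<subseteq> W \<and>
    (\<forall>y\<in>ball z r. g (L (X y)) = y) \<and> (g has_derivative (\<lambda>v. v)) (at (L (X z)))"
proof -
  note lin = dir_deriv_linear[OF W imm] and inj = dir_deriv_inj[OF W imm]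
  obtain L where L: "linear L" "L \<circ> (\<lambda>v. dir_deriv v X z) = id"
    using linear_injective_left_inverse[OF lin[OF z] inj[OF z]] by blast
  have L': "L (dir_deriv v X z) = v" for v using L(2) by (metis comp_apply id_apply)
  have bL: "bounded_linear L" using L(1) by (simp add: linear_conv_bounded_linear)
  have der: "((L \<circ> X) has_derivative (\<lambda>v. L (dir_deriv v X y))) (at y)" if "y \<in> W" for y
    using bounded_linear.has_derivative[OF bL immersion_has_derivative[OF W imm that]] by (simp add: o_def)
  have cont: "\<exists>d>0. \<forall>y. dist z y < d \<longrightarrow> onorm (\<lambda>v. L (dir_deriv v X y) - L (dir_deriv v X z)) < e"
    if "e > 0" for e
  proof -
    obtain B where B: "B > 0" "\<And>x. norm (L x) \<le> norm x * B"
      using bounded_linear.pos_bounded[OF bL] by blast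
    have *: "\<exists>d>0. \<forall>y. dist z y < d \<longrightarrow> norm (dir_deriv v X y - dir_deriv v X z) < e / (4 * B)" for v
    proof -
      have "isCont (dir_deriv v X) z"
        using dir_deriv_continuous_on[OF W imm] W z by (simp add: continuous_on_eq_continuous_at)
      then show ?thesis
        unfolding continuous_at_eps_delta dist_norm[symmetric] using that B(1)
        by (metis dist_commute divide_pos_pos mult_pos_pos zero_less_numeral)
    qed
    obtain d1 d2 where d: "d1 > 0" "d2 > 0"
      "\<And>y. dist z y < d1 \<Longrightarrow> norm (dir_deriv (1,0) X y - dir_deriv (1,0) X z) < e / (4 * B)"
      "\<And>y. dist z y < d2 \<Longrightarrow> norm (dir_deriv (0,1) X y - dir_deriv (0,1) X z) < e / (4 * B)"
      using *[of "(1,0)"] *[of "(0,1)"] by blast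
    obtain d3 where d3: "d3 > 0" "ball z d3 \<subseteq> W" using W z open_contains_ball by blast
    have "onorm (\<lambda>v. L (dir_deriv v X y) - L (dir_deriv v X z)) < e"
      if y: "dist z y < min d1 (min d2 d3)" for y
    proof -
      have yW: "y \<in> W" using y d3 by auto
      have "norm (L (dir_deriv v X y) - L (dir_deriv v X z)) \<le> e / 2 * norm v" for v
      proof -
        obtain v1 v2 where v: "v = (v1, v2)" by fastforce
        have v12: "\<bar>v1\<bar> \<le> norm v" "\<bar>v2\<bar> \<le> norm v"
          using norm_fst_le[of v1 v2] norm_snd_le[of v2 v1] by (auto simp: v)
        define R where "R = (\<lambda>v. dir_deriv v X y - dir_deriv v X z)"
        have R: "linear R" unfolding R_def by (intro linear_compose_sub lin yW z)
        have "v = v1 *\<^sub>R (1,0) + v2 *\<^sub>R (0,1)" by (simp add: v)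
        then have "R v = v1 *\<^sub>R R (1,0) + v2 *\<^sub>R R (0,1)"
          using linear_add[OF R] linear_scale[OF R] by metis
        then have "norm (R v) \<le> \<bar>v1\<bar> * norm (R (1,0)) + \<bar>v2\<bar> * norm (R (0,1))"
          by (metis norm_scaleR norm_triangle_ineq)
        also have "\<dots> \<le> norm v * (e / (4 * B)) + norm v * (e / (4 * B))"
          using v12 d(3)[of y] d(4)[of y] y unfolding R_def
          by (intro add_mono mult_mono) (auto intro: less_imp_le)
        finally have "norm (R v) \<le> norm v * (e / (2 * B))" by (simp add: mult.commute)
        then have "norm (R v) * B \<le> norm v * (e / (2 * B)) * B" using B(1) by (intro mult_right_mono) auto
        then have "norm (L (R v)) \<le> e / 2 * norm v" using B(2)[of "R v"] B(1) by (simp add: mult.commute)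
        then show ?thesis unfolding R_def by (simp add: linear_diff[OF L(1)])
      qed
      then have "onorm (\<lambda>v. L (dir_deriv v X y) - L (dir_deriv v X z)) \<le> e / 2"
        using \<open>e > 0\<close> by (intro onorm_bound) auto
      then show ?thesis using \<open>e > 0\<close> by simp
    qed
    moreover have "min d1 (min d2 d3) > 0" using d d3 by simp
    ultimately show ?thesis by blast
  qed
  obtain r where r: "r > 0" "ball z r \<subseteq> W" "inj_on (L \<circ> X) (ball z r)"
    by (rule has_derivative_locally_injective[OF z W bounded_linear_ident _ der cont])
      (auto simp: L' fun_eq_iff)
  define g where "g = inv_into (ball z r) (L \<circ> X)"
  have g: "g ((L \<circ> X) y) = y" if "y \<in> ball z r" for y
    unfolding g_def using r(3) that by (rule inv_into_f_f)
  have contLX: "continuous_on (ball z r) (L \<circ> X)"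
    using der r(2) by (meson continuous_at_imp_continuous_on has_derivative_continuous subsetD)
  have derz: "((L \<circ> X) has_derivative (\<lambda>v. v)) (at z)" using der[OF z] by (simp add: L')
  have "(g has_derivative (\<lambda>v. v)) (at ((L \<circ> X) z))"
    using has_derivative_inverse_strong[OF open_ball _ contLX g derz, of "\<lambda>v. v"] r(1) by (simp add: o_def id_def)
  then show ?thesis using L(1) L' r g by (intro exI[of _ L] exI[of _ g] exI[of _ r]) auto
qed

end

section \<open>Lifting maps and curves to a surface\<close>

lemma local_coordsD:
  assumes "local_coords f M W \<sigma>"
  shows "open W" "smooth_immersion_on W (f \<circ> \<sigma>)" "openin (top_of_set M) (\<sigma> ` W)" "\<sigma> ` W \<subseteq> M"
    and "\<exists>\<tau>. homeomorphism W (\<sigma> ` W) \<sigma> \<tau>"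
  using assms by (simp_all add: local_coords_def) (meson openin_imp_subset)

lemma local_coords_open_image:
  assumes lc: "local_coords f M W \<sigma>" and B: "open B" "B \<subseteq> W"
  shows "openin (top_of_set M) (\<sigma> ` B)"
proof -
  obtain \<tau> where "homeomorphism W (\<sigma> ` W) \<sigma> \<tau>" using local_coordsD(5)[OF lc] by blast
  moreover have "openin (top_of_set W) B" using B by (simp add: open_subset)
  ultimately have "openin (top_of_set (\<sigma> ` W)) (\<sigma> ` B)" by (rule homeomorphism_imp_open_map)
  then show ?thesis using local_coordsD(3)[OF lc] openin_trans by blast
qed

lemma immersed_locally_injective:
  assumes "immersed_surface_S3 f M" "x \<in> M"
  shows "\<exists>U. openin (top_of_set M) U \<and> x \<in> U \<and> inj_on f U"
proof -
  obtain W \<sigma> z where lc: "local_coords f M W \<sigma>" and z: "z \<in> W" "x = \<sigma> z"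
    using assms by (auto simp: immersed_surface_S3_def)
  obtain L :: "real^4 \<Rightarrow> real \<times> real" and g :: "real \<times> real \<Rightarrow> real \<times> real" and r where g: "r > 0" "ball z r \<subseteq> W" "\<And>y. y \<in> ball z r \<Longrightarrow> g (L ((f \<circ> \<sigma>) y)) = y"
    using immersion_local_inverse[OF local_coordsD(1,2)[OF lc] z(1)] by blast
  have "inj_on f (\<sigma> ` ball z r)"
  proof (rule inj_onI)
    fix x y assume "x \<in> \<sigma> ` ball z r" "y \<in> \<sigma> ` ball z r" "f x = f y"
    then obtain x' y' where xy: "x' \<in> ball z r" "y' \<in> ball z r" "x = \<sigma> x'" "y = \<sigma> y'" by blast
    then have "(f \<circ> \<sigma>) x' = (f \<circ> \<sigma>) y'" using \<open>f x = f y\<close> by simp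
    then have "x' = y'" using g(3)[OF xy(1)] g(3)[OF xy(2)] by simp
    then show "x = y" using xy by simp
  qed
  moreover have "x \<in> \<sigma> ` ball z r" using z g by auto
  ultimately show ?thesis using local_coords_open_image[OF lc open_ball g(2)] by blast
qed

text \<open>
  The points of the source at which two lifts of the same map agree form an open set because \<open>f\<close> is
  locally injective, and a closed one because \<open>M\<close> is Hausdorff.
\<close>

lemma lifts_agree:
  fixes \<beta>1 \<beta>2 :: "'s::topological_space \<Rightarrow> 'm::t2_space"
  assumes surf: "immersed_surface_S3 f M" and S: "connected S" "s0 \<in> S"
    and cont: "continuous_on S \<beta>1" "continuous_on S \<beta>2" and im: "\<beta>1 ` S \<subseteq> M" "\<beta>2 ` S \<subseteq> M"
    and f: "\<And>s. s \<in> S \<Longrightarrow> f (\<beta>1 s) = f (\<beta>2 s)" and eq: "\<beta>1 s0 = \<beta>2 s0" and s: "s \<in> S"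
  shows "\<beta>1 s = \<beta>2 s"
proof -
  define A where "A = {s \<in> S. \<beta>1 s = \<beta>2 s}"
  have "closedin (top_of_set S) A"
  proof -
    have "Hausdorff_space (euclidean :: 'm topology)"
      unfolding Hausdorff_space_def disjnt_def by simp (metis hausdorff)
    then show ?thesis
      using closedin_continuous_maps_eq[of euclidean "top_of_set S" \<beta>1 \<beta>2] cont by (simp add: A_def)
  qed
  moreover have "openin (top_of_set S) A"
  proof (subst openin_subopen, intro ballI)
    fix x assume x: "x \<in> A"
    then have xS: "x \<in> S" "\<beta>1 x \<in> M" using im by (auto simp: A_def)
    then obtain U where U: "openin (top_of_set M) U" "\<beta>1 x \<in> U" "inj_on f U"
      using immersed_locally_injective[OF surf] by blast
    define T where "T = (S \<inter> \<beta>1 -` U) \<inter> (S \<inter> \<beta>2 -` U)"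
    have "openin (top_of_set S) T"
      unfolding T_def using im U(1)
      by (intro openin_Int continuous_openin_preimage[OF cont(1)] continuous_openin_preimage[OF cont(2)]) auto
    moreover have "x \<in> T" using x U(2) by (auto simp: T_def A_def)
    moreover have "T \<subseteq> A" using U(3) f by (auto simp: T_def A_def inj_on_def)
    ultimately show "\<exists>T. openin (top_of_set S) T \<and> x \<in> T \<and> T \<subseteq> A" by blast
  qed
  ultimately have "A = {} \<or> A = S" using S(1) connected_clopen by blast
  then show ?thesis using S(2) eq s by (auto simp: A_def)
qed

lemma real_taylor2_limit:
  fixes F :: "real \<Rightarrow> real"
  assumes F: "\<forall>\<^sub>F t in nhds 0. (F has_real_derivative F' t) (at t)"
    and F': "(F' has_real_derivative m) (at 0)" "F' 0 = 0"
  shows "((\<lambda>t. (F t - F 0) / t\<^sup>2) \<longlongrightarrow> m / 2) (at 0)"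
proof (rule lhopital)
  have ev: "\<forall>\<^sub>F t in at 0. (F has_real_derivative F' t) (at t)"
    using F by (simp add: eventually_nhds_conv_at)
  have "isCont F 0" using F by (meson DERIV_isCont eventually_nhds_x_imp_x)
  then show "((\<lambda>t. F t - F 0) \<longlongrightarrow> 0) (at 0)" by (simp add: isCont_def LIM_zero_iff)
  show "((\<lambda>t::real. t\<^sup>2) \<longlongrightarrow> 0) (at 0)" by (auto intro!: tendsto_eq_intros)
  show "\<forall>\<^sub>F t in at 0. t\<^sup>2 \<noteq> (0::real)" "\<forall>\<^sub>F t in at 0. 2 * t \<noteq> (0::real)"
    by (auto simp: eventually_at_filter)
  show "\<forall>\<^sub>F t in at 0. ((\<lambda>t. F t - F 0) has_real_derivative F' t) (at t)"
    using ev by eventually_elim (auto intro!: derivative_eq_intros)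
  show "\<forall>\<^sub>F t in at 0. ((\<lambda>t::real. t\<^sup>2) has_real_derivative 2 * t) (at t)"
    by (intro always_eventually allI) (auto intro!: derivative_eq_intros)
  have "((\<lambda>t. F' t / t) \<longlongrightarrow> m) (at 0)"
    using F' by (simp add: DERIV_def)
  then have "((\<lambda>t. F' t / t / 2) \<longlongrightarrow> m / 2) (at 0)" by (intro tendsto_intros) auto
  then show "((\<lambda>t. F' t / (2 * t)) \<longlongrightarrow> m / 2) (at 0)" by (simp add: mult.commute)
qed

text \<open>
  A curve \<open>\<beta>\<close> in \<open>M\<close> is only continuous, as \<open>M\<close> is a topological space. Its chart representation \<open>\<eta>\<close> inherits
  differentiability from \<open>f \<circ> \<beta>\<close>, by the local inverse of the immersion.
\<close>

lemma curve_in_chart: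
  fixes \<beta> :: "real \<Rightarrow> 'm::t2_space"
  assumes lc: "local_coords f M W \<sigma>" and z: "z \<in> W" "\<beta> 0 = \<sigma> z"
    and M: "\<forall>\<^sub>F t in nhds 0. \<beta> t \<in> M" and cont: "isCont \<beta> 0"
    and e: "((\<lambda>t. f (\<beta> t)) has_vector_derivative e) (at 0)"
  shows "\<exists>\<zeta> \<eta>. dir_deriv \<zeta> (f \<circ> \<sigma>) z = e \<and> \<eta> 0 = z \<and> (\<eta> has_vector_derivative \<zeta>) (at 0) \<and>
    (\<forall>\<^sub>F t in nhds 0. f (\<beta> t) = (f \<circ> \<sigma>) (\<eta> t))"
proof -
  let ?X = "f \<circ> \<sigma>"
  note lcd = local_coordsD[OF lc]
  obtain \<tau> where \<tau>: "homeomorphism W (\<sigma> ` W) \<sigma> \<tau>" using lcd(5) by blast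
  obtain L :: "real^4 \<Rightarrow> real \<times> real" and g :: "real \<times> real \<Rightarrow> real \<times> real" and r where g: "linear L" "\<And>v. L (dir_deriv v ?X z) = v" "r > 0" "ball z r \<subseteq> W"
     "\<And>y. y \<in> ball z r \<Longrightarrow> g (L (?X y)) = y" "(g has_derivative (\<lambda>v. v)) (at (L (?X z)))"
    using immersion_local_inverse[OF lcd(1,2) z(1)] by blast
  define \<eta> where "\<eta> = (\<lambda>t. \<tau> (\<beta> t))"
  have \<eta>0: "\<eta> 0 = z" using \<tau> z by (simp add: \<eta>_def homeomorphism_apply1)
  obtain Ob where Ob: "open Ob" "\<sigma> ` W = M \<inter> Ob" using lcd(3) by (auto simp: openin_open)
  have "\<beta> 0 \<in> Ob" using z Ob by auto
  with topological_tendstoD[OF cont[unfolded isCont_def] Ob(1)]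
  have "\<forall>\<^sub>F t in nhds 0. \<beta> t \<in> Ob" by (simp add: eventually_nhds_conv_at)
  then have ev: "\<forall>\<^sub>F t in nhds 0. \<beta> t \<in> \<sigma> ` W"
    using M by eventually_elim (simp add: Ob)
  have "((\<lambda>t. \<tau> (\<beta> t)) \<longlongrightarrow> \<tau> (\<beta> 0)) (at 0)"
  proof (rule continuous_on_tendsto_compose[of "\<sigma> ` W" \<tau> \<beta> "\<beta> 0"])
    show "continuous_on (\<sigma> ` W) \<tau>" using \<tau> by (simp add: homeomorphism_def)
    show "(\<beta> \<longlongrightarrow> \<beta> 0) (at 0)" using cont by (simp add: isCont_def)
    show "\<beta> 0 \<in> \<sigma> ` W" using z by simp
    show "\<forall>\<^sub>F t in at 0. \<beta> t \<in> \<sigma> ` W" using ev by (simp add: eventually_nhds_conv_at)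
  qed
  then have lim: "(\<eta> \<longlongrightarrow> z) (at 0)" unfolding \<eta>0[symmetric] by (simp add: \<eta>_def)
  have "\<forall>\<^sub>F t in at 0. \<eta> t \<in> ball z r" using topological_tendstoD[OF lim open_ball[of z r]] g(3) by simp
  then have ball: "\<forall>\<^sub>F t in nhds 0. \<eta> t \<in> ball z r" using \<eta>0 g(3) by (simp add: eventually_nhds_conv_at)
  have X\<eta>: "\<forall>\<^sub>F t in nhds 0. f (\<beta> t) = ?X (\<eta> t)"
    using ev by eventually_elim (use \<tau> in \<open>simp add: \<eta>_def homeomorphism_apply2\<close>)
  have \<eta>g: "\<forall>\<^sub>F t in nhds 0. \<eta> t = g (L (f (\<beta> t)))"
    using X\<eta> ball by eventually_elim (simp add: g(5)[unfolded o_apply])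
  have bL: "bounded_linear L" using g(1) by (simp add: linear_conv_bounded_linear)
  have "((\<lambda>t. g (L (f (\<beta> t)))) has_derivative (\<lambda>h. L (h *\<^sub>R e))) (at 0)"
  proof -
    have "((\<lambda>t. L (f (\<beta> t))) has_derivative (\<lambda>h. L (h *\<^sub>R e))) (at 0)"
      using bounded_linear.has_derivative[OF bL e[unfolded has_vector_derivative_def]] .
    moreover have "(g has_derivative (\<lambda>v. v)) (at (L (f (\<beta> 0))))" using g(6) z by simp
    ultimately show ?thesis using has_derivative_compose by fastforce
  qed
  then have "((\<lambda>t. g (L (f (\<beta> t)))) has_vector_derivative L e) (at 0)"
    by (simp add: has_vector_derivative_def linear_scale[OF g(1)])
  moreover have "(\<eta> has_vector_derivative L e) (at 0) =
      ((\<lambda>t. g (L (f (\<beta> t)))) has_vector_derivative L e) (at 0)"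
    using \<eta>g eventually_nhds_x_imp_x[OF \<eta>g] by (intro has_vector_derivative_cong_ev) simp_all
  ultimately have \<eta>': "(\<eta> has_vector_derivative L e) (at 0)" by simp
  have "((\<lambda>t. ?X (\<eta> t)) has_derivative (\<lambda>h. dir_deriv (h *\<^sub>R L e) ?X z)) (at 0)"
    using has_derivative_compose[OF \<eta>'[unfolded has_vector_derivative_def], of ?X "\<lambda>v. dir_deriv v ?X z"]
      immersion_has_derivative[OF lcd(1,2) z(1)] \<eta>0 by simp
  then have "((\<lambda>t. ?X (\<eta> t)) has_vector_derivative dir_deriv (L e) ?X z) (at 0)"
    by (simp add: has_vector_derivative_def linear_scale[OF dir_deriv_linear[OF lcd(1,2) z(1)]])
  moreover have "((\<lambda>t. ?X (\<eta> t)) has_vector_derivative e) (at 0)"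
  proof -
    have "((\<lambda>t. ?X (\<eta> t)) has_vector_derivative e) (at 0) = ((\<lambda>t. f (\<beta> t)) has_vector_derivative e) (at 0)"
      using X\<eta> eventually_nhds_x_imp_x[OF X\<eta>]
      by (intro has_vector_derivative_cong_ev) (auto elim: eventually_mono)
    then show ?thesis using e by simp
  qed
  ultimately have "dir_deriv (L e) ?X z = e" by (rule vector_derivative_unique_at)
  then show ?thesis using \<eta>0 \<eta>' X\<eta> by blast
qed

text \<open>
  Meusnier's theorem: the normal part of the acceleration of a curve on the surface is the second
  fundamental form of its velocity. The height of the curve over the tangent plane has one expansion from
  \<open>real_taylor2_limit\<close>, by the acceleration, and another from \<open>normal_taylor2\<close>, by the second
  fundamental form; the curve in the chart enters by its velocity alone.
\<close>

lemma curve_in_chart_second: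
  fixes \<beta> :: "real \<Rightarrow> 'm::t2_space"
  assumes lc: "local_coords f M W \<sigma>" and z: "z \<in> W" "\<beta> 0 = \<sigma> z"
    and M: "\<forall>\<^sub>F t in nhds 0. \<beta> t \<in> M" and cont: "isCont \<beta> 0"
    and c': "\<forall>\<^sub>F t in nhds 0. ((\<lambda>t. f (\<beta> t)) has_vector_derivative c' t) (at t)"
    and c2: "(c' has_vector_derivative c2) (at 0)"
    and \<nu>: "\<And>v. \<nu> \<bullet> dir_deriv v (f \<circ> \<sigma>) z = 0"
  shows "\<exists>\<zeta>. dir_deriv \<zeta> (f \<circ> \<sigma>) z = c' 0 \<and> fund_form2 (f \<circ> \<sigma>) z \<nu> \<zeta> \<zeta> = c2 \<bullet> \<nu>"
proof -
  let ?X = "f \<circ> \<sigma>"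
  note lcd = local_coordsD[OF lc]
  obtain \<zeta> \<eta> where \<zeta>: "dir_deriv \<zeta> ?X z = c' 0" "\<eta> 0 = z" "(\<eta> has_vector_derivative \<zeta>) (at 0)"
    and X\<eta>: "\<forall>\<^sub>F t in nhds 0. f (\<beta> t) = ?X (\<eta> t)"
    using curve_in_chart[OF lc z M cont eventually_nhds_x_imp_x[OF c']] by blast
  let ?B = "\<lambda>h. fund_form2 ?X z \<nu> h h"
  have lim1: "((\<lambda>t. (f (\<beta> t) \<bullet> \<nu> - f (\<beta> 0) \<bullet> \<nu>) / t\<^sup>2) \<longlongrightarrow> (c2 \<bullet> \<nu>) / 2) (at 0)"
  proof (rule real_taylor2_limit)
    show "\<forall>\<^sub>F t in nhds 0. ((\<lambda>t. f (\<beta> t) \<bullet> \<nu>) has_real_derivative c' t \<bullet> \<nu>) (at t)"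
      using c' by eventually_elim
        (simp add: has_real_derivative_iff_has_vector_derivative bounded_linear.has_vector_derivative[OF bounded_linear_inner_left])
    show "((\<lambda>t. c' t \<bullet> \<nu>) has_real_derivative c2 \<bullet> \<nu>) (at 0)"
      using c2 by (simp add: has_real_derivative_iff_has_vector_derivative bounded_linear.has_vector_derivative[OF bounded_linear_inner_left])
    show "c' 0 \<bullet> \<nu> = 0" using \<nu> \<zeta>(1) by (metis inner_commute)
  qed
  define q where "q = (\<lambda>t. (\<eta> t - z) /\<^sub>R t)"
  have q: "(q \<longlongrightarrow> \<zeta>) (at 0)"
  proof -
    have "((\<lambda>h. norm (\<eta> h - z - h *\<^sub>R \<zeta>) / norm h) \<longlongrightarrow> 0) (at 0)"
      using \<zeta>(2,3) by (simp add: has_vector_derivative_def has_derivative_at)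
    moreover have "\<forall>\<^sub>F h in at 0. norm (\<eta> h - z - h *\<^sub>R \<zeta>) / norm h = norm (q h - \<zeta>)"
    proof -
      have "norm (\<eta> h - z - h *\<^sub>R \<zeta>) / norm h = norm (q h - \<zeta>)" if "h \<noteq> 0" for h
      proof -
        have "q h - \<zeta> = (\<eta> h - z - h *\<^sub>R \<zeta>) /\<^sub>R h"
          using that by (simp add: q_def scaleR_diff_right)
        then show ?thesis by (simp add: divide_inverse)
      qed
      then show ?thesis by (simp add: eventually_at_filter)
    qed
    ultimately have "((\<lambda>h. norm (q h - \<zeta>)) \<longlongrightarrow> 0) (at 0)" by (rule Lim_transform_eventually)
    then show ?thesis using LIM_zero_iff tendsto_norm_zero_iff by blast
  qed
  have Bq: "?B (\<eta> t - z) = t\<^sup>2 * ?B (q t)" if "t \<noteq> 0" for t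
  proof -
    have "\<eta> t - z = t *\<^sub>R q t" using that by (simp add: q_def)
    then show ?thesis
      using linear_scale[OF fund_form_linear(1)[OF lcd(1,2) z(1)]] linear_scale[OF fund_form_linear(2)[OF lcd(1,2) z(1)]]
      by (simp add: power2_eq_square)
  qed
  have lim2: "((\<lambda>t. (?X (\<eta> t) - ?X z) \<bullet> \<nu> / t\<^sup>2 - ?B (q t) / 2) \<longlongrightarrow> 0) (at 0)"
  proof (rule tendstoI)
    fix e :: real assume "e > 0"
    define N where "N = (norm \<zeta> + 1)\<^sup>2"
    have N: "N > 0" using norm_ge_zero[of \<zeta>] unfolding N_def by (intro zero_less_power) linarith
    obtain \<delta> where \<delta>: "\<delta> > 0" "\<And>h. norm h < \<delta> \<Longrightarrow> \<bar>(?X (z + h) - ?X z) \<bullet> \<nu> - ?B h / 2\<bar> \<le> e / (2 * N) * (norm h)\<^sup>2"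
      using normal_taylor2[OF lcd(1,2) z(1) \<nu>, of "e / (2 * N)"] \<open>e > 0\<close> N by auto
    have "(\<eta> \<longlongrightarrow> z) (at 0)"
      using has_vector_derivative_continuous[OF \<zeta>(3)] \<zeta>(2) by (simp add: continuous_within)
    then have "\<forall>\<^sub>F t in at 0. dist (\<eta> t) z < \<delta>" using \<delta>(1) by (simp add: tendstoD)
    moreover have "\<forall>\<^sub>F t in at 0. dist (q t) \<zeta> < 1" using q by (simp add: tendstoD)
    moreover have "\<forall>\<^sub>F t in at (0::real). t \<noteq> 0" by (simp add: eventually_at_filter)
    ultimately show "\<forall>\<^sub>F t in at 0. dist ((?X (\<eta> t) - ?X z) \<bullet> \<nu> / t\<^sup>2 - ?B (q t) / 2) 0 < e"
    proof eventually_elim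
      case (elim t)
      have "norm (q t) \<le> norm \<zeta> + 1"
        using elim(2) norm_triangle_ineq2[of "q t" \<zeta>] by (simp add: dist_norm)
      then have qN: "(norm (q t))\<^sup>2 \<le> N" unfolding N_def by (intro power_mono) auto
      have "norm (\<eta> t - z) = \<bar>t\<bar> * norm (q t)" using elim(3) by (simp add: q_def)
      then have nsq: "(norm (\<eta> t - z))\<^sup>2 = t\<^sup>2 * (norm (q t))\<^sup>2" by (simp add: power_mult_distrib)
      have "\<bar>(?X (\<eta> t) - ?X z) \<bullet> \<nu> - t\<^sup>2 * ?B (q t) / 2\<bar> \<le> e / (2 * N) * (t\<^sup>2 * (norm (q t))\<^sup>2)"
        using \<delta>(2)[of "\<eta> t - z"] elim(1) unfolding nsq Bq[OF elim(3)] by (simp add: dist_norm)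
      also have "\<dots> \<le> e / (2 * N) * (t\<^sup>2 * N)"
        using qN N \<open>e > 0\<close> by (intro mult_left_mono) auto
      also have "\<dots> = t\<^sup>2 * (e / 2)" using N by simp
      finally have *: "\<bar>(?X (\<eta> t) - ?X z) \<bullet> \<nu> - t\<^sup>2 * ?B (q t) / 2\<bar> \<le> t\<^sup>2 * (e / 2)" .
      have "(?X (\<eta> t) - ?X z) \<bullet> \<nu> / t\<^sup>2 - ?B (q t) / 2 =
          ((?X (\<eta> t) - ?X z) \<bullet> \<nu> - t\<^sup>2 * ?B (q t) / 2) / t\<^sup>2"
        using elim(3) by (simp add: diff_divide_distrib)
      also have "\<bar>\<dots>\<bar> \<le> e / 2"
        using * elim(3) by (simp add: abs_divide pos_divide_le_eq mult.commute)
      finally show ?case using \<open>e > 0\<close> by simp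
    qed
  qed
  have lim3: "((\<lambda>t. ?B (q t)) \<longlongrightarrow> ?B \<zeta>) (at 0)"
  proof -
    define b where "b = (\<lambda>u v. fund_form2 ?X z \<nu> u v)"
    note lin = fund_form_linear(1,2)[OF lcd(1,2) z(1), of \<nu>, folded b_def]
    have dec: "b h h = (fst h)\<^sup>2 * b (1,0) (1,0) + fst h * snd h * (b (1,0) (0,1) + b (0,1) (1,0)) + (snd h)\<^sup>2 * b (0,1) (0,1)" for h
    proof -
      have h: "h = fst h *\<^sub>R (1,0) + snd h *\<^sub>R (0,1)" by (simp add: prod_eq_iff)
      have "b h v = fst h * b (1,0) v + snd h * b (0,1) v" for v
        by (subst h) (simp add: linear_add[OF lin(1)] linear_scale[OF lin(1)] del: scaleR_Pair)
      moreover have "b u h = fst h * b u (1,0) + snd h * b u (0,1)" for u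
        by (subst h) (simp add: linear_add[OF lin(2)] linear_scale[OF lin(2)] del: scaleR_Pair)
      ultimately show ?thesis by (simp add: algebra_simps power2_eq_square)
    qed
    have "((\<lambda>t. b (q t) (q t)) \<longlongrightarrow> b \<zeta> \<zeta>) (at 0)"
      unfolding dec[of "q _"] dec[of \<zeta>] by (intro tendsto_intros q)
    then show ?thesis unfolding b_def .
  qed
  have "((\<lambda>t. ?B (q t) / 2) \<longlongrightarrow> (c2 \<bullet> \<nu>) / 2 - 0) (at 0)"
  proof (rule Lim_transform_eventually[OF tendsto_diff[OF lim1 lim2]])
    show "\<forall>\<^sub>F t in at 0. (f (\<beta> t) \<bullet> \<nu> - f (\<beta> 0) \<bullet> \<nu>) / t\<^sup>2 - ((?X (\<eta> t) - ?X z) \<bullet> \<nu> / t\<^sup>2 - ?B (q t) / 2) = ?B (q t) / 2"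
      using X\<eta> unfolding eventually_nhds_conv_at
      by (auto elim!: eventually_mono simp: inner_diff_left z)
  qed
  moreover have "((\<lambda>t. ?B (q t) / 2) \<longlongrightarrow> ?B \<zeta> / 2) (at 0)" by (intro tendsto_intros lim3) auto
  ultimately have "?B \<zeta> / 2 = (c2 \<bullet> \<nu>) / 2" using tendsto_unique[OF at_neq_bot] by force
  then have "?B \<zeta> = c2 \<bullet> \<nu>" by simp
  then show ?thesis using \<zeta>(1) by blast
qed

section \<open>Rotations of a plane in four-space\<close>

lemma orthonormal_frame_expand:
  fixes a b c d y :: "real^4"
  assumes n: "norm a = 1" "norm b = 1" "norm c = 1" "norm d = 1"
    and o: "a \<bullet> b = 0" "a \<bullet> c = 0" "a \<bullet> d = 0" "b \<bullet> c = 0" "b \<bullet> d = 0" "c \<bullet> d = 0"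
  shows "y = (y \<bullet> a) *\<^sub>R a + (y \<bullet> b) *\<^sub>R b + (y \<bullet> c) *\<^sub>R c + (y \<bullet> d) *\<^sub>R d"
proof -
  have s: "a \<bullet> a = 1" "b \<bullet> b = 1" "c \<bullet> c = 1" "d \<bullet> d = 1" using n by (simp_all add: dot_square_norm)
  note sym = inner_commute[of b a] inner_commute[of c a] inner_commute[of d a]
    inner_commute[of c b] inner_commute[of d b] inner_commute[of d c]
  have ne: "a \<noteq> b" "a \<noteq> c" "a \<noteq> d" "b \<noteq> c" "b \<noteq> d" "c \<noteq> d" using s o by auto
  have "0 \<notin> {a,b,c,d}" using n by auto
  moreover have "pairwise orthogonal {a,b,c,d}"
    using o by (auto simp: pairwise_def orthogonal_def sym)
  ultimately have ind: "independent {a,b,c,d}" using pairwise_orthogonal_independent by blast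
  have "card {a,b,c,d} = 4" using ne by simp
  then have span: "span {a,b,c,d} = UNIV"
    using card_ge_dim_independent[of "{a,b,c,d}" UNIV] ind by auto
  define w where "w = y - ((y \<bullet> a) *\<^sub>R a + (y \<bullet> b) *\<^sub>R b + (y \<bullet> c) *\<^sub>R c + (y \<bullet> d) *\<^sub>R d)"
  have "w \<bullet> a = 0" "w \<bullet> b = 0" "w \<bullet> c = 0" "w \<bullet> d = 0"
    using o s by (auto simp: w_def inner_diff_left inner_add_left sym)
  then have "orthogonal w x" if "x \<in> {a,b,c,d}" for x using that by (auto simp: orthogonal_def)
  then have "orthogonal w w" using orthogonal_to_span[of w "{a,b,c,d}" w] span by blast
  then have "w = 0" by (simp add: orthogonal_def)
  then show ?thesis by (simp add: w_def)
qed

definition plane_coord :: "real^4 \<Rightarrow> real^4 \<Rightarrow> real^4 \<Rightarrow> complex" where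
  "plane_coord a b y = Complex (y \<bullet> a) (y \<bullet> b)"

lemma plane_coord_linear: "linear (plane_coord a b)"
  by (rule linearI) (simp_all add: plane_coord_def complex_eq_iff inner_add_left)

lemmas plane_coord_simps = linear_add[OF plane_coord_linear] linear_diff[OF plane_coord_linear]
  linear_scale[OF plane_coord_linear] linear_0[OF plane_coord_linear] linear_neg[OF plane_coord_linear]

lemma plane_coord_bounded_linear: "bounded_linear (plane_coord a b)"
  using plane_coord_linear linear_conv_bounded_linear by blast

text \<open>
  \<open>c\<close>, \<open>d\<close> complete the plane of rotation to an orthonormal frame. Identifying both planes with the
  complex numbers, a point \<open>y\<close> has the coordinates \<open>P y\<close> and \<open>Q y\<close>; the rotation by \<open>t\<close> multiplies \<open>P y\<close>
  by \<open>cis t\<close> and fixes \<open>Q y\<close>. The field \<open>J\<close> is its velocity.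
\<close>

locale rotational =
  fixes f :: "'m::t2_space \<Rightarrow> real^4" and M :: "'m set" and K :: real
    and a b c d :: "real^4" and \<phi> :: "real \<Rightarrow> 'm \<Rightarrow> 'm"
  assumes surf: "immersed_surface_S3 f M"
    and curv: "constant_gauss_curvature f M K" and K0: "K \<noteq> 0"
    and norms: "norm a = 1" "norm b = 1" "norm c = 1" "norm d = 1"
    and orth: "a \<bullet> b = 0" "a \<bullet> c = 0" "a \<bullet> d = 0" "b \<bullet> c = 0" "b \<bullet> d = 0" "c \<bullet> d = 0"
    and \<phi>_cont: "continuous_on (UNIV \<times> M) (\<lambda>(t, x). \<phi> t x)"
    and \<phi>_0: "\<And>x. x \<in> M \<Longrightarrow> \<phi> 0 x = x"
    and \<phi>_M: "\<And>t x. x \<in> M \<Longrightarrow> \<phi> t x \<in> M"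
    and f_\<phi>: "\<And>t x. x \<in> M \<Longrightarrow> f (\<phi> t x) = plane_rotation a b t (f x)"
    and \<phi>_add: "\<And>s t x. x \<in> M \<Longrightarrow> \<phi> (s + t) x = \<phi> s (\<phi> t x)"
begin

abbreviation "P \<equiv> plane_coord a b"
abbreviation "Q \<equiv> plane_coord c d"
abbreviation "R \<equiv> plane_rotation a b"

definition J :: "real^4 \<Rightarrow> real^4" where "J y = (y \<bullet> a) *\<^sub>R b - (y \<bullet> b) *\<^sub>R a"

lemma selfs: "a \<bullet> a = 1" "b \<bullet> b = 1" "c \<bullet> c = 1" "d \<bullet> d = 1"
  using norms by (simp_all add: dot_square_norm)

lemma orth': "b \<bullet> a = 0" "c \<bullet> a = 0" "d \<bullet> a = 0" "c \<bullet> b = 0" "d \<bullet> b = 0" "d \<bullet> c = 0"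
  using orth by (simp_all add: inner_commute)

lemma expand: "y = (y \<bullet> a) *\<^sub>R a + (y \<bullet> b) *\<^sub>R b + (y \<bullet> c) *\<^sub>R c + (y \<bullet> d) *\<^sub>R d"
  by (rule orthonormal_frame_expand[OF norms orth])

lemma inner_PQ: "x \<bullet> y = P x \<bullet> P y + Q x \<bullet> Q y"
  by (subst expand[of x]) (simp add: inner_add_left inner_add_right plane_coord_def inner_complex_def inner_commute)

lemma PQ_eqI: "P x = P y \<Longrightarrow> Q x = Q y \<Longrightarrow> x = y"
  by (subst expand[of x], subst expand[of y]) (simp add: plane_coord_def)

lemma norm_PQ: "(norm y)\<^sup>2 = (cmod (P y))\<^sup>2 + (cmod (Q y))\<^sup>2"
  using inner_PQ[of y y] by (simp add: dot_square_norm)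

lemma P_R: "P (R t y) = cis t * P y" and Q_R: "Q (R t y) = Q y"
  by (simp_all add: plane_coord_def plane_rotation_def complex_eq_iff inner_add_left selfs orth orth' algebra_simps)

lemma P_J: "P (J y) = \<i> * P y" and Q_J: "Q (J y) = 0"
  by (simp_all add: plane_coord_def J_def complex_eq_iff inner_diff_left selfs orth orth')

lemma P_frame: "P a = 1" "P b = \<i>" "Q a = 0" "Q b = 0" "P c = 0" "P d = 0" "Q c = 1" "Q d = \<i>"
  by (simp_all add: plane_coord_def complex_eq_iff selfs orth orth')

lemma linear_R: "linear (R t)"
  by (rule linearI; rule PQ_eqI; simp add: P_R Q_R plane_coord_simps algebra_simps)

lemma linear_J: "linear J"
  by (rule linearI; rule PQ_eqI; simp add: P_J Q_J plane_coord_simps algebra_simps)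

lemma J_R: "J (R t y) = R t (J y)"
  by (rule PQ_eqI) (simp_all add: P_J Q_J P_R Q_R)

lemma R_0: "R 0 y = y"
  by (rule PQ_eqI) (simp_all add: P_R Q_R)

lemma J_skew: "J x \<bullet> y = - (x \<bullet> J y)"
  by (simp add: inner_PQ P_J Q_J inner_complex_def)

lemma has_vector_derivative_R:
  assumes u: "(u has_vector_derivative u') (at t)"
  shows "((\<lambda>t. R t (u t)) has_vector_derivative R t u' + J (R t (u t))) (at t)"
proof -
  have ua: "((\<lambda>t. u t \<bullet> e) has_real_derivative u' \<bullet> e) (at t)" for e
    using bounded_linear.has_vector_derivative[OF bounded_linear_inner_left u]
    by (simp add: has_real_derivative_iff_has_vector_derivative)
  have uav: "((\<lambda>t. cos t - 1) has_real_derivative - sin t) (at t)" "(sin has_real_derivative cos t) (at t)"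
    by (auto intro!: derivative_eq_intros)
  have "((\<lambda>t. R t (u t)) has_vector_derivative
      u' + (((cos t - 1) * (u' \<bullet> a) + - sin t * (u t \<bullet> a)) - (sin t * (u' \<bullet> b) + cos t * (u t \<bullet> b))) *\<^sub>R a +
      ((sin t * (u' \<bullet> a) + cos t * (u t \<bullet> a)) + ((cos t - 1) * (u' \<bullet> b) + - sin t * (u t \<bullet> b))) *\<^sub>R b) (at t)"
    unfolding plane_rotation_def
    by (intro has_vector_derivative_add u)
      (auto intro!: has_vector_derivative_scaleR[where g="\<lambda>_. a" and g'=0, THEN has_vector_derivative_eq_rhs]
          has_vector_derivative_scaleR[where g="\<lambda>_. b" and g'=0, THEN has_vector_derivative_eq_rhs]
          DERIV_diff DERIV_add DERIV_mult'[OF uav(1) ua] DERIV_mult'[OF uav(2) ua])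
  moreover have "u' + (((cos t - 1) * (u' \<bullet> a) + - sin t * (u t \<bullet> a)) - (sin t * (u' \<bullet> b) + cos t * (u t \<bullet> b))) *\<^sub>R a +
      ((sin t * (u' \<bullet> a) + cos t * (u t \<bullet> a)) + ((cos t - 1) * (u' \<bullet> b) + - sin t * (u t \<bullet> b))) *\<^sub>R b
      = R t u' + J (R t (u t))"
    by (rule PQ_eqI)
      (simp_all add: P_J Q_J P_R Q_R plane_coord_simps P_frame, simp_all add: plane_coord_def complex_eq_iff algebra_simps)
  ultimately show ?thesis by simp
qed

lemma sphere: "x \<in> M \<Longrightarrow> norm (f x) = 1"
  using surf by (auto simp: immersed_surface_S3_def)

lemma \<phi>_continuous_on:
  assumes "continuous_on S u" "continuous_on S g" "g ` S \<subseteq> M"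
  shows "continuous_on S (\<lambda>s. \<phi> (u s) (g s))"
  using continuous_on_compose2[OF \<phi>_cont continuous_on_Pair[OF assms(1,2)]] assms(3) by auto

section \<open>Curvature of rotational surfaces\<close>

text \<open>
  A witness for a pair of principal curvatures, with the chart, normal and principal directions that
  realise it.
\<close>

definition shape_at where
  "shape_at W \<sigma> z \<nu> v1 v2 k1 k2 \<longleftrightarrow> local_coords f M W \<sigma> \<and> z \<in> W \<and>
     unit_normal (f \<circ> \<sigma>) z \<nu> \<and> v1 \<noteq> v2 \<and> independent {v1, v2} \<and>
     (\<forall>w. fund_form2 (f \<circ> \<sigma>) z \<nu> v1 w = k1 * fund_form1 (f \<circ> \<sigma>) z v1 w) \<and>
     (\<forall>w. fund_form2 (f \<circ> \<sigma>) z \<nu> v2 w = k2 * fund_form1 (f \<circ> \<sigma>) z v2 w)"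

lemma principal_curvatures_iff:
  "principal_curvatures f M x k1 k2 \<longleftrightarrow> (\<exists>W \<sigma> z \<nu> v1 v2. shape_at W \<sigma> z \<nu> v1 v2 k1 k2 \<and> \<sigma> z = x)"
  unfolding principal_curvatures_def shape_at_def by (intro ex_cong1) blast

lemma shape_exists:
  assumes "x \<in> M"
  shows "\<exists>W \<sigma> z \<nu> v1 v2 k1 k2. shape_at W \<sigma> z \<nu> v1 v2 k1 k2 \<and> \<sigma> z = x \<and> k1 * k2 = K"
proof -
  have "{k1 * k2 | k1 k2. principal_curvatures f M x k1 k2} = {K}"
    using curv assms by (simp add: constant_gauss_curvature_def)
  then have "\<exists>k1 k2. K = k1 * k2 \<and> principal_curvatures f M x k1 k2" by blast
  then show ?thesis unfolding principal_curvatures_iff by metis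
qed

lemma shape_swap: "shape_at W \<sigma> z \<nu> v1 v2 k1 k2 \<Longrightarrow> shape_at W \<sigma> z \<nu> v2 v1 k2 k1"
  unfolding shape_at_def by (metis insert_commute)

lemma shape_flip: "shape_at W \<sigma> z \<nu> v1 v2 k1 k2 \<Longrightarrow> shape_at W \<sigma> z (- \<nu>) v1 v2 (- k1) (- k2)"
  by (simp add: shape_at_def unit_normal_def fund_form2_def)

text \<open>
  Replacing the normal by its negative and exchanging the two directions brings a principal curvature
  of square \<open>K\<close> to the first place with the positive sign.
\<close>

lemma principal_curvature_sqrt:
  assumes "shape_at W \<sigma> z \<nu> v1 v2 k1 k2" "\<sigma> z = x" "k1\<^sup>2 = K \<or> k2\<^sup>2 = K"
  shows "\<exists>k. principal_curvatures f M x (sqrt K) k"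
proof -
  have *: "\<exists>k. principal_curvatures f M x (sqrt K) k"
    if s: "shape_at W \<sigma> z \<nu> v1 v2 k1 k2" "k1\<^sup>2 = K" for \<nu> v1 v2 k1 k2
  proof (cases "k1 \<ge> 0")
    case True
    then have "sqrt K = k1" using s(2) by (simp add: real_sqrt_unique)
    then show ?thesis unfolding principal_curvatures_iff using s(1) assms(2) by blast
  next
    case False
    then have "sqrt K = - k1" using s(2) by (simp add: real_sqrt_unique)
    then show ?thesis unfolding principal_curvatures_iff using shape_flip[OF s(1)] assms(2) by metis
  qed
  show ?thesis using assms(3) *[OF assms(1)] *[OF shape_swap[OF assms(1)]] by blast
qed

context
  fixes W \<sigma> z \<nu> v1 v2 k1 k2
  assumes sh: "shape_at W \<sigma> z \<nu> v1 v2 k1 k2"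
begin

private abbreviation (input) "X \<equiv> f \<circ> \<sigma>"
private abbreviation (input) "II \<equiv> fund_form2 X z \<nu>"
private abbreviation (input) "I1 \<equiv> fund_form1 X z"
private abbreviation (input) "D v \<equiv> dir_deriv v X z"
private abbreviation (input) "y \<equiv> f (\<sigma> z)"

lemma shape_chart: "local_coords f M W \<sigma>" "z \<in> W" "open W" "smooth_immersion_on W X" "\<sigma> ` W \<subseteq> M"
  and shape_normal: "norm \<nu> = 1" "\<nu> \<bullet> y = 0" "\<nu> \<bullet> D v = 0"
  and shape_eigen: "II v1 w = k1 * I1 v1 w" "II v2 w = k2 * I1 v2 w" "independent {v1, v2}" "v1 \<noteq> v2"
  using sh local_coordsD[of f M W \<sigma>] by (auto simp: shape_at_def unit_normal_def simp del: split_paired_All split_paired_Ex)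

lemma D_linear: "linear D" and D_inj: "D v = D w \<Longrightarrow> v = w"
  using dir_deriv_linear[OF shape_chart(3,4,2)] dir_deriv_inj[OF shape_chart(3,4,2)] by (auto simp: inj_def simp del: split_paired_All)

lemma D_tangent: "y \<bullet> D v = 0"
proof -
  have "((\<lambda>x. X x \<bullet> X x) has_derivative (\<lambda>v. X z \<bullet> D v + D v \<bullet> X z)) (at z)"
    by (intro has_derivative_inner immersion_has_derivative[OF shape_chart(3,4,2)])
  moreover have "((\<lambda>x. X x \<bullet> X x) has_derivative (\<lambda>v. 0)) (at z)"
  proof (rule has_derivative_transform_within_open[OF has_derivative_const shape_chart(3,2)])
    fix x assume "x \<in> W"
    then have "norm (X x) = 1" using sphere shape_chart(5) by auto
    then show "1 = X x \<bullet> X x" by (simp add: dot_square_norm)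
  qed
  ultimately have "X z \<bullet> D v + D v \<bullet> X z = 0" using has_derivative_unique by (metis (no_types, lifting))
  then show ?thesis by (simp add: inner_commute)
qed

lemma span_eigen: "\<exists>\<alpha> \<beta>. w = \<alpha> *\<^sub>R v1 + \<beta> *\<^sub>R v2"
proof -
  have "card {v1, v2} = 2" using shape_eigen(4) by simp
  then have "w \<in> span {v1, v2}"
    using card_ge_dim_independent[of "{v1,v2}" UNIV] shape_eigen(3) by auto
  then show ?thesis by (auto simp: span_insert span_singleton algebra_simps simp del: split_paired_Ex)
qed

lemmas II_lin = fund_form_linear(1,2)[OF shape_chart(3,4,2), of \<nu>]
lemmas I_lin = fund_form_linear(3,4)[OF shape_chart(3,4,2)]

lemma I1_eq: "I1 v w = D v \<bullet> D w" by (simp add: fund_form1_def)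

lemma eigenvalue_unique:
  assumes w: "w \<noteq> 0" and eig: "\<And>u. II w u = k * I1 w u"
  shows "k = k1 \<or> k = k2"
proof (rule ccontr)
  assume k: "\<not> (k = k1 \<or> k = k2)"
  obtain \<alpha> \<beta> where ab: "w = \<alpha> *\<^sub>R v1 + \<beta> *\<^sub>R v2" using span_eigen by blast
  define u where "u = (\<alpha> * (k1 - k)) *\<^sub>R v1 + (\<beta> * (k2 - k)) *\<^sub>R v2"
  have "I1 u u' = II w u' - k * I1 w u'" for u'
    unfolding u_def ab by (simp add: linear_add[OF II_lin(1)] linear_scale[OF II_lin(1)] linear_add[OF I_lin(1)]
      linear_scale[OF I_lin(1)] shape_eigen(1,2)) (simp add: algebra_simps)
  then have "D u \<bullet> D u = 0" using eig by (simp add: I1_eq[symmetric])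
  then have "D u = D 0" by (simp add: linear_0[OF D_linear])
  then have u0: "u = 0" using D_inj by blast
  have "\<alpha> * (k1 - k) = 0 \<and> \<beta> * (k2 - k) = 0"
  proof (rule ccontr)
    assume *: "\<not> (\<alpha> * (k1 - k) = 0 \<and> \<beta> * (k2 - k) = 0)"
    have "dependent {v1, v2}"
      using u0 * shape_eigen(4) unfolding u_def
      by (intro dependent_finite[THEN iffD2, OF _ exI[of _ "\<lambda>v. if v = v1 then \<alpha> * (k1 - k) else \<beta> * (k2 - k)"]]) auto
    then show False using shape_eigen(3) by simp
  qed
  then have "\<alpha> = 0" "\<beta> = 0" using k by auto
  then show False using ab w by simp
qed

text \<open>
  Both sides are the determinant of a symmetric form in the frame \<open>u\<close>, \<open>w\<close>. Expanding \<open>u\<close> and \<open>w\<close> in the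
  principal directions multiplies both determinants by the same factor.
\<close>

lemma gauss_determinant:
  "II u u * II w w - II u w * II w u = k1 * k2 * (I1 u u * I1 w w - (I1 u w)\<^sup>2)"
proof -
  obtain \<alpha> \<beta> where u: "u = \<alpha> *\<^sub>R v1 + \<beta> *\<^sub>R v2" using span_eigen by blast
  obtain \<gamma> \<delta> where w: "w = \<gamma> *\<^sub>R v1 + \<delta> *\<^sub>R v2" using span_eigen by blast
  have IIe: "II (p *\<^sub>R v1 + q *\<^sub>R v2) x = p * k1 * I1 v1 x + q * k2 * I1 v2 x" for p q x
    by (simp add: linear_add[OF II_lin(1)] linear_scale[OF II_lin(1)] shape_eigen(1,2))
  have Ie: "I1 (p *\<^sub>R v1 + q *\<^sub>R v2) x = p * I1 v1 x + q * I1 v2 x" for p q x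
    by (simp add: linear_add[OF I_lin(1)] linear_scale[OF I_lin(1)])
  have sym: "I1 v2 v1 = I1 v1 v2" by (simp add: I1_eq inner_commute)
  have Ir: "I1 x (p *\<^sub>R v1 + q *\<^sub>R v2) = p * I1 x v1 + q * I1 x v2" for p q x
    by (simp add: linear_add[OF I_lin(2)] linear_scale[OF I_lin(2)])
  show ?thesis unfolding u w IIe Ie Ir sym by algebra
qed

lemma curve_tangent:
  assumes "\<beta> 0 = \<sigma> z" "\<forall>\<^sub>F t in nhds 0. \<beta> t \<in> M" "isCont \<beta> 0"
    and "((\<lambda>t. f (\<beta> t)) has_vector_derivative e) (at 0)"
  shows "\<exists>\<zeta>. D \<zeta> = e"
  using curve_in_chart[OF shape_chart(1,2) assms] by blast

lemma chart_line:
  fixes \<zeta> :: "real \<times> real"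
  defines "T \<equiv> {t. z + t *\<^sub>R \<zeta> \<in> W}"
  shows "open T" "0 \<in> T" "continuous_on T (\<lambda>t. \<sigma> (z + t *\<^sub>R \<zeta>))" "\<And>t. t \<in> T \<Longrightarrow> \<sigma> (z + t *\<^sub>R \<zeta>) \<in> M"
    and "\<And>t. t \<in> T \<Longrightarrow> ((\<lambda>t. X (z + t *\<^sub>R \<zeta>)) has_vector_derivative dir_deriv \<zeta> X (z + t *\<^sub>R \<zeta>)) (at t)"
    and "\<And>t. t \<in> T \<Longrightarrow> ((\<lambda>t. dir_deriv \<zeta> X (z + t *\<^sub>R \<zeta>)) has_vector_derivative
          dir_deriv \<zeta> (dir_deriv \<zeta> X) (z + t *\<^sub>R \<zeta>)) (at t)"
proof -
  have T: "T = (\<lambda>t. z + t *\<^sub>R \<zeta>) -` W" by (auto simp: T_def)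
  show "open T" unfolding T by (intro open_vimage shape_chart(3) continuous_intros)
  show "0 \<in> T" using shape_chart(2) by (simp add: T_def)
  obtain \<tau> where "homeomorphism W (\<sigma> ` W) \<sigma> \<tau>" using local_coordsD(5)[OF shape_chart(1)] by blast
  then have "continuous_on W \<sigma>" by (simp add: homeomorphism_def)
  then show "continuous_on T (\<lambda>t. \<sigma> (z + t *\<^sub>R \<zeta>))"
    by (rule continuous_on_compose2) (auto simp: T_def intro!: continuous_intros)
  show "\<And>t. t \<in> T \<Longrightarrow> \<sigma> (z + t *\<^sub>R \<zeta>) \<in> M" using shape_chart(5) by (auto simp: T_def)
  have line: "((\<lambda>t. z + t *\<^sub>R \<zeta>) has_derivative (\<lambda>h. h *\<^sub>R \<zeta>)) (at t)" for t
    by (auto intro!: derivative_eq_intros)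
  fix t assume t: "t \<in> T"
  then have tW: "z + t *\<^sub>R \<zeta> \<in> W" by (simp add: T_def)
  show "((\<lambda>t. X (z + t *\<^sub>R \<zeta>)) has_vector_derivative dir_deriv \<zeta> X (z + t *\<^sub>R \<zeta>)) (at t)"
    using has_derivative_compose[OF line immersion_has_derivative[OF shape_chart(3,4) tW]]
    unfolding has_vector_derivative_def by (simp add: linear_scale[OF dir_deriv_linear[OF shape_chart(3,4) tW]])
  show "((\<lambda>t. dir_deriv \<zeta> X (z + t *\<^sub>R \<zeta>)) has_vector_derivative
          dir_deriv \<zeta> (dir_deriv \<zeta> X) (z + t *\<^sub>R \<zeta>)) (at t)"
    using has_derivative_compose[OF line dir_deriv_has_derivative[OF shape_chart(3,4) tW]]
    unfolding has_vector_derivative_def by (simp add: linear_scale[OF dir_deriv2_linear_left[OF shape_chart(3,4) tW]])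
qed

text \<open>
  The curve \<open>t \<mapsto> \<phi> (\<theta> t) (\<sigma> (z + t \<zeta>))\<close> moves along a line of the chart while it is rotated with speed 1
  (for \<open>\<theta> t = t\<close>), or is the rotated image of such a line through a fixed point. Its acceleration, inserted
  in \<open>curve_in_chart_second\<close>, gives the second fundamental form.
\<close>

lemma rotated_line_second:
  assumes \<theta>: "\<theta> = (\<lambda>t. t) \<and> \<theta>' = 1 \<or> \<theta> = (\<lambda>t. \<theta>0) \<and> \<theta>' = 0 \<and> \<phi> \<theta>0 (\<sigma> z) = \<sigma> z"
  shows "\<exists>\<xi>. D \<xi> = R (\<theta> 0) (D \<zeta>) + \<theta>' *\<^sub>R J y \<and>
    II \<xi> \<xi> = (R (\<theta> 0) (dir_deriv \<zeta> (dir_deriv \<zeta> X) z) + \<theta>' *\<^sub>R (2 *\<^sub>R J (D \<zeta>) + J (J y))) \<bullet> \<nu>"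
proof -
  define T where "T = {t. z + t *\<^sub>R \<zeta> \<in> W}"
  note line = chart_line[where \<zeta> = \<zeta>, folded T_def]
  define u where "u = (\<lambda>t. X (z + t *\<^sub>R \<zeta>))"
  define u' where "u' = (\<lambda>t. dir_deriv \<zeta> X (z + t *\<^sub>R \<zeta>))"
  define \<beta> where "\<beta> = (\<lambda>t. \<phi> (\<theta> t) (\<sigma> (z + t *\<^sub>R \<zeta>)))"
  have zM: "\<sigma> z \<in> M" using shape_chart(2,5) by auto
  have evT: "\<forall>\<^sub>F t in nhds 0. t \<in> T" using line(1,2) by (simp add: eventually_nhds_in_open)
  have 1: "\<beta> 0 = \<sigma> z" using \<theta> \<phi>_0 zM by (auto simp: \<beta>_def)
  have 2: "\<forall>\<^sub>F t in nhds 0. \<beta> t \<in> M" using evT by eventually_elim (simp add: \<beta>_def \<phi>_M line(4))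
  have "continuous_on T \<beta>"
    unfolding \<beta>_def using \<theta> line(4) by (intro \<phi>_continuous_on line(3)) (auto intro: continuous_intros)
  then have 3: "isCont \<beta> 0" using line(1,2) by (simp add: continuous_on_eq_continuous_at)
  have f\<beta>: "f (\<beta> t) = R (\<theta> t) (u t)" if "t \<in> T" for t using f_\<phi> line(4)[OF that] by (simp add: \<beta>_def u_def)
  have rot: "((\<lambda>t. R (\<theta> t) (w t)) has_vector_derivative R (\<theta> t) w' + \<theta>' *\<^sub>R J (R (\<theta> t) (w t))) (at t)"
    if "(w has_vector_derivative w') (at t)" for w w' t
  proof -
    have "((\<lambda>t. R q (w t)) has_vector_derivative R q w') (at t)" for q
      using bounded_linear.has_vector_derivative[OF _ that] linear_R linear_conv_bounded_linear by blast
    then show ?thesis using \<theta> has_vector_derivative_R[OF that] by auto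
  qed
  have Jv: "((\<lambda>t. J (w t)) has_vector_derivative J w') (at t)"
    if "(w has_vector_derivative w') (at t)" for w w' t
    using bounded_linear.has_vector_derivative[OF _ that] linear_J linear_conv_bounded_linear by blast
  define c' where "c' = (\<lambda>t. R (\<theta> t) (u' t) + \<theta>' *\<^sub>R J (R (\<theta> t) (u t)))"
  have 4: "\<forall>\<^sub>F t in nhds 0. ((\<lambda>t. f (\<beta> t)) has_vector_derivative c' t) (at t)"
    using evT
  proof eventually_elim
    case (elim t)
    have "(u has_vector_derivative u' t) (at t)" using line(5)[OF elim] by (simp add: u_def u'_def)
    from rot[OF this] show ?case unfolding c'_def
      by (rule has_vector_derivative_transform_within_open[OF _ line(1) elim]) (simp add: f\<beta>)
  qed
  have u0: "(u has_vector_derivative D \<zeta>) (at 0)" using line(5)[OF line(2)] by (simp add: u_def)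
  have u'0: "(u' has_vector_derivative dir_deriv \<zeta> (dir_deriv \<zeta> X) z) (at 0)"
    using line(6)[OF line(2)] by (simp add: u'_def)
  have vals: "u 0 = y" "u' 0 = D \<zeta>" by (simp_all add: u_def u'_def)
  have 5: "(c' has_vector_derivative (R (\<theta> 0) (dir_deriv \<zeta> (dir_deriv \<zeta> X) z) + \<theta>' *\<^sub>R J (R (\<theta> 0) (D \<zeta>))) +
      \<theta>' *\<^sub>R J (R (\<theta> 0) (D \<zeta>) + \<theta>' *\<^sub>R J (R (\<theta> 0) y))) (at 0)"
    unfolding c'_def
    using has_vector_derivative_add[OF rot[OF u'0] has_vector_derivative_scaleR[OF DERIV_const[of \<theta>'] Jv[OF rot[OF u0]]]]
    by (simp add: vals)
  obtain \<xi> where \<xi>: "D \<xi> = c' 0" "II \<xi> \<xi> = ((R (\<theta> 0) (dir_deriv \<zeta> (dir_deriv \<zeta> X) z) + \<theta>' *\<^sub>R J (R (\<theta> 0) (D \<zeta>))) +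
      \<theta>' *\<^sub>R J (R (\<theta> 0) (D \<zeta>) + \<theta>' *\<^sub>R J (R (\<theta> 0) y))) \<bullet> \<nu>"
    using curve_in_chart_second[OF shape_chart(1,2) 1 2 3 4 5 shape_normal(3)] by blast
  have "c' 0 = R (\<theta> 0) (D \<zeta>) + \<theta>' *\<^sub>R J y"
    using \<theta> by (auto simp: c'_def vals R_0)
  moreover have "(R (\<theta> 0) (dir_deriv \<zeta> (dir_deriv \<zeta> X) z) + \<theta>' *\<^sub>R J (R (\<theta> 0) (D \<zeta>))) +
      \<theta>' *\<^sub>R J (R (\<theta> 0) (D \<zeta>) + \<theta>' *\<^sub>R J (R (\<theta> 0) y)) =
     R (\<theta> 0) (dir_deriv \<zeta> (dir_deriv \<zeta> X) z) + \<theta>' *\<^sub>R (2 *\<^sub>R J (D \<zeta>) + J (J y))"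
    using \<theta> by (auto simp: R_0 linear_add[OF linear_J] scaleR_2)
  ultimately show ?thesis using \<xi> by metis
qed

lemma orbit_direction: "\<exists>\<zeta>. D \<zeta> = J y"
  using rotated_line_second[of "\<lambda>t. t" 1 _ 0] by (auto simp: R_0 linear_0[OF D_linear])

text \<open>
  Polarise the second fundamental form of the velocity \<open>J y + D \<zeta>\<close> of a rotated line, given by
  \<open>rotated_line_second\<close>: its mixed part is the normal component of \<open>J (D \<zeta>)\<close>.
\<close>

lemma orbit_second_form:
  assumes o: "D \<zeta>o = J y" shows "II \<zeta> \<zeta>o = J (D \<zeta>) \<bullet> \<nu>"
proof -
  have key: "II (\<zeta> + \<zeta>o) (\<zeta> + \<zeta>o) = II \<zeta> \<zeta> + (2 *\<^sub>R J (D \<zeta>) + J (J y)) \<bullet> \<nu>" for \<zeta>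
  proof -
    obtain \<xi> where \<xi>: "D \<xi> = D \<zeta> + J y"
      "II \<xi> \<xi> = (dir_deriv \<zeta> (dir_deriv \<zeta> X) z + (2 *\<^sub>R J (D \<zeta>) + J (J y))) \<bullet> \<nu>"
      using rotated_line_second[of "\<lambda>t. t" 1 _ \<zeta>] by (auto simp: R_0 simp del: split_paired_Ex)
    have "D \<xi> = D (\<zeta> + \<zeta>o)" using \<xi>(1) o linear_add[OF D_linear] by simp
    then have "\<xi> = \<zeta> + \<zeta>o" by (rule D_inj)
    then show ?thesis using \<xi>(2) by (simp add: fund_form2_def[of _ _ _ \<zeta> \<zeta>] inner_add_left)
  qed
  have "II \<zeta>o \<zeta>o = J (J y) \<bullet> \<nu>"
    using key[of 0] by (simp add: linear_0[OF D_linear] linear_0[OF linear_J] linear_0[OF II_lin(1)])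
  moreover have "II (\<zeta> + \<zeta>o) (\<zeta> + \<zeta>o) = II \<zeta> \<zeta> + 2 * II \<zeta> \<zeta>o + II \<zeta>o \<zeta>o"
    using fund_form2_commute[OF shape_chart(3,4,2), of \<nu> \<zeta>o \<zeta>]
    by (simp add: linear_add[OF II_lin(1)] linear_add[OF II_lin(2)])
  ultimately show ?thesis using key[of \<zeta>] by (simp add: inner_add_left)
qed

end

end

context rotational
begin

text \<open>
  The normal curvature of the orbit through \<open>y\<close>, up to sign: the orbit has radius \<open>cmod (P y)\<close>.
\<close>

definition kappa :: "real^4 \<Rightarrow> real^4 \<Rightarrow> real" where
  "kappa y \<nu> = (P y \<bullet> P \<nu>) / (cmod (P y))\<^sup>2"

context
  fixes W \<sigma> z \<nu> v1 v2 k1 k2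
  assumes sh: "shape_at W \<sigma> z \<nu> v1 v2 k1 k2"
begin

lemmas [simp del] = split_paired_Ex split_paired_All

text \<open>
  The normal is orthogonal to \<open>J y\<close>. In the plane of rotation this means that \<open>P \<nu>\<close> is a real multiple of
  \<open>P y\<close>.
\<close>

lemma J_normal:
  assumes "P (f (\<sigma> z)) \<noteq> 0" shows "J \<nu> = kappa (f (\<sigma> z)) \<nu> *\<^sub>R J (f (\<sigma> z))"
    and "(kappa (f (\<sigma> z)) \<nu>)\<^sup>2 = (cmod (P \<nu>))\<^sup>2 / (cmod (P (f (\<sigma> z))))\<^sup>2"
proof -
  let ?y = "f (\<sigma> z)"
  obtain \<zeta> where "dir_deriv \<zeta> (f \<circ> \<sigma>) z = J ?y" using orbit_direction[OF sh] by blast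
  then have "\<nu> \<bullet> J ?y = 0" using shape_normal(3)[OF sh] by metis
  then have "P \<nu> \<bullet> (\<i> * P ?y) = 0" by (simp add: inner_PQ P_J Q_J)
  then have Im: "Im (P \<nu> * cnj (P ?y)) = 0" by (simp add: inner_complex_def algebra_simps)
  have Re: "Re (P \<nu> * cnj (P ?y)) = P ?y \<bullet> P \<nu>" by (simp add: inner_complex_def algebra_simps)
  have "P \<nu> * cnj (P ?y) = of_real (P ?y \<bullet> P \<nu>)" using Im Re by (simp add: complex_eq_iff)
  moreover have "P ?y * cnj (P ?y) = of_real ((cmod (P ?y))\<^sup>2)" by (rule complex_norm_square[symmetric])
  ultimately have "P \<nu> * cnj (P ?y) = of_real (kappa ?y \<nu>) * P ?y * cnj (P ?y)"
    using assms by (simp add: kappa_def mult.assoc)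
  then have Pn: "P \<nu> = of_real (kappa ?y \<nu>) * P ?y" using assms by simp
  show "J \<nu> = kappa ?y \<nu> *\<^sub>R J ?y"
    by (rule PQ_eqI) (simp_all add: P_J Q_J plane_coord_simps Pn scaleR_conv_of_real[where 'a = complex])
  have "(cmod (P \<nu>))\<^sup>2 = (kappa ?y \<nu>)\<^sup>2 * (cmod (P ?y))\<^sup>2"
    unfolding Pn by (simp add: norm_mult power_mult_distrib)
  then show "(kappa ?y \<nu>)\<^sup>2 = (cmod (P \<nu>))\<^sup>2 / (cmod (P ?y))\<^sup>2" using assms by simp
qed

text \<open>
  Orbits are lines of curvature. The second form of the orbit direction with \<open>\<zeta>\<close> is \<open>J (D \<zeta>) \<bullet> \<nu>\<close>; by
  skewness it is \<open>- D \<zeta> \<bullet> J \<nu>\<close>, and \<open>J \<nu>\<close> is a multiple of \<open>J y\<close>.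
\<close>

lemma orbit_eigenvector:
  assumes "P (f (\<sigma> z)) \<noteq> 0" "dir_deriv \<zeta>o (f \<circ> \<sigma>) z = J (f (\<sigma> z))"
  shows "fund_form2 (f \<circ> \<sigma>) z \<nu> \<zeta> \<zeta>o = - kappa (f (\<sigma> z)) \<nu> * fund_form1 (f \<circ> \<sigma>) z \<zeta> \<zeta>o"
  using orbit_second_form[OF sh assms(2), of \<zeta>] J_skew[of _ \<nu>] J_normal(1)[OF assms(1)] assms(2)
  by (simp add: fund_form1_def)

lemma orbit_principal:
  assumes "P (f (\<sigma> z)) \<noteq> 0" shows "- kappa (f (\<sigma> z)) \<nu> = k1 \<or> - kappa (f (\<sigma> z)) \<nu> = k2"
proof -
  obtain \<zeta>o where o: "dir_deriv \<zeta>o (f \<circ> \<sigma>) z = J (f (\<sigma> z))" using orbit_direction[OF sh] by blast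
  have "P (J (f (\<sigma> z))) \<noteq> 0" using assms by (simp add: P_J)
  then have "\<zeta>o \<noteq> 0" using o linear_0[OF D_linear[OF sh]] by (auto simp: plane_coord_simps)
  then show ?thesis
  proof (rule eigenvalue_unique[OF sh])
    fix u
    show "fund_form2 (f \<circ> \<sigma>) z \<nu> \<zeta>o u = - kappa (f (\<sigma> z)) \<nu> * fund_form1 (f \<circ> \<sigma>) z \<zeta>o u"
      using orbit_eigenvector[OF assms o, of u] fund_form2_commute[OF shape_chart(3,4,2)[OF sh]]
        fund_form1_commute[of "f \<circ> \<sigma>" z \<zeta>o u] by simp
  qed
qed

lemma sqrt_curvature_off_axis:
  assumes "P (f (\<sigma> z)) \<noteq> 0" "(cmod (P \<nu>))\<^sup>2 = K * (cmod (P (f (\<sigma> z))))\<^sup>2"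
  shows "\<exists>k. principal_curvatures f M (\<sigma> z) (sqrt K) k"
proof -
  have "(- kappa (f (\<sigma> z)) \<nu>)\<^sup>2 = K" using J_normal(2)[OF assms(1)] assms by simp
  then show ?thesis
    using orbit_principal[OF assms(1)] by (intro principal_curvature_sqrt[OF sh refl]) auto
qed

text \<open>
  The direction \<open>\<zeta>\<close> orthogonal to the orbit is the other principal direction, so its normal curvature
  times that of the orbit is \<open>K\<close>.
\<close>

lemma gauss_equation:
  assumes K: "k1 * k2 = K" and off: "P (f (\<sigma> z)) \<noteq> 0"
    and perp: "dir_deriv \<zeta> (f \<circ> \<sigma>) z \<bullet> J (f (\<sigma> z)) = 0"
  shows "- kappa (f (\<sigma> z)) \<nu> * fund_form2 (f \<circ> \<sigma>) z \<nu> \<zeta> \<zeta> = K * fund_form1 (f \<circ> \<sigma>) z \<zeta> \<zeta>"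
proof -
  obtain \<zeta>o where o: "dir_deriv \<zeta>o (f \<circ> \<sigma>) z = J (f (\<sigma> z))" using orbit_direction[OF sh] by blast
  have I: "fund_form1 (f \<circ> \<sigma>) z \<zeta> \<zeta>o = 0" using perp by (simp add: fund_form1_def o)
  then have II: "fund_form2 (f \<circ> \<sigma>) z \<nu> \<zeta> \<zeta>o = 0" using orbit_eigenvector[OF off o] by simp
  have "P (J (f (\<sigma> z))) \<noteq> 0" using off by (simp add: P_J)
  then have "J (f (\<sigma> z)) \<noteq> 0" by (auto simp: plane_coord_simps)
  then have pos: "fund_form1 (f \<circ> \<sigma>) z \<zeta>o \<zeta>o \<noteq> 0" by (simp add: fund_form1_def o)
  have "fund_form2 (f \<circ> \<sigma>) z \<nu> \<zeta> \<zeta> * (- kappa (f (\<sigma> z)) \<nu> * fund_form1 (f \<circ> \<sigma>) z \<zeta>o \<zeta>o) =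
      K * (fund_form1 (f \<circ> \<sigma>) z \<zeta> \<zeta> * fund_form1 (f \<circ> \<sigma>) z \<zeta>o \<zeta>o)"
    using gauss_determinant[OF sh, of \<zeta> \<zeta>o] unfolding I II K orbit_eigenvector[OF off o, of \<zeta>o] by simp
  then have "(- kappa (f (\<sigma> z)) \<nu> * fund_form2 (f \<circ> \<sigma>) z \<nu> \<zeta> \<zeta> - K * fund_form1 (f \<circ> \<sigma>) z \<zeta> \<zeta>) *
      fund_form1 (f \<circ> \<sigma>) z \<zeta>o \<zeta>o = 0"
    by algebra
  then show ?thesis using pos by simp
qed

section \<open>Points on the axis\<close>

text \<open>
  The rotation keeps the image point, so the orbit is a lift of a constant curve.
\<close>

lemma axis_fixed:
  assumes "P (f (\<sigma> z)) = 0" shows "\<phi> t (\<sigma> z) = \<sigma> z"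
proof -
  have zM: "\<sigma> z \<in> M" using shape_chart(2,5)[OF sh] by auto
  have "f (\<phi> t (\<sigma> z)) = f (\<sigma> z)" for t
    unfolding f_\<phi>[OF zM] by (rule PQ_eqI) (simp_all add: P_R Q_R assms)
  then show ?thesis
    using lifts_agree[OF surf connected_UNIV, of 0 "\<lambda>t. \<phi> t (\<sigma> z)" "\<lambda>_. \<sigma> z" t]
      \<phi>_continuous_on[of UNIV "\<lambda>t. t" "\<lambda>_. \<sigma> z"] zM \<phi>_M \<phi>_0
    by (auto simp: continuous_on_const)
qed

lemma axis_rotation_invariant:
  assumes "P (f (\<sigma> z)) = 0"
  shows "\<exists>\<xi>. dir_deriv \<xi> (f \<circ> \<sigma>) z = R t (dir_deriv \<zeta> (f \<circ> \<sigma>) z) \<and>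
    fund_form2 (f \<circ> \<sigma>) z \<nu> \<xi> \<xi> = R t (dir_deriv \<zeta> (dir_deriv \<zeta> (f \<circ> \<sigma>)) z) \<bullet> \<nu>"
  using rotated_line_second[OF sh, of "\<lambda>_. t" 0 t \<zeta>] axis_fixed[OF assms] by simp

text \<open>
  The tangent plane at a point of the axis is invariant under all rotations. Some tangent vector has a
  component in the plane of rotation, since otherwise the tangent plane would be orthogonal to \<open>y\<close> within
  the plane of \<open>Q\<close>; its images under the half and the quarter turn produce the whole plane of rotation.
\<close>

lemma axis_tangent_plane:
  assumes ax: "P (f (\<sigma> z)) = 0"
  shows "\<exists>\<zeta>. P (dir_deriv \<zeta> (f \<circ> \<sigma>) z) = p \<and> Q (dir_deriv \<zeta> (f \<circ> \<sigma>) z) = 0"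
    and "P \<nu> = 0" and "Q (dir_deriv \<zeta> (f \<circ> \<sigma>) z) = 0"
proof -
  let ?D = "\<lambda>v. dir_deriv v (f \<circ> \<sigma>) z" and ?y = "f (\<sigma> z)"
  note lin = D_linear[OF sh]
  have zM: "\<sigma> z \<in> M" using shape_chart(2,5)[OF sh] by auto
  have unit: "t = 1" if "t \<ge> 0" "t\<^sup>2 = 1" for t :: real using that by (simp add: power2_eq_1_iff)
  have Qy: "cmod (Q ?y) = 1" using norm_PQ[of ?y] sphere[OF zM] ax by (rule_tac unit) auto
  have Qperp: "Q ?y \<bullet> Q (?D v) = 0" if "P (?D v) = 0" for v
    using D_tangent[OF sh, of v] that by (simp add: inner_PQ ax)
  have "\<exists>v. P (?D v) \<noteq> 0"
  proof (rule ccontr)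
    assume none: "\<not> (\<exists>v. P (?D v) \<noteq> 0)"
    define l where "l = (\<lambda>v. Im (Q (?D v) * cnj (Q ?y)))"
    have Ql: "Q (?D v) = of_real (l v) * (\<i> * Q ?y)" for v
    proof -
      have "Re (Q (?D v) * cnj (Q ?y)) = 0" using Qperp[of v] none by (simp add: inner_complex_def algebra_simps)
      then have "Q (?D v) * cnj (Q ?y) = of_real (l v) * \<i>" by (simp add: complex_eq_iff l_def)
      then have "Q (?D v) * (cnj (Q ?y) * Q ?y) = of_real (l v) * \<i> * Q ?y" by (simp add: mult.assoc)
      moreover have "cnj (Q ?y) * Q ?y = 1" using Qy by (simp add: complex_norm_square[symmetric] mult.commute)
      ultimately show ?thesis by (simp add: mult.assoc)
    qed
    have eq0: "v = 0" if "l v = 0" for v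
    proof -
      have "?D v = ?D 0" using none that by (intro PQ_eqI) (simp_all add: Ql linear_0[OF lin] plane_coord_simps)
      then show ?thesis by (rule D_inj[OF sh])
    qed
    have llin: "l (s *\<^sub>R v + t *\<^sub>R w) = s * l v + t * l w" for s t v w
      by (simp add: l_def linear_add[OF lin] linear_scale[OF lin] plane_coord_simps distrib_right) (simp add: algebra_simps)
    define v where "v = l (0,1) *\<^sub>R (1::real,0::real) + (- l (1,0)) *\<^sub>R (0,1)"
    have "l v = 0" unfolding v_def llin by simp
    then have "v = 0" by (rule eq0)
    then have "l (0,1) = 0" by (simp add: v_def zero_prod_def)
    then have "((0::real),(1::real)) = 0" by (rule eq0)
    then show False by (simp add: zero_prod_def)
  qed
  then obtain v where v: "P (?D v) \<noteq> 0" by blast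
  \<comment> \<open>The half turn changes the sign of \<open>P\<close> and keeps \<open>Q\<close>.\<close>
  obtain v' where v': "?D v' = R pi (?D v)" using axis_rotation_invariant[OF ax] by blast
  define u where "u = (1/2) *\<^sub>R (v - v')"
  have u: "P (?D u) = P (?D v)" "Q (?D u) = 0"
    by (simp_all add: u_def linear_scale[OF lin] linear_diff[OF lin] v' plane_coord_simps P_R Q_R cis_pi scaleR_conv_of_real[where 'a = complex])
  obtain u' where u': "?D u' = R (pi/2) (?D u)" using axis_rotation_invariant[OF ax] by blast
  have u'PQ: "P (?D u') = \<i> * P (?D v)" "Q (?D u') = 0"
    by (simp_all add: u' P_R Q_R u cis_pi_half)
  have all: "\<exists>\<zeta>. P (?D \<zeta>) = p \<and> Q (?D \<zeta>) = 0" for p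
  proof (intro exI conjI)
    define q where "q = p / P (?D v)"
    have q: "q * P (?D v) = p" unfolding q_def using v by (rule nonzero_eq_divide_eq[THEN iffD1]) (rule refl)
    let ?\<zeta> = "Re q *\<^sub>R u + Im q *\<^sub>R u'"
    have "P (?D ?\<zeta>) = (of_real (Re q) + of_real (Im q) * \<i>) * P (?D v)"
      by (simp add: linear_add[OF lin] linear_scale[OF lin] plane_coord_simps u u'PQ scaleR_conv_of_real[where 'a = complex] algebra_simps)
    also have "of_real (Re q) + of_real (Im q) * \<i> = q" by (simp add: complex_eq_iff)
    finally show "P (?D ?\<zeta>) = p" unfolding q .
    show "Q (?D ?\<zeta>) = 0"
      by (simp add: linear_add[OF lin] linear_scale[OF lin] plane_coord_simps u u'PQ)
  qed
  then show "\<exists>\<zeta>. P (?D \<zeta>) = p \<and> Q (?D \<zeta>) = 0" .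
  obtain w where w: "P (?D w) = P \<nu>" "Q (?D w) = 0" using all by blast
  have "\<nu> \<bullet> ?D w = 0" by (rule shape_normal(3)[OF sh])
  then have "P \<nu> \<bullet> P \<nu> = 0" by (simp add: inner_PQ w)
  then show Pn: "P \<nu> = 0" by simp
  have Qn: "cmod (Q \<nu>) = 1" using norm_PQ[of \<nu>] shape_normal(1)[OF sh] Pn by (rule_tac unit) auto
  have yn: "Q \<nu> \<bullet> Q ?y = 0" using shape_normal(2)[OF sh] by (simp add: inner_PQ Pn)
  have t1: "Q ?y \<bullet> Q (?D \<zeta>) = 0" using D_tangent[OF sh, of \<zeta>] by (simp add: inner_PQ ax)
  have t2: "Q \<nu> \<bullet> Q (?D \<zeta>) = 0" using shape_normal(3)[OF sh, of \<zeta>] by (simp add: inner_PQ Pn)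
  obtain n1 n2 where n: "Q \<nu> = Complex n1 n2" by (cases "Q \<nu>")
  obtain y1 y2 where yy: "Q ?y = Complex y1 y2" by (cases "Q ?y")
  obtain q1 q2 where qq: "Q (?D \<zeta>) = Complex q1 q2" by (cases "Q (?D \<zeta>)")
  have e: "n1\<^sup>2 + n2\<^sup>2 = 1" "y1\<^sup>2 + y2\<^sup>2 = 1" "n1 * y1 + n2 * y2 = 0" "y1 * q1 + y2 * q2 = 0" "n1 * q1 + n2 * q2 = 0"
    using Qn Qy yn t1 t2 by (simp_all add: n yy qq inner_complex_def cmod_def)
  have "(n1 * y2 - n2 * y1)\<^sup>2 = 1" using e(1-3) by algebra
  then have "n1 * y2 - n2 * y1 \<noteq> 0" by auto
  moreover have "(n1 * y2 - n2 * y1) * q1 = 0" "(n1 * y2 - n2 * y1) * q2 = 0" using e(4,5) by algebra+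
  ultimately show "Q (?D \<zeta>) = 0" by (simp add: qq complex_eq_iff)
qed

text \<open>
  Rotations act transitively on the directions of the tangent plane and preserve the second fundamental
  form.
\<close>

lemma axis_umbilic:
  assumes ax: "P (f (\<sigma> z)) = 0" shows "k1 = k2"
proof -
  let ?D = "\<lambda>v. dir_deriv v (f \<circ> \<sigma>) z" and ?II = "fund_form2 (f \<circ> \<sigma>) z \<nu>"
  note lin = D_linear[OF sh]
  have ne: "v1 \<noteq> 0" "v2 \<noteq> 0" using shape_eigen(3)[OF sh] dependent_zero by blast+
  have Pne: "P (?D v) \<noteq> 0" if "v \<noteq> 0" for v
  proof
    assume "P (?D v) = 0"
    then have "?D v = ?D 0" using axis_tangent_plane(3)[OF ax] by (intro PQ_eqI) (simp_all add: linear_0[OF lin] plane_coord_simps)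
    then show False using D_inj[OF sh] that by blast
  qed
  have I: "fund_form1 (f \<circ> \<sigma>) z v v = (cmod (P (?D v)))\<^sup>2" for v
    using axis_tangent_plane(3)[OF ax] by (simp add: fund_form1_def inner_PQ dot_square_norm)
  define q where "q = P (?D v2) / P (?D v1)"
  have q: "P (?D v2) = q * P (?D v1)" "q \<noteq> 0" using Pne ne by (simp_all add: q_def)
  obtain \<xi> where \<xi>: "?D \<xi> = R (Arg q) (?D v1)" "?II \<xi> \<xi> = R (Arg q) (dir_deriv v1 (dir_deriv v1 (f \<circ> \<sigma>)) z) \<bullet> \<nu>"
    using axis_rotation_invariant[OF ax] by blast
  have "?II \<xi> \<xi> = ?II v1 v1"
    unfolding \<xi>(2) unfolding fund_form2_def by (simp add: inner_PQ axis_tangent_plane(2)[OF ax] Q_R)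
  moreover have "v2 = cmod q *\<^sub>R \<xi>"
  proof (rule D_inj[OF sh], rule PQ_eqI)
    have "of_real (cmod q) * cis (Arg q) = q" using rcis_cmod_Arg[of q] by (simp add: rcis_def)
    then show "P (?D v2) = P (?D (cmod q *\<^sub>R \<xi>))"
      by (simp add: linear_scale[OF lin] plane_coord_simps \<xi>(1) P_R q(1) scaleR_conv_of_real[where 'a = complex] mult.assoc[symmetric])
    show "Q (?D v2) = Q (?D (cmod q *\<^sub>R \<xi>))" by (simp add: axis_tangent_plane(3)[OF ax])
  qed
  ultimately have "?II v2 v2 = (cmod q)\<^sup>2 * ?II v1 v1"
    using linear_scale[OF II_lin(1)[OF sh]] linear_scale[OF II_lin(2)[OF sh]] by (simp add: power2_eq_square)
  then have "k2 * (cmod (P (?D v2)))\<^sup>2 = k1 * ((cmod q)\<^sup>2 * (cmod (P (?D v1)))\<^sup>2)"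
    by (simp add: shape_eigen(1,2)[OF sh] I)
  then have "k2 * (cmod (P (?D v2)))\<^sup>2 = k1 * (cmod (P (?D v2)))\<^sup>2"
    by (simp add: q(1) norm_mult power_mult_distrib)
  then show ?thesis using Pne[OF ne(2)] by simp
qed

lemma sqrt_curvature_on_axis:
  assumes "P (f (\<sigma> z)) = 0" "k1 * k2 = K"
  shows "\<exists>k. principal_curvatures f M (\<sigma> z) (sqrt K) k"
  using axis_umbilic[OF assms(1)] assms(2) by (intro principal_curvature_sqrt[OF sh refl]) (simp add: power2_eq_square)

end

text \<open>
  If \<open>|P \<nu>|^2 = K |P y|^2\<close> held at all points off the axis, the orbits would have normal curvature of
  modulus \<open>sqrt K\<close> there; on the axis both principal curvatures have the square \<open>K\<close> anyway. So \<open>sqrt K\<close>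
  would be a principal curvature everywhere.
\<close>

lemma not_tubular_point:
  assumes "\<not> tubular f M"
  shows "\<exists>W \<sigma> z \<nu> v1 v2 k1 k2. shape_at W \<sigma> z \<nu> v1 v2 k1 k2 \<and> k1 * k2 = K \<and> \<sigma> z \<in> M \<and>
    P (f (\<sigma> z)) \<noteq> 0 \<and> (cmod (P \<nu>))\<^sup>2 \<noteq> K * (cmod (P (f (\<sigma> z))))\<^sup>2"
proof -
  obtain x where x: "x \<in> M" "\<nexists>k. principal_curvatures f M x (sqrt K) k"
    using assms unfolding tubular_def by blast
  obtain W \<sigma> z \<nu> v1 v2 k1 k2 where s: "shape_at W \<sigma> z \<nu> v1 v2 k1 k2" "\<sigma> z = x" "k1 * k2 = K"
    using shape_exists[OF x(1)] by blast
  have "P (f (\<sigma> z)) \<noteq> 0" using sqrt_curvature_on_axis[OF s(1)] s x by blast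
  moreover have "(cmod (P \<nu>))\<^sup>2 \<noteq> K * (cmod (P (f (\<sigma> z))))\<^sup>2"
    using sqrt_curvature_off_axis[OF s(1) calculation] s x by blast
  ultimately show ?thesis using s x by blast
qed

end

section \<open>Changes of parameter and frames along spherical curves\<close>

lemma has_vector_derivative_shift:
  assumes "(g has_vector_derivative g') (at (s + t))"
  shows "((\<lambda>t::real. g (s + t)) has_vector_derivative g') (at t)"
proof -
  have "((\<lambda>t. s + t) has_vector_derivative 1) (at t)" by (auto intro!: derivative_eq_intros)
  from vector_diff_chain_at[OF this assms] show ?thesis by (simp add: o_def)
qed

lemma eventually_in_open_shift:
  fixes s :: real
  assumes "open I" "s \<in> I" shows "\<forall>\<^sub>F t in nhds 0. s + t \<in> I"
proof -
  have "open ((\<lambda>t. s + t) -` I)" by (intro open_vimage assms continuous_intros)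
  then have "\<forall>\<^sub>F t in nhds 0. t \<in> (\<lambda>t. s + t) -` I" using assms by (intro eventually_nhds_in_open) auto
  then show ?thesis by simp
qed

lemma isCont_shift:
  fixes s :: real
  assumes "open I" "s \<in> I" "continuous_on I g" shows "isCont (\<lambda>t. g (s + t)) 0"
proof (rule isCont_o2[where g = g])
  show "isCont (\<lambda>t. s + t) 0" by (intro continuous_intros)
  show "isCont g (s + 0)" using assms by (simp add: continuous_on_eq_continuous_at)
qed

text \<open>
  Integrate \<open>\<mu>\<close> and invert.
\<close>

lemma time_change:
  fixes \<mu> :: "real \<Rightarrow> real"
  assumes \<delta>: "\<delta> > 0" and \<mu>: "continuous_on {-\<delta><..<\<delta>} \<mu>" "\<And>t. t \<in> {-\<delta><..<\<delta>} \<Longrightarrow> \<mu> t > 0"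
  shows "\<exists>\<epsilon>>0. \<exists>T. T 0 = 0 \<and> (\<forall>s\<in>{-\<epsilon><..<\<epsilon>}. T s \<in> {-\<delta><..<\<delta>} \<and> (T has_real_derivative 1 / \<mu> (T s)) (at s))"
proof -
  let ?I = "{-\<delta><..<\<delta>}"
  define S where "S = (\<lambda>t::real. LBINT x=0..t. \<mu> x)"
  have S': "(S has_real_derivative \<mu> t) (at t)" if "t \<in> ?I" for t
    unfolding S_def using interval_integral_from_0_has_derivative[of ?I t \<mu>] that \<delta> \<mu>(1) by (simp add: is_interval_1)
  have S0: "S 0 = 0" by (simp add: S_def zero_ereal_def)
  have mono: "S s < S t" if "s \<in> ?I" "t \<in> ?I" "s < t" for s t
    using that S' \<mu>(2) by (intro DERIV_pos_imp_increasing[OF that(3)]) (meson atLeastAtMost_iff greaterThanLessThan_iff le_less_trans less_le_trans)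
  have contS: "continuous_on ?I S" using S' by (meson DERIV_isCont continuous_at_imp_continuous_on)
  define T where "T = inv_into ?I S"
  have inj: "inj_on S ?I" using mono by (metis (no_types, lifting) inj_onI less_irrefl linorder_neqE_linordered_idom)
  have TS: "T (S t) = t" if "t \<in> ?I" for t unfolding T_def using inj that by (rule inv_into_f_f)
  have h: "\<delta> / 2 \<in> ?I" "- (\<delta> / 2) \<in> ?I" "0 \<in> ?I" using \<delta> by auto
  define \<epsilon> where "\<epsilon> = min (S (\<delta> / 2)) (- S (- (\<delta> / 2)))"
  have "\<epsilon> > 0" using mono[OF h(3,1)] mono[OF h(2,3)] S0 \<delta> by (simp add: \<epsilon>_def)
  moreover have "T s \<in> ?I \<and> (T has_real_derivative 1 / \<mu> (T s)) (at s)" if "s \<in> {-\<epsilon><..<\<epsilon>}" for s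
  proof -
    have "S (- (\<delta> / 2)) \<le> s" "s \<le> S (\<delta> / 2)" using that by (auto simp: \<epsilon>_def)
    moreover have "{- (\<delta> / 2)..\<delta> / 2} \<subseteq> ?I" using \<delta> by auto
    ultimately have "\<exists>t. - (\<delta> / 2) \<le> t \<and> t \<le> \<delta> / 2 \<and> S t = s"
      using \<delta> by (intro IVT' continuous_on_subset[OF contS]) simp_all
    then obtain t where t': "- (\<delta> / 2) \<le> t" "t \<le> \<delta> / 2" "S t = s" by blast
    have t: "t \<in> ?I" "S t = s" using t' \<delta> by auto
    have "(T has_real_derivative inverse (\<mu> t)) (at (S t))"
      using DERIV_inverse_open[OF _ t(1) contS TS S'[OF t(1)]] \<mu>(2)[OF t(1)] by simp
    then show ?thesis using t TS[OF t(1)] by (simp add: inverse_eq_divide)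
  qed
  moreover have "T 0 = 0" using TS[OF h(3)] S0 by simp
  ultimately show ?thesis by blast
qed

text \<open>
  The three determinants are the components of the cross product of position and velocity, which is
  \<open>sqrt E\<close> times the unit normal, up to sign. So the product of a component of the normal with the normal
  acceleration is a rational expression in the curve, whatever the sign of the normal.
\<close>

lemma sphere_frame_normal:
  fixes r q1 q2 r' q1' q2' n0 n1 n2 :: real
  assumes "r\<^sup>2 + q1\<^sup>2 + q2\<^sup>2 = 1" "r * r' + q1 * q1' + q2 * q2' = 0"
    and n: "n0\<^sup>2 + n1\<^sup>2 + n2\<^sup>2 = 1" "n0 * r + n1 * q1 + n2 * q2 = 0" "n0 * r' + n1 * q1' + n2 * q2' = 0"
  defines "E \<equiv> r'\<^sup>2 + q1'\<^sup>2 + q2'\<^sup>2" and "\<Delta> \<equiv> q1 * q2' - q2 * q1'"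
  shows "E * (n0 * (r2 * n0 + x2 * n1 + y2 * n2)) =
    \<Delta> * (r2 * \<Delta> + x2 * (q2 * r' - r * q2') + y2 * (r * q1' - q1 * r'))"
proof -
  define m where "m = n0 * \<Delta> + n1 * (q2 * r' - r * q2') + n2 * (r * q1' - q1 * r')"
  have c: "\<Delta> = m * n0" "q2 * r' - r * q2' = m * n1" "r * q1' - q1 * r' = m * n2"
    unfolding m_def \<Delta>_def using n by algebra+
  have "E = \<Delta>\<^sup>2 + (q2 * r' - r * q2')\<^sup>2 + (r * q1' - q1 * r')\<^sup>2"
    unfolding E_def \<Delta>_def using assms(1,2) by algebra
  also have "\<dots> = m\<^sup>2" unfolding c using n(1) by algebra
  finally have "E = m\<^sup>2" .
  then show ?thesis unfolding c by algebra
qed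

text \<open>
  Expansion of the acceleration in the frame of position, velocity and their cross product; its component
  along the position is \<open>- E\<close>.
\<close>

lemma sphere_frame_second:
  fixes r q1 q2 r' q1' q2' r2 x2 y2 :: real
  assumes "r\<^sup>2 + q1\<^sup>2 + q2\<^sup>2 = 1" "r * r' + q1 * q1' + q2 * q2' = 0"
    and E: "E = r'\<^sup>2 + q1'\<^sup>2 + q2'\<^sup>2" and acc: "r * r2 + q1 * x2 + q2 * y2 + E = 0"
    and \<Delta>: "\<Delta> = q1 * q2' - q2 * q1'"
  shows "r2 * E - r' * (r' * r2 + q1' * x2 + q2' * y2) =
      - r * E\<^sup>2 + \<Delta> * (r2 * \<Delta> + x2 * (q2 * r' - r * q2') + y2 * (r * q1' - q1 * r'))"
    and "\<Delta>\<^sup>2 + r'\<^sup>2 + r\<^sup>2 * E = E"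
proof -
  show "\<Delta>\<^sup>2 + r'\<^sup>2 + r\<^sup>2 * E = E" unfolding E \<Delta> using assms(1,2) by algebra
  show "r2 * E - r' * (r' * r2 + q1' * x2 + q2' * y2) =
      - r * E\<^sup>2 + \<Delta> * (r2 * \<Delta> + x2 * (q2 * r' - r * q2') + y2 * (r * q1' - q1 * r'))"
    using assms by algebra
qed

text \<open>
  \<open>n0\<close> is the component of the normal in the plane of rotation, \<open>A\<close> and \<open>B\<close> are its products with \<open>q\<close> and
  \<open>\<i> q\<close>. Orthogonality to the velocity is a linear relation between \<open>w\<close> and \<open>v\<close>, and
  the unit lengths of \<open>(r, w, v)\<close> and of the normal fix the scale.
\<close>

lemma profile_velocity_determined:
  fixes r w v n0 A B :: real
  assumes "r\<^sup>2 + w\<^sup>2 + v\<^sup>2 = 1" "v > 0" "A = - n0 * r" "A\<^sup>2 + B\<^sup>2 = (1 - n0\<^sup>2) * (1 - r\<^sup>2)"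
    and "n0 * w * v * (1 - r\<^sup>2) + (- r * w * v * A + v\<^sup>2 * B) = 0"
  shows "v = \<bar>n0\<bar>" "n0 \<noteq> 0" "w = - v * B / n0"
proof -
  have "v * (n0 * w + v * B) = 0" using assms(3,5) by algebra
  then have w: "n0 * w + v * B = 0" using assms(2) by simp
  have "v\<^sup>2 * (1 - r\<^sup>2 - n0\<^sup>2) = v\<^sup>2 * B\<^sup>2" using assms(3,4) by algebra
  then have "(v\<^sup>2 - n0\<^sup>2) * (w\<^sup>2 + v\<^sup>2) = 0" using w assms(1) by algebra
  moreover have "w\<^sup>2 + v\<^sup>2 > 0" using assms(2) by (simp add: add_nonneg_pos)
  ultimately have "v\<^sup>2 = n0\<^sup>2" by auto
  then show v: "v = \<bar>n0\<bar>" using assms(2) by (metis abs_of_pos power2_eq_iff abs_minus_cancel)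
  then show n0: "n0 \<noteq> 0" using assms(2) by auto
  have "w * n0 = - v * B" using w by algebra
  then show "w = - v * B / n0" by (rule nonzero_eq_divide_eq[OF n0, THEN iffD2])
qed

lemma complex_div_real: "q * Complex x y / of_real k = (x / k) *\<^sub>R q + (y / k) *\<^sub>R (\<i> * q)"
  by (simp add: complex_eq_iff diff_divide_distrib add_divide_distrib mult.commute)

context rotational
begin

section \<open>Profile curves\<close>

text \<open>
  A piece of the profile: a curve of \<open>M\<close> in the half plane where \<open>P\<close> is positive, parametrised by the time
  of the Euler system. The real part of the logarithmic derivative of \<open>q\<close> keeps \<open>|q|^2 = 1 - r^2\<close>; its
  imaginary part is the velocity \<open>v^2 / (1 - r^2)\<close> of the angle. The curve is recorded in \<open>M\<close> and not only by its image, because \<open>f\<close> need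
  not be injective.
\<close>

definition profile_curve where
  "profile_curve I \<gamma> r w v q \<longleftrightarrow> open I \<and> continuous_on I \<gamma> \<and> \<gamma> ` I \<subseteq> M \<and> euler_top K I r w v \<and>
     (\<forall>s\<in>I. r s > 0 \<and> v s > 0 \<and> P (f (\<gamma> s)) = of_real (r s) \<and> Q (f (\<gamma> s)) = q s \<and>
        (q has_vector_derivative q s * Complex (- r s * w s * v s) ((v s)\<^sup>2) / of_real (1 - (r s)\<^sup>2)) (at s))"

lemma profile_curveD:
  assumes "profile_curve I \<gamma> r w v q"
  shows "open I" "continuous_on I \<gamma>" "\<gamma> ` I \<subseteq> M" "euler_top K I r w v"
    and "s \<in> I \<Longrightarrow> r s > 0" "s \<in> I \<Longrightarrow> v s > 0" "s \<in> I \<Longrightarrow> P (f (\<gamma> s)) = of_real (r s)" "s \<in> I \<Longrightarrow> Q (f (\<gamma> s)) = q s"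
    and "s \<in> I \<Longrightarrow> (q has_vector_derivative q s * Complex (- r s * w s * v s) ((v s)\<^sup>2) / of_real (1 - (r s)\<^sup>2)) (at s)"
    and "s \<in> I \<Longrightarrow> (r s)\<^sup>2 + (w s)\<^sup>2 + (v s)\<^sup>2 = 1" "s \<in> I \<Longrightarrow> (r has_real_derivative w s * v s) (at s)"
    and "s \<in> I \<Longrightarrow> (cmod (q s))\<^sup>2 = 1 - (r s)\<^sup>2" "s \<in> I \<Longrightarrow> 1 - (r s)\<^sup>2 > 0"
proof -
  note a = assms[unfolded profile_curve_def]
  show "open I" "continuous_on I \<gamma>" "\<gamma> ` I \<subseteq> M" "euler_top K I r w v"
    "s \<in> I \<Longrightarrow> r s > 0" "s \<in> I \<Longrightarrow> v s > 0" "s \<in> I \<Longrightarrow> P (f (\<gamma> s)) = of_real (r s)" "s \<in> I \<Longrightarrow> Q (f (\<gamma> s)) = q s"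
    "s \<in> I \<Longrightarrow> (q has_vector_derivative q s * Complex (- r s * w s * v s) ((v s)\<^sup>2) / of_real (1 - (r s)\<^sup>2)) (at s)"
    using a by blast+
  show e: "s \<in> I \<Longrightarrow> (r s)\<^sup>2 + (w s)\<^sup>2 + (v s)\<^sup>2 = 1" "s \<in> I \<Longrightarrow> (r has_real_derivative w s * v s) (at s)"
    using a by (auto simp: euler_top_def)
  show "(cmod (q s))\<^sup>2 = 1 - (r s)\<^sup>2" if s: "s \<in> I"
  proof -
    have "\<gamma> s \<in> M" using a s by blast
    then show ?thesis using norm_PQ[of "f (\<gamma> s)"] sphere a s by auto
  qed
  show "1 - (r s)\<^sup>2 > 0" if s: "s \<in> I"
    using e(1)[OF s] a s zero_less_power[of "v s" 2] zero_le_power2[of "w s"] by (smt (verit, best))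
qed

definition profile_velocity where
  "profile_velocity r w v q s = (w s * v s) *\<^sub>R a +
     Re (q s * Complex (- r s * w s * v s) ((v s)\<^sup>2) / of_real (1 - (r s)\<^sup>2)) *\<^sub>R c +
     Im (q s * Complex (- r s * w s * v s) ((v s)\<^sup>2) / of_real (1 - (r s)\<^sup>2)) *\<^sub>R d"

lemma profile_curve_velocity:
  assumes p: "profile_curve I \<gamma> r w v q" and s: "s \<in> I"
  shows "((\<lambda>s. f (\<gamma> s)) has_vector_derivative profile_velocity r w v q s) (at s)"
proof -
  note pd = profile_curveD[OF p]
  let ?q' = "q s * Complex (- r s * w s * v s) ((v s)\<^sup>2) / of_real (1 - (r s)\<^sup>2)"
  have q: "((\<lambda>s. Re (q s)) has_real_derivative Re ?q') (at s)" "((\<lambda>s. Im (q s)) has_real_derivative Im ?q') (at s)"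
    using bounded_linear.has_vector_derivative[OF bounded_linear_Re pd(9)[OF s]]
      bounded_linear.has_vector_derivative[OF bounded_linear_Im pd(9)[OF s]]
    by (simp_all add: has_real_derivative_iff_has_vector_derivative)
  have "((\<lambda>s. r s *\<^sub>R a + Re (q s) *\<^sub>R c + Im (q s) *\<^sub>R d) has_vector_derivative
      (w s * v s) *\<^sub>R a + Re ?q' *\<^sub>R c + Im ?q' *\<^sub>R d) (at s)"
    using has_vector_derivative_scaleR[OF pd(11)[OF s] has_vector_derivative_const[of a]]
      has_vector_derivative_scaleR[OF q(1) has_vector_derivative_const[of c]]
      has_vector_derivative_scaleR[OF q(2) has_vector_derivative_const[of d]]
    by (intro has_vector_derivative_add) simp_all
  then show ?thesis unfolding profile_velocity_def
  proof (rule has_vector_derivative_transform_within_open[OF _ pd(1) s])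
    fix t assume t: "t \<in> I"
    show "r t *\<^sub>R a + Re (q t) *\<^sub>R c + Im (q t) *\<^sub>R d = f (\<gamma> t)"
      by (rule PQ_eqI) (simp_all add: pd(7,8)[OF t] plane_coord_simps P_frame complex_eq_iff)
  qed
qed

lemma R_adjoint: "R (- t) x \<bullet> y = x \<bullet> R t y"
  by (simp add: inner_PQ P_R Q_R inner_complex_def algebra_simps)

text \<open>
  At \<open>\<phi> t (\<gamma> s)\<close> the tangent plane is spanned by the orbit and by the rotated velocity of the profile;
  rotating back moves the normal to the profile.
\<close>

lemma sweep_normal:
  assumes p: "profile_curve I \<gamma> r w v q" "s \<in> I"
    and sh: "shape_at W \<sigma> z \<nu> e1 e2 k1 k2" "\<sigma> z = \<phi> t (\<gamma> s)"
  defines "n \<equiv> R (- t) \<nu>"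
  shows "norm n = 1" "n \<bullet> f (\<gamma> s) = 0" "n \<bullet> J (f (\<gamma> s)) = 0" "n \<bullet> profile_velocity r w v q s = 0"
proof -
  note pd = profile_curveD[OF p(1)]
  have M: "\<gamma> s \<in> M" using pd(3) p(2) by blast
  have y: "f (\<sigma> z) = R t (f (\<gamma> s))" by (simp add: sh(2) f_\<phi>[OF M])
  have "(norm n)\<^sup>2 = (norm \<nu>)\<^sup>2" unfolding norm_PQ n_def by (simp add: P_R Q_R norm_mult)
  then show "norm n = 1" using shape_normal(1)[OF sh(1)] by (simp add: power2_eq_1_iff) (use norm_ge_zero[of n] in linarith)
  show "n \<bullet> f (\<gamma> s) = 0" unfolding n_def R_adjoint using shape_normal(2)[OF sh(1)] by (simp add: y)
  obtain \<zeta>o where "dir_deriv \<zeta>o (f \<circ> \<sigma>) z = J (f (\<sigma> z))" using orbit_direction[OF sh(1)] by blast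
  then have "\<nu> \<bullet> J (f (\<sigma> z)) = 0" using shape_normal(3)[OF sh(1)] by metis
  then show "n \<bullet> J (f (\<gamma> s)) = 0" unfolding n_def R_adjoint by (simp add: y J_R)
  let ?e = "profile_velocity r w v q s"
  have ev: "\<forall>\<^sub>F \<tau> in nhds 0. s + \<tau> \<in> I" by (rule eventually_in_open_shift[OF pd(1) p(2)])
  have "((\<lambda>\<tau>. f (\<phi> t (\<gamma> (s + \<tau>)))) has_vector_derivative R t ?e) (at 0)"
  proof -
    have "((\<lambda>\<tau>. R t (f (\<gamma> (s + \<tau>)))) has_vector_derivative R t ?e) (at 0)"
      using has_vector_derivative_shift[of "\<lambda>s. f (\<gamma> s)" ?e s 0] profile_curve_velocity[OF p]
        bounded_linear.has_vector_derivative[OF linear_conv_bounded_linear[THEN iffD1, OF linear_R]] by simp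
    moreover have "\<forall>\<^sub>F \<tau> in nhds 0. R t (f (\<gamma> (s + \<tau>))) = f (\<phi> t (\<gamma> (s + \<tau>)))"
      using ev by eventually_elim (use pd(3) f_\<phi> in auto)
    ultimately show ?thesis
      using has_vector_derivative_cong_ev[of UNIV "\<lambda>\<tau>. R t (f (\<gamma> (s + \<tau>)))" "\<lambda>\<tau>. f (\<phi> t (\<gamma> (s + \<tau>)))" 0] f_\<phi>[OF M]
      by simp
  qed
  moreover have "\<forall>\<^sub>F \<tau> in nhds 0. \<phi> t (\<gamma> (s + \<tau>)) \<in> M"
    using ev by eventually_elim (use pd(3) \<phi>_M in auto)
  moreover have "continuous_on I (\<lambda>s. \<phi> t (\<gamma> s))" by (intro \<phi>_continuous_on continuous_intros pd(2,3))
  then have "isCont (\<lambda>\<tau>. \<phi> t (\<gamma> (s + \<tau>))) 0" by (rule isCont_shift[OF pd(1) p(2)])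
  ultimately obtain \<zeta> where "dir_deriv \<zeta> (f \<circ> \<sigma>) z = R t ?e"
    using curve_tangent[OF sh(1), of "\<lambda>\<tau>. \<phi> t (\<gamma> (s + \<tau>))" "R t ?e"] sh(2) by auto
  then have "\<nu> \<bullet> R t ?e = 0" using shape_normal(3)[OF sh(1)] by metis
  then show "n \<bullet> ?e = 0" unfolding n_def R_adjoint .
qed

lemma profile_normal:
  assumes p: "profile_curve I \<gamma> r w v q" "s \<in> I"
    and n: "norm \<nu> = 1" "\<nu> \<bullet> f (\<gamma> s) = 0" "\<nu> \<bullet> J (f (\<gamma> s)) = 0" "\<nu> \<bullet> profile_velocity r w v q s = 0"
  shows "v s = cmod (P \<nu>) \<and> w s = - v s * (Q \<nu> \<bullet> (\<i> * q s)) / Re (P \<nu>)"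
proof -
    note pd = profile_curveD[OF p(1)]
    let ?q' = "q s * Complex (- r s * w s * v s) ((v s)\<^sup>2) / of_real (1 - (r s)\<^sup>2)"
    define e where "e = (w s * v s) *\<^sub>R a + Re ?q' *\<^sub>R c + Im ?q' *\<^sub>R d"
    have Pe: "P e = of_real (w s * v s)" "Q e = ?q'"
      by (simp_all add: e_def plane_coord_simps P_frame complex_eq_iff)
    have ne: "\<nu> \<bullet> e = 0" using n(4) by (simp only: e_def profile_velocity_def)
    have Im0: "Im (P \<nu>) = 0"
      using n(3) pd(5,7)[OF p(2)] by (simp add: inner_PQ P_J Q_J inner_complex_def)
    define n0 where "n0 = Re (P \<nu>)"
    have Pn: "P \<nu> = of_real n0" using Im0 by (simp add: complex_eq_iff n0_def)
    have nn: "n0\<^sup>2 + (cmod (Q \<nu>))\<^sup>2 = 1"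
      using norm_PQ[of \<nu>] n(1) by (simp add: Pn)
    have ny: "n0 * r s + Q \<nu> \<bullet> q s = 0"
      using n(2) pd(7,8)[OF p(2)] by (simp add: inner_PQ Pn inner_complex_def)
    define A B where "A = Q \<nu> \<bullet> q s" and "B = Q \<nu> \<bullet> (\<i> * q s)"
    have "Q \<nu> \<bullet> ?q' = (- r s * w s * v s * A + (v s)\<^sup>2 * B) / (1 - (r s)\<^sup>2)"
    proof -
      have "?q' = (- r s * w s * v s / (1 - (r s)\<^sup>2)) *\<^sub>R q s + ((v s)\<^sup>2 / (1 - (r s)\<^sup>2)) *\<^sub>R (\<i> * q s)"
        by (rule complex_div_real)
      then have "Q \<nu> \<bullet> ?q' = - r s * w s * v s / (1 - (r s)\<^sup>2) * A + (v s)\<^sup>2 / (1 - (r s)\<^sup>2) * B"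
        by (simp only: inner_add_right inner_scaleR_right A_def B_def)
      then show ?thesis by (simp only: add_divide_distrib times_divide_eq_left)
    qed
    then have "n0 * (w s * v s) + (- r s * w s * v s * A + (v s)\<^sup>2 * B) / (1 - (r s)\<^sup>2) = 0"
      using ne by (simp add: inner_PQ Pe Pn inner_complex_def[of "complex_of_real _"])
    then have eq1: "n0 * w s * v s * (1 - (r s)\<^sup>2) + (- r s * w s * v s * A + (v s)\<^sup>2 * B) = 0"
      using pd(13)[OF p(2)] by (simp add: field_simps)
    have eq2: "A\<^sup>2 + B\<^sup>2 = (1 - n0\<^sup>2) * (1 - (r s)\<^sup>2)"
    proof -
      have "A\<^sup>2 + B\<^sup>2 = (cmod (Q \<nu>))\<^sup>2 * (cmod (q s))\<^sup>2"
        unfolding A_def B_def cmod_power2 inner_complex_def by (simp add: algebra_simps power2_eq_square)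
      then show ?thesis using nn pd(12)[OF p(2)] by algebra
    qed
    have eq3: "A = - n0 * r s" using ny by (simp add: A_def)
    show ?thesis
      using profile_velocity_determined[OF pd(10)[OF p(2)] pd(6)[OF p(2)] eq3 eq2 eq1] by (simp add: Pn B_def)
qed

text \<open>
  The tangent plane of the surface at a point of the profile determines the data of the Euler system
  there. So two profile curves through a common point of \<open>M\<close> have equal initial values.
\<close>

lemma profile_curve_determined:
  assumes p1: "profile_curve I1 \<gamma>1 r1 w1 v1 q1" "s1 \<in> I1" and p2: "profile_curve I2 \<gamma>2 r2 w2 v2 q2" "s2 \<in> I2"
    and eq: "\<gamma>1 s1 = \<gamma>2 s2"
  shows "r1 s1 = r2 s2 \<and> w1 s1 = w2 s2 \<and> v1 s1 = v2 s2 \<and> q1 s1 = q2 s2"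
proof -
  have M: "\<gamma>1 s1 \<in> M" using profile_curveD(3)[OF p1(1)] p1(2) by blast
  obtain W \<sigma> z \<nu> e1 e2 k1 k2 where sh: "shape_at W \<sigma> z \<nu> e1 e2 k1 k2" "\<sigma> z = \<gamma>1 s1"
    using shape_exists[OF M] by blast
  have q: "q1 s1 = q2 s2" using profile_curveD(8)[OF p1] profile_curveD(8)[OF p2] eq by simp
  moreover have "r1 s1 = r2 s2" using profile_curveD(7)[OF p1] profile_curveD(7)[OF p2] eq by simp
  moreover have "v1 s1 = v2 s2" "w1 s1 = w2 s2"
    using profile_normal[OF p1 sweep_normal[OF p1 sh(1)], of 0] profile_normal[OF p2 sweep_normal[OF p2 sh(1)], of 0]
      sh(2) eq q M \<phi>_0 by simp_all
  ultimately show ?thesis by simp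
qed

end

lemma linear_functional_kernel:
  fixes l :: "real \<times> real \<Rightarrow> real"
  assumes "linear l" shows "\<exists>v. v \<noteq> 0 \<and> l v = 0"
proof (cases "l (0,1) = 0")
  case True
  then show ?thesis by (intro exI[of _ "(0,1)"]) (simp add: zero_prod_def)
next
  case False
  let ?v = "l (0,1) *\<^sub>R (1::real,0::real) + (- l (1,0)) *\<^sub>R (0,1)"
  have "l ?v = 0" unfolding linear_add[OF assms] linear_scale[OF assms] by simp
  then show ?thesis using False by (intro exI[of _ ?v]) (simp add: zero_prod_def)
qed

lemma cis_eq_near:
  assumes "cis s = cis t" "\<bar>s - t\<bar> < 2 * pi" shows "s = t"
proof -
  have "sin s = sin t \<and> cos s = cos t" using assms(1) by (simp add: cis_conv_exp[symmetric] complex_eq_iff)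
  then obtain n :: int where "s = t + 2 * pi * real_of_int n" using sin_cos_eq_iff by metis
  then have n: "s = t + 2 * real_of_int n * pi" by simp
  then have "\<bar>2 * real_of_int n * pi\<bar> < 2 * pi" using assms(2) by simp
  then have "\<bar>real_of_int n\<bar> * (2 * pi) < 1 * (2 * pi)" by (simp add: abs_mult)
  then have "\<bar>real_of_int n\<bar> < 1" using mult_less_cancel_right_pos[of "2 * pi"] pi_gt_zero by (metis mult_pos_pos zero_less_numeral)
  then have "n = 0" by linarith
  then show ?thesis using n by simp
qed

context rotational
begin

text \<open>
  In a chart, \<open>(s, t) \<mapsto> \<phi> t (\<gamma> s)\<close> is a continuous injective map between open sets of the plane, so its
  image is open by invariance of domain. It is injective because the angle of \<open>q\<close> is increasing.
\<close>

lemma profile_sweep_open: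
  assumes p: "profile_curve I \<gamma> r w v q"
  shows "openin (top_of_set M) {\<phi> t (\<gamma> s) | t s. s \<in> I}"
proof (subst openin_subopen, safe)
  fix t0 s0 assume s0: "s0 \<in> I"
  note pd = profile_curveD[OF p]
  let ?y = "\<phi> t0 (\<gamma> s0)"
  have yM: "?y \<in> M" using pd(3) s0 \<phi>_M by blast
  obtain W \<sigma> where lc: "local_coords f M W \<sigma>" and y: "?y \<in> \<sigma> ` W"
    using surf yM by (auto simp: immersed_surface_S3_def)
  obtain \<tau> where \<tau>: "homeomorphism W (\<sigma> ` W) \<sigma> \<tau>" using local_coordsD(5)[OF lc] by blast
  define q' where "q' = (\<lambda>s. q s * Complex (- r s * w s * v s) ((v s)\<^sup>2) / of_real (1 - (r s)\<^sup>2))"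
  \<comment> \<open>The sine of the angle between \<open>q s0\<close> and \<open>q s\<close>, times their lengths; \<open>q s = q s'\<close> gives \<open>g s = g s'\<close>.\<close>
  define g where "g = (\<lambda>s. Im (q s * cnj (q s0)))"
  define g' where "g' = (\<lambda>s. Im (q' s * cnj (q s0)))"
  have dg: "(g has_real_derivative g' s) (at s)" if "s \<in> I" for s
  proof -
    have "((\<lambda>s. q s * cnj (q s0)) has_vector_derivative q' s * cnj (q s0)) (at s)"
      using has_vector_derivative_mult[OF pd(9)[OF that] has_vector_derivative_const[of "cnj (q s0)"]] by (simp add: q'_def)
    from bounded_linear.has_vector_derivative[OF bounded_linear_Im this]
    show ?thesis by (simp add: g_def g'_def has_real_derivative_iff_has_vector_derivative)
  qed
  have conts: "continuous_on I q" "continuous_on I r" "continuous_on I w" "continuous_on I v"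
    using pd(9) pd(4) unfolding euler_top_def
    by (meson DERIV_isCont continuous_at_imp_continuous_on has_vector_derivative_continuous)+
  have "continuous_on I g'"
    unfolding g'_def q'_def Complex_eq using pd(13)
    by (intro continuous_intros conts) (fastforce dest: pd(13) simp del: of_real_diff of_real_power of_real_1)
  moreover have "g' s0 > 0"
  proof -
    have "q s0 * cnj (q s0) = of_real (1 - (r s0)\<^sup>2)"
      using pd(12)[OF s0] by (simp only: complex_norm_square[symmetric])
    then have "q' s0 * cnj (q s0) = Complex (- r s0 * w s0 * v s0) ((v s0)\<^sup>2)"
      using pd(13)[OF s0] unfolding q'_def by (simp add: ac_simps divide_eq_eq del: of_real_diff)
    then have "g' s0 = (v s0)\<^sup>2" unfolding g'_def by (simp only: complex.sel)
    then show ?thesis using pd(6)[OF s0] by simp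
  qed
  ultimately have "open (I \<inter> g' -` {0<..})" "s0 \<in> I \<inter> g' -` {0<..}"
    using continuous_open_preimage[OF _ pd(1) open_greaterThan] s0 by auto
  then obtain \<epsilon> where \<epsilon>: "\<epsilon> > 0" "ball s0 \<epsilon> \<subseteq> I \<inter> g' -` {0<..}" using open_contains_ball by blast
  have mono: "g s < g t" if "s \<in> ball s0 \<epsilon>" "t \<in> ball s0 \<epsilon>" "s < t" for s t
  proof (rule DERIV_pos_imp_increasing[OF that(3)])
    fix x assume "s \<le> x" "x \<le> t"
    then have "x \<in> ball s0 \<epsilon>" using that by (auto simp: dist_real_def)
    then show "\<exists>y. (g has_real_derivative y) (at x) \<and> 0 < y" using \<epsilon>(2) dg by blast
  qed
  \<comment> \<open>Two angles in \<open>ball t0 1\<close> differ by less than a full turn.\<close>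
  define B where "B = ball s0 \<epsilon> \<times> ball t0 1"
  define G where "G = (\<lambda>(s, t). \<phi> t (\<gamma> s))"
  have BI: "fst x \<in> I" if "x \<in> B" for x using that \<epsilon>(2) by (auto simp: B_def)
  have contG: "continuous_on B G"
    unfolding G_def split_def using BI pd(3)
    by (intro \<phi>_continuous_on continuous_intros continuous_on_compose2[OF pd(2)]) auto
  have \<gamma>M: "\<gamma> s \<in> M" if "s \<in> I" for s using pd(3) that by blast
  have GM: "G ` B \<subseteq> M" using BI \<gamma>M \<phi>_M by (auto simp: G_def)
  define Ob where "Ob = B \<inter> G -` (\<sigma> ` W)"
  have "openin (top_of_set B) Ob"
    unfolding Ob_def using continuous_openin_preimage[OF contG _ local_coordsD(3)[OF lc]] GM by blast
  moreover have "open B" unfolding B_def by (intro open_Times open_ball)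
  ultimately have oO: "open Ob" by (simp add: openin_open_eq)
  have injG: "inj_on G Ob"
  proof (rule inj_onI)
    fix x x' assume x: "x \<in> Ob" "x' \<in> Ob" "G x = G x'"
    obtain s t s' t' where st: "x = (s, t)" "x' = (s', t')" by fastforce
    have B: "s \<in> ball s0 \<epsilon>" "s' \<in> ball s0 \<epsilon>" "t \<in> ball t0 1" "t' \<in> ball t0 1" using x st by (auto simp: Ob_def B_def)
    have I: "s \<in> I" "s' \<in> I" using B \<epsilon>(2) by auto
    have M: "\<gamma> s \<in> M" "\<gamma> s' \<in> M" using I pd(3) by auto
    have "f (\<phi> t (\<gamma> s)) = f (\<phi> t' (\<gamma> s'))" using x(3) by (simp add: G_def st)
    then have "R t (f (\<gamma> s)) = R t' (f (\<gamma> s'))" by (simp add: f_\<phi> M)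
    then have "cis t * of_real (r s) = cis t' * of_real (r s')" "q s = q s'"
      using P_R[of t "f (\<gamma> s)"] P_R[of t' "f (\<gamma> s')"] Q_R[of t "f (\<gamma> s)"] Q_R[of t' "f (\<gamma> s')"] pd(7,8) I by auto
    moreover from this(1) have "cmod (cis t * of_real (r s)) = cmod (cis t' * of_real (r s'))" by simp
    then have "r s = r s'" using pd(5) I by (simp add: norm_mult abs_of_pos)
    ultimately have "cis t = cis t'" "g s = g s'" using pd(5)[OF I(1)] by (auto simp: g_def)
    then have "t = t'" using B(3,4) pi_gt3 by (intro cis_eq_near) (auto simp: dist_real_def)
    moreover have "s = s'" using mono[OF B(1,2)] mono[OF B(2,1)] \<open>g s = g s'\<close> by linarith
    ultimately show "x = x'" by (simp add: st)
  qed
  define h where "h = \<tau> \<circ> G"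
  have "continuous_on Ob h"
    unfolding h_def
  proof (rule continuous_on_compose)
    show "continuous_on Ob G" by (rule continuous_on_subset[OF contG]) (simp add: Ob_def)
    have "continuous_on (\<sigma> ` W) \<tau>" using \<tau> by (simp add: homeomorphism_def)
    then show "continuous_on (G ` Ob) \<tau>" by (rule continuous_on_subset) (auto simp: Ob_def)
  qed
  moreover have "inj_on h Ob"
    unfolding h_def
  proof (rule comp_inj_on[OF injG])
    have "inj_on \<tau> (\<sigma> ` W)" by (rule inj_on_inverseI[of _ \<sigma>]) (rule homeomorphism_apply2[OF \<tau>])
    then show "inj_on \<tau> (G ` Ob)" by (rule inj_on_subset) (auto simp: Ob_def)
  qed
  ultimately have "open (h ` Ob)" using oO invariance_of_domain by blast
  moreover have "h ` Ob \<subseteq> W" using homeomorphism_image2[OF \<tau>] by (auto simp: h_def Ob_def)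
  ultimately have "openin (top_of_set M) (\<sigma> ` (h ` Ob))" by (rule local_coords_open_image[OF lc])
  moreover have "\<sigma> (h x) = G x" if "x \<in> Ob" for x
    using that \<tau> by (simp add: h_def Ob_def homeomorphism_apply2)
  then have "\<sigma> ` (h ` Ob) = G ` Ob" by (simp add: image_image)
  ultimately have "openin (top_of_set M) (G ` Ob)" by simp
  moreover have "?y \<in> G ` Ob"
    using y \<epsilon>(1) by (intro image_eqI[of _ _ "(s0, t0)"]) (auto simp: G_def Ob_def B_def)
  moreover have "G ` Ob \<subseteq> {\<phi> t (\<gamma> s) | t s. s \<in> I}" using BI by (fastforce simp: Ob_def G_def)
  ultimately show "\<exists>T. openin (top_of_set M) T \<and> ?y \<in> T \<and> T \<subseteq> {\<phi> t (\<gamma> s) | t s. s \<in> I}" by blast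
qed

end

section \<open>Local existence of profile curves\<close>

lemma inner_has_real_derivative:
  fixes g h :: "real \<Rightarrow> 'a::real_inner"
  assumes "(g has_vector_derivative g') (at t)" "(h has_vector_derivative h') (at t)"
  shows "((\<lambda>t. g t \<bullet> h t) has_real_derivative g t \<bullet> h' + g' \<bullet> h t) (at t)"
  using bounded_bilinear.has_vector_derivative[OF bounded_bilinear_inner assms]
  by (simp add: has_real_derivative_iff_has_vector_derivative)

lemma cmod_has_real_derivative:
  fixes p :: "real \<Rightarrow> complex"
  assumes p: "(p has_vector_derivative p') (at t)" and "p t \<noteq> 0"
  shows "((\<lambda>t. cmod (p t)) has_real_derivative (p t \<bullet> p') / cmod (p t)) (at t)"
proof -
  have "(sqrt has_real_derivative inverse (sqrt (p t \<bullet> p t)) / 2) (at (p t \<bullet> p t))"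
    by (rule DERIV_real_sqrt) (use assms(2) in simp)
  then have d: "((\<lambda>t. sqrt (p t \<bullet> p t)) has_real_derivative inverse (sqrt (p t \<bullet> p t)) / 2 * (p t \<bullet> p' + p' \<bullet> p t)) (at t)"
    by (rule DERIV_chain2[of sqrt _ "\<lambda>t. p t \<bullet> p t"]) (rule inner_has_real_derivative[OF p p])
  have N: "sqrt (x \<bullet> x) = cmod x" for x :: complex by (rule norm_eq_sqrt_inner[symmetric])
  have "((\<lambda>t. cmod (p t)) has_real_derivative inverse (cmod (p t)) / 2 * (p t \<bullet> p' + p' \<bullet> p t)) (at t)"
    using d unfolding N .
  moreover have "inverse (cmod (p t)) / 2 * (p t \<bullet> p' + p' \<bullet> p t) = (p t \<bullet> p') / cmod (p t)"
    unfolding inner_commute[of p' "p t"] by (simp only: mult_2[symmetric] divide_inverse) (simp add: mult.commute)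
  ultimately show ?thesis by simp
qed

lemma complex_quotient_has_real_derivative:
  assumes "(g has_real_derivative g') (at t)" "(h has_real_derivative h') (at t)" "h t \<noteq> 0"
  shows "((\<lambda>t. g t / h t) has_real_derivative (g' * h t - g t * h') / (h t)\<^sup>2) (at t)"
  using DERIV_divide[OF assms] by (simp add: power2_eq_square)

context rotational
begin

text \<open>
  Gauss' equation for a curve in the half plane of the profile. With \<open>E\<close> the square of its speed,
  \<open>\<Delta> / (r sqrt E)\<close> and \<open>trip / E^(3/2)\<close> are up to sign the normal curvatures of the orbit and of the
  curve, which are the principal curvatures.
\<close>

lemma gauss_along_profile:
  fixes \<gamma> :: "real \<Rightarrow> 'm" and r r1 :: "real \<Rightarrow> real" and q q1 :: "real \<Rightarrow> complex"
  assumes S: "open S" "t \<in> S" and \<gamma>: "continuous_on S \<gamma>" "\<gamma> ` S \<subseteq> M"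
    and f: "\<And>s. s \<in> S \<Longrightarrow> P (f (\<gamma> s)) = of_real (r s)" "\<And>s. s \<in> S \<Longrightarrow> Q (f (\<gamma> s)) = q s" and r: "r t > 0"
    and d1: "\<And>s. s \<in> S \<Longrightarrow> (r has_real_derivative r1 s) (at s)" "\<And>s. s \<in> S \<Longrightarrow> (q has_vector_derivative q1 s) (at s)"
    and d2: "(r1 has_real_derivative r2) (at t)" "(q1 has_vector_derivative q2) (at t)"
  defines "E \<equiv> (r1 t)\<^sup>2 + (cmod (q1 t))\<^sup>2"
    and "\<Delta> \<equiv> Re (q t) * Im (q1 t) - Im (q t) * Re (q1 t)"
    and "trip \<equiv> r2 * (Re (q t) * Im (q1 t) - Im (q t) * Re (q1 t)) +
      Re q2 * (Im (q t) * r1 t - r t * Im (q1 t)) + Im q2 * (r t * Re (q1 t) - Re (q t) * r1 t)"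
  shows "- \<Delta> * trip = K * r t * E\<^sup>2" "(r t)\<^sup>2 + (cmod (q t))\<^sup>2 = 1" "r t * r1 t + q t \<bullet> q1 t = 0"
    and "r t * r2 + q t \<bullet> q2 + E = 0"
proof -
  have unit: "(r s)\<^sup>2 + (cmod (q s))\<^sup>2 = 1" if "s \<in> S" for s
  proof -
    have "\<gamma> s \<in> M" using \<gamma>(2) that by blast
    then show ?thesis using norm_PQ[of "f (\<gamma> s)"] sphere f[OF that] by simp
  qed
  show "(r t)\<^sup>2 + (cmod (q t))\<^sup>2 = 1" by (rule unit[OF S(2)])
  have perp: "r s * r1 s + q s \<bullet> q1 s = 0" if s: "s \<in> S" for s
  proof -
    have "((\<lambda>s. (r s)\<^sup>2 + q s \<bullet> q s) has_real_derivative (2 * r s * r1 s + (q s \<bullet> q1 s + q1 s \<bullet> q s))) (at s)"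
      using DERIV_add[OF DERIV_power[OF d1(1)[OF s], of 2] inner_has_real_derivative[OF d1(2)[OF s] d1(2)[OF s]]]
      by (simp add: mult.commute mult.left_commute)
    moreover have "((\<lambda>s. (r s)\<^sup>2 + q s \<bullet> q s) has_real_derivative 0) (at s)"
      by (rule has_field_derivative_transform_within_open[OF DERIV_const S(1) s]) (use unit in \<open>simp add: dot_square_norm\<close>)
    ultimately have "2 * r s * r1 s + (q s \<bullet> q1 s + q1 s \<bullet> q s) = 0" by (rule DERIV_unique)
    then show ?thesis by (simp add: inner_commute)
  qed
  show "r t * r1 t + q t \<bullet> q1 t = 0" by (rule perp[OF S(2)])
  show acc: "r t * r2 + q t \<bullet> q2 + E = 0"
  proof -
    have "((\<lambda>s. r s * r1 s + q s \<bullet> q1 s) has_real_derivative ((r t * r2 + r1 t * r1 t) + (q t \<bullet> q2 + q1 t \<bullet> q1 t))) (at t)"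
      using DERIV_add[OF DERIV_mult'[OF d1(1)[OF S(2)] d2(1)] inner_has_real_derivative[OF d1(2)[OF S(2)] d2(2)]] .
    moreover have "((\<lambda>s. r s * r1 s + q s \<bullet> q1 s) has_real_derivative 0) (at t)"
      by (rule has_field_derivative_transform_within_open[OF DERIV_const S(1,2)]) (use perp in simp)
    ultimately have "(r t * r2 + r1 t * r1 t) + (q t \<bullet> q2 + q1 t \<bullet> q1 t) = 0" by (rule DERIV_unique)
    then show ?thesis by (simp add: E_def dot_square_norm power2_eq_square)
  qed
  have M: "\<gamma> t \<in> M" using \<gamma>(2) S(2) by blast
  obtain W \<sigma> z \<nu> e1 e2 k1 k2 where sh: "shape_at W \<sigma> z \<nu> e1 e2 k1 k2" "\<sigma> z = \<gamma> t" "k1 * k2 = K"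
    using shape_exists[OF M] by blast
  define vec where "vec = (\<lambda>x (y :: complex). x *\<^sub>R a + Re y *\<^sub>R c + Im y *\<^sub>R d)"
  have vec: "P (vec x y) = of_real x" "Q (vec x y) = y" for x y
    by (simp_all add: vec_def plane_coord_simps P_frame complex_eq_iff)
  have vecd: "((\<lambda>s. vec (x s) (y s)) has_vector_derivative vec x' y') (at s)"
    if "(x has_real_derivative x') (at s)" "(y has_vector_derivative y') (at s)" for x y x' y' s
  proof -
    have y: "((\<lambda>s. Re (y s)) has_real_derivative Re y') (at s)" "((\<lambda>s. Im (y s)) has_real_derivative Im y') (at s)"
      using bounded_linear.has_vector_derivative[OF bounded_linear_Re that(2)]
        bounded_linear.has_vector_derivative[OF bounded_linear_Im that(2)]
      by (simp_all add: has_real_derivative_iff_has_vector_derivative)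
    show ?thesis unfolding vec_def
      using has_vector_derivative_scaleR[OF that(1) has_vector_derivative_const[of a]]
        has_vector_derivative_scaleR[OF y(1) has_vector_derivative_const[of c]]
        has_vector_derivative_scaleR[OF y(2) has_vector_derivative_const[of d]]
      by (intro has_vector_derivative_add) simp_all
  qed
  have f\<gamma>: "f (\<gamma> s) = vec (r s) (q s)" if "s \<in> S" for s
    by (rule PQ_eqI) (simp_all add: f[OF that] vec)
  have ev: "\<forall>\<^sub>F \<tau> in nhds 0. t + \<tau> \<in> S" by (rule eventually_in_open_shift[OF S])
  obtain \<zeta> where \<zeta>: "dir_deriv \<zeta> (f \<circ> \<sigma>) z = vec (r1 (t + 0)) (q1 (t + 0))"
    "fund_form2 (f \<circ> \<sigma>) z \<nu> \<zeta> \<zeta> = vec r2 q2 \<bullet> \<nu>"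
  proof -
    have "\<forall>\<^sub>F \<tau> in nhds 0. ((\<lambda>\<tau>. f (\<gamma> (t + \<tau>))) has_vector_derivative vec (r1 (t + \<tau>)) (q1 (t + \<tau>))) (at \<tau>)"
      using ev
    proof eventually_elim
      case (elim \<tau>)
      have "((\<lambda>s. f (\<gamma> s)) has_vector_derivative vec (r1 (t + \<tau>)) (q1 (t + \<tau>))) (at (t + \<tau>))"
        using vecd[OF d1[OF elim]]
        by (rule has_vector_derivative_transform_within_open[OF _ S(1) elim]) (simp add: f\<gamma>)
      then show ?case by (rule has_vector_derivative_shift)
    qed
    moreover have "((\<lambda>\<tau>. vec (r1 (t + \<tau>)) (q1 (t + \<tau>))) has_vector_derivative vec r2 q2) (at 0)"
      using has_vector_derivative_shift[of "\<lambda>s. vec (r1 s) (q1 s)" _ t 0] vecd[OF d2] by simp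
    moreover have "\<forall>\<^sub>F \<tau> in nhds 0. \<gamma> (t + \<tau>) \<in> M" using ev by eventually_elim (use \<gamma>(2) in auto)
    ultimately show thesis
      using curve_in_chart_second[OF shape_chart(1,2)[OF sh(1)], of "\<lambda>\<tau>. \<gamma> (t + \<tau>)"]
        isCont_shift[OF S \<gamma>(1)] shape_normal(3)[OF sh(1)] sh(2) that by force
  qed
  have Py: "P (f (\<sigma> z)) = of_real (r t)" "Q (f (\<sigma> z)) = q t" using f[OF S(2)] sh(2) by simp_all
  obtain \<zeta>o where "dir_deriv \<zeta>o (f \<circ> \<sigma>) z = J (f (\<sigma> z))" using orbit_direction[OF sh(1)] by blast
  then have "\<nu> \<bullet> J (f (\<sigma> z)) = 0" using shape_normal(3)[OF sh(1)] by metis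
  then have Im0: "Im (P \<nu>) = 0" using r by (simp add: inner_PQ P_J Q_J Py inner_complex_def)
  define n0 where "n0 = Re (P \<nu>)"
  have Pn: "P \<nu> = of_real n0" using Im0 by (simp add: complex_eq_iff n0_def)
  have "n0\<^sup>2 + (cmod (Q \<nu>))\<^sup>2 = 1"
    using norm_PQ[of \<nu>] shape_normal(1)[OF sh(1)] by (simp add: Pn)
  moreover have "n0 * r t + Q \<nu> \<bullet> q t = 0"
    using shape_normal(2)[OF sh(1)] by (simp add: inner_PQ Pn Py inner_complex_def)
  moreover have "n0 * r1 t + Q \<nu> \<bullet> q1 t = 0"
    using shape_normal(3)[OF sh(1), of \<zeta>] unfolding \<zeta>(1) by (simp add: inner_PQ Pn vec inner_complex_def)
  ultimately have frame: "E * (n0 * (r2 * n0 + Re q2 * Re (Q \<nu>) + Im q2 * Im (Q \<nu>))) = \<Delta> * trip"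
    using sphere_frame_normal[of "r t" "Re (q t)" "Im (q t)" "r1 t" "Re (q1 t)" "Im (q1 t)" n0 "Re (Q \<nu>)" "Im (Q \<nu>)" r2 "Re q2" "Im q2"]
      unit[OF S(2)] perp[OF S(2)]
    by (simp add: E_def \<Delta>_def trip_def cmod_power2 inner_complex_def add.assoc)
  have "- kappa (f (\<sigma> z)) \<nu> * fund_form2 (f \<circ> \<sigma>) z \<nu> \<zeta> \<zeta> = K * fund_form1 (f \<circ> \<sigma>) z \<zeta> \<zeta>"
  proof (rule gauss_equation[OF sh(1,3)])
    show "P (f (\<sigma> z)) \<noteq> 0" using r by (simp add: Py)
    show "dir_deriv \<zeta> (f \<circ> \<sigma>) z \<bullet> J (f (\<sigma> z)) = 0"
      unfolding \<zeta>(1) by (simp add: inner_PQ vec P_J Q_J Py inner_complex_def)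
  qed
  moreover have "kappa (f (\<sigma> z)) \<nu> = n0 / r t"
    using r by (simp add: kappa_def Py Pn inner_complex_def power2_eq_square)
  moreover have "fund_form1 (f \<circ> \<sigma>) z \<zeta> \<zeta> = E"
    unfolding fund_form1_def \<zeta>(1) by (simp add: inner_PQ vec E_def dot_square_norm)
  moreover have "vec r2 q2 \<bullet> \<nu> = r2 * n0 + Re q2 * Re (Q \<nu>) + Im q2 * Im (Q \<nu>)"
    by (simp add: inner_PQ vec Pn inner_complex_def)
  ultimately have "- (n0 / r t) * (r2 * n0 + Re q2 * Re (Q \<nu>) + Im q2 * Im (Q \<nu>)) = K * E"
    using \<zeta>(2) by simp
  then have "- (n0 * (r2 * n0 + Re q2 * Re (Q \<nu>) + Im q2 * Im (Q \<nu>))) = K * E * r t"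
    using r by (simp add: field_simps)
  then show "- \<Delta> * trip = K * r t * E\<^sup>2" using frame by algebra
qed

end

context rotational
begin

text \<open>
  The tangent plane contains a vector that is not along the orbit.
\<close>

lemma profile_direction:
  assumes sh: "shape_at W \<sigma> z \<nu> e1 e2 k1 k2" and y: "P (f (\<sigma> z)) = of_real \<rho>" "\<rho> > 0"
  shows "\<exists>\<zeta>. (Re (P (dir_deriv \<zeta> (f \<circ> \<sigma>) z)))\<^sup>2 + (cmod (Q (dir_deriv \<zeta> (f \<circ> \<sigma>) z)))\<^sup>2 \<noteq> 0"
proof (rule ccontr)
  let ?D = "\<lambda>v. dir_deriv v (f \<circ> \<sigma>) z"
  note lin = D_linear[OF sh]
  assume "\<not> ?thesis"
  then have "(Re (P (?D v)))\<^sup>2 + (cmod (Q (?D v)))\<^sup>2 = 0" for v by blast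
  then have none: "Re (P (?D v)) = 0" "Q (?D v) = 0" for v
    by (simp_all add: sum_power2_eq_zero_iff)
  have "linear (\<lambda>v. Im (P (?D v)))"
    by (rule linearI) (simp_all add: linear_add[OF lin] linear_scale[OF lin] plane_coord_simps)
  from linear_functional_kernel[OF this] obtain v where v: "v \<noteq> 0" "Im (P (?D v)) = 0" by blast
  have "?D v = ?D 0"
    by (rule PQ_eqI) (simp_all add: none v complex_eq_iff linear_0[OF lin] plane_coord_simps)
  then show False using D_inj[OF sh] v(1) by blast
qed

text \<open>
  A straight line of a chart, rotated into the half plane of the profile, solves the equations of a profile
  curve up to the speed \<open>\<mu>\<close> of its parameter. Put \<open>w = r' / sqrt E\<close> and \<open>v = \<Delta> / sqrt E\<close>, where \<open>E\<close> is the
  square of the speed: then \<open>r^2 + w^2 + v^2 = 1\<close> by \<open>sphere_frame_second\<close>, and Gauss' equation replaces the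
  remaining component of the acceleration in \<open>w'\<close>. As \<open>K\<close>, \<open>r\<close> and \<open>E\<close> are nonzero, Gauss' equation also
  shows that \<open>\<Delta>\<close> never vanishes; its sign is a matter of the orientation of the line.
\<close>

lemma profile_of_chart_line:
  assumes sh: "shape_at W \<sigma> z \<nu> e1 e2 k1 k2" and y: "P (f (\<sigma> z)) = of_real \<rho>" "\<rho> > 0"
    and E0: "(Re (P (dir_deriv \<zeta> (f \<circ> \<sigma>) z)))\<^sup>2 + (cmod (Q (dir_deriv \<zeta> (f \<circ> \<sigma>) z)))\<^sup>2 \<noteq> 0"
  defines "\<Delta>0 \<equiv> Re (Q (f (\<sigma> z))) * Im (Q (dir_deriv \<zeta> (f \<circ> \<sigma>) z)) - Im (Q (f (\<sigma> z))) * Re (Q (dir_deriv \<zeta> (f \<circ> \<sigma>) z))"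
  shows "\<Delta>0 \<noteq> 0"
    and "\<Delta>0 > 0 \<Longrightarrow> \<exists>\<delta>>0. \<exists>\<gamma> r w v q \<mu>. continuous_on {-\<delta><..<\<delta>} \<gamma> \<and> continuous_on {-\<delta><..<\<delta>} \<mu> \<and> \<gamma> 0 = \<sigma> z \<and>
      (\<forall>t\<in>{-\<delta><..<\<delta>}. \<gamma> t \<in> M \<and> \<mu> t > 0 \<and> r t > 0 \<and> v t > 0 \<and> P (f (\<gamma> t)) = of_real (r t) \<and> Q (f (\<gamma> t)) = q t \<and>
        (r t)\<^sup>2 + (w t)\<^sup>2 + (v t)\<^sup>2 = 1 \<and>
        (r has_real_derivative \<mu> t * (w t * v t)) (at t) \<and>
        (w has_real_derivative \<mu> t * (- (K + 1) * r t * v t)) (at t) \<and>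
        (v has_real_derivative \<mu> t * (K * r t * w t)) (at t) \<and>
        (q has_vector_derivative \<mu> t *\<^sub>R (q t * Complex (- r t * w t * v t) ((v t)\<^sup>2) / of_real (1 - (r t)\<^sup>2))) (at t))"
proof -
  define T where "T = {t. z + t *\<^sub>R \<zeta> \<in> W}"
  note line = chart_line[OF sh, where \<zeta> = \<zeta>, folded T_def]
  define u where "u = (\<lambda>t. (f \<circ> \<sigma>) (z + t *\<^sub>R \<zeta>))"
  define u1 where "u1 = (\<lambda>t. dir_deriv \<zeta> (f \<circ> \<sigma>) (z + t *\<^sub>R \<zeta>))"
  define u2 where "u2 = (\<lambda>t. dir_deriv \<zeta> (dir_deriv \<zeta> (f \<circ> \<sigma>)) (z + t *\<^sub>R \<zeta>))"
  have du: "(u has_vector_derivative u1 t) (at t)" "(u1 has_vector_derivative u2 t) (at t)" if "t \<in> T" for t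
    using line(5,6)[OF that] by (simp_all add: u_def u1_def u2_def)
  define p p1 p2 q q1 q2 where defs: "p = (\<lambda>t. P (u t))" "p1 = (\<lambda>t. P (u1 t))" "p2 = (\<lambda>t. P (u2 t))"
    "q = (\<lambda>t. Q (u t))" "q1 = (\<lambda>t. Q (u1 t))" "q2 = (\<lambda>t. Q (u2 t))"
  have dp: "(p has_vector_derivative p1 t) (at t)" "(p1 has_vector_derivative p2 t) (at t)"
    "(q has_vector_derivative q1 t) (at t)" "(q1 has_vector_derivative q2 t) (at t)" if "t \<in> T" for t
    unfolding defs using du[OF that]
    by (blast intro: bounded_linear.has_vector_derivative[OF plane_coord_bounded_linear])+
  have contT: "continuous_on T p" "continuous_on T p1" "continuous_on T q" "continuous_on T q1"
    using dp by (meson continuous_at_imp_continuous_on has_vector_derivative_continuous)+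
  define S where "S = T \<inter> (\<lambda>t. Re (p t)) -` {0<..}"
  have openS: "open S"
    unfolding S_def by (intro continuous_open_preimage line(1) open_greaterThan continuous_intros contT)
  have vals: "u 0 = f (\<sigma> z)" "u1 0 = dir_deriv \<zeta> (f \<circ> \<sigma>) z" by (simp_all add: u_def u1_def)
  have p0: "p 0 = of_real \<rho>" by (simp add: defs vals y)
  have S0: "0 \<in> S" using line(2) y by (simp add: S_def p0)
  have ST: "t \<in> T" "Re (p t) > 0" "p t \<noteq> 0" if "t \<in> S" for t using that by (auto simp: S_def)
  define r r1 r2 where rdefs: "r = (\<lambda>t. cmod (p t))" "r1 = (\<lambda>t. (p t \<bullet> p1 t) / cmod (p t))"
    "r2 = (\<lambda>t. ((p t \<bullet> p2 t + p1 t \<bullet> p1 t) * r t - (p t \<bullet> p1 t) * r1 t) / (r t)\<^sup>2)"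
  have rpos: "r t > 0" if "t \<in> S" for t using ST[OF that] by (simp add: rdefs)
  have dr: "(r has_real_derivative r1 t) (at t)" "(r1 has_real_derivative r2 t) (at t)" if t: "t \<in> S" for t
  proof -
    show 1: "(r has_real_derivative r1 t) (at t)"
      unfolding rdefs by (rule cmod_has_real_derivative[OF dp(1)[OF ST(1)[OF t]] ST(3)[OF t]])
    show "(r1 has_real_derivative r2 t) (at t)"
      using complex_quotient_has_real_derivative[OF inner_has_real_derivative[OF dp(1,2)[OF ST(1)[OF t]]] 1] rpos[OF t]
      unfolding rdefs by simp
  qed
  define \<gamma> where "\<gamma> = (\<lambda>t. \<phi> (- Arg (p t)) (\<sigma> (z + t *\<^sub>R \<zeta>)))"
  have contS: "continuous_on S \<gamma>"
    unfolding \<gamma>_def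
  proof (intro \<phi>_continuous_on continuous_intros)
    show "continuous_on S (\<lambda>t. \<sigma> (z + t *\<^sub>R \<zeta>))" using line(3) by (rule continuous_on_subset) (auto simp: S_def)
    show "continuous_on S p" using contT(1) by (rule continuous_on_subset) (auto simp: S_def)
    show "p t \<notin> \<real>\<^sub>\<le>\<^sub>0" if "t \<in> S" for t using ST(2)[OF that] by (auto simp: complex_nonpos_Reals_iff)
    show "(\<lambda>t. \<sigma> (z + t *\<^sub>R \<zeta>)) ` S \<subseteq> M" using line(4) ST by auto
  qed
  have \<gamma>M: "\<gamma> t \<in> M" if "t \<in> S" for t using line(4) ST(1)[OF that] by (simp add: \<gamma>_def \<phi>_M)
  have f\<gamma>: "f (\<gamma> t) = R (- Arg (p t)) (u t)" if "t \<in> S" for t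
    using line(4) ST(1)[OF that] by (simp add: \<gamma>_def f_\<phi> u_def)
  have Pf: "P (f (\<gamma> t)) = of_real (r t)" if "t \<in> S" for t
  proof -
    have "p t = of_real (r t) * cis (Arg (p t))" using rcis_cmod_Arg[of "p t"] by (simp add: rcis_def rdefs)
    then have "cis (- Arg (p t)) * p t = of_real (r t) * (cis (- Arg (p t)) * cis (Arg (p t)))" by (metis mult.left_commute)
    then show ?thesis unfolding f\<gamma>[OF that] P_R defs(1)[symmetric] by (simp add: cis_mult defs)
  qed
  have Qf: "Q (f (\<gamma> t)) = q t" if "t \<in> S" for t unfolding f\<gamma>[OF that] by (simp add: Q_R defs)
  have \<gamma>0: "\<gamma> 0 = \<sigma> z"
  proof -
    have "\<sigma> z \<in> M" using shape_chart(2,5)[OF sh] by auto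
    then show ?thesis using y by (simp add: \<gamma>_def p0 \<phi>_0)
  qed
  define E where "E = (\<lambda>t. (r1 t)\<^sup>2 + (cmod (q1 t))\<^sup>2)"
  define \<Delta> where "\<Delta> = (\<lambda>t. Re (q t) * Im (q1 t) - Im (q t) * Re (q1 t))"
  define trip where "trip = (\<lambda>t. r2 t * \<Delta> t + Re (q2 t) * (Im (q t) * r1 t - r t * Im (q1 t)) +
      Im (q2 t) * (r t * Re (q1 t) - Re (q t) * r1 t))"
  have imS: "\<gamma> ` S \<subseteq> M" using \<gamma>M by auto
  have gauss: "- \<Delta> t * trip t = K * r t * (E t)\<^sup>2" "(r t)\<^sup>2 + (cmod (q t))\<^sup>2 = 1"
     "r t * r1 t + q t \<bullet> q1 t = 0" "r t * r2 t + q t \<bullet> q2 t + E t = 0" if t: "t \<in> S" for t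
    unfolding E_def trip_def \<Delta>_def
    using gauss_along_profile[OF openS t contS imS Pf Qf rpos[OF t] dr(1) dp(3)[OF ST(1)] dr(2)[OF t] dp(4)[OF ST(1)[OF t]]]
    by simp_all
  have E_0: "E 0 > 0"
  proof -
    have "r1 0 = Re (P (dir_deriv \<zeta> (f \<circ> \<sigma>) z))"
      using y by (simp add: rdefs p0) (simp add: defs vals inner_complex_def)
    then have "E 0 \<noteq> 0" using E0 by (simp add: E_def defs vals)
    then show ?thesis unfolding E_def using sum_power2_ge_zero[of "r1 0" "cmod (q1 0)"] by linarith
  qed
  have \<Delta>_0: "\<Delta> 0 = \<Delta>0" by (simp add: \<Delta>_def \<Delta>0_def defs vals)
  show "\<Delta>0 \<noteq> 0"
  proof
    assume "\<Delta>0 = 0"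
    then have "K * r 0 * (E 0)\<^sup>2 = 0" using gauss(1)[OF S0] \<Delta>_0 by simp
    then show False using K0 rpos[OF S0] E_0 by simp
  qed
  assume \<Delta>0: "\<Delta>0 > 0"
  have cont: "continuous_on S r" "continuous_on S r1" "continuous_on S q" "continuous_on S q1"
    using dr contT(3,4) ST(1) by (meson DERIV_isCont continuous_at_imp_continuous_on continuous_on_subset subsetI)+
  have cE: "continuous_on S E" "continuous_on S \<Delta>"
    unfolding E_def \<Delta>_def by (intro continuous_intros cont)+
  have "open (S \<inter> E -` {0<..})" by (rule continuous_open_preimage[OF cE(1) openS open_greaterThan])
  moreover have "open (S \<inter> \<Delta> -` {0<..})" by (rule continuous_open_preimage[OF cE(2) openS open_greaterThan])
  ultimately have "open ((S \<inter> E -` {0<..}) \<inter> (S \<inter> \<Delta> -` {0<..}))" by (rule open_Int)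
  moreover have "0 \<in> (S \<inter> E -` {0<..}) \<inter> (S \<inter> \<Delta> -` {0<..})" using S0 E_0 \<Delta>_0 \<Delta>0 by simp
  ultimately obtain \<delta> where \<delta>: "\<delta> > 0" "ball 0 \<delta> \<subseteq> (S \<inter> E -` {0<..}) \<inter> (S \<inter> \<Delta> -` {0<..})"
    using open_contains_ball by blast
  have I: "t \<in> S" "E t > 0" "\<Delta> t > 0" if "t \<in> {-\<delta><..<\<delta>}" for t
  proof -
    have "t \<in> ball 0 \<delta>" using that by (auto simp: dist_real_def)
    then show "t \<in> S" "E t > 0" "\<Delta> t > 0" using \<delta>(2) by auto
  qed
  define w v \<mu> where wv: "w = (\<lambda>t. r1 t / sqrt (E t))" "v = (\<lambda>t. \<Delta> t / sqrt (E t))" "\<mu> = (\<lambda>t. E t / \<Delta> t)"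
  have c\<mu>: "continuous_on {-\<delta><..<\<delta>} \<mu>"
    unfolding wv using I by (intro continuous_on_divide continuous_on_subset[OF cE(1)] continuous_on_subset[OF cE(2)]) force+
  have c\<gamma>: "continuous_on {-\<delta><..<\<delta>} \<gamma>" using I(1) by (intro continuous_on_subset[OF contS]) auto
  have all: "\<gamma> t \<in> M \<and> \<mu> t > 0 \<and> r t > 0 \<and> v t > 0 \<and> P (f (\<gamma> t)) = of_real (r t) \<and> Q (f (\<gamma> t)) = q t \<and>
        (r t)\<^sup>2 + (w t)\<^sup>2 + (v t)\<^sup>2 = 1 \<and>
        (r has_real_derivative \<mu> t * (w t * v t)) (at t) \<and>
        (w has_real_derivative \<mu> t * (- (K + 1) * r t * v t)) (at t) \<and>
        (v has_real_derivative \<mu> t * (K * r t * w t)) (at t) \<and>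
        (q has_vector_derivative \<mu> t *\<^sub>R (q t * Complex (- r t * w t * v t) ((v t)\<^sup>2) / of_real (1 - (r t)\<^sup>2))) (at t)"
    if t: "t \<in> {-\<delta><..<\<delta>}" for t
  proof -
    have unit_wv: "(r t)\<^sup>2 + (w t)\<^sup>2 + (v t)\<^sup>2 = 1" "v t > 0" if t: "t \<in> {-\<delta><..<\<delta>}" for t
    proof -
      have "(\<Delta> t)\<^sup>2 + (r1 t)\<^sup>2 + (r t)\<^sup>2 * E t = E t"
      proof (rule sphere_frame_second(2))
        show "(r t)\<^sup>2 + (Re (q t))\<^sup>2 + (Im (q t))\<^sup>2 = 1" using gauss(2)[OF I(1)[OF t]] by (simp add: cmod_power2)
        show "r t * r1 t + Re (q t) * Re (q1 t) + Im (q t) * Im (q1 t) = 0"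
          using gauss(3)[OF I(1)[OF t]] by (simp add: inner_complex_def)
        show "E t = (r1 t)\<^sup>2 + (Re (q1 t))\<^sup>2 + (Im (q1 t))\<^sup>2" by (simp add: E_def cmod_power2)
        show "r t * r2 t + Re (q t) * Re (q2 t) + Im (q t) * Im (q2 t) + E t = 0"
          using gauss(4)[OF I(1)[OF t]] by (simp add: inner_complex_def)
      qed (simp add: \<Delta>_def)
      then have "((\<Delta> t)\<^sup>2 + (r1 t)\<^sup>2) / E t = 1 - (r t)\<^sup>2"
        using I(2)[OF t] by (simp add: divide_eq_eq left_diff_distrib)
      then have "(w t)\<^sup>2 + (v t)\<^sup>2 = 1 - (r t)\<^sup>2"
        using I(2)[OF t] by (simp add: wv power_divide add_divide_distrib)
      then show "(r t)\<^sup>2 + (w t)\<^sup>2 + (v t)\<^sup>2 = 1" by linarith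
      show "v t > 0" using I[OF t] by (simp add: wv)
    qed
    have tS: "t \<in> S" and Et: "E t > 0" and \<Delta>t: "\<Delta> t > 0" using I[OF t] by auto
    define e where "e = sqrt (E t)"
    have e: "e > 0" "e\<^sup>2 = E t" using Et by (simp_all add: e_def)
    have we: "r1 t = w t * e" and ve: "\<Delta> t = v t * e" using e(1) by (simp_all add: wv e_def)
    have vt: "v t > 0" by (rule unit_wv(2)[OF t])
    have \<mu>e: "\<mu> t * v t = e" using e vt ve by (simp add: wv(3) e(2)[symmetric] power2_eq_square)
    have \<mu>pos: "\<mu> t > 0" using Et \<Delta>t by (simp add: wv)
    have second: "r2 t * E t - r1 t * (r1 t * r2 t + Re (q1 t) * Re (q2 t) + Im (q1 t) * Im (q2 t)) = - (K + 1) * r t * (E t)\<^sup>2"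
    proof -
      have "r2 t * E t - r1 t * (r1 t * r2 t + Re (q1 t) * Re (q2 t) + Im (q1 t) * Im (q2 t)) =
          - r t * (E t)\<^sup>2 + \<Delta> t * (r2 t * \<Delta> t + Re (q2 t) * (Im (q t) * r1 t - r t * Im (q1 t)) +
            Im (q2 t) * (r t * Re (q1 t) - Re (q t) * r1 t))"
      proof (rule sphere_frame_second(1))
        show "(r t)\<^sup>2 + (Re (q t))\<^sup>2 + (Im (q t))\<^sup>2 = 1" using gauss(2)[OF tS] by (simp add: cmod_power2)
        show "r t * r1 t + Re (q t) * Re (q1 t) + Im (q t) * Im (q1 t) = 0"
          using gauss(3)[OF tS] by (simp add: inner_complex_def)
        show "E t = (r1 t)\<^sup>2 + (Re (q1 t))\<^sup>2 + (Im (q1 t))\<^sup>2" by (simp add: E_def cmod_power2)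
        show "r t * r2 t + Re (q t) * Re (q2 t) + Im (q t) * Im (q2 t) + E t = 0"
          using gauss(4)[OF tS] by (simp add: inner_complex_def)
      qed (simp add: \<Delta>_def)
      then show ?thesis using gauss(1)[OF tS] unfolding trip_def by algebra
    qed
    have r': "(r has_real_derivative \<mu> t * (w t * v t)) (at t)"
      by (rule DERIV_cong[OF dr(1)[OF tS]]) (simp add: we \<mu>e[symmetric])
    have E': "(E has_real_derivative 2 * (r1 t * r2 t + Re (q1 t) * Re (q2 t) + Im (q1 t) * Im (q2 t))) (at t)"
    proof -
      have "((\<lambda>t. (r1 t)\<^sup>2 + q1 t \<bullet> q1 t) has_real_derivative
          (2 * (r1 t * r2 t) + (q1 t \<bullet> q2 t + q2 t \<bullet> q1 t))) (at t)"
        using DERIV_add[OF DERIV_power[OF dr(2)[OF tS], of 2] inner_has_real_derivative[OF dp(4) dp(4)]] ST(1)[OF tS]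
        by (simp add: mult.commute mult.left_commute)
      then show ?thesis
        unfolding E_def by (simp add: dot_square_norm) (simp add: inner_complex_def algebra_simps)
    qed
    have w': "(w has_real_derivative \<mu> t * (- (K + 1) * r t * v t)) (at t)"
    proof -
      define S2 where "S2 = r1 t * r2 t + Re (q1 t) * Re (q2 t) + Im (q1 t) * Im (q2 t)"
      have "((\<lambda>t. sqrt (E t)) has_real_derivative inverse e / 2 * (2 * S2)) (at t)"
        by (rule DERIV_chain2[of sqrt _ E, OF _ E'[folded S2_def]]) (use DERIV_real_sqrt[OF Et] in \<open>simp add: e_def\<close>)
      from complex_quotient_has_real_derivative[OF dr(2)[OF tS] this] e
      have "(w has_real_derivative (r2 t * e - r1 t * (inverse e / 2 * (2 * S2))) / e\<^sup>2) (at t)"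
        by (simp add: wv(1) e_def)
      moreover have "(r2 t * e - r1 t * (inverse e / 2 * (2 * S2))) / e\<^sup>2 = \<mu> t * (- (K + 1) * r t * v t)"
      proof -
        have "(r2 t * e - r1 t * (inverse e / 2 * (2 * S2))) = (r2 t * e\<^sup>2 - r1 t * S2) / e"
          using e(1) by (simp add: field_simps power2_eq_square)
        also have "\<dots> = - (K + 1) * r t * (e\<^sup>2)\<^sup>2 / e"
          using second unfolding S2_def[symmetric] e(2) by simp
        also have "\<dots> / e\<^sup>2 = - (K + 1) * r t * e" using e(1) by (simp add: power2_eq_square)
        finally show ?thesis using \<mu>e by algebra
      qed
      ultimately show ?thesis by simp
    qed
    have v': "(v has_real_derivative \<mu> t * (K * r t * w t)) (at t)"
    proof -
      define g where "g = (\<lambda>t. 1 - (r t)\<^sup>2 - (w t)\<^sup>2)"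
      have gv: "sqrt (g s) = v s" if "s \<in> {-\<delta><..<\<delta>}" for s
      proof (rule real_sqrt_unique)
        show "(v s)\<^sup>2 = g s" using unit_wv(1)[OF that] by (simp add: g_def algebra_simps)
        show "0 \<le> v s" using unit_wv(2)[OF that] by simp
      qed
      have "g t > 0" using gv[OF t] vt by (metis real_sqrt_gt_0_iff)
      have "(g has_real_derivative - (2 * r t * (\<mu> t * (w t * v t))) - 2 * w t * (\<mu> t * (- (K + 1) * r t * v t))) (at t)"
        unfolding g_def by (auto intro!: derivative_eq_intros r' w')
      moreover have "(sqrt has_real_derivative inverse (v t) / 2) (at (g t))"
        using DERIV_real_sqrt[OF \<open>g t > 0\<close>] by (simp add: gv[OF t])
      ultimately have "((\<lambda>s. sqrt (g s)) has_real_derivative inverse (v t) / 2 *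
          (- (2 * r t * (\<mu> t * (w t * v t))) - 2 * w t * (\<mu> t * (- (K + 1) * r t * v t)))) (at t)"
        by (intro DERIV_chain2[of sqrt _ g])
      moreover have "inverse (v t) / 2 *
          (- (2 * r t * (\<mu> t * (w t * v t))) - 2 * w t * (\<mu> t * (- (K + 1) * r t * v t))) = \<mu> t * (K * r t * w t)"
        using vt by (simp add: field_simps)
      ultimately have "((\<lambda>s. sqrt (g s)) has_real_derivative \<mu> t * (K * r t * w t)) (at t)" by simp
      then show ?thesis
        by (rule has_field_derivative_transform_within_open[OF _ _ t]) (auto simp: gv)
    qed
    have q': "(q has_vector_derivative \<mu> t *\<^sub>R (q t * Complex (- r t * w t * v t) ((v t)\<^sup>2) / of_real (1 - (r t)\<^sup>2))) (at t)"
    proof -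
      have nq: "q t * cnj (q t) = of_real (1 - (r t)\<^sup>2)"
      proof -
        have "(cmod (q t))\<^sup>2 = 1 - (r t)\<^sup>2" using gauss(2)[OF tS] by simp
        then show ?thesis by (simp only: complex_norm_square[symmetric])
      qed
      have "(v t)\<^sup>2 > 0" "(w t)\<^sup>2 \<ge> 0" using vt by simp_all
      then have nz: "1 - (r t)\<^sup>2 \<noteq> 0" using unit_wv(1)[OF t] by linarith
      have "q1 t * cnj (q t) = Complex (q t \<bullet> q1 t) (\<Delta> t)"
        by (simp add: complex_eq_iff inner_complex_def \<Delta>_def algebra_simps)
      also have "q t \<bullet> q1 t = \<mu> t * (- r t * w t * v t)" using gauss(3)[OF tS] \<mu>e we by algebra
      also have "\<Delta> t = \<mu> t * (v t)\<^sup>2" by (simp add: ve \<mu>e[symmetric] power2_eq_square)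
      finally have "q1 t * cnj (q t) = of_real (\<mu> t) * Complex (- r t * w t * v t) ((v t)\<^sup>2)"
        by (simp add: complex_eq_iff)
      then have "q1 t * (q t * cnj (q t)) = of_real (\<mu> t) * (q t * Complex (- r t * w t * v t) ((v t)\<^sup>2))"
        by (simp add: mult.left_commute mult.commute)
      then have "q1 t = \<mu> t *\<^sub>R (q t * Complex (- r t * w t * v t) ((v t)\<^sup>2) / of_real (1 - (r t)\<^sup>2))"
        unfolding nq using nz by (simp add: scaleR_conv_of_real eq_divide_eq del: of_real_diff)
      then show ?thesis using dp(3)[OF ST(1)[OF tS]] by simp
    qed
    show ?thesis using \<gamma>M[OF tS] \<mu>pos rpos[OF tS] unit_wv[OF t] Pf[OF tS] Qf[OF tS] r' w' v' q' by (intro conjI)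
  qed
  show "\<exists>\<delta>>0. \<exists>\<gamma> r w v q \<mu>. continuous_on {-\<delta><..<\<delta>} \<gamma> \<and> continuous_on {-\<delta><..<\<delta>} \<mu> \<and> \<gamma> 0 = \<sigma> z \<and>
      (\<forall>t\<in>{-\<delta><..<\<delta>}. \<gamma> t \<in> M \<and> \<mu> t > 0 \<and> r t > 0 \<and> v t > 0 \<and> P (f (\<gamma> t)) = of_real (r t) \<and> Q (f (\<gamma> t)) = q t \<and>
        (r t)\<^sup>2 + (w t)\<^sup>2 + (v t)\<^sup>2 = 1 \<and>
        (r has_real_derivative \<mu> t * (w t * v t)) (at t) \<and>
        (w has_real_derivative \<mu> t * (- (K + 1) * r t * v t)) (at t) \<and>
        (v has_real_derivative \<mu> t * (K * r t * w t)) (at t) \<and>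
        (q has_vector_derivative \<mu> t *\<^sub>R (q t * Complex (- r t * w t * v t) ((v t)\<^sup>2) / of_real (1 - (r t)\<^sup>2))) (at t))"
    by (rule exI[of _ \<delta>], rule conjI[OF \<delta>(1)], rule exI[of _ \<gamma>], rule exI[of _ r], rule exI[of _ w], rule exI[of _ v],
        rule exI[of _ q], rule exI[of _ \<mu>], rule conjI[OF c\<gamma> conjI[OF c\<mu> conjI[OF \<gamma>0]]], rule ballI, rule all)
qed

end

context rotational
begin

text \<open>
  Rotate the point into the half plane, take the profile of a chart line in the direction with positive
  \<open>\<Delta>\<close>, and change the parameter.
\<close>

lemma local_profile:
  assumes x: "x \<in> M" "P (f x) \<noteq> 0"
  shows "\<exists>\<epsilon>>0. \<exists>\<theta> \<gamma> r w v q. profile_curve {-\<epsilon><..<\<epsilon>} \<gamma> r w v q \<and> \<gamma> 0 = \<phi> \<theta> x"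
proof -
  \<comment> \<open>The rotation that makes \<open>P (f x)\<close> positive.\<close>
  define \<theta> where "\<theta> = - Arg (P (f x))"
  define x' where "x' = \<phi> \<theta> x"
  have x'M: "x' \<in> M" using x by (simp add: x'_def \<phi>_M)
  have "P (f x') = cis \<theta> * P (f x)" using x by (simp add: x'_def f_\<phi> P_R)
  also have "P (f x) = of_real (cmod (P (f x))) * cis (Arg (P (f x)))"
    using rcis_cmod_Arg[of "P (f x)"] by (simp add: rcis_def)
  also have "cis \<theta> * (of_real (cmod (P (f x))) * cis (Arg (P (f x)))) = of_real (cmod (P (f x)))"
    by (simp add: \<theta>_def mult.left_commute[of "cis _"] cis_mult)
  finally have Px': "P (f x') = of_real (cmod (P (f x)))" .
  obtain W \<sigma> z \<nu> e1 e2 k1 k2 where sh: "shape_at W \<sigma> z \<nu> e1 e2 k1 k2" "\<sigma> z = x'"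
    using shape_exists[OF x'M] by blast
  define \<rho> where "\<rho> = cmod (P (f x))"
  have y: "P (f (\<sigma> z)) = of_real \<rho>" "\<rho> > 0" using Px' sh(2) x by (simp_all add: \<rho>_def)
  let ?D = "\<lambda>v. dir_deriv v (f \<circ> \<sigma>) z"
  let ?\<Delta> = "\<lambda>\<zeta>. Re (Q (f (\<sigma> z))) * Im (Q (?D \<zeta>)) - Im (Q (f (\<sigma> z))) * Re (Q (?D \<zeta>))"
  obtain \<zeta> where \<zeta>: "(Re (P (?D \<zeta>)))\<^sup>2 + (cmod (Q (?D \<zeta>)))\<^sup>2 \<noteq> 0"
    using profile_direction[OF sh(1) y] by blast
  have "\<exists>\<zeta>. (Re (P (?D \<zeta>)))\<^sup>2 + (cmod (Q (?D \<zeta>)))\<^sup>2 \<noteq> 0 \<and> ?\<Delta> \<zeta> > 0"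
  proof (cases "?\<Delta> \<zeta> > 0")
    case False
    have "?\<Delta> \<zeta> \<noteq> 0" by (rule profile_of_chart_line(1)[OF sh(1) y \<zeta>])
    then show ?thesis using False \<zeta>
      by (intro exI[of _ "- \<zeta>"]) (simp add: linear_neg[OF D_linear[OF sh(1)]] plane_coord_simps)
  qed (use \<zeta> in blast)
  then obtain \<zeta> where \<zeta>: "(Re (P (?D \<zeta>)))\<^sup>2 + (cmod (Q (?D \<zeta>)))\<^sup>2 \<noteq> 0" "?\<Delta> \<zeta> > 0" by blast
  obtain \<delta> \<gamma> r w v q \<mu> where \<delta>: "\<delta> > 0" and c: "continuous_on {-\<delta><..<\<delta>} \<gamma>" "continuous_on {-\<delta><..<\<delta>} \<mu>" "\<gamma> 0 = \<sigma> z"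
    and all: "\<forall>t\<in>{-\<delta><..<\<delta>}. \<gamma> t \<in> M \<and> \<mu> t > 0 \<and> r t > 0 \<and> v t > 0 \<and> P (f (\<gamma> t)) = of_real (r t) \<and> Q (f (\<gamma> t)) = q t \<and>
        (r t)\<^sup>2 + (w t)\<^sup>2 + (v t)\<^sup>2 = 1 \<and>
        (r has_real_derivative \<mu> t * (w t * v t)) (at t) \<and>
        (w has_real_derivative \<mu> t * (- (K + 1) * r t * v t)) (at t) \<and>
        (v has_real_derivative \<mu> t * (K * r t * w t)) (at t) \<and>
        (q has_vector_derivative \<mu> t *\<^sub>R (q t * Complex (- r t * w t * v t) ((v t)\<^sup>2) / of_real (1 - (r t)\<^sup>2))) (at t)"
    using profile_of_chart_line(2)[OF sh(1) y \<zeta>(1,2)] by metis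
  note al = bspec[OF all]
  have \<mu>pos: "\<mu> t > 0" if "t \<in> {-\<delta><..<\<delta>}" for t using al[OF that] by blast
  obtain \<epsilon> T where \<epsilon>: "\<epsilon> > 0" and T0: "T 0 = 0"
    and T: "\<forall>s\<in>{-\<epsilon><..<\<epsilon>}. T s \<in> {-\<delta><..<\<delta>} \<and> (T has_real_derivative 1 / \<mu> (T s)) (at s)"
    using time_change[OF \<delta> c(2) \<mu>pos] by metis
  have TI: "T s \<in> {-\<delta><..<\<delta>}" and T': "(T has_real_derivative 1 / \<mu> (T s)) (at s)" if "s \<in> {-\<epsilon><..<\<epsilon>}" for s
    using T that by blast+
  have contT: "continuous_on {-\<epsilon><..<\<epsilon>} T" using T' by (meson DERIV_isCont continuous_at_imp_continuous_on)
  have "profile_curve {-\<epsilon><..<\<epsilon>} (\<gamma> \<circ> T) (r \<circ> T) (w \<circ> T) (v \<circ> T) (q \<circ> T)"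
    unfolding profile_curve_def euler_top_def
  proof (intro conjI ballI)
    show "continuous_on {-\<epsilon><..<\<epsilon>} (\<gamma> \<circ> T)"
      using contT c(1) TI by (intro continuous_on_compose continuous_on_subset[OF c(1)]) auto
    show "(\<gamma> \<circ> T) ` {-\<epsilon><..<\<epsilon>} \<subseteq> M" using al TI by auto
    fix s assume s: "s \<in> {-\<epsilon><..<\<epsilon>}"
    note a = al[OF TI[OF s]]
    have m: "\<mu> (T s) \<noteq> 0" using \<mu>pos[OF TI[OF s]] by simp
    have ch: "((g \<circ> T) has_real_derivative y) (at s)" if "(g has_real_derivative \<mu> (T s) * y) (at (T s))" for g y
      using DERIV_chain[OF that T'[OF s]] m by simp
    show "((r \<circ> T) has_real_derivative (w \<circ> T) s * (v \<circ> T) s) (at s)"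
      "((w \<circ> T) has_real_derivative - (K + 1) * (r \<circ> T) s * (v \<circ> T) s) (at s)"
      "((v \<circ> T) has_real_derivative K * (r \<circ> T) s * (w \<circ> T) s) (at s)"
      using a by (auto intro!: ch simp del: minus_add_distrib)
    show "((r \<circ> T) s)\<^sup>2 + ((w \<circ> T) s)\<^sup>2 + ((v \<circ> T) s)\<^sup>2 = 1" "(r \<circ> T) s > 0" "(v \<circ> T) s > 0"
      "P (f ((\<gamma> \<circ> T) s)) = of_real ((r \<circ> T) s)" "Q (f ((\<gamma> \<circ> T) s)) = (q \<circ> T) s"
      using a by simp_all
    define y where "y = q (T s) * Complex (- r (T s) * w (T s) * v (T s)) ((v (T s))\<^sup>2) / of_real (1 - (r (T s))\<^sup>2)"
    have "(q has_vector_derivative \<mu> (T s) *\<^sub>R y) (at (T s))" using a unfolding y_def by blast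
    from vector_diff_chain_at[OF T'[OF s, unfolded has_real_derivative_iff_has_vector_derivative] this]
    have "((q \<circ> T) has_vector_derivative y) (at s)" using m by simp
    then show "((q \<circ> T) has_vector_derivative (q \<circ> T) s * Complex (- (r \<circ> T) s * (w \<circ> T) s * (v \<circ> T) s) (((v \<circ> T) s)\<^sup>2) /
        of_real (1 - ((r \<circ> T) s)\<^sup>2)) (at s)"
      by (simp only: y_def o_apply)
  qed simp
  then show ?thesis using \<epsilon> c(3) T0 sh(2)
    by (intro exI[of _ \<epsilon>] conjI exI[of _ \<theta>] exI[of _ "\<gamma> \<circ> T"] exI) (auto simp: x'_def)
qed

end

section \<open>Uniqueness for the profile equations\<close>

lemma gronwall_zero:
  fixes D D' :: "real \<Rightarrow> real"
  assumes I: "is_interval I" "s0 \<in> I" "s \<in> I"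
    and D: "\<And>s. s \<in> I \<Longrightarrow> (D has_real_derivative D' s) (at s)" "\<And>s. s \<in> I \<Longrightarrow> \<bar>D' s\<bar> \<le> C * D s"
    and D0: "D s0 = 0" and Dpos: "\<And>s. D s \<ge> 0"
  shows "D s = 0"
proof (cases "s0 \<le> s")
  case True
  have "exp (- C * s) * D s \<le> exp (- C * s0) * D s0"
  proof (rule DERIV_nonpos_imp_nonincreasing[OF True])
    fix x assume "s0 \<le> x" "x \<le> s"
    then have x: "x \<in> I" using I unfolding is_interval_1 by blast
    have "((\<lambda>x. exp (- C * x) * D x) has_real_derivative exp (- C * x) * (D' x - C * D x)) (at x)"
      by (auto intro!: derivative_eq_intros D(1)[OF x] simp: algebra_simps)
    moreover have "exp (- C * x) * (D' x - C * D x) \<le> 0"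
      using D(2)[OF x] by (intro mult_nonneg_nonpos) auto
    ultimately show "\<exists>y. ((\<lambda>x. exp (- C * x) * D x) has_real_derivative y) (at x) \<and> y \<le> 0" by blast
  qed
  then have "D s \<le> 0" using D0 by (simp add: mult_le_0_iff)
  then show ?thesis using Dpos[of s] by linarith
next
  case False
  have "exp (C * s) * D s \<le> exp (C * s0) * D s0"
  proof (rule DERIV_nonneg_imp_nondecreasing[of s s0 "\<lambda>x. exp (C * x) * D x"])
    show "s \<le> s0" using False by simp
  next
    fix x assume "s \<le> x" "x \<le> s0"
    then have x: "x \<in> I" using I unfolding is_interval_1 by blast
    have "((\<lambda>x. exp (C * x) * D x) has_real_derivative exp (C * x) * (D' x + C * D x)) (at x)"
      by (auto intro!: derivative_eq_intros D(1)[OF x] simp: algebra_simps)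
    moreover have "exp (C * x) * (D' x + C * D x) \<ge> 0"
      using D(2)[OF x] by (intro mult_nonneg_nonneg) auto
    ultimately show "\<exists>y. ((\<lambda>x. exp (C * x) * D x) has_real_derivative y) (at x) \<and> 0 \<le> y" by blast
  qed
  then have "D s \<le> 0" using D0 by (simp add: mult_le_0_iff)
  then show ?thesis using Dpos[of s] by linarith
qed

text \<open>
  Gronwall's inequality for the squared distance of two solutions; the solutions stay on the unit sphere,
  so the quadratic terms are Lipschitz.
\<close>

lemma euler_top_unique:
  assumes I: "is_interval I" "s0 \<in> I" "s \<in> I"
    and e1: "euler_top K I r1 w1 v1" and e2: "euler_top K I r2 w2 v2"
    and eq: "r1 s0 = r2 s0" "w1 s0 = w2 s0" "v1 s0 = v2 s0"
  shows "r1 s = r2 s \<and> w1 s = w2 s \<and> v1 s = v2 s"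
proof -
  define L where "L = 1 + \<bar>K + 1\<bar> + \<bar>K\<bar>"
  define D where "D = (\<lambda>s. (r1 s - r2 s)\<^sup>2 + (w1 s - w2 s)\<^sup>2 + (v1 s - v2 s)\<^sup>2)"
  define D' where "D' = (\<lambda>s. 2 * (r1 s - r2 s) * (w1 s * v1 s - w2 s * v2 s) +
     2 * (w1 s - w2 s) * (- (K + 1) * (r1 s * v1 s - r2 s * v2 s)) + 2 * (v1 s - v2 s) * (K * (r1 s * w1 s - r2 s * w2 s)))"
  have "D s = 0"
  proof (rule gronwall_zero[OF I, of D D' "4 * L"])
    fix s assume s: "s \<in> I"
    note a1 = bspec[OF e1[unfolded euler_top_def] s] and a2 = bspec[OF e2[unfolded euler_top_def] s]
    have d: "((\<lambda>s. r1 s - r2 s) has_real_derivative w1 s * v1 s - w2 s * v2 s) (at s)"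
      "((\<lambda>s. w1 s - w2 s) has_real_derivative - (K + 1) * r1 s * v1 s - - (K + 1) * r2 s * v2 s) (at s)"
      "((\<lambda>s. v1 s - v2 s) has_real_derivative K * r1 s * w1 s - K * r2 s * w2 s) (at s)"
      using a1 a2 by (blast intro: DERIV_diff)+
    show "(D has_real_derivative D' s) (at s)"
      unfolding D_def
      by (rule DERIV_cong[OF DERIV_add[OF DERIV_add[OF DERIV_power[OF d(1), of 2] DERIV_power[OF d(2), of 2]] DERIV_power[OF d(3), of 2]]])
        (simp add: D'_def algebra_simps)
    define x y z where xyz: "x = \<bar>r1 s - r2 s\<bar>" "y = \<bar>w1 s - w2 s\<bar>" "z = \<bar>v1 s - v2 s\<bar>"
    have le1: "\<bar>t\<bar> \<le> 1" if "t\<^sup>2 + p\<^sup>2 + q\<^sup>2 = 1" for t p q :: real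
    proof -
      have "t\<^sup>2 \<le> 1" using that zero_le_power2[of p] zero_le_power2[of q] by linarith
      then show ?thesis by (simp add: abs_square_le_1)
    qed
    have b: "\<bar>r1 s\<bar> \<le> 1" "\<bar>w1 s\<bar> \<le> 1" "\<bar>r2 s\<bar> \<le> 1" "\<bar>v2 s\<bar> \<le> 1" "\<bar>w2 s\<bar> \<le> 1"
    proof -
      have n: "(r1 s)\<^sup>2 + (w1 s)\<^sup>2 + (v1 s)\<^sup>2 = 1" "(r2 s)\<^sup>2 + (w2 s)\<^sup>2 + (v2 s)\<^sup>2 = 1" using a1 a2 by blast+
      show "\<bar>r1 s\<bar> \<le> 1" by (rule le1[of _ "w1 s" "v1 s"]) (use n in linarith)
      show "\<bar>w1 s\<bar> \<le> 1" by (rule le1[of _ "r1 s" "v1 s"]) (use n in linarith)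
      show "\<bar>r2 s\<bar> \<le> 1" by (rule le1[of _ "w2 s" "v2 s"]) (use n in linarith)
      show "\<bar>v2 s\<bar> \<le> 1" by (rule le1[of _ "r2 s" "w2 s"]) (use n in linarith)
      show "\<bar>w2 s\<bar> \<le> 1" by (rule le1[of _ "r2 s" "v2 s"]) (use n in linarith)
    qed
    have prod: "\<bar>p * q - p' * q'\<bar> \<le> \<bar>p - p'\<bar> + \<bar>q - q'\<bar>" if "\<bar>p\<bar> \<le> 1" "\<bar>q'\<bar> \<le> 1" for p q p' q' :: real
    proof -
      have "p * q - p' * q' = p * (q - q') + (p - p') * q'" by (simp add: algebra_simps)
      also have "\<bar>\<dots>\<bar> \<le> \<bar>p\<bar> * \<bar>q - q'\<bar> + \<bar>p - p'\<bar> * \<bar>q'\<bar>" using abs_triangle_ineq by (simp add: abs_mult[symmetric])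
      also have "\<dots> \<le> 1 * \<bar>q - q'\<bar> + \<bar>p - p'\<bar> * 1" using that by (intro add_mono mult_mono) auto
      finally show ?thesis by simp
    qed
    have "\<bar>w1 s * v1 s - w2 s * v2 s\<bar> \<le> y + z" "\<bar>r1 s * v1 s - r2 s * v2 s\<bar> \<le> x + z" "\<bar>r1 s * w1 s - r2 s * w2 s\<bar> \<le> x + y"
      using prod b unfolding xyz by blast+
    note b3 = this
    have "\<bar>D' s\<bar> \<le> 2 * x * \<bar>w1 s * v1 s - w2 s * v2 s\<bar> + 2 * y * (\<bar>K + 1\<bar> * \<bar>r1 s * v1 s - r2 s * v2 s\<bar>) +
        2 * z * (\<bar>K\<bar> * \<bar>r1 s * w1 s - r2 s * w2 s\<bar>)"
    proof -
      have 1: "\<bar>p + q + t\<bar> \<le> \<bar>p\<bar> + \<bar>q\<bar> + \<bar>t\<bar>" for p q t :: real by linarith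
      have "\<bar>- (K + 1)\<bar> = \<bar>K + 1\<bar>" by (rule abs_minus_cancel)
      then show ?thesis using 1 unfolding D'_def xyz by (metis (no_types) abs_mult abs_numeral)
    qed
    also have "\<dots> \<le> 2 * x * (y + z) + 2 * y * (\<bar>K + 1\<bar> * (x + z)) + 2 * z * (\<bar>K\<bar> * (x + y))"
      using b3 by (intro add_mono mult_left_mono) (auto simp: xyz)
    also have "\<dots> \<le> 2 * x * (L * (y + z)) + 2 * y * (L * (x + z)) + 2 * z * (L * (x + y))"
    proof -
      have "1 * (y + z) \<le> L * (y + z)" "\<bar>K + 1\<bar> * (x + z) \<le> L * (x + z)" "\<bar>K\<bar> * (x + y) \<le> L * (x + y)"
        by (intro mult_right_mono; simp add: L_def xyz)+
      then show ?thesis by (intro add_mono mult_left_mono) (auto simp: xyz)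
    qed
    also have "\<dots> = 2 * L * (2 * x * y + 2 * y * z + 2 * x * z)" by (simp add: algebra_simps)
    also have "\<dots> \<le> 2 * L * (2 * (x\<^sup>2 + y\<^sup>2 + z\<^sup>2))"
    proof (rule mult_left_mono)
      show "2 * x * y + 2 * y * z + 2 * x * z \<le> 2 * (x\<^sup>2 + y\<^sup>2 + z\<^sup>2)"
        using sum_squares_bound[of x y] sum_squares_bound[of y z] sum_squares_bound[of x z] unfolding distrib_left by linarith
    qed (simp add: L_def)
    also have "\<dots> = 4 * L * D s" by (simp add: D_def xyz)
    finally show "\<bar>D' s\<bar> \<le> 4 * L * D s" .
  qed (auto simp: D_def eq)
  then have "(r1 s - r2 s)\<^sup>2 = 0 \<and> (w1 s - w2 s)\<^sup>2 = 0 \<and> (v1 s - v2 s)\<^sup>2 = 0"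
    unfolding D_def using zero_le_power2[of "r1 s - r2 s"] zero_le_power2[of "w1 s - w2 s"] zero_le_power2[of "v1 s - v2 s"] by linarith
  then show ?thesis by simp
qed

text \<open>
  The quotient of the two solutions is constant. It is written as \<open>q1 * cnj q2 / m\<close>, as \<open>m = |q2|^2\<close>.
\<close>

lemma linear_ode_unique:
  fixes q1 q2 :: "real \<Rightarrow> complex" and m :: "real \<Rightarrow> real"
  assumes I: "is_interval I" "s0 \<in> I" "s \<in> I"
    and q1: "\<And>s. s \<in> I \<Longrightarrow> (q1 has_vector_derivative q1 s * g s) (at s)"
    and q2: "\<And>s. s \<in> I \<Longrightarrow> (q2 has_vector_derivative q2 s * g s) (at s)"
    and m: "\<And>s. s \<in> I \<Longrightarrow> (m has_real_derivative 2 * Re (g s) * m s) (at s)"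
    and norm: "\<And>s. s \<in> I \<Longrightarrow> (cmod (q2 s))\<^sup>2 = m s" "\<And>s. s \<in> I \<Longrightarrow> m s > 0" and eq: "q1 s0 = q2 s0"
  shows "q1 s = q2 s"
proof -
  define k where "k = (\<lambda>s. (1 / m s) *\<^sub>R (q1 s * cnj (q2 s)))"
  have k': "(k has_vector_derivative 0) (at s within I)" if s: "s \<in> I" for s
  proof -
    have mz: "m s \<noteq> 0" using norm(2)[OF s] by simp
    have cj: "((\<lambda>s. cnj (q2 s)) has_vector_derivative cnj (q2 s * g s)) (at s)"
      using bounded_linear.has_vector_derivative[OF bounded_linear_cnj q2[OF s]] .
    have dm: "((\<lambda>s. 1 / m s) has_real_derivative - (2 * Re (g s)) / m s) (at s)"
      using DERIV_divide[OF DERIV_const m[OF s] mz, of 1] mz by simp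
    have "(k has_vector_derivative (1 / m s) *\<^sub>R (q1 s * cnj (q2 s * g s) + q1 s * g s * cnj (q2 s)) +
        (- (2 * Re (g s)) / m s) *\<^sub>R (q1 s * cnj (q2 s))) (at s)"
      unfolding k_def by (rule has_vector_derivative_scaleR[OF dm has_vector_derivative_mult[OF q1[OF s] cj]])
    moreover have "(1 / m s) *\<^sub>R (q1 s * cnj (q2 s * g s) + q1 s * g s * cnj (q2 s)) +
        (- (2 * Re (g s)) / m s) *\<^sub>R (q1 s * cnj (q2 s)) = 0"
    proof -
      have "q1 s * cnj (q2 s * g s) + q1 s * g s * cnj (q2 s) = (q1 s * cnj (q2 s)) * (g s + cnj (g s))"
        by (simp add: algebra_simps)
      also have "\<dots> = (2 * Re (g s)) *\<^sub>R (q1 s * cnj (q2 s))"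
        by (simp add: complex_add_cnj scaleR_conv_of_real mult.commute)
      finally show ?thesis by (simp add: scaleR_conv_of_real)
    qed
    ultimately have "(k has_vector_derivative 0) (at s)" by simp
    then show ?thesis by (rule has_vector_derivative_at_within)
  qed
  obtain c where c: "\<And>s. s \<in> I \<Longrightarrow> k s = c"
    using has_vector_derivative_zero_constant[OF is_interval_convex[OF I(1)] k'] by blast
  have k1: "k t * of_real (m t) = q1 t * cnj (q2 t)" if "t \<in> I" for t
    using norm(2)[OF that] by (simp add: k_def scaleR_conv_of_real)
  have qq: "q2 t * cnj (q2 t) = of_real (m t)" if "t \<in> I" for t
    using norm(1)[OF that] by (simp only: complex_norm_square[symmetric])
  have "c * of_real (m s0) = of_real (m s0)" using k1[OF I(2)] c[OF I(2)] eq qq[OF I(2)] by simp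
  then have "c = 1" using norm(2)[OF I(2)] by simp
  then have "q1 s * cnj (q2 s) = q2 s * cnj (q2 s)" using k1[OF I(3)] c[OF I(3)] qq[OF I(3)] by (metis mult_1)
  moreover have "cnj (q2 s) \<noteq> 0" using norm[OF I(3)] by auto
  ultimately show ?thesis by simp
qed

context rotational
begin

section \<open>Maximal profile curves\<close>

lemma profile_curve_localI:
  assumes "\<And>s. s \<in> I \<Longrightarrow> \<exists>N \<gamma>'. s \<in> N \<and> N \<subseteq> I \<and> profile_curve N \<gamma>' r w v q \<and> (\<forall>t\<in>N. \<gamma> t = \<gamma>' t)"
  shows "profile_curve I \<gamma> r w v q"
proof -
  have point: "\<exists>N. open N \<and> s \<in> N \<and> N \<subseteq> I \<and> isCont \<gamma> s \<and> \<gamma> s \<in> M \<and>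
     (r has_real_derivative w s * v s) (at s) \<and> (w has_real_derivative - (K + 1) * r s * v s) (at s) \<and>
     (v has_real_derivative K * r s * w s) (at s) \<and> (r s)\<^sup>2 + (w s)\<^sup>2 + (v s)\<^sup>2 = 1 \<and>
     r s > 0 \<and> v s > 0 \<and> P (f (\<gamma> s)) = of_real (r s) \<and> Q (f (\<gamma> s)) = q s \<and>
     (q has_vector_derivative q s * Complex (- r s * w s * v s) ((v s)\<^sup>2) / of_real (1 - (r s)\<^sup>2)) (at s)" if s: "s \<in> I" for s
  proof -
    obtain N \<gamma>' where N: "s \<in> N" "N \<subseteq> I" "profile_curve N \<gamma>' r w v q" "\<And>t. t \<in> N \<Longrightarrow> \<gamma> t = \<gamma>' t"
      using assms[OF s] by blast
    note pd = profile_curveD[OF N(3)]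
    have "continuous_on N \<gamma>" using pd(2) N(4) by (simp cong: continuous_on_cong)
    then have "isCont \<gamma> s" using pd(1) N(1) by (simp add: continuous_on_eq_continuous_at)
    moreover have "\<gamma> s \<in> M" using pd(3) N(1,4) by auto
    ultimately show ?thesis
      using N(1,2) pd(1) pd(4)[unfolded euler_top_def] pd(5-9)[OF N(1)] N(4)[OF N(1)] by (intro exI[of _ N]) auto
  qed
  have "open I"
    unfolding open_subopen[of I] using point by blast
  moreover have "continuous_on I \<gamma>" using point by (meson continuous_at_imp_continuous_on)
  moreover have "\<gamma> ` I \<subseteq> M" using point by blast
  moreover have "euler_top K I r w v" unfolding euler_top_def using point by blast
  ultimately show ?thesis unfolding profile_curve_def using point by blast
qed

lemma profile_curves_agree:
  assumes p1: "profile_curve I1 \<gamma>1 r w v q" "is_interval I1" and p2: "profile_curve I2 \<gamma>2 r w v q" "is_interval I2"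
    and eq: "t \<in> I1" "t \<in> I2" "\<gamma>1 t = \<gamma>2 t" and s: "s \<in> I1" "s \<in> I2"
  shows "\<gamma>1 s = \<gamma>2 s"
proof -
  note a = profile_curveD[OF p1(1)] and b = profile_curveD[OF p2(1)]
  have int: "is_interval (I1 \<inter> I2)" using p1(2) p2(2) by (rule is_interval_Int)
  show ?thesis
  proof (rule lifts_agree[OF surf, of "I1 \<inter> I2" t])
    show "connected (I1 \<inter> I2)" using int by (simp add: is_interval_connected)
    show "continuous_on (I1 \<inter> I2) \<gamma>1" "continuous_on (I1 \<inter> I2) \<gamma>2"
      using a(2) b(2) by (auto intro: continuous_on_subset)
    show "\<gamma>1 ` (I1 \<inter> I2) \<subseteq> M" "\<gamma>2 ` (I1 \<inter> I2) \<subseteq> M" using a(3) b(3) by auto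
    show "f (\<gamma>1 s) = f (\<gamma>2 s)" if "s \<in> I1 \<inter> I2" for s
      by (rule PQ_eqI) (use a(7,8)[of s] b(7,8)[of s] that in auto)
  qed (use eq s in auto)
qed

text \<open>
  The union of all profile curves on intervals that start at the same point of \<open>M\<close>. They fit together by
  \<open>lifts_agree\<close>. The data \<open>r, w, v, q\<close> are prescribed on the whole line, so a competitor that meets the
  maximal curve anywhere extends it.
\<close>

lemma maximal_profile_curve:
  assumes p0: "profile_curve I0 \<gamma>0 r w v q" "is_interval I0" "s0 \<in> I0"
  shows "\<exists>I \<gamma>. profile_curve I \<gamma> r w v q \<and> is_interval I \<and> s0 \<in> I \<and> \<gamma> s0 = \<gamma>0 s0 \<and>
    (\<forall>I' \<gamma>' s. profile_curve I' \<gamma>' r w v q \<longrightarrow> is_interval I' \<longrightarrow> s \<in> I \<longrightarrow> s \<in> I' \<longrightarrow> \<gamma> s = \<gamma>' s \<longrightarrow>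
       I' \<subseteq> I \<and> (\<forall>t\<in>I'. \<gamma> t = \<gamma>' t))"
proof -
  define L where "L = {(I, \<gamma>). profile_curve I \<gamma> r w v q \<and> is_interval I \<and> s0 \<in> I \<and> \<gamma> s0 = \<gamma>0 s0}"
  define I where "I = (\<Union>(N, \<gamma>)\<in>L. N)"
  define \<gamma> where "\<gamma> = (\<lambda>s. snd (SOME x. x \<in> L \<and> s \<in> fst x) s)"
  have \<gamma>eq: "\<gamma> s = \<gamma>' s" if "(N, \<gamma>') \<in> L" "s \<in> N" for N \<gamma>' s
  proof -
    have "\<exists>x. x \<in> L \<and> s \<in> fst x" using that by (intro exI[of _ "(N, \<gamma>')"]) simp
    note some = someI_ex[OF this]
    obtain N1 \<gamma>1 where x1: "(SOME x. x \<in> L \<and> s \<in> fst x) = (N1, \<gamma>1)" by (rule prod.exhaust)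
    note x = x1 some[unfolded x1, THEN conjunct1] some[unfolded x1, THEN conjunct2, unfolded fst_conv]
    have "\<gamma>1 s = \<gamma>' s"
      using x(2,3) that unfolding L_def by (rule_tac profile_curves_agree[of N1 \<gamma>1 r w v q N \<gamma>' s0]) auto
    then show ?thesis by (simp add: \<gamma>_def x(1))
  qed
  have L0: "(I0, \<gamma>0) \<in> L" using p0 by (simp add: L_def)
  have pI: "profile_curve I \<gamma> r w v q"
  proof (rule profile_curve_localI)
    fix s assume "s \<in> I"
    then obtain N \<gamma>' where "(N, \<gamma>') \<in> L" "s \<in> N" by (auto simp: I_def)
    then show "\<exists>N \<gamma>'. s \<in> N \<and> N \<subseteq> I \<and> profile_curve N \<gamma>' r w v q \<and> (\<forall>t\<in>N. \<gamma> t = \<gamma>' t)"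
      using \<gamma>eq by (intro exI[of _ N] exI[of _ \<gamma>']) (auto simp: I_def L_def)
  qed
  have "connected (\<Union>(fst ` L))"
    by (rule connected_Union) (use p0(3) in \<open>auto simp: L_def is_interval_connected intro!: exI[of _ s0]\<close>)
  moreover have "I = \<Union>(fst ` L)" by (auto simp: I_def)
  ultimately have int: "is_interval I" by (simp add: is_interval_connected_1)
  have s0: "s0 \<in> I" "\<gamma> s0 = \<gamma>0 s0" using L0 p0(3) \<gamma>eq[OF L0 p0(3)] by (auto simp: I_def)
  have "I' \<subseteq> I \<and> (\<forall>t\<in>I'. \<gamma> t = \<gamma>' t)"
    if p': "profile_curve I' \<gamma>' r w v q" "is_interval I'" and s: "s \<in> I" "s \<in> I'" "\<gamma> s = \<gamma>' s" for I' \<gamma>' s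
  proof -
    \<comment> \<open>The competitor is glued to the maximal curve.\<close>
    define \<gamma>2 where "\<gamma>2 = (\<lambda>t. if t \<in> I then \<gamma> t else \<gamma>' t)"
    have \<gamma>2: "\<gamma>2 t = \<gamma>' t" if "t \<in> I'" for t
      using profile_curves_agree[OF pI int p' s] that by (simp add: \<gamma>2_def)
    have "profile_curve (I \<union> I') \<gamma>2 r w v q"
    proof (rule profile_curve_localI)
      fix t assume "t \<in> I \<union> I'"
      then show "\<exists>N \<gamma>''. t \<in> N \<and> N \<subseteq> I \<union> I' \<and> profile_curve N \<gamma>'' r w v q \<and> (\<forall>t\<in>N. \<gamma>2 t = \<gamma>'' t)"
      proof
        assume "t \<in> I" then show ?thesis using pI by (intro exI[of _ I] exI[of _ \<gamma>]) (auto simp: \<gamma>2_def)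
      next
        assume "t \<in> I'" then show ?thesis using p'(1) \<gamma>2 by (intro exI[of _ I'] exI[of _ \<gamma>']) auto
      qed
    qed
    moreover have "is_interval (I \<union> I')"
      using int p'(2) s(1,2) connected_Un[of I I'] by (auto simp: is_interval_connected_1)
    ultimately have "(I \<union> I', \<gamma>2) \<in> L" using s0 by (simp add: L_def \<gamma>2_def)
    then have sub: "I' \<subseteq> I" by (auto simp: I_def)
    then show ?thesis using profile_curves_agree[OF pI int p' s] by blast
  qed
  then show ?thesis using pI int s0 by (intro exI[of _ I] exI[of _ \<gamma>] conjI) blast+
qed

text \<open>
  The full turn \<open>\<phi> \<kappa>\<close> acts trivially on the image but possibly not on \<open>M\<close>, which may cover its image.
\<close>

lemma profile_curve_shift:
  assumes p: "profile_curve I \<gamma> r w v q" and "cis \<kappa> = 1"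
  shows "profile_curve {s. s + h \<in> I} (\<lambda>s. \<phi> \<kappa> (\<gamma> (s + h))) (\<lambda>s. r (s + h)) (\<lambda>s. w (s + h)) (\<lambda>s. v (s + h)) (\<lambda>s. q (s + h))"
  unfolding profile_curve_def euler_top_def
proof (intro conjI ballI)
  note pd = profile_curveD[OF p]
  have "open ((\<lambda>s. s + h) -` I)" by (intro open_vimage pd(1) continuous_intros)
  then show "open {s. s + h \<in> I}" by (simp add: vimage_def)
  have \<gamma>M: "\<gamma> s \<in> M" if "s \<in> I" for s using pd(3) that by blast
  show "continuous_on {s. s + h \<in> I} (\<lambda>s. \<phi> \<kappa> (\<gamma> (s + h)))"
    using \<gamma>M by (intro \<phi>_continuous_on continuous_intros continuous_on_compose2[OF pd(2)]) auto
  show "(\<lambda>s. \<phi> \<kappa> (\<gamma> (s + h))) ` {s. s + h \<in> I} \<subseteq> M" using \<gamma>M \<phi>_M by auto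
  fix s assume "s \<in> {s. s + h \<in> I}"
  then have s: "s + h \<in> I" by simp
  have e: "(r has_real_derivative w (s + h) * v (s + h)) (at (s + h))" "(w has_real_derivative - (K + 1) * r (s + h) * v (s + h)) (at (s + h))"
    "(v has_real_derivative K * r (s + h) * w (s + h)) (at (s + h))"
    using pd(4) s unfolding euler_top_def by blast+
  then show "((\<lambda>s. r (s + h)) has_real_derivative w (s + h) * v (s + h)) (at s)"
    "((\<lambda>s. w (s + h)) has_real_derivative - (K + 1) * r (s + h) * v (s + h)) (at s)"
    "((\<lambda>s. v (s + h)) has_real_derivative K * r (s + h) * w (s + h)) (at s)"
    by (simp_all only: DERIV_shift[symmetric])
  show "(r (s + h))\<^sup>2 + (w (s + h))\<^sup>2 + (v (s + h))\<^sup>2 = 1" by (rule pd(10)[OF s])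
  show "r (s + h) > 0" "v (s + h) > 0" using pd(5,6)[OF s] .
  show "P (f (\<phi> \<kappa> (\<gamma> (s + h)))) = of_real (r (s + h))" "Q (f (\<phi> \<kappa> (\<gamma> (s + h)))) = q (s + h)"
    using pd(7,8)[OF s] assms(2) by (simp_all add: f_\<phi>[OF \<gamma>M[OF s]] P_R Q_R)
  show "((\<lambda>s. q (s + h)) has_vector_derivative q (s + h) * Complex (- r (s + h) * w (s + h) * v (s + h)) ((v (s + h))\<^sup>2) /
      of_real (1 - (r (s + h))\<^sup>2)) (at s)"
    using has_vector_derivative_shift[of q _ h s] pd(9)[OF s] by (simp add: add.commute)
qed

text \<open>
  Uniqueness for both differential equations: a global solution with the initial values of a profile curve
  can serve as its data.
\<close>

lemma profile_curve_solution:
  assumes p: "profile_curve I \<gamma> r' w' v' q'" "is_interval I" "s0 \<in> I"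
    and top: "euler_top K UNIV r w v"
    and q: "\<And>s. r s > 0 \<Longrightarrow> v s > 0 \<Longrightarrow>
      (q has_vector_derivative q s * Complex (- r s * w s * v s) ((v s)\<^sup>2) / of_real (1 - (r s)\<^sup>2)) (at s)"
    and eq: "r' s0 = r s0" "w' s0 = w s0" "v' s0 = v s0" "q' s0 = q s0"
  shows "profile_curve I \<gamma> r w v q"
proof -
  note pd = profile_curveD[OF p(1)]
  have topI: "euler_top K I r w v" using top by (simp add: euler_top_def)
  have e: "r' s = r s" "w' s = w s" "v' s = v s" if "s \<in> I" for s
    using euler_top_unique[OF p(2,3) that pd(4) topI eq(1-3)] by auto
  have qI: "(q has_vector_derivative q s * (Complex (- r s * w s * v s) ((v s)\<^sup>2) / of_real (1 - (r s)\<^sup>2))) (at s)" if "s \<in> I" for s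
    using q[of s] pd(5,6)[OF that] e[OF that] by simp
  have q'I: "(q' has_vector_derivative q' s * (Complex (- r s * w s * v s) ((v s)\<^sup>2) / of_real (1 - (r s)\<^sup>2))) (at s)" if "s \<in> I" for s
    using pd(9)[OF that] e[OF that] by simp
  have q'eq: "q s = q' s" if s: "s \<in> I" for s
  proof (rule linear_ode_unique[OF p(2,3) s qI q'I, where m = "\<lambda>s. 1 - (r s)\<^sup>2"])
    fix t assume t: "t \<in> I"
    have "1 - (r t)\<^sup>2 > 0" using pd(13)[OF t] e[OF t] by simp
    then show "1 - (r t)\<^sup>2 > 0" .
    show "(cmod (q' t))\<^sup>2 = 1 - (r t)\<^sup>2" using pd(12)[OF t] e[OF t] by simp
    have "((\<lambda>s. 1 - (r s)\<^sup>2) has_real_derivative - (2 * r t * (w t * v t))) (at t)"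
      using top unfolding euler_top_def by (auto intro!: derivative_eq_intros)
    moreover have "- (2 * r t * (w t * v t)) = 2 * Re (Complex (- r t * w t * v t) ((v t)\<^sup>2) / of_real (1 - (r t)\<^sup>2)) * (1 - (r t)\<^sup>2)"
      using \<open>1 - (r t)\<^sup>2 > 0\<close> by (simp add: Re_divide_of_real del: of_real_diff)
    ultimately show "((\<lambda>s. 1 - (r s)\<^sup>2) has_real_derivative
        2 * Re (Complex (- r t * w t * v t) ((v t)\<^sup>2) / of_real (1 - (r t)\<^sup>2)) * (1 - (r t)\<^sup>2)) (at t)" by simp
  qed (use eq in simp_all)
  show ?thesis
    unfolding profile_curve_def
    using pd(1-3,5-8) e q'eq topI qI by (auto simp: mult.assoc)
qed

text \<open>
  If an orbit of \<open>\<beta>\<close> meets the maximal curve \<open>\<gamma>\<close>, the two curves touch after a rotation of \<open>\<beta>\<close>, have there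
  the same data, and so the rotated \<open>\<beta>\<close> is a reparametrised piece of \<open>\<gamma>\<close>.
\<close>

lemma sweep_absorbs:
  assumes p: "profile_curve I \<gamma> r w v q" "is_interval I"
    and top: "euler_top K UNIV r w v"
    and q: "\<And>s. r s > 0 \<Longrightarrow> v s > 0 \<Longrightarrow>
      (q has_vector_derivative q s * Complex (- r s * w s * v s) ((v s)\<^sup>2) / of_real (1 - (r s)\<^sup>2)) (at s)"
    and max: "\<And>I' \<gamma>' s. profile_curve I' \<gamma>' r w v q \<Longrightarrow> is_interval I' \<Longrightarrow> s \<in> I \<Longrightarrow> s \<in> I' \<Longrightarrow> \<gamma> s = \<gamma>' s \<Longrightarrow>
       I' \<subseteq> I \<and> (\<forall>t\<in>I'. \<gamma> t = \<gamma>' t)"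
    and p': "profile_curve N \<beta> r' w' v' q'" "is_interval N"
    and meet: "\<phi> t1 (\<beta> s1) = \<phi> t2 (\<gamma> s2)" "s1 \<in> N" "s2 \<in> I" and s: "s \<in> N"
  shows "\<exists>t' s'. s' \<in> I \<and> \<phi> t (\<beta> s) = \<phi> t' (\<gamma> s')"
proof -
  note pd = profile_curveD[OF p(1)] and pd' = profile_curveD[OF p'(1)]
  have M: "\<beta> s1 \<in> M" "\<gamma> s2 \<in> M" "\<beta> s \<in> M" using pd(3) pd'(3) meet s by auto
  define \<kappa> where "\<kappa> = t1 - t2"
  have "\<phi> (- t2) (\<phi> t1 (\<beta> s1)) = \<phi> (- t2) (\<phi> t2 (\<gamma> s2))" using meet(1) by simp
  then have k: "\<phi> \<kappa> (\<beta> s1) = \<gamma> s2"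
    using \<phi>_add[OF M(1), of "- t2" t1] \<phi>_add[OF M(2), of "- t2" t2] \<phi>_0[OF M(2)] by (simp add: \<kappa>_def)
  have "cis \<kappa> * of_real (r' s1) = of_real (r s2)"
    using arg_cong[OF k, of "\<lambda>x. P (f x)"] pd(7)[OF meet(3)] pd'(7)[OF meet(2)] by (simp add: f_\<phi>[OF M(1)] P_R)
  moreover from this have "cmod (cis \<kappa> * of_real (r' s1)) = cmod (of_real (r s2))" by simp
  then have "r' s1 = r s2" using pd(5)[OF meet(3)] pd'(5)[OF meet(2)] by (simp add: norm_mult)
  ultimately have cis: "cis \<kappa> = 1" using pd(5)[OF meet(3)] by simp
  define h where "h = s1 - s2"
  define N' where "N' = {s. s + h \<in> N}"
  note sh = profile_curve_shift[OF p'(1) cis, of h, folded N'_def]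
  have intN': "is_interval N'" using p'(2) unfolding N'_def is_interval_1 by (smt (verit) mem_Collect_eq)
  have s2N': "s2 \<in> N'" using meet(2) by (simp add: N'_def h_def)
  have join: "\<phi> \<kappa> (\<beta> (s2 + h)) = \<gamma> s2" using k by (simp add: h_def)
  have det: "r' (s2 + h) = r s2" "w' (s2 + h) = w s2" "v' (s2 + h) = v s2" "q' (s2 + h) = q s2"
    using profile_curve_determined[OF sh s2N' p(1) meet(3) join] by auto
  have "profile_curve N' (\<lambda>s. \<phi> \<kappa> (\<beta> (s + h))) r w v q"
    by (rule profile_curve_solution[OF sh intN' s2N' top q det])
  from max[OF this intN' meet(3) s2N'] join
  have sub: "N' \<subseteq> I" and eq: "\<And>t. t \<in> N' \<Longrightarrow> \<gamma> t = \<phi> \<kappa> (\<beta> (t + h))" by auto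
  have sN': "s - h \<in> N'" using s by (simp add: N'_def)
  have "\<phi> (t - \<kappa>) (\<gamma> (s - h)) = \<phi> t (\<beta> s)"
    using eq[OF sN'] \<phi>_add[OF M(3), of "t - \<kappa>" \<kappa>] by simp
  then show ?thesis using sub sN' by (intro exI[of _ "t - \<kappa>"] exI[of _ "s - h"]) auto
qed

end

context rotational
begin

section \<open>The surface is the sweep of one profile curve\<close>

lemma sweep_normal_length:
  assumes p: "profile_curve I \<gamma> r w v q" "s \<in> I"
    and sh: "shape_at W \<sigma> z \<nu> e1 e2 k1 k2" "\<sigma> z = \<phi> t (\<gamma> s)"
  shows "cmod (P \<nu>) = v s" "cmod (P (f (\<sigma> z))) = r s"
proof -
  note pd = profile_curveD[OF p(1)]
  have M: "\<gamma> s \<in> M" using pd(3) p(2) by blast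
  show "cmod (P \<nu>) = v s"
    using profile_normal[OF p sweep_normal[OF p sh]] by (simp add: P_R norm_mult)
  show "cmod (P (f (\<sigma> z))) = r s"
    using pd(5,7)[OF p(2)] by (simp add: sh(2) f_\<phi>[OF M] P_R norm_mult)
qed

text \<open>
  Near a point of the axis, \<open>r\<close> is small and the tangent plane is close to the plane of rotation, so that
  \<open>v = |P \<nu>|\<close> is small too. The constant value \<open>h \<noteq> 0\<close> of \<open>v^2 - K r^2\<close> does not allow both.
\<close>

lemma axis_not_adherent:
  assumes p: "profile_curve I \<gamma> r w v q" and h: "\<And>s. s \<in> I \<Longrightarrow> (v s)\<^sup>2 - K * (r s)\<^sup>2 = h" "h \<noteq> 0"
    and y: "y \<in> M" "P (f y) = 0"
  shows "\<exists>U. openin (top_of_set M) U \<and> y \<in> U \<and> U \<inter> {\<phi> t (\<gamma> s) | t s. s \<in> I} = {}"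
proof -
  obtain W \<sigma> z \<nu> e1 e2 k1 k2 where sh: "shape_at W \<sigma> z \<nu> e1 e2 k1 k2" "\<sigma> z = y"
    using shape_exists[OF y(1)] by blast
  note ch = shape_chart[OF sh(1)]
  let ?X = "f \<circ> \<sigma>"
  have ax: "P (f (\<sigma> z)) = 0" using y sh by simp
  obtain \<zeta>a where "P (dir_deriv \<zeta>a ?X z) = 1 \<and> Q (dir_deriv \<zeta>a ?X z) = 0"
    using axis_tangent_plane(1)[OF sh(1) ax] by blast
  then have a: "dir_deriv \<zeta>a ?X z = a" by (intro PQ_eqI) (simp_all add: P_frame)
  obtain \<zeta>b where "P (dir_deriv \<zeta>b ?X z) = \<i> \<and> Q (dir_deriv \<zeta>b ?X z) = 0"
    using axis_tangent_plane(1)[OF sh(1) ax] by blast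
  then have b: "dir_deriv \<zeta>b ?X z = b" by (intro PQ_eqI) (simp_all add: P_frame)
  \<comment> \<open>A continuous function that vanishes at \<open>y\<close> and, by \<open>bound\<close> below, majorises \<open>|v^2 - K r^2|\<close> on the sweep.\<close>
  define \<eta> where "\<eta> = (\<lambda>z'. (norm (a - dir_deriv \<zeta>a ?X z'))\<^sup>2 + (norm (b - dir_deriv \<zeta>b ?X z'))\<^sup>2 + \<bar>K\<bar> * (cmod (P (?X z')))\<^sup>2)"
  have "continuous_on W ?X"
    using immersion_has_derivative[OF ch(3,4)] by (meson continuous_at_imp_continuous_on has_derivative_continuous)
  then have "continuous_on W (\<lambda>z'. P (?X z'))"
    by (rule bounded_linear.continuous_on[OF plane_coord_bounded_linear])
  then have "continuous_on W \<eta>"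
    unfolding \<eta>_def by (intro continuous_intros dir_deriv_continuous_on[OF ch(3,4)])
  then have oB: "open (W \<inter> \<eta> -` {..<\<bar>h\<bar>})" by (rule continuous_open_preimage[OF _ ch(3) open_lessThan])
  let ?B = "W \<inter> \<eta> -` {..<\<bar>h\<bar>}"
  have "\<eta> z = 0" by (simp add: \<eta>_def a b ax)
  then have zB: "z \<in> ?B" using ch(2) h(2) by simp
  have no: False if z': "z' \<in> ?B" "\<sigma> z' = \<phi> t (\<gamma> s)" "s \<in> I" for z' t s
  proof -
    have x: "\<sigma> z' \<in> M" "z' \<in> W" using ch(5) z' by auto
    obtain W' \<sigma>' z'' \<nu>' e1' e2' k1' k2' where sh': "shape_at W' \<sigma>' z'' \<nu>' e1' e2' k1' k2'" "\<sigma>' z'' = \<sigma> z'"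
      using shape_exists[OF x(1)] by blast
    have len: "cmod (P \<nu>') = v s" "cmod (P (f (\<sigma> z'))) = r s"
      using sweep_normal_length[OF p z'(3) sh'(1)] sh'(2) z'(2) by simp_all
    have perp: "\<nu>' \<bullet> dir_deriv \<zeta> ?X z' = 0" for \<zeta>
    proof -
      obtain \<tau> where "homeomorphism W (\<sigma> ` W) \<sigma> \<tau>" using local_coordsD(5)[OF ch(1)] by blast
      then have c\<sigma>: "continuous_on W \<sigma>" by (simp add: homeomorphism_def)
      define T where "T = (\<lambda>t::real. z' + t *\<^sub>R \<zeta>) -` W"
      have oT: "open T" unfolding T_def by (intro open_vimage ch(3) continuous_intros)
      have T0: "0 \<in> T" using x(2) by (simp add: T_def)
      have "\<forall>\<^sub>F t in nhds 0. t \<in> T" by (rule eventually_nhds_in_open[OF oT T0])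
      then have 1: "\<forall>\<^sub>F t in nhds 0. \<sigma> (z' + t *\<^sub>R \<zeta>) \<in> M" by eventually_elim (use ch(5) in \<open>auto simp: T_def\<close>)
      have "continuous_on T (\<lambda>t. \<sigma> (z' + t *\<^sub>R \<zeta>))"
        by (rule continuous_on_compose2[OF c\<sigma>]) (auto simp: T_def intro!: continuous_intros)
      then have 2: "isCont (\<lambda>t. \<sigma> (z' + t *\<^sub>R \<zeta>)) 0" using oT T0 by (simp add: continuous_on_eq_continuous_at)
      have line: "((\<lambda>t::real. z' + t *\<^sub>R \<zeta>) has_derivative (\<lambda>h. h *\<^sub>R \<zeta>)) (at 0)" by (auto intro!: derivative_eq_intros)
      have "((\<lambda>t. f (\<sigma> (z' + t *\<^sub>R \<zeta>))) has_vector_derivative dir_deriv \<zeta> ?X z') (at 0)"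
        using has_derivative_compose[OF line, of ?X "\<lambda>v. dir_deriv v ?X z'"] immersion_has_derivative[OF ch(3,4) x(2)]
        unfolding has_vector_derivative_def by (simp add: linear_scale[OF dir_deriv_linear[OF ch(3,4) x(2)]])
      then have "\<exists>\<xi>. dir_deriv \<xi> (f \<circ> \<sigma>') z'' = dir_deriv \<zeta> ?X z'"
        by (rule curve_tangent[OF sh'(1) _ 1 2, rotated]) (simp add: sh'(2))
      then obtain \<xi> where "dir_deriv \<xi> (f \<circ> \<sigma>') z'' = dir_deriv \<zeta> ?X z'" by blast
      then show ?thesis using shape_normal(3)[OF sh'(1)] by metis
    qed
    have bound: "(\<nu>' \<bullet> e)\<^sup>2 \<le> (norm (e - dir_deriv \<zeta> ?X z'))\<^sup>2" for e \<zeta>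
    proof -
      have "\<nu>' \<bullet> e = \<nu>' \<bullet> (e - dir_deriv \<zeta> ?X z')" using perp by (simp add: inner_diff_right)
      then have "\<bar>\<nu>' \<bullet> e\<bar> \<le> norm (e - dir_deriv \<zeta> ?X z')"
        using Cauchy_Schwarz_ineq2[of \<nu>' "e - dir_deriv \<zeta> ?X z'"] shape_normal(1)[OF sh'(1)] by simp
      then show ?thesis by (metis abs_le_square_iff abs_norm_cancel)
    qed
    have "(v s)\<^sup>2 = (\<nu>' \<bullet> a)\<^sup>2 + (\<nu>' \<bullet> b)\<^sup>2" unfolding len(1)[symmetric] by (simp add: plane_coord_def cmod_power2)
    then have v: "(v s)\<^sup>2 \<le> (norm (a - dir_deriv \<zeta>a ?X z'))\<^sup>2 + (norm (b - dir_deriv \<zeta>b ?X z'))\<^sup>2"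
      using bound[of a \<zeta>a] bound[of b \<zeta>b] by linarith
    have "\<bar>h\<bar> \<le> (v s)\<^sup>2 + \<bar>K * (r s)\<^sup>2\<bar>" using h(1)[OF z'(3)] zero_le_power2[of "v s"] by linarith
    also have "\<dots> \<le> \<eta> z'" using v len(2) by (simp add: \<eta>_def abs_mult)
    finally show False using z'(1) by simp
  qed
  have "openin (top_of_set M) (\<sigma> ` ?B)" by (rule local_coords_open_image[OF ch(1) oB]) simp
  moreover have "y \<in> \<sigma> ` ?B" using zB sh(2) by blast
  moreover have "\<sigma> ` ?B \<inter> {\<phi> t (\<gamma> s) | t s. s \<in> I} = {}" using no by blast
  ultimately show ?thesis by blast
qed

lemma euler_top_conserved:
  assumes "euler_top K UNIV r w v" shows "(v s)\<^sup>2 - K * (r s)\<^sup>2 = (v s0)\<^sup>2 - K * (r s0)\<^sup>2"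
proof -
  have "((\<lambda>s. (v s)\<^sup>2 - K * (r s)\<^sup>2) has_real_derivative 0) (at s)" for s
    using assms unfolding euler_top_def by (auto intro!: derivative_eq_intros)
  then show ?thesis using DERIV_isconst_all[of "\<lambda>s. (v s)\<^sup>2 - K * (r s)\<^sup>2"] by blast
qed

text \<open>
  The sweep \<open>G\<close> of the maximal curve is open. It is closed as well: a point on the axis is not adherent to
  it, and the sweep of the local profile through any other point is a neighbourhood that lies in \<open>G\<close> as
  soon as it meets \<open>G\<close>. The surface is connected.
\<close>

theorem surface_is_sweep:
  assumes p0: "profile_curve I0 \<gamma>0 r w v q" "is_interval I0" "s0 \<in> I0"
    and top: "euler_top K UNIV r w v"
    and q: "\<And>s. r s > 0 \<Longrightarrow> v s > 0 \<Longrightarrow>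
      (q has_vector_derivative q s * Complex (- r s * w s * v s) ((v s)\<^sup>2) / of_real (1 - (r s)\<^sup>2)) (at s)"
    and nontub: "(v s0)\<^sup>2 \<noteq> K * (r s0)\<^sup>2"
  shows "\<exists>I \<gamma>. profile_curve I \<gamma> r w v q \<and> is_interval I \<and> s0 \<in> I \<and> M = {\<phi> t (\<gamma> s) | t s. s \<in> I}"
proof -
  obtain I \<gamma> where I: "profile_curve I \<gamma> r w v q" "is_interval I" "s0 \<in> I"
    and max: "\<And>I' \<gamma>' s. profile_curve I' \<gamma>' r w v q \<Longrightarrow> is_interval I' \<Longrightarrow> s \<in> I \<Longrightarrow> s \<in> I' \<Longrightarrow> \<gamma> s = \<gamma>' s \<Longrightarrow>
       I' \<subseteq> I \<and> (\<forall>t\<in>I'. \<gamma> t = \<gamma>' t)"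
    using maximal_profile_curve[OF p0] by metis
  define G where "G = {\<phi> t (\<gamma> s) | t s. s \<in> I}"
  note pd = profile_curveD[OF I(1)]
  have GM: "G \<subseteq> M" using pd(3) \<phi>_M by (auto simp: G_def)
  have "openin (top_of_set M) G" unfolding G_def by (rule profile_sweep_open[OF I(1)])
  moreover have "openin (top_of_set M) (M - G)"
  proof (subst openin_subopen, intro ballI)
    fix y assume y: "y \<in> M - G"
    show "\<exists>T. openin (top_of_set M) T \<and> y \<in> T \<and> T \<subseteq> M - G"
    proof (cases "P (f y) = 0")
      case True
      obtain U where U: "openin (top_of_set M) U" "y \<in> U" "U \<inter> G = {}"
        using axis_not_adherent[OF I(1), of "(v s0)\<^sup>2 - K * (r s0)\<^sup>2" y] euler_top_conserved[OF top] nontub y True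
        unfolding G_def by auto
      have "U \<subseteq> M - G" using openin_imp_subset[OF U(1)] U(3) by blast
      with U(1,2) show ?thesis by (intro exI[of _ U] conjI)
    next
      case False
      obtain \<epsilon> \<theta> \<beta> r' w' v' q' where \<epsilon>: "\<epsilon> > 0" "profile_curve {-\<epsilon><..<\<epsilon>} \<beta> r' w' v' q'" "\<beta> 0 = \<phi> \<theta> y"
        using local_profile[of y] y False by blast
      have int: "is_interval {-\<epsilon><..<\<epsilon>}" by (simp add: is_interval_1)
      let ?N = "{\<phi> t (\<beta> s) | t s. s \<in> {-\<epsilon><..<\<epsilon>}}"
      have oN: "openin (top_of_set M) ?N" by (rule profile_sweep_open[OF \<epsilon>(2)])
      have yN: "y \<in> ?N"
      proof -
        have "\<phi> (- \<theta>) (\<beta> 0) = y" using \<phi>_add[of y "- \<theta>" \<theta>] \<phi>_0[of y] y \<epsilon>(3) by simp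
        then show ?thesis using \<epsilon>(1) by force
      qed
      have disj: "?N \<inter> G = {}"
      proof (rule ccontr)
        assume "?N \<inter> G \<noteq> {}"
        then obtain t1 s1 t2 s2 where m: "\<phi> t1 (\<beta> s1) = \<phi> t2 (\<gamma> s2)" "s1 \<in> {-\<epsilon><..<\<epsilon>}" "s2 \<in> I"
          by (auto simp: G_def)
        obtain t s where ts: "y = \<phi> t (\<beta> s)" "s \<in> {-\<epsilon><..<\<epsilon>}" using yN by blast
        have "\<exists>t' s'. s' \<in> I \<and> \<phi> t (\<beta> s) = \<phi> t' (\<gamma> s')"
          by (rule sweep_absorbs[OF I(1,2) top q max \<epsilon>(2) int m ts(2)])
        then have "y \<in> G" using ts(1) by (auto simp: G_def)
        then show False using y by simp
      qed
      have "?N \<subseteq> M - G" using openin_imp_subset[OF oN] disj by (simp only: Diff_eq) blast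
      with oN yN show ?thesis by (intro exI[of _ ?N] conjI)
    qed
  qed
  then have "closedin (top_of_set M) G" using GM by (simp add: closedin_def)
  moreover have "connected M" using surf by (simp add: immersed_surface_S3_def)
  ultimately have "G = {} \<or> G = M" using connected_clopen[of M] by blast
  moreover have "\<phi> 0 (\<gamma> s0) \<in> G" using I(3) by (auto simp: G_def)
  ultimately have "M = G" by blast
  then show ?thesis using I unfolding G_def by blast
qed

text \<open>
  The orbits all have normal curvature of modulus \<open>v / r\<close>.
\<close>

lemma constant_radius_tubular:
  assumes p: "profile_curve I \<gamma> r w v q" and M: "M = {\<phi> t (\<gamma> s) | t s. s \<in> I}"
    and const: "\<And>s. s \<in> I \<Longrightarrow> r s = \<rho> \<and> v s = \<upsilon>"
  shows "tubular f M"
  unfolding tubular_def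
proof (rule exI[of _ "\<upsilon> / \<rho>"], rule ballI)
  fix x assume x: "x \<in> M"
  then obtain t s where ts: "x = \<phi> t (\<gamma> s)" "s \<in> I" using M by blast
  obtain W \<sigma> z \<nu> e1 e2 k1 k2 where sh: "shape_at W \<sigma> z \<nu> e1 e2 k1 k2" "\<sigma> z = x"
    using shape_exists[OF x] by blast
  have len: "cmod (P \<nu>) = \<upsilon>" "cmod (P (f (\<sigma> z))) = \<rho>"
    using sweep_normal_length[OF p ts(2) sh(1)] sh(2) ts(1) const[OF ts(2)] by simp_all
  have pos: "\<rho> > 0" "\<upsilon> > 0" using profile_curveD(5,6)[OF p ts(2)] const[OF ts(2)] by auto
  then have off: "P (f (\<sigma> z)) \<noteq> 0" using len(2) by auto
  have "(kappa (f (\<sigma> z)) \<nu>)\<^sup>2 = (\<upsilon> / \<rho>)\<^sup>2" using J_normal(2)[OF sh(1) off] len by (simp add: power_divide)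
  then have k: "- kappa (f (\<sigma> z)) \<nu> = \<upsilon> / \<rho> \<or> - kappa (f (\<sigma> z)) \<nu> = - (\<upsilon> / \<rho>)" by (auto simp: power2_eq_iff)
  have *: "\<exists>k. principal_curvatures f M x (\<upsilon> / \<rho>) k"
    if "shape_at W \<sigma> z \<nu> e1 e2 k1 k2" "k1 = \<upsilon> / \<rho> \<or> k1 = - (\<upsilon> / \<rho>)" for e1 e2 k1 k2
    using that(2)
  proof
    assume "k1 = \<upsilon> / \<rho>"
    then show ?thesis unfolding principal_curvatures_iff using that(1) sh(2) by blast
  next
    assume "k1 = - (\<upsilon> / \<rho>)"
    then show ?thesis unfolding principal_curvatures_iff using shape_flip[OF that(1)] sh(2) by fastforce
  qed
  show "\<exists>k. principal_curvatures f M x (\<upsilon> / \<rho>) k"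
    using orbit_principal[OF sh(1) off] k *[OF sh(1)] *[OF shape_swap[OF sh(1)]] by metis
qed

end

section \<open>The classification\<close>

lemma vector_4:
  fixes w x y z :: real
  shows "(vector [w, x, y, z] :: real^4) $ 1 = w" "(vector [w, x, y, z] :: real^4) $ 2 = x"
    "(vector [w, x, y, z] :: real^4) $ 3 = y" "(vector [w, x, y, z] :: real^4) $ 4 = z"
  unfolding vector_def by simp_all

lemma vector4_axis:
  "(vector [x1, x2, x3, x4] :: real^4) = x1 *\<^sub>R axis 1 1 + x2 *\<^sub>R axis 2 1 + x3 *\<^sub>R axis 3 1 + x4 *\<^sub>R axis 4 1"
  by (simp add: vec_eq_iff forall_4 vector_4 axis_def)

text \<open>
  The velocities in \<open>s\<close> and \<open>\<theta>\<close> are independent as the second moves in the plane of rotation orthogonally to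
  the radius, and the first has the component \<open>\<rho> \<psi>'\<close> orthogonal to the position in the other plane.
\<close>

lemma rotational_param_regular:
  assumes dr: "(r has_real_derivative r') (at s)" and d\<psi>: "(\<psi> has_real_derivative \<psi>') (at s)"
    and pos: "r s > 0" "1 - (r s)\<^sup>2 > 0" "\<psi>' \<noteq> 0"
  shows "rotational_param r \<psi> differentiable (at (s, \<theta>)) \<and>
    inj (frechet_derivative (rotational_param r \<psi>) (at (s, \<theta>)))"
proof -
  define \<rho> where "\<rho> = (\<lambda>s. sqrt (1 - (r s)\<^sup>2))"
  have \<rho>: "\<rho> s > 0" using pos by (simp add: \<rho>_def)
  have "((\<lambda>s. 1 - (r s)\<^sup>2) has_real_derivative - (2 * r s * r')) (at s)" by (auto intro!: derivative_eq_intros dr)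
  then have "\<exists>\<rho>'. (\<rho> has_real_derivative \<rho>') (at s)"
    unfolding \<rho>_def
    using DERIV_chain2[of sqrt "inverse (sqrt (1 - (r s)\<^sup>2)) / 2" "\<lambda>s. 1 - (r s)\<^sup>2" s, OF DERIV_real_sqrt[OF pos(2)]] by blast
  then obtain \<rho>' where d\<rho>: "(\<rho> has_real_derivative \<rho>') (at s)" by blast
  have fst': "((\<lambda>z. g (fst z)) has_derivative (\<lambda>h. g' * fst h)) (at (s, \<theta>))"
    if "(g has_real_derivative g') (at s)" for g g'
  proof -
    have "(fst has_derivative fst) (at (s, \<theta>))" by (rule has_derivative_fst[OF has_derivative_ident])
    from has_derivative_compose[OF this, of g "(*) g'"] that show ?thesis by (simp add: has_field_derivative_def)
  qed
  have snd': "((\<lambda>z. g (snd z)) has_derivative (\<lambda>h. g' * snd h)) (at (s, \<theta>))"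
    if "(g has_real_derivative g') (at \<theta>)" for g g'
  proof -
    have "(snd has_derivative snd) (at (s, \<theta>))" by (rule has_derivative_snd[OF has_derivative_ident])
    from has_derivative_compose[OF this, of g "(*) g'"] that show ?thesis by (simp add: has_field_derivative_def)
  qed
  have cs: "((\<lambda>s. cos (\<psi> s)) has_real_derivative - sin (\<psi> s) * \<psi>') (at s)" "((\<lambda>s. sin (\<psi> s)) has_real_derivative cos (\<psi> s) * \<psi>') (at s)"
    by (auto intro!: derivative_eq_intros d\<psi>)
  define X where "X = (\<lambda>z. (r (fst z) * cos (snd z)) *\<^sub>R (axis 1 1 :: real^4) + (r (fst z) * sin (snd z)) *\<^sub>R axis 2 1 +
     (\<rho> (fst z) * cos (\<psi> (fst z))) *\<^sub>R axis 3 1 + (\<rho> (fst z) * sin (\<psi> (fst z))) *\<^sub>R axis 4 1)"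
  have X: "rotational_param r \<psi> = X"
    by (rule ext) (simp add: rotational_param_def X_def vector4_axis \<rho>_def split_def)
  define D where "D = (\<lambda>h. (r s * (- sin \<theta> * snd h) + r' * fst h * cos \<theta>) *\<^sub>R (axis 1 1 :: real^4) +
     (r s * (cos \<theta> * snd h) + r' * fst h * sin \<theta>) *\<^sub>R axis 2 1 +
     (\<rho> s * (- sin (\<psi> s) * \<psi>' * fst h) + \<rho>' * fst h * cos (\<psi> s)) *\<^sub>R axis 3 1 +
     (\<rho> s * (cos (\<psi> s) * \<psi>' * fst h) + \<rho>' * fst h * sin (\<psi> s)) *\<^sub>R axis 4 1)"
  have XD: "(X has_derivative D) (at (s, \<theta>))"
    unfolding X_def D_def
    using has_derivative_mult[OF fst'[OF dr] snd'[OF DERIV_cos]] has_derivative_mult[OF fst'[OF dr] snd'[OF DERIV_sin]]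
      has_derivative_mult[OF fst'[OF d\<rho>] fst'[OF cs(1)]] has_derivative_mult[OF fst'[OF d\<rho>] fst'[OF cs(2)]]
    by (intro has_derivative_add has_derivative_scaleR_left) simp_all
  have "inj D"
  proof -
    have "linear D" using XD by (rule has_derivative_linear)
    moreover have "h = 0" if "D h = 0" for h
    proof -
      have 1: "r s * (- sin \<theta> * snd h) + r' * fst h * cos \<theta> = 0"
        and 2: "r s * (cos \<theta> * snd h) + r' * fst h * sin \<theta> = 0"
        and 3: "\<rho> s * (- sin (\<psi> s) * \<psi>' * fst h) + \<rho>' * fst h * cos (\<psi> s) = 0"
        and 4: "\<rho> s * (cos (\<psi> s) * \<psi>' * fst h) + \<rho>' * fst h * sin (\<psi> s) = 0"
        using that by (simp_all add: D_def vec_eq_iff forall_4 axis_def)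
      have "\<rho> s * \<psi>' * fst h * ((sin (\<psi> s))\<^sup>2 + (cos (\<psi> s))\<^sup>2) = 0" using 3 4 by algebra
      then have "fst h = 0" using \<rho> pos(3) by simp
      moreover have "r s * snd h * ((sin \<theta>)\<^sup>2 + (cos \<theta>)\<^sup>2) = 0" using 1 2 by algebra
      then have "snd h = 0" using pos(1) by simp
      ultimately show ?thesis by (simp add: prod_eq_iff)
    qed
    ultimately show ?thesis using linear_injective_0 by blast
  qed
  moreover have "frechet_derivative X (at (s, \<theta>)) = D" using frechet_derivative_at[OF XD] by simp
  ultimately show ?thesis unfolding X using XD by (auto simp: differentiable_def)
qed

text \<open>
  The unit complex number \<open>\<zeta>\<close> turns the plane fixed by the rotation and adjusts the initial angle of \<open>\<psi>\<close>.
\<close>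

definition profile_coord :: "complex \<Rightarrow> (real \<Rightarrow> real) \<Rightarrow> (real \<Rightarrow> real) \<Rightarrow> real \<Rightarrow> complex" where
  "profile_coord \<zeta> r \<psi> s = \<zeta> * (of_real (sqrt (1 - (r s)\<^sup>2)) * cis (\<psi> s))"

lemma profile_coord_ode:
  assumes sol: "profile_solution K r w v \<psi>" and pos: "r s > 0" "v s > 0"
  shows "(profile_coord \<zeta> r \<psi> has_vector_derivative
    profile_coord \<zeta> r \<psi> s * Complex (- r s * w s * v s) ((v s)\<^sup>2) / of_real (1 - (r s)\<^sup>2)) (at s)"
proof -
  have top: "euler_top K UNIV r w v" and d\<psi>: "(\<psi> has_real_derivative (v s)\<^sup>2 / (1 - (r s)\<^sup>2)) (at s)"
    using sol pos by (auto simp: profile_solution_def)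
  have e: "(r has_real_derivative w s * v s) (at s)" "(r s)\<^sup>2 + (w s)\<^sup>2 + (v s)\<^sup>2 = 1"
    using top by (auto simp: euler_top_def)
  have "(v s)\<^sup>2 > 0" using pos by simp
  then have m: "1 - (r s)\<^sup>2 > 0" using e(2) zero_le_power2[of "w s"] by linarith
  define \<rho> where "\<rho> = sqrt (1 - (r s)\<^sup>2)"
  have \<rho>: "\<rho> > 0" "\<rho>\<^sup>2 = 1 - (r s)\<^sup>2" using m by (simp_all add: \<rho>_def)
  have "((\<lambda>s. 1 - (r s)\<^sup>2) has_real_derivative - (2 * r s * (w s * v s))) (at s)" by (auto intro!: derivative_eq_intros e(1))
  from DERIV_chain2[of sqrt "inverse (sqrt (1 - (r s)\<^sup>2)) / 2" "\<lambda>s. 1 - (r s)\<^sup>2" s, OF DERIV_real_sqrt[OF m] this]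
  have "((\<lambda>s. sqrt (1 - (r s)\<^sup>2)) has_real_derivative inverse \<rho> / 2 * - (2 * r s * (w s * v s))) (at s)" by (simp add: \<rho>_def)
  moreover have "inverse \<rho> / 2 * - (2 * r s * (w s * v s)) = (- r s * w s * v s) / \<rho>" using \<rho>(1) by (simp add: field_simps)
  ultimately have d\<rho>: "((\<lambda>s. sqrt (1 - (r s)\<^sup>2)) has_real_derivative (- r s * w s * v s) / \<rho>) (at s)" by simp
  have dcis: "((\<lambda>s. cis (\<psi> s)) has_vector_derivative ((v s)\<^sup>2 / (1 - (r s)\<^sup>2)) *\<^sub>R (\<i> * cis (\<psi> s))) (at s)"
  proof -
    define h where "h = (v s)\<^sup>2 / (1 - (r s)\<^sup>2)"
    have "((\<lambda>s. \<i> * of_real (\<psi> s)) has_vector_derivative \<i> * of_real h) (at s)"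
      by (rule has_vector_derivative_mult_right) (use has_vector_derivative_of_real[OF d\<psi>] in \<open>simp only: h_def\<close>)
    from field_vector_diff_chain_at[OF this DERIV_exp]
    show ?thesis
      unfolding cis_conv_exp h_def[symmetric] by (simp add: o_def scaleR_conv_of_real mult_ac)
  qed
  have "((\<lambda>s. sqrt (1 - (r s)\<^sup>2) *\<^sub>R cis (\<psi> s)) has_vector_derivative
      \<rho> *\<^sub>R (((v s)\<^sup>2 / (1 - (r s)\<^sup>2)) *\<^sub>R (\<i> * cis (\<psi> s))) + ((- r s * w s * v s) / \<rho>) *\<^sub>R cis (\<psi> s)) (at s)"
    using has_vector_derivative_scaleR[OF d\<rho> dcis] by (simp add: \<rho>_def)
  moreover have "\<rho> *\<^sub>R (((v s)\<^sup>2 / (1 - (r s)\<^sup>2)) *\<^sub>R (\<i> * cis (\<psi> s))) + ((- r s * w s * v s) / \<rho>) *\<^sub>R cis (\<psi> s) =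
      (of_real \<rho> * cis (\<psi> s)) * Complex (- r s * w s * v s) ((v s)\<^sup>2) / of_real (1 - (r s)\<^sup>2)"
  proof -
    have "(- r s * w s * v s) / \<rho> = \<rho> * ((- r s * w s * v s) / (1 - (r s)\<^sup>2))"
      unfolding \<rho>(2)[symmetric] using \<rho>(1) by (simp add: power2_eq_square)
    moreover define g h where "g = (- r s * w s * v s) / (1 - (r s)\<^sup>2)" "h = (v s)\<^sup>2 / (1 - (r s)\<^sup>2)"
    moreover have "Complex (- r s * w s * v s) ((v s)\<^sup>2) / of_real (1 - (r s)\<^sup>2) = of_real g + \<i> * of_real h"
      unfolding g_h_def by (rule complex_eqI) (simp_all only: Re_divide_of_real Im_divide_of_real, simp_all)
    then have "(of_real \<rho> * cis (\<psi> s)) * Complex (- r s * w s * v s) ((v s)\<^sup>2) / of_real (1 - (r s)\<^sup>2) =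
        (of_real \<rho> * cis (\<psi> s)) * (of_real g + \<i> * of_real h)"
      by (simp only: times_divide_eq_right[symmetric])
    ultimately show ?thesis by (simp only: scaleR_conv_of_real of_real_mult) (simp only: algebra_simps)
  qed
  ultimately have "((\<lambda>s. of_real (sqrt (1 - (r s)\<^sup>2)) * cis (\<psi> s)) has_vector_derivative
      (of_real \<rho> * cis (\<psi> s)) * Complex (- r s * w s * v s) ((v s)\<^sup>2) / of_real (1 - (r s)\<^sup>2)) (at s)"
    by (simp only: scaleR_conv_of_real)
  from has_vector_derivative_mult_right[OF this, of \<zeta>]
  show ?thesis by (simp add: profile_coord_def[abs_def] \<rho>_def mult.assoc)
qed

context rotational
begin

lemma sweep_given_by:
  assumes p: "profile_curve I \<gamma> r w v (profile_coord \<zeta> r \<psi>)" "is_interval I"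
    and M: "M = {\<phi> t (\<gamma> s) | t s. s \<in> I}" and \<zeta>: "cmod \<zeta> = 1"
    and d\<psi>: "\<And>s. s \<in> I \<Longrightarrow> (\<psi> has_real_derivative (v s)\<^sup>2 / (1 - (r s)\<^sup>2)) (at s)"
  shows "given_by f M r \<psi>"
proof -
  note pd = profile_curveD[OF p(1)]
  define \<Phi> where "\<Phi> = (\<lambda>y :: real^4. (y $ 1) *\<^sub>R a + (y $ 2) *\<^sub>R b +
    Re (\<zeta> * Complex (y $ 3) (y $ 4)) *\<^sub>R c + Im (\<zeta> * Complex (y $ 3) (y $ 4)) *\<^sub>R d)"
  have \<Phi>: "P (\<Phi> y) = Complex (y $ 1) (y $ 2)" "Q (\<Phi> y) = \<zeta> * Complex (y $ 3) (y $ 4)" for y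
    by (simp_all add: \<Phi>_def plane_coord_simps P_frame complex_eq_iff)
  have orthogonal: "orthogonal_transformation \<Phi>"
    unfolding orthogonal_transformation_def
  proof (intro conjI allI)
    show "linear \<Phi>"
      by (rule linearI; rule PQ_eqI; simp add: \<Phi> plane_coord_simps complex_eq_iff algebra_simps)
    fix x y :: "real^4"
    have u: "(Re \<zeta>)\<^sup>2 + (Im \<zeta>)\<^sup>2 = 1" using \<zeta> by (simp add: cmod_power2[symmetric])
    have "(\<zeta> * Complex p q) \<bullet> (\<zeta> * Complex p' q') = p * p' + q * q'" for p q p' q'
    proof -
      have "(\<zeta> * Complex p q) \<bullet> (\<zeta> * Complex p' q') = ((Re \<zeta>)\<^sup>2 + (Im \<zeta>)\<^sup>2) * (p * p' + q * q')"
        by (simp add: inner_complex_def algebra_simps power2_eq_square)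
      then show ?thesis by (simp add: u)
    qed
    then have "P (\<Phi> x) \<bullet> P (\<Phi> y) + Q (\<Phi> x) \<bullet> Q (\<Phi> y) = x $ 1 * y $ 1 + x $ 2 * y $ 2 + (x $ 3 * y $ 3 + x $ 4 * y $ 4)"
      unfolding \<Phi> by (simp add: inner_complex_def[of "Complex (x $ 1) (x $ 2)"])
    then show "\<Phi> x \<bullet> \<Phi> y = x \<bullet> y"
      unfolding inner_PQ[of "\<Phi> x"] by (simp add: inner_vec_def sum_4)
  qed
  have regular: "rotational_param r \<psi> differentiable (at z) \<and> inj (frechet_derivative (rotational_param r \<psi>) (at z))"
    if "z \<in> I \<times> UNIV" for z
  proof -
    obtain s \<theta> where z: "z = (s, \<theta>)" "s \<in> I" using \<open>z \<in> I \<times> UNIV\<close> by auto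
    have "(v s)\<^sup>2 / (1 - (r s)\<^sup>2) \<noteq> 0" using pd(6,13)[OF z(2)] by simp
    then show ?thesis
      unfolding z(1) by (rule rotational_param_regular[OF pd(11)[OF z(2)] d\<psi>[OF z(2)] pd(5)[OF z(2)] pd(13)[OF z(2)]])
  qed
  have cont: "continuous_on (I \<times> UNIV) (\<lambda>(s, \<theta>). \<phi> \<theta> (\<gamma> s))"
    unfolding split_def using pd(3)
    by (intro \<phi>_continuous_on continuous_intros continuous_on_compose2[OF pd(2)]) auto
  have onto: "(\<lambda>(s, \<theta>). \<phi> \<theta> (\<gamma> s)) ` (I \<times> UNIV) = M" unfolding M by auto
  have param: "f ((\<lambda>(s, \<theta>). \<phi> \<theta> (\<gamma> s)) z) = \<Phi> (rotational_param r \<psi> z)" if "z \<in> I \<times> UNIV" for z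
  proof -
    obtain s \<theta> where z: "z = (s, \<theta>)" "s \<in> I" using \<open>z \<in> I \<times> UNIV\<close> by auto
    have "\<gamma> s \<in> M" using pd(3) z(2) by blast
    then show ?thesis
      using pd(7,8)[OF z(2)] unfolding z(1)
      by (intro PQ_eqI) (simp_all add: f_\<phi> P_R Q_R \<Phi> rotational_param_def vector_4 profile_coord_def complex_eq_iff algebra_simps)
  qed
  show ?thesis
    unfolding given_by_def
    by (rule exI[of _ \<Phi>], rule exI[of _ I], rule exI[of _ "\<lambda>(s, \<theta>). \<phi> \<theta> (\<gamma> s)"], intro conjI ballI)
      (fact orthogonal pd(1) p(2) regular[THEN conjunct1] regular[THEN conjunct2] cont onto param)+
qed

text \<open>
  The local profile gives initial values, and an explicit solution passes through them; by uniqueness it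
  describes the local profile, and its maximal profile curve sweeps out the surface. For \<open>K = -1\<close> and
  \<open>w = 0\<close> the solution is constant, and the surface would be tubular.
\<close>

lemma classification_oriented:
  assumes p: "profile_curve {-\<epsilon><..<\<epsilon>} \<gamma> r1 w1 v1 q1" "\<epsilon> > 0" and nt: "\<not> tubular f M"
    and ne: "(v1 0)\<^sup>2 \<noteq> K * (r1 0)\<^sup>2"
    and sgn: "if -1 < K \<and> K < 0 \<and> (K + 1) * (r1 0)\<^sup>2 + (w1 0)\<^sup>2 = K + 1 then w1 0 \<ge> 0 else w1 0 \<le> 0"
  shows "\<exists>r \<psi>. given_by f M r \<psi> \<and> explicit_profile K r \<psi>"
proof -
  note pd = profile_curveD[OF p(1)]
  have z: "0 \<in> {-\<epsilon><..<\<epsilon>}" using p(2) by simp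
  note v0 = pd(5,6,10,12,13)[OF z]
  have int: "is_interval {-\<epsilon><..<\<epsilon>}" by (simp add: is_interval_1)
  have "K = -1 \<longrightarrow> w1 0 \<noteq> 0"
  proof (intro impI notI)
    assume K: "K = -1" and w: "w1 0 = 0"
    define r w v \<psi> where m: "r = (\<lambda>_::real. r1 0)" "w = (\<lambda>_::real. 0::real)" "v = (\<lambda>_::real. v1 0)"
      "\<psi> = (\<lambda>s. (v1 0)\<^sup>2 / (1 - (r1 0)\<^sup>2) * s)"
    have sol: "profile_solution K r w v \<psi>"
      unfolding profile_solution_def euler_top_def m using v0(3) w K
      by (auto intro!: derivative_eq_intros simp del: of_real_divide)
    define \<zeta> where "\<zeta> = q1 0 / (of_real (sqrt (1 - (r1 0)\<^sup>2)))"
    have q0: "q1 0 = profile_coord \<zeta> r \<psi> 0" using v0(5) by (simp add: profile_coord_def \<zeta>_def m)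
    have top: "euler_top K UNIV r w v" using sol by (simp add: profile_solution_def)
    note ode = profile_coord_ode[OF sol]
    have c: "profile_curve {-\<epsilon><..<\<epsilon>} \<gamma> r w v (profile_coord \<zeta> r \<psi>)"
      by (rule profile_curve_solution[OF p(1) int z top ode]) (simp_all only: q0, simp_all add: m w)
    obtain I \<beta> where "profile_curve I \<beta> r w v (profile_coord \<zeta> r \<psi>)" "M = {\<phi> t (\<beta> s) | t s. s \<in> I}"
      using surface_is_sweep[OF c int z top ode] ne by (auto simp: m)
    then have "tubular f M" by (rule constant_radius_tubular) (simp add: m)
    then show False using nt by simp
  qed
  then obtain r w v \<psi> s0 where sol: "profile_solution K r w v \<psi>" and init: "r s0 = r1 0" "w s0 = w1 0" "v s0 = v1 0"
    and ex: "explicit_profile K r \<psi>"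
    using explicit_profile_through[OF v0(3,1,2) K0 ne _ sgn] by blast
  have top: "euler_top K UNIV r w v" using sol by (simp add: profile_solution_def)
  define \<zeta> where "\<zeta> = q1 0 / (of_real (sqrt (1 - (r1 0)\<^sup>2)) * cis (\<psi> s0))"
  have "cmod (q1 0) = sqrt (1 - (r1 0)\<^sup>2)" using v0(4) by (simp add: real_sqrt_unique)
  then have \<zeta>: "cmod \<zeta> = 1" using v0(5) by (simp add: \<zeta>_def norm_divide norm_mult)
  have q0: "q1 0 = profile_coord \<zeta> r \<psi> s0" using v0(5) init by (simp add: profile_coord_def \<zeta>_def)
  let ?N = "{s. s + - s0 \<in> {-\<epsilon><..<\<epsilon>}}"
  have sh: "profile_curve ?N (\<lambda>s. \<phi> 0 (\<gamma> (s + - s0))) (\<lambda>s. r1 (s + - s0)) (\<lambda>s. w1 (s + - s0)) (\<lambda>s. v1 (s + - s0)) (\<lambda>s. q1 (s + - s0))"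
    by (rule profile_curve_shift[OF p(1)]) simp
  have intN: "is_interval ?N" by (auto simp: is_interval_1)
  have s0N: "s0 \<in> ?N" using p(2) by simp
  note ode = profile_coord_ode[OF sol]
  have c: "profile_curve ?N (\<lambda>s. \<phi> 0 (\<gamma> (s + - s0))) r w v (profile_coord \<zeta> r \<psi>)"
    by (rule profile_curve_solution[OF sh intN s0N top ode]) (simp_all add: init q0)
  obtain I \<beta> where I: "profile_curve I \<beta> r w v (profile_coord \<zeta> r \<psi>)" "is_interval I" "M = {\<phi> t (\<beta> s) | t s. s \<in> I}"
    using surface_is_sweep[OF c intN s0N top ode] ne init by auto
  have "given_by f M r \<psi>"
  proof (rule sweep_given_by[OF I \<zeta>])
    fix s assume "s \<in> I"
    then show "(\<psi> has_real_derivative (v s)\<^sup>2 / (1 - (r s)\<^sup>2)) (at s)"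
      using sol profile_curveD(5,6)[OF I(1)] by (simp add: profile_solution_def)
  qed
  then show ?thesis using ex by blast
qed

end

lemma (in rotational) reflected_frame: "rotational f M K a b c (- d) \<phi>"
  using surf curv K0 norms orth \<phi>_cont \<phi>_0 \<phi>_M f_\<phi> \<phi>_add by unfold_locales simp_all

text \<open>
  Reversing the profile changes the sign of \<open>w\<close>. It also makes the angle of \<open>q\<close> decrease, which the reflection
  of \<open>d\<close> undoes.
\<close>

lemma (in rotational) reversed_profile_curve:
  assumes p: "profile_curve {-\<epsilon><..<\<epsilon>} \<gamma> r w v q"
  shows "rotational.profile_curve f M K a b c (- d) {-\<epsilon><..<\<epsilon>} (\<lambda>s. \<gamma> (- s)) (\<lambda>s. r (- s)) (\<lambda>s. - w (- s)) (\<lambda>s. v (- s)) (\<lambda>s. cnj (q (- s)))"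
proof -
  interpret refl: rotational f M K a b c "- d" \<phi> by (rule reflected_frame)
  note pd = profile_curveD[OF p]
  show ?thesis
    unfolding refl.profile_curve_def euler_top_def
  proof (intro conjI ballI)
    show "open {-\<epsilon><..<\<epsilon>}" by simp
    show "continuous_on {-\<epsilon><..<\<epsilon>} (\<lambda>s. \<gamma> (- s))"
      by (rule continuous_on_compose2[OF pd(2)]) (auto intro!: continuous_intros)
    show "(\<lambda>s. \<gamma> (- s)) ` {-\<epsilon><..<\<epsilon>} \<subseteq> M" using pd(3) by auto
    fix s assume "s \<in> {-\<epsilon><..<\<epsilon>}"
    then have s: "- s \<in> {-\<epsilon><..<\<epsilon>}" by simp
    have e: "(r has_real_derivative w (- s) * v (- s)) (at (- s))" "(w has_real_derivative - (K + 1) * r (- s) * v (- s)) (at (- s))"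
      "(v has_real_derivative K * r (- s) * w (- s)) (at (- s))"
      using pd(4) s unfolding euler_top_def by blast+
    have m: "((\<lambda>s. g (- s)) has_real_derivative - g') (at s)" if "(g has_real_derivative g') (at (- s))" for g g'
      using that by (simp add: DERIV_mirror)
    show "((\<lambda>s. r (- s)) has_real_derivative - w (- s) * v (- s)) (at s)" using m[OF e(1)] by simp
    show "((\<lambda>s. - w (- s)) has_real_derivative - (K + 1) * r (- s) * v (- s)) (at s)"
      using DERIV_minus[OF m[OF e(2)]] by simp
    show "((\<lambda>s. v (- s)) has_real_derivative K * r (- s) * - w (- s)) (at s)" using m[OF e(3)] by simp
    show "(r (- s))\<^sup>2 + (- w (- s))\<^sup>2 + (v (- s))\<^sup>2 = 1" using pd(10)[OF s] by simp
    show "r (- s) > 0" "v (- s) > 0" "P (f (\<gamma> (- s))) = of_real (r (- s))" using pd(5,6,7)[OF s] .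
    show "plane_coord c (- d) (f (\<gamma> (- s))) = cnj (q (- s))"
      using pd(8)[OF s] by (simp add: plane_coord_def complex_eq_iff)
    have neg: "((\<lambda>s::real. - s) has_vector_derivative - 1) (at s)" by (auto intro!: derivative_eq_intros)
    define q' where "q' = q (- s) * Complex (- r (- s) * w (- s) * v (- s)) ((v (- s))\<^sup>2) / of_real (1 - (r (- s))\<^sup>2)"
    have "((\<lambda>s. q (- s)) has_vector_derivative - q') (at s)"
      using vector_diff_chain_at[OF neg, of q q'] pd(9)[OF s] by (simp add: o_def q'_def)
    from bounded_linear.has_vector_derivative[OF bounded_linear_cnj this]
    have "((\<lambda>s. cnj (q (- s))) has_vector_derivative - cnj q') (at s)" by simp
    moreover have "- cnj q' = cnj (q (- s)) * Complex (- r (- s) * - w (- s) * v (- s)) ((v (- s))\<^sup>2) / of_real (1 - (r (- s))\<^sup>2)"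
      unfolding q'_def complex_div_real by (simp add: complex_eq_iff)
    ultimately show "((\<lambda>s. cnj (q (- s))) has_vector_derivative
        cnj (q (- s)) * Complex (- r (- s) * - w (- s) * v (- s)) ((v (- s))\<^sup>2) / of_real (1 - (r (- s))\<^sup>2)) (at s)" by simp
  qed
qed

theorem (in rotational) classification:
  assumes nt: "\<not> tubular f M"
  shows "\<exists>r \<psi>. given_by f M r \<psi> \<and> explicit_profile K r \<psi>"
proof -
  obtain W \<sigma> z \<nu> e1 e2 k1 k2 where sh: "shape_at W \<sigma> z \<nu> e1 e2 k1 k2" "\<sigma> z \<in> M" "P (f (\<sigma> z)) \<noteq> 0"
    and ne: "(cmod (P \<nu>))\<^sup>2 \<noteq> K * (cmod (P (f (\<sigma> z))))\<^sup>2"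
    using not_tubular_point[OF nt] by blast
  obtain \<epsilon> \<theta> \<gamma> r w v q where p: "profile_curve {-\<epsilon><..<\<epsilon>} \<gamma> r w v q" "\<epsilon> > 0" "\<gamma> 0 = \<phi> \<theta> (\<sigma> z)"
    using local_profile[OF sh(2,3)] by blast
  have 0: "0 \<in> {-\<epsilon><..<\<epsilon>}" using p(2) by simp
  have "\<sigma> z = \<phi> (- \<theta>) (\<gamma> 0)" using \<phi>_add[OF sh(2), of "- \<theta>" \<theta>] \<phi>_0[OF sh(2)] p(3) by simp
  from sweep_normal_length[OF p(1) 0 sh(1) this] have ne': "(v 0)\<^sup>2 \<noteq> K * (r 0)\<^sup>2" using ne by simp
  show ?thesis
  proof (cases "if -1 < K \<and> K < 0 \<and> (K + 1) * (r 0)\<^sup>2 + (w 0)\<^sup>2 = K + 1 then w 0 \<ge> 0 else w 0 \<le> 0")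
    case True
    then show ?thesis by (rule classification_oriented[OF p(1,2) nt ne'])
  next
    case False
    \<comment> \<open>The wrong sign of \<open>w\<close> is repaired by reversing the profile.\<close>
    interpret refl: rotational f M K a b c "- d" \<phi> by (rule reflected_frame)
    show ?thesis
      by (rule refl.classification_oriented[OF reversed_profile_curve[OF p(1)] p(2) nt])
        (use ne' False in \<open>auto split: if_splits\<close>)
  qed
qed

lemma orthonormal_pair_extends:
  fixes a b :: "real^4"
  assumes "norm a = 1" "norm b = 1" "a \<bullet> b = 0"
  shows "\<exists>c d. norm c = 1 \<and> norm d = 1 \<and> a \<bullet> c = 0 \<and> a \<bullet> d = 0 \<and> b \<bullet> c = 0 \<and> b \<bullet> d = 0 \<and> c \<bullet> d = 0"
proof -
  have ext: "\<exists>c. norm c = 1 \<and> (\<forall>x\<in>S. x \<bullet> c = 0)" if S: "finite S" "card S < 4" for S :: "(real^4) set"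
  proof -
    have "dim S < DIM(real^4)" using dim_le_card'[OF S(1)] S(2) by simp
    then obtain c where c: "c \<noteq> 0" "\<And>y. y \<in> span S \<Longrightarrow> orthogonal c y" by (rule orthogonal_to_subspace_exists) blast
    have "x \<bullet> (c /\<^sub>R norm c) = 0" if "x \<in> S" for x
      using c(2)[OF span_base[OF that]] by (simp add: orthogonal_def inner_commute)
    moreover have "norm (c /\<^sub>R norm c) = 1" using c(1) by simp
    ultimately show ?thesis by blast
  qed
  have card: "card {a, b} < 4" "card {a, b, c} < 4" for c by (auto simp: card_insert_if)
  have "\<exists>c. norm c = 1 \<and> (\<forall>x\<in>{a, b}. x \<bullet> c = 0)" by (rule ext[OF _ card(1)]) simp
  then obtain c where c: "norm c = 1" "\<forall>x\<in>{a, b}. x \<bullet> c = 0" by blast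
  have "\<exists>d. norm d = 1 \<and> (\<forall>x\<in>{a, b, c}. x \<bullet> d = 0)" by (rule ext[OF _ card(2)]) simp
  then obtain d where d: "norm d = 1" "\<forall>x\<in>{a, b, c}. x \<bullet> d = 0" by blast
  show ?thesis using c d by (intro exI[of _ c] exI[of _ d]) auto
qed

theorem theorem6p2:
  fixes f :: "'m::t2_space \<Rightarrow> real^4" and M :: "'m set" and K :: real
  assumes "immersed_surface_S3 f M"
    and "rotational_surface f M"
    and "constant_gauss_curvature f M K"
    and "K \<noteq> 0"
    and "\<not> tubular f M"
  shows "\<exists>r \<psi>. given_by f M r \<psi> \<and>
           (K < -1 \<longrightarrow> profile_hyperbolic K r \<psi>) \<and>
           (K = -1 \<longrightarrow> profile_flat r \<psi>) \<and>
           (-1 < K \<and> K < 0 \<longrightarrow> profile_intermediate K r \<psi>) \<and>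
           (K > 0 \<longrightarrow> profile_spherical K r \<psi>)"
proof -
  from assms(2) obtain a b \<phi> where ab: "norm a = 1" "norm b = 1" "a \<bullet> b = 0"
    and \<phi>: "continuous_on (UNIV \<times> M) (\<lambda>(t, x). \<phi> t x)" "\<forall>x\<in>M. \<phi> 0 x = x"
    "\<forall>t. \<forall>x\<in>M. \<phi> t x \<in> M \<and> f (\<phi> t x) = plane_rotation a b t (f x)"
    "\<forall>s t. \<forall>x\<in>M. \<phi> (s + t) x = \<phi> s (\<phi> t x)"
    unfolding rotational_surface_def by (elim exE conjE) (rule that)
  obtain c d where cd: "norm c = 1" "norm d = 1" "a \<bullet> c = 0" "a \<bullet> d = 0" "b \<bullet> c = 0" "b \<bullet> d = 0" "c \<bullet> d = 0"
    using orthonormal_pair_extends[OF ab] by blast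
  interpret rotational f M K a b c d \<phi>
  proof unfold_locales
    show "continuous_on (UNIV \<times> M) (\<lambda>(t, x). \<phi> t x)" by (fact \<phi>(1))
  qed (use ab cd \<phi>(2-4) in \<open>simp_all add: assms(1,3,4)\<close>)
  show ?thesis using classification[OF assms(5)] unfolding explicit_profile_def .
qed

end
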